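(* Suppose that $\{u,z\}\in\mathcal X\times\mathcal Y$ is a stationary point of the Lagrangian functional $\mathcal L$, i.e. $\mathcal L_u(u,z)(\psi)+\mathcal L_z(u,z)(\varphi)=0$ for all $\{\psi,\varphi\}\in\mathcal X\times\mathcal Y$. Let $\{u_{kh},z_{kh}\}\in\mathcal X_{kh}^{r,p}\times\mathcal X_{kh}^{r,p}$ denote its stabilized Galerkin approximation, i.e. $u_{kh}$ solves the stabilized discrete primal problem and $z_{kh}$ solves the stabilized discrete dual problem. Then $$\mathcal J(u)-\mathcal J(u_{kh})=\rho(u_{kh})(z-\varphi_{kh})+\mathcal R_{\mathcal S}+\mathcal R_{\mathcal J}+\frac12\Delta\rho_{\mathcal J}$$ for arbitrary functions $\varphi_{kh}\in\mathcal X_{kh}^{r,p}$, where, with $e=u-u_{kh}$, $$\mathcal R_{\mathcal S}:=S(u_{kh})(\varphi_{kh}),\qquad \mathcal R_{\mathcal J}:=\frac12\int_0^1\mathcal J'''(u_{kh}+s\cdot e)(e,e,e)\cdot s\cdot(s-1)\,\mathrm ds,\qquad \Delta\rho_{\mathcal J}:=-\int_0^1\mathcal J''(u_{kh}+s\cdot e)(e,e)\,\mathrm ds .$$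
   Context: **Data.** $\Omega\subset\mathbb R^d$, $d\in\{2,3\}$, is a bounded polygonal/polyhedral domain, $I=(0,T]$. The coefficients satisfy $\alpha\ge 0$ constant, $\varepsilon>0$ constant, $\boldsymbol b\in H^1(\Omega)^d\cap L^\infty(\Omega)^d$ with $\nabla\cdot\boldsymbol b=0$ a.e.; $f\in L^2(0,T;H^{-1}(\Omega))$ (in the discrete stabilization terms, element-wise $L^2$ products with $f$ are assumed to make sense), $u_0\in L^2(\Omega)$. The underlying problem is $\partial_tu+\boldsymbol b\cdot\nabla u-\nabla\cdot(\varepsilon\nabla u)+\alpha u=f$ in $\Omega\times(0,T]$, $u=0$ on $\partial\Omega\times(0,T]$, $u(0)=u_0$. **Notation.** $\langle\cdot,\cdot\rangle$ is the $L^2(\Omega)$ inner product (or the $H^{-1}$–$H^1_0$ duality pairing where needed), $\langle\cdot,\cdot\rangle_K$ the $L^2(K)$ inner product, $\langle\langle v,w\rangle\rangle=\int_0^T\langle v,w\rangle\,\mathrm dt$. Time grid $0=t_0<t_1<\dots<t_M=T$, $I_m=(t_{m-1},t_m]$, $k_m=t_m-t_{m-1}$. One-sided limits $v_m^\pm=\lim_{s\to0,\,s>0}v(t_m\pm s)$, jumps $[v]_m=v_m^+-v_m^-$. For piecewise-in-time functions, the values at $0$ and $T$ occurring in the forms below are understood as $v(0)=v_0^+$, $v(T)=v_M^-=v_T^-$. **Spaces.** $\mathcal X=\{v\in L^2(0,T;H^1_0(\Omega)):\partial_tv\in L^2(0,T;H^{-1}(\Omega))\}$. $\mathcal Y=\{v\in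 L^2(0,T;H^1_0(\Omega)): v|_{I_m}\in C(\overline{I_m};H^1_0(\Omega))\text{ for all }m\}$ (i.e. $v|_{I_m}$ has a continuous extension to $\overline{I_m}$). $\mathcal T_h=\{K\}$ is a conforming decomposition of $\Omega$ into triangles/tetrahedra; $\mathcal V_h^p=\{v\in H^1_0(\Omega)\cap C(\overline\Omega):v|_K\in\mathcal P_p(K)\ \forall K\in\mathcal T_h\}$; $\mathcal V_h^{p,m}$ is such a space for the time interval $I_m$ (the mesh may differ between the $I_m$; $\mathcal T_h$ denotes the mesh of the respective interval). For integers $r\ge0$, $p\ge1$, $\mathcal X_{kh}^{r,p}$ is the space of functions $v_{kh}$ with $v_{kh}|_{I_m}\in\mathcal P_r(I_m;\mathcal V_h^{p,m})$ (polynomials in time of degree at most $r$ with values in $\mathcal V_h^{p,m}$), $m=1,\dots,M$, and $v_{kh}(0)\in\mathcal V_h^p$. One has $\mathcal X_{kh}^{r,p}\subset\mathcal Y$. **Target functional.** $\mathcal J:\mathcal Y\to\mathbb R$ is Fréchet differentiable, as often as derivatives of it are used, and is also evaluated on $\mathcal X+\mathcal X_{kh}^{r,p}$. Its derivative has an $L^2$ representation: for each $v$ there is $j(v)\in L^2(0,T;L^2(\Omega))$ with $\mathcal J'(v)(\varphi)=\langle\langle j(v),\varphi\rangle\rangle$. **Forms.** $F(\varphi)=\langle\langle f,\varphi\rangle\rangle$, $a(v)(\varphi)=\langle\langle\boldsymbol b\cdot\nabla v,\varphi\rangle\rangle+\langle\langle\varepsilon\nabla v,\nabla\varphi\rangle\rangle+\langle\langle\alpha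 v,\varphi\rangle\rangle$, $$A(v)(\varphi)=\sum_{m=1}^M\int_{I_m}\langle\partial_tv,\varphi\rangle\,\mathrm dt+a(v)(\varphi)+\sum_{m=2}^M\langle[v]_{m-1},\varphi_{m-1}^+\rangle,$$ $$A^\ast(z)(\psi)=-\sum_{m=1}^M\int_{I_m}\langle\partial_tz,\psi\rangle\,\mathrm dt-\langle\langle\boldsymbol b\cdot\nabla z,\psi\rangle\rangle+\langle\langle\varepsilon\nabla z,\nabla\psi\rangle\rangle+\langle\langle\alpha z,\psi\rangle\rangle-\sum_{m=2}^M\langle[z]_{m-1},\psi_{m-1}^-\rangle.$$ Stabilization (SUPG) forms, with positive parameters $\delta_K,\delta_K^\ast$ ($\delta_K\sim\min\{h_K/(p\|\boldsymbol b\|_{L^\infty(K)}),\,h_K^2/(p^4\varepsilon),\,1/(k_m+\alpha),\,(k_m+\alpha)/\alpha^2\}$, where $h_K$ is the diameter of $K$): $$S(u_{kh})(\varphi_{kh})=\sum_{m=1}^M\int_{I_m}\sum_K\delta_K\langle R(u_{kh}),\boldsymbol b\cdot\nabla\varphi_{kh}\rangle_K\,\mathrm dt+\sum_{m=2}^M\sum_K\delta_K\langle[u_{kh}]_{m-1},\boldsymbol b\cdot\nabla\varphi_{kh,m-1}^+\rangle_K+\sum_K\delta_K\langle u_{kh,0}^+-u_0,\boldsymbol b\cdot\nabla\varphi_{kh,0}^+\rangle_K,$$ $R(u_{kh})=\partial_tu_{kh}+\boldsymbol b\cdot\nabla u_{kh}-\nabla\cdot(\varepsilon\nabla u_{kh})+\alpha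 u_{kh}-f$; $$S^\ast(z_{kh})(\psi_{kh})=\sum_{m=1}^M\int_{I_m}\sum_K\delta_K^\ast\langle R^\ast(z_{kh}),-\boldsymbol b\cdot\nabla\psi_{kh}\rangle_K\,\mathrm dt-\sum_{m=2}^M\sum_K\delta_K^\ast\langle[z_{kh}]_{m-1},-\boldsymbol b\cdot\nabla\psi_{kh,m-1}^-\rangle_K+\sum_K\delta_K^\ast\langle z_{kh,M}^-,-\boldsymbol b\cdot\nabla\psi_{kh,M}^-\rangle_K,$$ $R^\ast(z_{kh})=-\partial_tz_{kh}-\boldsymbol b\cdot\nabla z_{kh}-\nabla\cdot(\varepsilon\nabla z_{kh})+\alpha z_{kh}-j(u_{kh})$ (residuals taken element-wise). **Lagrangian.** $\mathcal L:(\mathcal X+\mathcal X_{kh}^{r,p})\times\mathcal Y\to\mathbb R$, $$\mathcal L(u,z)=\mathcal J(u)+F(z)-\sum_{m=1}^M\int_{I_m}\langle\partial_tu,z\rangle\,\mathrm dt-a(u)(z)-\sum_{m=2}^M\langle[u]_{m-1},z_{m-1}^+\rangle-\langle u(0)-u_0,z(0)\rangle,$$ $\mathcal L_u,\mathcal L_z$ being its partial derivatives. For a stationary point $\{u,z\}$, $u$ is the weak solution of the primal problem and $z\in\mathcal X\cap\mathcal Y$ is the solution of the dual problem $-\langle\langle\partial_tz,\psi\rangle\rangle-\langle\langle\boldsymbol b\cdot\nabla z,\psi\rangle\rangle+\langle\langle\varepsilon\nabla z,\nabla\psi\rangle\rangle+\langle\langle\alpha z,\psi\rangle\rangle+\langle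 z(T),\psi(T)\rangle=\mathcal J'(u)(\psi)$ for all $\psi\in\mathcal Y$; $u,z\in C([0,T];L^2(\Omega))$. **Discrete problems.** Stabilized discrete primal problem: $u_{kh}\in\mathcal X_{kh}^{r,p}$ with $A(u_{kh})(\varphi_{kh})+S(u_{kh})(\varphi_{kh})+\langle u_{kh,0}^+,\varphi_{kh,0}^+\rangle=F(\varphi_{kh})+\langle u_0,\varphi_{kh,0}^+\rangle$ for all $\varphi_{kh}\in\mathcal X_{kh}^{r,p}$. Stabilized discrete dual problem: $z_{kh}\in\mathcal X_{kh}^{r,p}$ with $A^\ast(z_{kh})(\psi_{kh})+S^\ast(z_{kh})(\psi_{kh})+\langle z_{kh,M}^-,\psi_{kh,M}^-\rangle=\mathcal J'(u_{kh})(\psi_{kh})$ for all $\psi_{kh}\in\mathcal X_{kh}^{r,p}$. **Primal residual.** For $\varphi\in\mathcal Y$: $\rho(u_{kh})(\varphi)=F(\varphi)-A(u_{kh})(\varphi)-\langle u_{kh,0}^+-u_0,\varphi(0)\rangle$. *)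

theory Defs
  imports "HOL-Analysis.Analysis" "HOL-Library.Function_Algebras" "HOL-Library.Set_Algebras"
begin

text \<open>Functions form a real vector space pointwise. Elements of \<open>L\<^sup>2\<close>, \<open>H\<^sup>1\<^sub>0\<close>, \<open>H\<^sup>-\<^sup>1\<close> and of
  the space-time spaces are functions throughout (representatives, not equivalence classes).\<close>

instantiation "fun" :: (type, real_vector) real_vector
begin

definition "r *\<^sub>R f = (\<lambda>x. r *\<^sub>R f x)"

instance
  by standard (auto simp: scaleR_fun_def fun_eq_iff scaleR_add_right scaleR_add_left)

end

section \<open>Normed subspaces, dual spaces, Frechet derivatives\<close>

definition dual_space :: "'v::real_vector set \<Rightarrow> ('v \<Rightarrow> real) \<Rightarrow> ('v \<Rightarrow> real) set" where
  "dual_space D N = {g. (\<forall>v\<in>D. \<forall>w\<in>D. \<forall>s. g (v + s *\<^sub>R w) = g v + s * g w) \<and>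
                        (\<exists>C. \<forall>v\<in>D. \<bar>g v\<bar> \<le> C * N v)}"

definition dual_norm :: "'v::real_vector set \<Rightarrow> ('v \<Rightarrow> real) \<Rightarrow> ('v \<Rightarrow> real) \<Rightarrow> real" where
  "dual_norm D N g = Sup {\<bar>g v\<bar> | v. v \<in> D \<and> N v \<le> 1}"

text \<open>\<open>J1\<close>, \<open>J2\<close>, \<open>J3\<close> are the first three Frechet derivatives of \<open>J\<close> on the subspace \<open>D\<close>
  normed by \<open>N\<close>; the errors of the difference quotients of \<open>J1\<close> and \<open>J2\<close> are measured in the
  operator norms of linear and bilinear forms.\<close>

definition frechet_deriv1 where
  "frechet_deriv1 (D :: 'v::real_vector set) N (J :: 'v \<Rightarrow> real) J1 \<longleftrightarrow>
     (\<forall>v\<in>D. J1 v \<in> dual_space D N \<and>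
        (\<forall>e>0. \<exists>d>0. \<forall>h\<in>D. N h < d \<longrightarrow> \<bar>J (v + h) - J v - J1 v h\<bar> \<le> e * N h))"

definition frechet_deriv2 where
  "frechet_deriv2 (D :: 'v::real_vector set) N (J1 :: 'v \<Rightarrow> 'v \<Rightarrow> real) J2 \<longleftrightarrow>
     (\<forall>v\<in>D. (\<forall>k\<in>D. J2 v k \<in> dual_space D N \<and> (\<lambda>h. J2 v h k) \<in> dual_space D N) \<and>
        (\<exists>C. \<forall>h\<in>D. \<forall>k\<in>D. \<bar>J2 v h k\<bar> \<le> C * N h * N k) \<and>
        (\<forall>e>0. \<exists>d>0. \<forall>h\<in>D. N h < d \<longrightarrow>
           (\<forall>k\<in>D. \<bar>J1 (v + h) k - J1 v k - J2 v h k\<bar> \<le> e * N h * N k)))"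

definition frechet_deriv3 where
  "frechet_deriv3 (D :: 'v::real_vector set) N (J2 :: 'v \<Rightarrow> 'v \<Rightarrow> 'v \<Rightarrow> real) J3 \<longleftrightarrow>
     (\<forall>v\<in>D. (\<forall>k\<in>D. \<forall>l\<in>D. J3 v k l \<in> dual_space D N \<and> (\<lambda>h. J3 v k h l) \<in> dual_space D N \<and>
                (\<lambda>h. J3 v h k l) \<in> dual_space D N) \<and>
        (\<exists>C. \<forall>h\<in>D. \<forall>k\<in>D. \<forall>l\<in>D. \<bar>J3 v h k l\<bar> \<le> C * N h * N k * N l) \<and>
        (\<forall>e>0. \<exists>d>0. \<forall>h\<in>D. N h < d \<longrightarrow>
           (\<forall>k\<in>D. \<forall>l\<in>D. \<bar>J2 (v + h) k l - J2 v k l - J3 v h k l\<bar> \<le> e * N h * N k * N l)))"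

section \<open>Lebesgue and Sobolev spaces in space\<close>

definition ip :: "(real^'d) set \<Rightarrow> (real^'d \<Rightarrow> real) \<Rightarrow> (real^'d \<Rightarrow> real) \<Rightarrow> real" where
  "ip A v w = (LINT x|lebesgue_on A. v x * w x)"

definition ip_vec :: "(real^'d) set \<Rightarrow> (real^'d \<Rightarrow> real^'d) \<Rightarrow> (real^'d \<Rightarrow> real^'d) \<Rightarrow> real" where
  "ip_vec A v w = (LINT x|lebesgue_on A. v x \<bullet> w x)"

definition L2 :: "(real^'d) set \<Rightarrow> (real^'d \<Rightarrow> real) set" where
  "L2 A = {v. v \<in> borel_measurable (lebesgue_on A) \<and> integrable (lebesgue_on A) (\<lambda>x. (v x)\<^sup>2)}"

definition L2_norm :: "(real^'d) set \<Rightarrow> (real^'d \<Rightarrow> real) \<Rightarrow> real" where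
  "L2_norm A v = sqrt (ip A v v)"

primrec Ck :: "nat \<Rightarrow> ('a::euclidean_space \<Rightarrow> real) \<Rightarrow> bool" where
  "Ck 0 f \<longleftrightarrow> continuous_on UNIV f"
| "Ck (Suc k) f \<longleftrightarrow> (\<forall>x. f differentiable (at x)) \<and>
     (\<forall>i\<in>Basis. Ck k (\<lambda>x. frechet_derivative f (at x) i))"

text \<open>\<open>C\<^sub>c\<^sup>\<infinity>(A)\<close>, each function being extended by zero.\<close>

definition test_fun :: "'a::euclidean_space set \<Rightarrow> ('a \<Rightarrow> real) set" where
  "test_fun A = {f. (\<forall>k. Ck k f) \<and> compact (closure {x. f x \<noteq> 0}) \<and> closure {x. f x \<noteq> 0} \<subseteq> A}"

definition grad :: "(real^'d \<Rightarrow> real) \<Rightarrow> real^'d \<Rightarrow> real^'d" where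
  "grad v x = (\<chi> i. frechet_derivative v (at x) (axis i 1))"

definition divg :: "(real^'d \<Rightarrow> real^'d) \<Rightarrow> real^'d \<Rightarrow> real" where
  "divg G x = (\<Sum>i\<in>UNIV. frechet_derivative (\<lambda>y. G y $ i) (at x) (axis i 1))"

definition is_weak_grad :: "(real^'d) set \<Rightarrow> (real^'d \<Rightarrow> real) \<Rightarrow> (real^'d \<Rightarrow> real^'d) \<Rightarrow> bool" where
  "is_weak_grad A v g \<longleftrightarrow> (\<forall>i. (\<lambda>x. g x $ i) \<in> L2 A) \<and>
     (\<forall>\<phi>\<in>test_fun A. \<forall>i. ip A v (\<lambda>x. grad \<phi> x $ i) = - ip A (\<lambda>x. g x $ i) \<phi>)"

definition H1 :: "(real^'d) set \<Rightarrow> (real^'d \<Rightarrow> real) set" where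
  "H1 A = {v. v \<in> L2 A \<and> (\<exists>g. is_weak_grad A v g)}"

text \<open>Determined up to equality almost everywhere in \<open>A\<close>.\<close>

definition wgrad :: "(real^'d) set \<Rightarrow> (real^'d \<Rightarrow> real) \<Rightarrow> real^'d \<Rightarrow> real^'d" where
  "wgrad A v = (SOME g. is_weak_grad A v g)"

definition H1_norm :: "(real^'d) set \<Rightarrow> (real^'d \<Rightarrow> real) \<Rightarrow> real" where
  "H1_norm A v = sqrt (ip A v v + ip_vec A (wgrad A v) (wgrad A v))"

definition H10 :: "(real^'d) set \<Rightarrow> (real^'d \<Rightarrow> real) set" where
  "H10 A = {v \<in> H1 A. \<exists>\<phi>. (\<forall>n. \<phi> n \<in> test_fun A) \<and> (\<lambda>n. H1_norm A (v - \<phi> n)) \<longlonglongrightarrow> 0}"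

abbreviation Hm1 :: "(real^'d) set \<Rightarrow> ((real^'d \<Rightarrow> real) \<Rightarrow> real) set" where
  "Hm1 A \<equiv> dual_space (H10 A) (H1_norm A)"

abbreviation Hm1_norm :: "(real^'d) set \<Rightarrow> ((real^'d \<Rightarrow> real) \<Rightarrow> real) \<Rightarrow> real" where
  "Hm1_norm A \<equiv> dual_norm (H10 A) (H1_norm A)"

section \<open>Functions of time\<close>

text \<open>The Bochner space \<open>L\<^sup>2(S; E)\<close> for a time set \<open>S\<close> and a space \<open>E\<close> with norm \<open>N\<close>. Strong
  measurability is almost everywhere approximation by \<open>E\<close>-valued simple functions.\<close>

definition bochner_L2 :: "real set \<Rightarrow> 'v::real_vector set \<Rightarrow> ('v \<Rightarrow> real) \<Rightarrow> (real \<Rightarrow> 'v) set" where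
  "bochner_L2 S E N = {v.
     (\<exists>s. (\<forall>n::nat. simple_function (lebesgue_on S) (s n) \<and> (\<forall>t\<in>S. s n t \<in> E)) \<and>
          (AE t in lebesgue_on S. v t \<in> E \<and> (\<lambda>n. N (s n t - v t)) \<longlonglongrightarrow> 0)) \<and>
     integrable (lebesgue_on S) (\<lambda>t. (N (v t))\<^sup>2)}"

text \<open>The weak time derivative in \<open>L\<^sup>2(a,b; H\<^sup>-\<^sup>1)\<close>. The identity in \<open>H\<^sup>-\<^sup>1\<close> defining it is an
  identity of functionals and is stated by evaluating it at every element of \<open>H\<^sup>1\<^sub>0\<close>.\<close>

definition is_weak_dt ::
  "(real^'d) set \<Rightarrow> real \<Rightarrow> real \<Rightarrow> (real \<Rightarrow> real^'d \<Rightarrow> real) \<Rightarrow> (real \<Rightarrow> (real^'d \<Rightarrow> real) \<Rightarrow> real) \<Rightarrow> bool"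
  where
  "is_weak_dt A a b v g \<longleftrightarrow> g \<in> bochner_L2 {a<..b} (Hm1 A) (Hm1_norm A) \<and>
     (\<forall>\<eta>\<in>test_fun {a<..<b}. \<forall>w\<in>H10 A.
        (LINT t|lebesgue_on {a<..b}. deriv \<eta> t * ip A (v t) w) =
        - (LINT t|lebesgue_on {a<..b}. \<eta> t * g t w))"

definition weak_dt ::
  "(real^'d) set \<Rightarrow> real \<Rightarrow> real \<Rightarrow> (real \<Rightarrow> real^'d \<Rightarrow> real) \<Rightarrow> real \<Rightarrow> (real^'d \<Rightarrow> real) \<Rightarrow> real" where
  "weak_dt A a b v = (SOME g. is_weak_dt A a b v g)"

text \<open>One-sided limits in \<open>L\<^sup>2\<close> that ignore null sets of times, so that they are those of the
  piecewise continuous representative.\<close>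

definition ess_lim_right where
  "ess_lim_right A (v :: real \<Rightarrow> real^'d \<Rightarrow> real) a w \<longleftrightarrow> w \<in> L2 A \<and>
     (\<forall>e>0. \<exists>d>0. AE s in lebesgue_on {a<..<a + d}. v s \<in> L2 A \<and> L2_norm A (v s - w) < e)"

definition ess_lim_left where
  "ess_lim_left A (v :: real \<Rightarrow> real^'d \<Rightarrow> real) a w \<longleftrightarrow> w \<in> L2 A \<and>
     (\<forall>e>0. \<exists>d>0. AE s in lebesgue_on {a - d<..<a}. v s \<in> L2 A \<and> L2_norm A (v s - w) < e)"

section \<open>Data of the problem and of its discretization\<close>

text \<open>Polynomials in \<open>d\<close> variables of total degree at most \<open>p\<close>; \<open>k\<close> is a multi-index.\<close>

definition poly_space :: "nat \<Rightarrow> (real^'d \<Rightarrow> real) set" where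
  "poly_space p = {q. \<exists>c. \<forall>x. q x =
     (\<Sum>k | (\<Sum>i\<in>UNIV. k i) \<le> p. c k * (\<Prod>i\<in>UNIV. (x $ i) ^ k i))}"

definition polyhedral_domain :: "(real^'d) set \<Rightarrow> bool" where
  "polyhedral_domain A \<longleftrightarrow> open A \<and> connected A \<and> bounded A \<and> A \<noteq> {} \<and>
     (\<exists>F. finite F \<and> (\<forall>f\<in>F. polytope f \<and> aff_dim f = int CARD('d) - 1) \<and> frontier A = \<Union>F)"

text \<open>\<open>triangulation\<close> supplies conformity: two elements meet in a common face.\<close>

definition conforming_mesh :: "(real^'d) set \<Rightarrow> (real^'d) set set \<Rightarrow> bool" where
  "conforming_mesh A Th \<longleftrightarrow> triangulation Th \<and>
     (\<forall>K\<in>Th. (int CARD('d)) simplex K \<and> interior K \<subseteq> A) \<and> \<Union>Th = closure A"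

definition FE_space :: "(real^'d) set \<Rightarrow> (real^'d) set set \<Rightarrow> nat \<Rightarrow> (real^'d \<Rightarrow> real) set" where
  "FE_space A Th p = {v \<in> H10 A. continuous_on (closure A) v \<and>
     (\<forall>K\<in>Th. \<exists>q\<in>poly_space p. \<forall>x\<in>K. v x = q x)}"

text \<open>The final time is \<open>tgrid nslab\<close>. \<open>src_el\<close> is the element-wise \<open>L\<^sup>2\<close> density of the source \<open>src\<close>,
  which itself is only a function with values in \<open>H\<^sup>-\<^sup>1\<close>. \<open>mesh m\<close> is the mesh of the \<open>m\<close>-th time
  interval for \<open>m \<ge> 1\<close>; \<open>mesh 0\<close> is the mesh for the value at time 0. The stabilization parameters
  \<open>delta m K\<close> and \<open>delta_adj m K\<close> belong to the element \<open>K\<close> of \<open>mesh m\<close>.\<close>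

record ('d::finite) dwr_data =
  Omega :: "(real^'d) set"
  alpha :: real
  epsi :: real
  conv :: "real^'d \<Rightarrow> real^'d"
  src :: "real \<Rightarrow> (real^'d \<Rightarrow> real) \<Rightarrow> real"
  src_el :: "real \<Rightarrow> real^'d \<Rightarrow> real"
  init :: "real^'d \<Rightarrow> real"
  nslab :: nat
  tgrid :: "nat \<Rightarrow> real"
  mesh :: "nat \<Rightarrow> (real^'d) set set"
  tdeg :: nat
  xdeg :: nat
  delta :: "nat \<Rightarrow> (real^'d) set \<Rightarrow> real"
  delta_adj :: "nat \<Rightarrow> (real^'d) set \<Rightarrow> real"

definition slab :: "('d::finite) dwr_data \<Rightarrow> nat \<Rightarrow> real set" where
  "slab P m = {tgrid P (m - 1)<..tgrid P m}"

definition timeint :: "('d::finite) dwr_data \<Rightarrow> real set" where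
  "timeint P = {0<..tgrid P (nslab P)}"

definition elementwise_source :: "('d::finite) dwr_data \<Rightarrow> bool" where
  "elementwise_source P \<longleftrightarrow> (\<forall>m\<in>{1..nslab P}. \<forall>K\<in>mesh P m.
     src_el P \<in> bochner_L2 (slab P m) (L2 K) (L2_norm K) \<and>
     (AE t in lebesgue_on (slab P m). \<forall>w\<in>test_fun (interior K). src P t w = ip K (src_el P t) w))"

definition admissible_data :: "('d::finite) dwr_data \<Rightarrow> bool" where
  "admissible_data P \<longleftrightarrow>
     CARD('d) \<in> {2, 3} \<and> polyhedral_domain (Omega P) \<and>
     alpha P \<ge> 0 \<and> epsi P > 0 \<and>
     (\<forall>i. (\<lambda>x. conv P x $ i) \<in> H1 (Omega P)) \<and>
     (\<exists>C. AE x in lebesgue_on (Omega P). norm (conv P x) \<le> C) \<and>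
     (AE x in lebesgue_on (Omega P). (\<Sum>i\<in>UNIV. wgrad (Omega P) (\<lambda>y. conv P y $ i) x $ i) = 0) \<and>
     src P \<in> bochner_L2 (timeint P) (Hm1 (Omega P)) (Hm1_norm (Omega P)) \<and>
     elementwise_source P \<and>
     init P \<in> L2 (Omega P) \<and>
     nslab P \<ge> 1 \<and> tgrid P 0 = 0 \<and> (\<forall>m<nslab P. tgrid P m < tgrid P (Suc m)) \<and>
     (\<forall>m\<le>nslab P. conforming_mesh (Omega P) (mesh P m)) \<and>
     xdeg P \<ge> 1 \<and>
     (\<forall>m\<in>{1..nslab P}. \<forall>K\<in>mesh P m. delta P m K > 0 \<and> delta_adj P m K > 0)"

section \<open>Space-time function spaces\<close>

definition L2H10 :: "('d::finite) dwr_data \<Rightarrow> (real \<Rightarrow> real^'d \<Rightarrow> real) set" where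
  "L2H10 P = bochner_L2 (timeint P) (H10 (Omega P)) (H1_norm (Omega P))"

definition X_space :: "('d::finite) dwr_data \<Rightarrow> (real \<Rightarrow> real^'d \<Rightarrow> real) set" where
  "X_space P = {v \<in> L2H10 P. \<exists>g. is_weak_dt (Omega P) 0 (tgrid P (nslab P)) v g}"

definition Y_space :: "('d::finite) dwr_data \<Rightarrow> (real \<Rightarrow> real^'d \<Rightarrow> real) set" where
  "Y_space P = {v \<in> L2H10 P. \<forall>m\<in>{1..nslab P}. \<exists>w.
     (\<forall>t\<in>{tgrid P (m - 1)..tgrid P m}. w t \<in> H10 (Omega P) \<and>
        ((\<lambda>s. H1_norm (Omega P) (w s - w t)) \<longlongrightarrow> 0) (at t within {tgrid P (m - 1)..tgrid P m})) \<and>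
     (AE t in lebesgue_on (slab P m). AE x in lebesgue_on (Omega P). v t x = w t x)}"

text \<open>Contains \<open>X + X\<^bsub>kh\<^esub>\<close>, because \<open>X\<^bsub>kh\<^esub> \<subseteq> Y\<close>. The target functional is defined on
  this space.\<close>

definition XY_space :: "('d::finite) dwr_data \<Rightarrow> (real \<Rightarrow> real^'d \<Rightarrow> real) set" where
  "XY_space P = X_space P + Y_space P"

definition Xkh_space :: "('d::finite) dwr_data \<Rightarrow> (real \<Rightarrow> real^'d \<Rightarrow> real) set" where
  "Xkh_space P = {v. v 0 \<in> FE_space (Omega P) (mesh P 0) (xdeg P) \<and>
     (\<forall>m\<in>{1..nslab P}. \<exists>c. (\<forall>i\<le>tdeg P. c i \<in> FE_space (Omega P) (mesh P m) (xdeg P)) \<and>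
        (\<forall>t\<in>slab P m. \<forall>x\<in>closure (Omega P). v t x = (\<Sum>i\<le>tdeg P. t ^ i * c i x)))}"

text \<open>A norm on the space \<open>D\<close> of representatives whose elements are identified when they are equal
  almost everywhere.\<close>

definition norm_on :: "('d::finite) dwr_data \<Rightarrow> (real \<Rightarrow> real^'d \<Rightarrow> real) set \<Rightarrow>
    ((real \<Rightarrow> real^'d \<Rightarrow> real) \<Rightarrow> real) \<Rightarrow> bool" where
  "norm_on P D N \<longleftrightarrow>
     (\<forall>v\<in>D. N v \<ge> 0 \<and>
        (N v = 0 \<longleftrightarrow> (AE t in lebesgue_on (timeint P). AE x in lebesgue_on (Omega P). v t x = 0)) \<and>
        (\<forall>s. N (s *\<^sub>R v) = \<bar>s\<bar> * N v) \<and> (\<forall>w\<in>D. N (v + w) \<le> N v + N w))"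

section \<open>Forms\<close>

definition st_ip :: "('d::finite) dwr_data \<Rightarrow>
    (real \<Rightarrow> real^'d \<Rightarrow> real) \<Rightarrow> (real \<Rightarrow> real^'d \<Rightarrow> real) \<Rightarrow> real" where
  "st_ip P v w = (LINT t|lebesgue_on (timeint P). ip (Omega P) (v t) (w t))"

definition tr_plus :: "('d::finite) dwr_data \<Rightarrow> (real \<Rightarrow> real^'d \<Rightarrow> real) \<Rightarrow> nat \<Rightarrow> real^'d \<Rightarrow> real" where
  "tr_plus P v m = (SOME w. ess_lim_right (Omega P) v (tgrid P m) w)"

definition tr_minus :: "('d::finite) dwr_data \<Rightarrow> (real \<Rightarrow> real^'d \<Rightarrow> real) \<Rightarrow> nat \<Rightarrow> real^'d \<Rightarrow> real" where
  "tr_minus P v m = (SOME w. ess_lim_left (Omega P) v (tgrid P m) w)"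

definition jump :: "('d::finite) dwr_data \<Rightarrow> (real \<Rightarrow> real^'d \<Rightarrow> real) \<Rightarrow> nat \<Rightarrow> real^'d \<Rightarrow> real" where
  "jump P v m = tr_plus P v m - tr_minus P v m"

definition conv_deriv :: "('d::finite) dwr_data \<Rightarrow> (real^'d \<Rightarrow> real) \<Rightarrow> real^'d \<Rightarrow> real" where
  "conv_deriv P v x = conv P x \<bullet> wgrad (Omega P) v x"

definition dt_sum :: "('d::finite) dwr_data \<Rightarrow>
    (real \<Rightarrow> real^'d \<Rightarrow> real) \<Rightarrow> (real \<Rightarrow> real^'d \<Rightarrow> real) \<Rightarrow> real" where
  "dt_sum P v \<phi> = (\<Sum>m=1..nslab P.
     LINT t|lebesgue_on (slab P m). weak_dt (Omega P) (tgrid P (m - 1)) (tgrid P m) v t (\<phi> t))"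

definition F_form :: "('d::finite) dwr_data \<Rightarrow> (real \<Rightarrow> real^'d \<Rightarrow> real) \<Rightarrow> real" where
  "F_form P \<phi> = (LINT t|lebesgue_on (timeint P). src P t (\<phi> t))"

definition diff_form :: "('d::finite) dwr_data \<Rightarrow>
    (real \<Rightarrow> real^'d \<Rightarrow> real) \<Rightarrow> (real \<Rightarrow> real^'d \<Rightarrow> real) \<Rightarrow> real" where
  "diff_form P v \<phi> = (LINT t|lebesgue_on (timeint P).
     ip_vec (Omega P) (\<lambda>x. epsi P *\<^sub>R wgrad (Omega P) (v t) x) (wgrad (Omega P) (\<phi> t)))"

definition a_form :: "('d::finite) dwr_data \<Rightarrow>
    (real \<Rightarrow> real^'d \<Rightarrow> real) \<Rightarrow> (real \<Rightarrow> real^'d \<Rightarrow> real) \<Rightarrow> real" where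
  "a_form P v \<phi> = st_ip P (\<lambda>t. conv_deriv P (v t)) \<phi> + diff_form P v \<phi> + st_ip P (alpha P *\<^sub>R v) \<phi>"

definition A_form :: "('d::finite) dwr_data \<Rightarrow>
    (real \<Rightarrow> real^'d \<Rightarrow> real) \<Rightarrow> (real \<Rightarrow> real^'d \<Rightarrow> real) \<Rightarrow> real" where
  "A_form P v \<phi> = dt_sum P v \<phi> + a_form P v \<phi> +
     (\<Sum>m=2..nslab P. ip (Omega P) (jump P v (m - 1)) (tr_plus P \<phi> (m - 1)))"

definition A_adj :: "('d::finite) dwr_data \<Rightarrow>
    (real \<Rightarrow> real^'d \<Rightarrow> real) \<Rightarrow> (real \<Rightarrow> real^'d \<Rightarrow> real) \<Rightarrow> real" where
  "A_adj P z \<psi> = - dt_sum P z \<psi> - st_ip P (\<lambda>t. conv_deriv P (z t)) \<psi> + diff_form P z \<psi> +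
     st_ip P (alpha P *\<^sub>R z) \<psi> -
     (\<Sum>m=2..nslab P. ip (Omega P) (jump P z (m - 1)) (tr_minus P \<psi> (m - 1)))"

text \<open>The residuals are classical derivatives of piecewise polynomials, evaluated in the interiors
  of time intervals and elements.\<close>

definition residual :: "('d::finite) dwr_data \<Rightarrow> (real \<Rightarrow> real^'d \<Rightarrow> real) \<Rightarrow> real \<Rightarrow> real^'d \<Rightarrow> real" where
  "residual P v t x = deriv (\<lambda>s. v s x) t + conv P x \<bullet> grad (v t) x -
     divg (\<lambda>y. epsi P *\<^sub>R grad (v t) y) x + alpha P * v t x - src_el P t x"

definition residual_adj :: "('d::finite) dwr_data \<Rightarrow> (real \<Rightarrow> real^'d \<Rightarrow> real) \<Rightarrow>
    (real \<Rightarrow> real^'d \<Rightarrow> real) \<Rightarrow> real \<Rightarrow> real^'d \<Rightarrow> real" where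
  "residual_adj P ju z t x = - deriv (\<lambda>s. z s x) t - conv P x \<bullet> grad (z t) x -
     divg (\<lambda>y. epsi P *\<^sub>R grad (z t) y) x + alpha P * z t x - ju t x"

definition S_form :: "('d::finite) dwr_data \<Rightarrow>
    (real \<Rightarrow> real^'d \<Rightarrow> real) \<Rightarrow> (real \<Rightarrow> real^'d \<Rightarrow> real) \<Rightarrow> real" where
  "S_form P v \<phi> =
     (\<Sum>m=1..nslab P. LINT t|lebesgue_on (slab P m).
        (\<Sum>K\<in>mesh P m. delta P m K * ip K (residual P v t) (conv_deriv P (\<phi> t)))) +
     (\<Sum>m=2..nslab P. \<Sum>K\<in>mesh P m.
        delta P m K * ip K (jump P v (m - 1)) (conv_deriv P (tr_plus P \<phi> (m - 1)))) +
     (\<Sum>K\<in>mesh P 1. delta P 1 K * ip K (tr_plus P v 0 - init P) (conv_deriv P (tr_plus P \<phi> 0)))"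

text \<open>In the jump terms the test function is taken from the left of \<open>t\<^bsub>m-1\<^esub>\<close>, so the mesh is that of
  the time interval ending there. \<open>ju\<close> is the density \<open>j(u\<^bsub>kh\<^esub>)\<close> of the target functional.\<close>

definition S_adj :: "('d::finite) dwr_data \<Rightarrow> (real \<Rightarrow> real^'d \<Rightarrow> real) \<Rightarrow>
    (real \<Rightarrow> real^'d \<Rightarrow> real) \<Rightarrow> (real \<Rightarrow> real^'d \<Rightarrow> real) \<Rightarrow> real" where
  "S_adj P ju z \<psi> =
     (\<Sum>m=1..nslab P. LINT t|lebesgue_on (slab P m).
        (\<Sum>K\<in>mesh P m. delta_adj P m K * ip K (residual_adj P ju z t) (- conv_deriv P (\<psi> t)))) -
     (\<Sum>m=2..nslab P. \<Sum>K\<in>mesh P (m - 1).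
        delta_adj P (m - 1) K * ip K (jump P z (m - 1)) (- conv_deriv P (tr_minus P \<psi> (m - 1)))) +
     (\<Sum>K\<in>mesh P (nslab P). delta_adj P (nslab P) K *
        ip K (tr_minus P z (nslab P)) (- conv_deriv P (tr_minus P \<psi> (nslab P))))"

section \<open>Lagrangian, discrete problems, primal residual\<close>

definition Lagrangian :: "('d::finite) dwr_data \<Rightarrow> ((real \<Rightarrow> real^'d \<Rightarrow> real) \<Rightarrow> real) \<Rightarrow>
    (real \<Rightarrow> real^'d \<Rightarrow> real) \<Rightarrow> (real \<Rightarrow> real^'d \<Rightarrow> real) \<Rightarrow> real" where
  "Lagrangian P J u z = J u + F_form P z - dt_sum P u z - a_form P u z -
     (\<Sum>m=2..nslab P. ip (Omega P) (jump P u (m - 1)) (tr_plus P z (m - 1))) -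
     ip (Omega P) (tr_plus P u 0 - init P) (tr_plus P z 0)"

definition Lagrangian_u where
  "Lagrangian_u P J u z \<psi> = deriv (\<lambda>s. Lagrangian P J (u + s *\<^sub>R \<psi>) z) 0"

definition Lagrangian_z where
  "Lagrangian_z P J u z \<phi> = deriv (\<lambda>s. Lagrangian P J u (z + s *\<^sub>R \<phi>)) 0"

definition stationary_point where
  "stationary_point P J u z \<longleftrightarrow> u \<in> X_space P \<and> z \<in> Y_space P \<and>
     (\<forall>\<psi>\<in>X_space P. \<forall>\<phi>\<in>Y_space P. Lagrangian_u P J u z \<psi> + Lagrangian_z P J u z \<phi> = 0)"

definition discrete_primal where
  "discrete_primal P ukh \<longleftrightarrow> ukh \<in> Xkh_space P \<and>
     (\<forall>\<phi>\<in>Xkh_space P.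
        A_form P ukh \<phi> + S_form P ukh \<phi> + ip (Omega P) (tr_plus P ukh 0) (tr_plus P \<phi> 0) =
        F_form P \<phi> + ip (Omega P) (init P) (tr_plus P \<phi> 0))"

definition discrete_dual where
  "discrete_dual P J1 j ukh zkh \<longleftrightarrow> zkh \<in> Xkh_space P \<and>
     (\<forall>\<psi>\<in>Xkh_space P.
        A_adj P zkh \<psi> + S_adj P (j ukh) zkh \<psi> +
          ip (Omega P) (tr_minus P zkh (nslab P)) (tr_minus P \<psi> (nslab P)) = J1 ukh \<psi>)"

definition primal_residual where
  "primal_residual P ukh \<phi> =
     F_form P \<phi> - A_form P ukh \<phi> - ip (Omega P) (tr_plus P ukh 0 - init P) (tr_plus P \<phi> 0)"

end

theory Submission
  imports Defs
begin

text \<open>Put \<open>g(s) = J(u\<^bsub>kh\<^esub> + s e)\<close>. Since \<open>g'' s (s - 1) - g' (2 s - 1) + 2 g\<close> is a primitive of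
\<open>g''' s (s - 1)\<close>, the two remainder integrals of the representation add up to
\<open>g(1) - g(0) - g'(1)\<close> (\<open>segment_expansion\<close>). The assertion is therefore
\<open>J'(u)(e) = \<rho>(u\<^bsub>kh\<^esub>)(z - \<phi>\<^bsub>kh\<^esub>) + S(u\<^bsub>kh\<^esub>)(\<phi>\<^bsub>kh\<^esub>)\<close>. The discrete primal problem says that
\<open>\<rho>(u\<^bsub>kh\<^esub>)(\<phi>\<^bsub>kh\<^esub>) = S(u\<^bsub>kh\<^esub>)(\<phi>\<^bsub>kh\<^esub>)\<close>, and \<open>\<rho>(u\<^bsub>kh\<^esub>)\<close> is linear, so the assertion reduces to
\<open>J'(u)(u - u\<^bsub>kh\<^esub>) = \<rho>(u\<^bsub>kh\<^esub>)(z)\<close>.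

Let \<open>B\<close> be the space-time form including the initial term (\<open>B_form\<close>) and \<open>l\<close> the data functional
(\<open>load\<close>). The Lagrangian is \<open>J(u) + l(z) - B(u, z)\<close>, so stationarity means \<open>B(u, z) = l(z)\<close> and
\<open>J'(u)(\<psi>) = B(\<psi>, z)\<close> for all \<open>\<psi>\<close> in \<open>X\<close>; with \<open>\<psi> = u\<close> this gives \<open>J'(u)(u) = l(z)\<close>. On the other
hand \<open>\<rho>(u\<^bsub>kh\<^esub>)(z) = l(z) - B(u\<^bsub>kh\<^esub>, z)\<close>. What is left is the dual identity
\<open>J'(u)(u\<^bsub>kh\<^esub>) = B(u\<^bsub>kh\<^esub>, z)\<close> for \<open>u\<^bsub>kh\<^esub>\<close>, which jumps in time and hence does not belong to \<open>X\<close>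
(\<open>dual_identity_Xkh\<close>). It is derived from the members \<open>\<chi>(t) c\<close> of \<open>X\<close> in which \<open>c\<close> is a fixed element of
\<open>H\<^sup>1\<^sub>0\<close> and \<open>\<chi>\<close> is constant outside one time interval. Steep ramps \<open>\<chi>\<close> at a time node express the right
limit of \<open>z\<close> there by an integral over all later times (\<open>defect_tail\<close>); this is where the \<open>L\<^sup>2\<close>
representation of \<open>J'(u)\<close> enters. Polynomial ramps then give an integration by parts on each time slab
(\<open>slab_parts\<close>), and summation over the slabs assembles the node terms to the jump terms of \<open>B\<close>.

The Lagrangian can be differentiated only if its terms are linear, which concerns above all the traces
at the time nodes. For \<open>u\<close> in \<open>X\<close> they exist by \<open>weak_dt_ess_lim\<close>: \<open>\<parallel>u(t) - u(s)\<parallel>\<^sup>2\<close> telescopes over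
partitions of \<open>(s, t)\<close>, and partition points at which the \<open>H\<^sup>1\<close> norm of \<open>u\<close> does not exceed its local
mean bound the sum by the integral of \<open>\<parallel>\<partial>\<^sub>tu\<parallel>\<^sup>2 + \<parallel>u\<parallel>\<^sup>2\<close> in the norms of \<open>H\<^sup>-\<^sup>1\<close> and \<open>H\<^sup>1\<close>
(\<open>telescoping_estimate\<close>). Weak gradients and weak time derivatives are determined almost everywhere by
the fundamental lemma of the calculus of variations, for which smooth bump functions are constructed
first (\<open>AE_eq_0_if_orthogonal_to_test_fun\<close>).\<close>

section \<open>Smooth functions and bump functions\<close>

lemma Ck_continuous: "Ck k f \<Longrightarrow> continuous_on UNIV f"
  by (cases k) (auto simp: differentiable_imp_continuous_within continuous_at_imp_continuous_on)

lemma Ck_SucD: "Ck (Suc k) f \<Longrightarrow> Ck k f"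
proof (induction k arbitrary: f)
  case 0
  then show ?case using Ck_continuous by fastforce
next
  case (Suc k)
  then show ?case by (metis Ck.simps(2))
qed

lemma Ck_const: "Ck k (\<lambda>x. c)"
  by (induction k arbitrary: c) auto

lemma Ck_SucI:
  assumes "\<And>x. (f has_derivative f' x) (at x)" "\<And>i. i \<in> Basis \<Longrightarrow> Ck k (\<lambda>x. f' x i)"
  shows "Ck (Suc k) f"
proof -
  have "frechet_derivative f (at x) = f' x" for x
    using frechet_derivative_at[OF assms(1)] by simp
  with assms show ?thesis by (auto simp: differentiable_def)
qed

lemma Ck_has_derivative: "Ck (Suc k) f \<Longrightarrow> (f has_derivative frechet_derivative f (at x)) (at x)"
  by (simp add: frechet_derivative_works[symmetric])

lemma Ck_add: "Ck k f \<Longrightarrow> Ck k g \<Longrightarrow> Ck k (\<lambda>x. f x + g x)"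
proof (induction k arbitrary: f g)
  case 0
  then show ?case by (auto intro: continuous_on_add)
next
  case (Suc k)
  show ?case
    by (rule Ck_SucI, rule has_derivative_add[OF Ck_has_derivative Ck_has_derivative, OF Suc.prems])
      (use Suc in simp)
qed

lemma Ck_mult: "Ck k f \<Longrightarrow> Ck k g \<Longrightarrow> Ck k (\<lambda>x. f x * g x)"
proof (induction k arbitrary: f g)
  case 0
  then show ?case by (auto intro: continuous_on_mult)
next
  case (Suc k)
  show ?case
  proof (rule Ck_SucI, rule has_derivative_mult[OF Ck_has_derivative Ck_has_derivative, OF Suc.prems])
    fix i :: 'a assume "i \<in> Basis"
    with Suc show "Ck k (\<lambda>x. f x * frechet_derivative g (at x) i + frechet_derivative f (at x) i * g x)"
      by (intro Ck_add Suc.IH Ck_SucD[OF Suc.prems(1)] Ck_SucD[OF Suc.prems(2)]) auto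
  qed
qed

lemma Ck_prod: "finite I \<Longrightarrow> (\<And>i. i \<in> I \<Longrightarrow> Ck k (f i)) \<Longrightarrow> Ck k (\<lambda>x. \<Prod>i\<in>I. f i x)"
  by (induction I rule: finite_induct) (auto intro: Ck_const Ck_mult)

lemma Ck_affine:
  fixes g :: "real \<Rightarrow> real" and b :: "'a::euclidean_space"
  shows "Ck k g \<Longrightarrow> Ck k (\<lambda>x. g (s * (x \<bullet> b) + c))"
proof (induction k arbitrary: g)
  case 0
  then show ?case
    by (auto intro!: continuous_intros continuous_on_compose2[of UNIV g])
next
  case (Suc k)
  have D: "((\<lambda>x. g (s * (x \<bullet> b) + c)) has_derivative
       (\<lambda>h. frechet_derivative g (at (s * (x \<bullet> b) + c)) (s * (h \<bullet> b)))) (at x)" for x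
  proof -
    have "(g has_derivative frechet_derivative g (at (s * (x \<bullet> b) + c))) (at (s * (x \<bullet> b) + c))"
      using Suc.prems by (auto simp: frechet_derivative_works[symmetric])
    moreover have "((\<lambda>x. s * (x \<bullet> b) + c) has_derivative (\<lambda>h. s * (h \<bullet> b))) (at x)"
      by (auto intro!: derivative_eq_intros)
    ultimately show ?thesis by (rule has_derivative_compose[rotated])
  qed
  have lin: "frechet_derivative g (at y) (s * h) = (s * h) * frechet_derivative g (at y) 1" for y h
  proof -
    have "linear (frechet_derivative g (at y))"
      using Suc.prems linear_frechet_derivative by auto
    from linear_scale[OF this, of "s * h" 1] show ?thesis by simp
  qed
  have eq: "frechet_derivative (\<lambda>x. g (s * (x \<bullet> b) + c)) (at x) i =
      (s * (i \<bullet> b)) * frechet_derivative g (at (s * (x \<bullet> b) + c)) 1" for x i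
    using frechet_derivative_at[OF D[of x], symmetric] lin by (simp add: fun_eq_iff)
  have "Ck k (\<lambda>x. frechet_derivative g (at x) 1)" using Suc.prems by auto
  from Suc.IH[OF this] have "Ck k (\<lambda>x. frechet_derivative g (at (s * (x \<bullet> b) + c)) 1)" .
  then have "Ck k (\<lambda>x. (s * (i \<bullet> b)) * frechet_derivative g (at (s * (x \<bullet> b) + c)) 1)" for i
    by (rule Ck_mult[OF Ck_const])
  then show ?case using D by (auto simp: eq differentiable_def)
qed

lemma poly_times_exp_minus_tendsto_0:
  fixes p :: "real poly"
  shows "((\<lambda>y. poly p y * exp (- y)) \<longlongrightarrow> 0) at_top"
proof -
  have "((\<lambda>y. \<Sum>i\<le>degree p. coeff p i * (y ^ i / exp y)) \<longlongrightarrow> (\<Sum>i\<le>degree p. coeff p i * 0)) at_top"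
    by (intro tendsto_sum tendsto_mult tendsto_const tendsto_power_div_exp_0)
  moreover have "(\<lambda>y. \<Sum>i\<le>degree p. coeff p i * (y ^ i / exp y)) = (\<lambda>y. poly p y * exp (- y))"
    by (auto simp: poly_altdef sum_distrib_left exp_minus divide_inverse mult_ac)
  ultimately show ?thesis by simp
qed

text \<open>The class of functions \<open>q(1/x) exp(-1/x)\<close> with \<open>q\<close> a polynomial, extended by zero, is closed
  under differentiation; this is what makes the standard flat function smooth.\<close>

definition flat :: "real poly \<Rightarrow> real \<Rightarrow> real" where
  "flat q x = (if x > 0 then poly q (1 / x) * exp (- (1 / x)) else 0)"

lemma flat_has_derivative:
  "(flat q has_real_derivative flat (monom 1 2 * (q - pderiv q)) x) (at x)"
proof -
  consider "x > 0" | "x < 0" | "x = 0" by linarith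
  then show ?thesis
  proof cases
    case 1
    have "((\<lambda>x. poly q (1 / x) * exp (- (1 / x))) has_real_derivative
        flat (monom 1 2 * (q - pderiv q)) x) (at x)"
      using 1 by (auto intro!: derivative_eq_intros DERIV_chain2[OF poly_DERIV]
          simp: flat_def poly_monom field_simps power2_eq_square)
    moreover have "eventually (\<lambda>x. poly q (1 / x) * exp (- (1 / x)) = flat q x) (nhds x)"
      using eventually_nhds_in_open[of "{0<..}" x] 1
      by (auto simp: flat_def elim!: eventually_mono)
    ultimately show ?thesis
      by (subst (asm) DERIV_cong_ev[OF refl _ refl]) auto
  next
    case 2
    have "((\<lambda>x. 0) has_real_derivative flat (monom 1 2 * (q - pderiv q)) x) (at x)"
      using 2 by (simp add: flat_def)
    moreover have "eventually (\<lambda>x. 0 = flat q x) (nhds x)"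
      using eventually_nhds_in_open[of "{..<0}" x] 2
      by (auto simp: flat_def elim!: eventually_mono)
    ultimately show ?thesis
      by (subst (asm) DERIV_cong_ev[OF refl _ refl]) auto
  next
    case 3
    have "((\<lambda>y. poly (monom 1 1 * q) y * exp (- y)) \<longlongrightarrow> 0) at_top"
      by (rule poly_times_exp_minus_tendsto_0)
    then have "((\<lambda>h. poly (monom 1 1 * q) (inverse h) * exp (- (inverse h))) \<longlongrightarrow> 0) (at_right 0)"
      by (rule filterlim_compose[OF _ filterlim_inverse_at_top_right])
    moreover have "eventually (\<lambda>h. poly (monom 1 1 * q) (inverse h) * exp (- (inverse h)) =
        flat q h / h) (at_right 0)"
      by (auto simp: eventually_at_filter flat_def poly_monom field_simps)
    ultimately have r: "((\<lambda>h. flat q h / h) \<longlongrightarrow> 0) (at_right 0)"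
      by (rule Lim_transform_eventually)
    have "eventually (\<lambda>h. 0 = flat q h / h) (at_left 0)"
      by (auto simp: eventually_at_filter flat_def)
    then have l: "((\<lambda>h. flat q h / h) \<longlongrightarrow> 0) (at_left 0)"
      by (rule Lim_transform_eventually[OF tendsto_const])
    have "((\<lambda>h. flat q h / h) \<longlongrightarrow> 0) (at 0)"
      using l r by (simp add: filterlim_split_at)
    then show ?thesis using 3 by (simp add: DERIV_def flat_def)
  qed
qed

lemma Ck_flat: "Ck k (flat q)"
proof (induction k arbitrary: q)
  case 0
  show ?case using flat_has_derivative DERIV_continuous_on[of UNIV "flat q"]
    by (auto intro: DERIV_continuous_on has_field_derivative_at_within)
next
  case (Suc k)
  have "frechet_derivative (flat q) (at x) 1 = flat (monom 1 2 * (q - pderiv q)) x" for x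
    using frechet_derivative_at[OF flat_has_derivative[of q x, unfolded has_field_derivative_def]]
    by (metis (no_types, lifting) mult.right_neutral)
  with Suc flat_has_derivative[of q] show ?case
    by (auto simp: has_field_derivative_def differentiable_def)
qed

text \<open>Tends to the indicator of \<open>box c d\<close> as \<open>n \<rightarrow> \<infinity>\<close>. The shift by 1 keeps the closure of the support
  inside the open box.\<close>

definition box_bump :: "'a::euclidean_space \<Rightarrow> 'a \<Rightarrow> nat \<Rightarrow> 'a \<Rightarrow> real" where
  "box_bump c d n x = (\<Prod>b\<in>Basis. flat 1 (real n * (x \<bullet> b) + (- real n * (c \<bullet> b) - 1)) *
      flat 1 (- real n * (x \<bullet> b) + (real n * (d \<bullet> b) - 1)))"

lemma flat_1_bounds: "0 \<le> flat 1 x" "flat 1 x \<le> 1"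
  by (auto simp: flat_def)

lemma flat_1_tendsto: "(\<lambda>n. flat 1 (real n * y - 1)) \<longlonglongrightarrow> (if y > 0 then 1 else 0)"
proof (cases "y > 0")
  case True
  have lim: "filterlim (\<lambda>n. real n * y - 1) at_top sequentially"
    using True by real_asymp
  have "((\<lambda>z::real. exp (- (1 / z))) \<longlongrightarrow> exp (- 0)) at_top"
    by (intro tendsto_intros tendsto_divide_0[OF tendsto_const] filterlim_at_top_imp_at_infinity
        filterlim_ident)
  then have "((\<lambda>n. exp (- (1 / (real n * y - 1)))) \<longlongrightarrow> exp (- 0)) sequentially"
    by (rule filterlim_compose[OF _ lim])
  moreover have "eventually (\<lambda>n. real n * y - 1 > 0) sequentially"
    using lim unfolding filterlim_at_top_dense by blast
  then have "eventually (\<lambda>n. exp (- (1 / (real n * y - 1))) = flat 1 (real n * y - 1)) sequentially"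
    by eventually_elim (auto simp: flat_def)
  ultimately show ?thesis using True by (simp add: tendsto_cong)
next
  case False
  have "flat 1 (real n * y - 1) = 0" for n
    using False mult_nonneg_nonpos[of "real n" y] by (auto simp: flat_def)
  with False show ?thesis by simp
qed

lemma box_bump_tendsto: "(\<lambda>n. box_bump c d n x) \<longlonglongrightarrow> indicat_real (box c d) x"
proof -
  have "(\<lambda>n. box_bump c d n x) \<longlonglongrightarrow>
     (\<Prod>b\<in>Basis. (if x \<bullet> b - c \<bullet> b > 0 then 1 else 0) * (if d \<bullet> b - x \<bullet> b > 0 then 1 else (0::real)))"
    unfolding box_bump_def
    using flat_1_tendsto[of "x \<bullet> b - c \<bullet> b" for b] flat_1_tendsto[of "d \<bullet> b - x \<bullet> b" for b]
    by (intro tendsto_prod tendsto_mult) (simp_all add: algebra_simps)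
  moreover have "(\<Prod>b\<in>Basis. (if x \<bullet> b - c \<bullet> b > 0 then 1 else 0) * (if d \<bullet> b - x \<bullet> b > 0 then 1 else (0::real)))
      = indicat_real (box c d) x"
    by (auto simp: indicator_def mem_box intro!: prod.neutral)
  ultimately show ?thesis by simp
qed

lemma box_bump_bounds: "0 \<le> box_bump c d n x" "box_bump c d n x \<le> 1"
  unfolding box_bump_def
  by (auto intro!: prod_nonneg prod_le_1 mult_nonneg_nonneg mult_le_one flat_1_bounds)

lemma box_bump_test_fun:
  assumes "box c d \<subseteq> A"
  shows "box_bump c d n \<in> test_fun A"
proof -
  have Ck: "Ck k (box_bump c d n)" for k
    unfolding box_bump_def[abs_def] by (intro Ck_prod Ck_mult Ck_affine Ck_flat) auto
  let ?e = "(\<Sum>b\<in>Basis. (1 / real n) *\<^sub>R b) :: 'a"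
  have *: "{x. box_bump c d n x \<noteq> 0} \<subseteq> (if n = 0 then {} else cbox (c + ?e) (d - ?e))"
  proof
    fix x assume "x \<in> {x. box_bump c d n x \<noteq> 0}"
    then have nz: "\<forall>b\<in>Basis. real n * (x \<bullet> b) + (- real n * (c \<bullet> b) - 1) > 0 \<and>
        - real n * (x \<bullet> b) + (real n * (d \<bullet> b) - 1) > 0"
      by (auto simp: box_bump_def flat_def split: if_splits)
    then have n: "n > 0" using nonempty_Basis by (cases "n = 0") fastforce+
    have "c \<bullet> b + 1 / n \<le> x \<bullet> b \<and> x \<bullet> b \<le> d \<bullet> b - 1 / n" if "b \<in> Basis" for b
      using nz that n by (auto simp: field_simps)
    then show "x \<in> (if n = 0 then {} else cbox (c + ?e) (d - ?e))"
      using n by (auto simp: mem_box inner_simps inner_sum_left_Basis)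
  qed
  have cl: "closure {x. box_bump c d n x \<noteq> 0} \<subseteq> (if n = 0 then {} else cbox (c + ?e) (d - ?e))"
    using * by (intro closure_minimal) auto
  also have "\<dots> \<subseteq> box c d"
    by (auto simp: mem_box inner_simps inner_sum_left_Basis) (smt (verit) divide_pos_pos of_nat_0_less_iff)+
  finally have "closure {x. box_bump c d n x \<noteq> 0} \<subseteq> A" using assms by blast
  moreover have "bounded {x. box_bump c d n x \<noteq> 0}"
    by (rule bounded_subset[OF _ *]) (auto intro: bounded_cbox)
  ultimately show ?thesis using Ck by (auto simp: test_fun_def compact_closure)
qed

section \<open>The fundamental lemma of the calculus of variations\<close>

lemma test_fun_continuous: "\<phi> \<in> test_fun A \<Longrightarrow> continuous_on UNIV \<phi>"
  unfolding test_fun_def using Ck_continuous by blast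

text \<open>A function orthogonal to all test functions has integral zero over every open box in the
  domain, because indicators of boxes are bounded limits of test functions. Open boxes form a
  generator of the Borel sets that is closed under intersections.\<close>

theorem AE_eq_0_if_orthogonal_to_test_fun:
  fixes h :: "'a::euclidean_space \<Rightarrow> real"
  assumes A: "open A" and h: "integrable (lebesgue_on A) h"
    and orth: "\<And>\<phi>. \<phi> \<in> test_fun A \<Longrightarrow> (LINT x|lebesgue_on A. h x * \<phi> x) = 0"
  shows "AE x in lebesgue_on A. h x = 0"
proof -
  define f where "f x = indicat_real A x * h x" for x
  have Am: "A \<in> sets lebesgue" using A by auto
  have f: "integrable lebesgue f"
    using h Am by (simp add: f_def[abs_def] integrable_restrict_space)
  obtain f' where f'm: "f' \<in> borel_measurable lborel" and ff': "AE x in lborel. f x = f' x"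
    using completion_ex_borel_measurable_real[OF borel_measurable_integrable[OF f]] by auto
  have ff'': "AE x in lebesgue. f x = f' x" using ff' by (rule AE_completion)
  have f'm': "f' \<in> borel_measurable lebesgue" using f'm by (rule measurable_completion)
  have f': "integrable lborel f'"
    using f ff'' f'm f'm' integrable_cong_AE[OF borel_measurable_integrable[OF f] f'm' ff'']
    by (simp add: integrable_completion)
  have box0: "(LINT x|lborel. indicat_real (box c d) x * f' x) = 0" if cd: "box c d \<subseteq> A" for c d
  proof -
    have "(\<lambda>n. LINT x|lebesgue. box_bump c d n x * f x) \<longlonglongrightarrow> (LINT x|lebesgue. indicat_real (box c d) x * f x)"
    proof (rule integral_dominated_convergence[where w = "\<lambda>x. norm (f x)"])
      have "box_bump c d n \<in> borel_measurable borel" for n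
        using test_fun_continuous[OF box_bump_test_fun[OF cd]] by (rule borel_measurable_continuous_onI)
      then have [measurable]: "box_bump c d n \<in> borel_measurable lebesgue" for n
        by (simp add: measurable_completion)
      have [measurable]: "f \<in> borel_measurable lebesgue" using f by auto
      show "(\<lambda>x. box_bump c d n x * f x) \<in> borel_measurable lebesgue" for n by measurable
      show "(\<lambda>x. indicat_real (box c d) x * f x) \<in> borel_measurable lebesgue"
        by (intro borel_measurable_times borel_measurable_indicator) auto
      show "AE x in lebesgue. (\<lambda>n. box_bump c d n x * f x) \<longlonglongrightarrow> indicat_real (box c d) x * f x"
        by (intro AE_I2 tendsto_mult box_bump_tendsto tendsto_const)
      show "AE x in lebesgue. norm (box_bump c d n x * f x) \<le> norm (f x)" for n
        using box_bump_bounds[of c d n] by (auto simp: abs_mult mult_left_le_one_le)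
    qed (use f in auto)
    moreover have "(LINT x|lebesgue. box_bump c d n x * f x) = 0" for n
      using orth[OF box_bump_test_fun[OF cd, of n]] Am
      by (simp add: integral_restrict_space f_def mult_ac)
    ultimately have "(LINT x|lebesgue. indicat_real (box c d) x * f x) = 0"
      by (simp add: LIMSEQ_const_iff)
    also have "(LINT x|lebesgue. indicat_real (box c d) x * f x) =
        (LINT x|lebesgue. indicat_real (box c d) x * f' x)"
    proof (rule integral_cong_AE)
      have ind: "indicat_real (box c d) \<in> borel_measurable lebesgue"
        by (rule borel_measurable_indicator) auto
      show "(\<lambda>x. indicat_real (box c d) x * f x) \<in> borel_measurable lebesgue"
        "(\<lambda>x. indicat_real (box c d) x * f' x) \<in> borel_measurable lebesgue"
        using borel_measurable_times[OF ind borel_measurable_integrable[OF f]]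
          borel_measurable_times[OF ind f'm'] by auto
    qed (use ff'' in auto)
    also have "\<dots> = (LINT x|lborel. indicat_real (box c d) x * f' x)"
      using f'm by (intro integral_completion borel_measurable_times) auto
    finally show ?thesis .
  qed
  have zero: "AE x in lborel. x \<in> box c d \<longrightarrow> f' x = 0" if cd: "box c d \<subseteq> A" for c d
  proof -
    define F where "F x = indicat_real (box c d) x * f' x" for x
    have F: "integrable lborel F"
      unfolding F_def[abs_def]
      using integrable_mult_indicator[OF _ f', of "box c d"] by simp
    have sb: "E \<in> sets borel \<longleftrightarrow> E \<in> sigma_sets UNIV (range (\<lambda>(a, b). box a b))" for E :: "'a set"
      unfolding borel_eq_box by simp
    have si: "set_integrable lborel E F" if "E \<in> sets lborel" for E
      unfolding set_integrable_def using integrable_mult_indicator[OF that F] .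
    have "set_lebesgue_integral lborel E F = 0" if "E \<in> sets lborel" for E
    proof -
      have "Int_stable (range (\<lambda>(a, b). box a (b::'a)))"
        by (auto simp: Int_stable_def box_Int_box)
      moreover have "range (\<lambda>(a, b). box a (b::'a)) \<subseteq> Pow UNIV" by simp
      moreover have "E \<in> sigma_sets UNIV (range (\<lambda>(a, b). box a b))"
        using that sb by simp
      ultimately show ?thesis
      proof (induction rule: sigma_sets_induct_disjoint[consumes 3])
        case (basic E)
        then obtain a b where "E = box a b" by auto
        then show ?case using box0[of "\<Sum>i\<in>Basis. max (a\<bullet>i) (c\<bullet>i) *\<^sub>R i" "\<Sum>i\<in>Basis. min (b\<bullet>i) (d\<bullet>i) *\<^sub>R i"] cd
          by (auto simp: set_lebesgue_integral_def F_def box_Int_box[symmetric] indicator_inter_arith mult_ac)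
      next
        case empty
        then show ?case by (simp add: set_lebesgue_integral_def)
      next
        case (compl E)
        then have E: "E \<in> sets lborel" using sb by simp
        have "set_lebesgue_integral lborel (UNIV - E) F + set_lebesgue_integral lborel E F =
            set_lebesgue_integral lborel ((UNIV - E) \<union> E) F"
          using E by (intro set_integral_Un[symmetric] si) auto
        also have "(UNIV - E) \<union> E = UNIV" by auto
        also have "set_lebesgue_integral lborel UNIV F = 0"
          using box0[OF cd] by (simp add: set_lebesgue_integral_def F_def)
        finally show ?case using compl by simp
      next
        case (union E)
        then have E: "E i \<in> sets lborel" for i using sb by auto
        have "set_lebesgue_integral lborel (\<Union>i. E i) F = (\<Sum>i. set_lebesgue_integral lborel (E i) F)"
          using E union(1) by (intro lebesgue_integral_countable_add si) (auto simp: disjoint_family_on_def)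
        with union show ?case by simp
      qed
    qed
    from sigma_finite_measure.density_zero[OF lborel.sigma_finite_measure_axioms F this] show ?thesis
      by (auto simp: F_def indicator_def split: if_splits)
  qed
  obtain D where D: "countable D" "D \<subseteq> Pow A" "\<And>X. X \<in> D \<Longrightarrow> \<exists>a b. X = box a b" "\<Union>D = A"
    using open_countable_Union_open_box[OF A] by blast
  have "AE x in lborel. x \<in> X \<longrightarrow> f' x = 0" if "X \<in> D" for X
  proof -
    obtain a b where "X = box a b" using D(3) \<open>X \<in> D\<close> by blast
    then show ?thesis using zero[of a b] D(2) \<open>X \<in> D\<close> by auto
  qed
  then have "AE x in lborel. \<forall>X\<in>D. x \<in> X \<longrightarrow> f' x = 0"
    by (subst AE_ball_countable[OF D(1)]) blast
  with ff' have "AE x in lborel. x \<in> A \<longrightarrow> h x = 0"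
    by eventually_elim (use D(4) in \<open>auto simp: f_def indicator_def\<close>)
  then have "AE x in lebesgue. x \<in> A \<longrightarrow> h x = 0" by (rule AE_completion)
  then show ?thesis using Am by (simp add: AE_restrict_space_iff)
qed

section \<open>Seminormed spaces of representatives\<close>

lemma scaleR_fun_apply [simp]: "(r *\<^sub>R f) x = r *\<^sub>R f x"
  by (simp add: scaleR_fun_def)

lemma sum_fun_apply: "(\<Sum>i\<in>I. f i) x = (\<Sum>i\<in>I. f i x)"
  by (induction I rule: infinite_finite_induct) auto

text \<open>Elements of the function spaces are representatives, so their norms are only seminorms, and they
  are meaningful only on a subspace of the type of all functions.\<close>

locale seminorm_space =
  fixes D :: "'v::real_vector set" and N :: "'v \<Rightarrow> real"
  assumes subspace: "subspace D"
    and nonneg: "v \<in> D \<Longrightarrow> 0 \<le> N v"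
    and scale: "v \<in> D \<Longrightarrow> N (s *\<^sub>R v) = \<bar>s\<bar> * N v"
    and triangle: "v \<in> D \<Longrightarrow> w \<in> D \<Longrightarrow> N (v + w) \<le> N v + N w"
begin

lemma zero_in: "0 \<in> D" using subspace by (rule subspace_0)
lemma add_in: "v \<in> D \<Longrightarrow> w \<in> D \<Longrightarrow> v + w \<in> D" using subspace by (rule subspace_add)
lemma scale_in: "v \<in> D \<Longrightarrow> s *\<^sub>R v \<in> D" using subspace by (rule subspace_scale)
lemma diff_in: "v \<in> D \<Longrightarrow> w \<in> D \<Longrightarrow> v - w \<in> D" using subspace by (rule subspace_diff)
lemma sum_in: "(\<And>i. i \<in> I \<Longrightarrow> f i \<in> D) \<Longrightarrow> (\<Sum>i\<in>I. f i) \<in> D"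
  using subspace by (rule subspace_sum)

lemma zero: "N 0 = 0" using scale[OF zero_in, of 0] by simp

lemma minus: "v \<in> D \<Longrightarrow> N (- v) = N v" using scale[of v "-1"] by simp

lemma minus_commute: "v \<in> D \<Longrightarrow> w \<in> D \<Longrightarrow> N (v - w) = N (w - v)"
  using minus[of "v - w"] diff_in by simp

lemma triangle_via: "u \<in> D \<Longrightarrow> v \<in> D \<Longrightarrow> w \<in> D \<Longrightarrow> N (u - w) \<le> N (u - v) + N (v - w)"
  using triangle[of "u - v" "v - w"] diff_in by simp

lemma abs_diff_le: "v \<in> D \<Longrightarrow> w \<in> D \<Longrightarrow> \<bar>N v - N w\<bar> \<le> N (v - w)"
  using triangle[of "v - w" w] triangle[of "w - v" v] diff_in minus_commute[of v w] by fastforce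

lemma tendsto_norm:
  assumes "\<And>n. s n \<in> D" "v \<in> D" "(\<lambda>n. N (s n - v)) \<longlonglongrightarrow> 0"
  shows "(\<lambda>n. N (s n)) \<longlonglongrightarrow> N v"
proof (rule LIM_zero_cancel, rule Lim_null_comparison[OF _ assms(3)])
  show "\<forall>\<^sub>F n in sequentially. norm (N (s n) - N v) \<le> N (s n - v)"
    using abs_diff_le assms by auto
qed

lemma square_triangle: "v \<in> D \<Longrightarrow> w \<in> D \<Longrightarrow> (N (v + w))\<^sup>2 \<le> 2 * (N v)\<^sup>2 + 2 * (N w)\<^sup>2"
proof -
  assume vw: "v \<in> D" "w \<in> D"
  have "(N (v + w))\<^sup>2 \<le> (N v + N w)\<^sup>2"
    using vw nonneg triangle add_in by (intro power_mono) auto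
  also have "\<dots> \<le> 2 * (N v)\<^sup>2 + 2 * (N w)\<^sup>2"
    using sum_squares_bound[of "N v" "N w"] by (simp add: power2_sum)
  finally show ?thesis .
qed

lemma square_triangle_diff: "v \<in> D \<Longrightarrow> w \<in> D \<Longrightarrow> (N (v - w))\<^sup>2 \<le> 2 * (N v)\<^sup>2 + 2 * (N w)\<^sup>2"
  using square_triangle[of v "- w"] minus[of w] scale_in[of w "-1"] by simp

end

subsection \<open>Positive semidefinite bilinear forms\<close>

definition semi_inner :: "'v::real_vector set \<Rightarrow> ('v \<Rightarrow> 'v \<Rightarrow> real) \<Rightarrow> bool" where
  "semi_inner D b \<longleftrightarrow> subspace D \<and> (\<forall>v\<in>D. \<forall>w\<in>D. b v w = b w v) \<and>
     (\<forall>u\<in>D. \<forall>v\<in>D. \<forall>w\<in>D. \<forall>s. b (u + s *\<^sub>R v) w = b u w + s * b v w) \<and> (\<forall>v\<in>D. 0 \<le> b v v)"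

lemma semi_innerD:
  assumes "semi_inner D b"
  shows semi_inner_subspace: "subspace D"
    and semi_inner_commute: "v \<in> D \<Longrightarrow> w \<in> D \<Longrightarrow> b v w = b w v"
    and semi_inner_linear: "u \<in> D \<Longrightarrow> v \<in> D \<Longrightarrow> w \<in> D \<Longrightarrow> b (u + s *\<^sub>R v) w = b u w + s * b v w"
    and semi_inner_nonneg: "v \<in> D \<Longrightarrow> 0 \<le> b v v"
  using assms unfolding semi_inner_def by blast+

lemma semi_inner_expand:
  assumes b: "semi_inner D b" and vw: "v \<in> D" "w \<in> D"
  shows "b (v + s *\<^sub>R w) (v + s *\<^sub>R w) = b v v + 2 * s * b v w + s\<^sup>2 * b w w"
proof -
  have in': "v + s *\<^sub>R w \<in> D"
    using semi_inner_subspace[OF b] vw by (simp add: subspace_add subspace_scale)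
  have "b (v + s *\<^sub>R w) (v + s *\<^sub>R w) = b v (v + s *\<^sub>R w) + s * b w (v + s *\<^sub>R w)"
    by (rule semi_inner_linear[OF b vw in'])
  also have "b v (v + s *\<^sub>R w) = b (v + s *\<^sub>R w) v" by (rule semi_inner_commute[OF b vw(1) in'])
  also have "\<dots> = b v v + s * b w v" by (rule semi_inner_linear[OF b vw vw(1)])
  also have "b w (v + s *\<^sub>R w) = b (v + s *\<^sub>R w) w" by (rule semi_inner_commute[OF b vw(2) in'])
  also have "\<dots> = b v w + s * b w w" by (rule semi_inner_linear[OF b vw vw(2)])
  also have "b w v = b v w" by (rule semi_inner_commute[OF b vw(2,1)])
  finally show ?thesis by (simp add: algebra_simps power2_eq_square)
qed

lemma semi_inner_Cauchy_Schwarz: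
  assumes b: "semi_inner D b" and vw: "v \<in> D" "w \<in> D"
  shows "\<bar>b v w\<bar> \<le> sqrt (b v v) * sqrt (b w w)"
proof -
  have nn: "0 \<le> b v v" "0 \<le> b w w" using semi_inner_nonneg[OF b] vw by auto
  have q: "0 \<le> b v v + 2 * s * b v w + s\<^sup>2 * b w w" for s
    unfolding semi_inner_expand[OF b vw, symmetric]
    using semi_inner_subspace[OF b] vw by (intro semi_inner_nonneg[OF b]) (simp add: subspace_add subspace_scale)
  have "(b v w)\<^sup>2 \<le> b v v * b w w"
  proof (cases "b w w = 0")
    case True
    have "b v w = 0"
    proof (rule ccontr)
      assume "b v w \<noteq> 0"
      then show False using q[of "- (b v v + 1) / (2 * b v w)"] True by (simp add: field_simps)
    qed
    then show ?thesis using True by simp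
  next
    case False
    then have p: "b w w > 0" using nn by simp
    have "0 \<le> (b v v + 2 * (- b v w / b w w) * b v w + (- b v w / b w w)\<^sup>2 * b w w) * b w w"
      using q[of "- b v w / b w w"] p by simp
    also have "\<dots> = b v v * b w w - (b v w)\<^sup>2"
      using p by (simp add: field_simps power2_eq_square)
    finally show ?thesis by simp
  qed
  then have "sqrt ((b v w)\<^sup>2) \<le> sqrt (b v v * b w w)" by (rule real_sqrt_le_mono)
  then show ?thesis by (simp add: real_sqrt_mult)
qed

lemma semi_inner_seminorm_space:
  assumes b: "semi_inner D b"
  shows "seminorm_space D (\<lambda>v. sqrt (b v v))"
proof
  show D: "subspace D" by (rule semi_inner_subspace[OF b])
  have nn: "0 \<le> b v v" if "v \<in> D" for v by (rule semi_inner_nonneg[OF b that])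
  show "0 \<le> sqrt (b v v)" if "v \<in> D" for v using nn that by simp
  have zero: "b 0 w = 0" if "w \<in> D" for w
  proof -
    have "b (0 + 1 *\<^sub>R 0) w = b 0 w + 1 * b 0 w"
      by (intro semi_inner_linear[OF b] subspace_0[OF D] that)
    then show ?thesis by simp
  qed
  show "sqrt (b (s *\<^sub>R v) (s *\<^sub>R v)) = \<bar>s\<bar> * sqrt (b v v)" if "v \<in> D" for v s
    using semi_inner_expand[OF b subspace_0[OF D] that, of s] zero[OF that] zero[OF subspace_0[OF D]]
    by (simp add: real_sqrt_mult)
  show "sqrt (b (v + w) (v + w)) \<le> sqrt (b v v) + sqrt (b w w)" if "v \<in> D" "w \<in> D" for v w
  proof (rule real_le_lsqrt)
    have "b (v + w) (v + w) = b v v + 2 * b v w + b w w"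
      using semi_inner_expand[OF b that, of 1] by simp
    also have "\<dots> \<le> b v v + 2 * (sqrt (b v v) * sqrt (b w w)) + b w w"
      using semi_inner_Cauchy_Schwarz[OF b that] by simp
    also have "\<dots> = (sqrt (b v v) + sqrt (b w w))\<^sup>2"
      using nn that by (simp add: power2_sum)
    finally show "b (v + w) (v + w) \<le> (sqrt (b v v) + sqrt (b w w))\<^sup>2" .
  qed (use nn that in auto)
qed

subsection \<open>Dual spaces\<close>

context seminorm_space
begin

lemma dual_add: "g \<in> dual_space D N \<Longrightarrow> v \<in> D \<Longrightarrow> w \<in> D \<Longrightarrow> g (v + w) = g v + g w"
  unfolding dual_space_def by (metis (mono_tags, lifting) mem_Collect_eq mult_1 scaleR_one)

lemma dual_zero: "g \<in> dual_space D N \<Longrightarrow> g 0 = 0"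
  using dual_add[of g 0 0] zero_in by simp

lemma dual_scale: "g \<in> dual_space D N \<Longrightarrow> w \<in> D \<Longrightarrow> g (s *\<^sub>R w) = s * g w"
proof -
  assume g: "g \<in> dual_space D N" "w \<in> D"
  then have "g (0 + s *\<^sub>R w) = g 0 + s * g w" using zero_in unfolding dual_space_def by blast
  then show ?thesis using dual_zero[OF g(1)] by simp
qed

lemma dual_diff: "g \<in> dual_space D N \<Longrightarrow> v \<in> D \<Longrightarrow> w \<in> D \<Longrightarrow> g (v - w) = g v - g w"
  using dual_add[of g v "- w"] dual_scale[of g w "-1"] scale_in[of w "-1"] by simp

lemma dual_norm_bdd:
  assumes "g \<in> dual_space D N"
  shows "bdd_above {\<bar>g v\<bar> | v. v \<in> D \<and> N v \<le> 1}"
proof -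
  obtain C where C: "\<forall>v\<in>D. \<bar>g v\<bar> \<le> C * N v" using assms by (auto simp: dual_space_def)
  have "\<bar>g v\<bar> \<le> \<bar>C\<bar>" if "v \<in> D" "N v \<le> 1" for v
  proof -
    have "\<bar>g v\<bar> \<le> C * N v" using C that by auto
    also have "\<dots> \<le> \<bar>C\<bar> * N v" using nonneg that by (intro mult_right_mono) auto
    also have "\<dots> \<le> \<bar>C\<bar> * 1" using that by (intro mult_left_mono) auto
    finally show ?thesis by simp
  qed
  then show ?thesis by (intro bdd_aboveI[of _ "\<bar>C\<bar>"]) auto
qed

lemma dual_norm_nonneg: "g \<in> dual_space D N \<Longrightarrow> 0 \<le> dual_norm D N g"
  unfolding dual_norm_def
  by (rule cSup_upper2[OF _ _ dual_norm_bdd, of "\<bar>g 0\<bar>"]) (use zero_in zero in auto)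

lemma dual_norm_le:
  assumes g: "g \<in> dual_space D N" and v: "v \<in> D"
  shows "\<bar>g v\<bar> \<le> dual_norm D N g * N v"
proof (cases "N v = 0")
  case True
  then show ?thesis using g v by (auto simp: dual_space_def)
next
  case False
  then have p: "N v > 0" using nonneg[OF v] by simp
  have "\<bar>g ((1 / N v) *\<^sub>R v)\<bar> \<le> dual_norm D N g"
    unfolding dual_norm_def
    by (rule cSup_upper[OF _ dual_norm_bdd[OF g]]) (use v p in \<open>auto simp: scale scale_in\<close>)
  then show ?thesis using p by (simp add: dual_scale[OF g v] field_simps abs_mult)
qed

lemma dual_norm_least:
  assumes "\<And>v. v \<in> D \<Longrightarrow> \<bar>g v\<bar> \<le> C * N v" "C \<ge> 0"
  shows "dual_norm D N g \<le> C"
  unfolding dual_norm_def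
proof (rule cSup_least)
  show "{\<bar>g v\<bar> | v. v \<in> D \<and> N v \<le> 1} \<noteq> {}" using zero_in zero by (auto intro!: exI[of _ 0])
  fix x assume "x \<in> {\<bar>g v\<bar> | v. v \<in> D \<and> N v \<le> 1}"
  then obtain v where v: "v \<in> D" "N v \<le> 1" "x = \<bar>g v\<bar>" by auto
  have "x \<le> C * N v" using assms(1) v by auto
  also have "\<dots> \<le> C * 1" using v assms(2) by (intro mult_left_mono) auto
  finally show "x \<le> C" by simp
qed

lemma dual_spaceI:
  assumes "\<And>v w s. v \<in> D \<Longrightarrow> w \<in> D \<Longrightarrow> g (v + s *\<^sub>R w) = g v + s * g w"
    and "\<And>v. v \<in> D \<Longrightarrow> \<bar>g v\<bar> \<le> C * N v"
  shows "g \<in> dual_space D N"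
  unfolding dual_space_def using assms by blast

lemma dual_linear: "g \<in> dual_space D N \<Longrightarrow> v \<in> D \<Longrightarrow> w \<in> D \<Longrightarrow> g (v + s *\<^sub>R w) = g v + s * g w"
  by (simp add: dual_add dual_scale scale_in)

lemma dual_add_bound:
  assumes "g \<in> dual_space D N" "h \<in> dual_space D N" "v \<in> D"
  shows "\<bar>(g + s *\<^sub>R h) v\<bar> \<le> (dual_norm D N g + \<bar>s\<bar> * dual_norm D N h) * N v"
proof -
  have "\<bar>(g + s *\<^sub>R h) v\<bar> \<le> \<bar>g v\<bar> + \<bar>s\<bar> * \<bar>h v\<bar>" by (auto simp: abs_mult[symmetric])
  also have "\<dots> \<le> dual_norm D N g * N v + \<bar>s\<bar> * (dual_norm D N h * N v)"
    using dual_norm_le assms by (intro add_mono mult_left_mono) auto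
  finally show ?thesis by (simp add: algebra_simps)
qed

lemma dual_comb_in:
  assumes g: "g \<in> dual_space D N" and h: "h \<in> dual_space D N"
  shows "g + s *\<^sub>R h \<in> dual_space D N"
proof (rule dual_spaceI)
  show "(g + s *\<^sub>R h) (v + r *\<^sub>R w) = (g + s *\<^sub>R h) v + r * (g + s *\<^sub>R h) w"
    if "v \<in> D" "w \<in> D" for v w r
    using that by (simp add: dual_linear[OF g] dual_linear[OF h] algebra_simps)
qed (rule dual_add_bound[OF g h])

lemma zero_in_dual: "0 \<in> dual_space D N"
  by (rule dual_spaceI[where C = 0]) auto

lemma dual_seminorm_space: "seminorm_space (dual_space D N) (dual_norm D N)"
proof
  show sub: "subspace (dual_space D N)"
    using dual_comb_in[OF zero_in_dual] dual_comb_in[where s = 1] zero_in_dual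
    by (auto intro!: subspaceI)
  show "0 \<le> dual_norm D N g" if "g \<in> dual_space D N" for g by (rule dual_norm_nonneg[OF that])
  have le: "dual_norm D N (s *\<^sub>R g) \<le> \<bar>s\<bar> * dual_norm D N g" if g: "g \<in> dual_space D N" for g s
    using dual_add_bound[OF zero_in_dual g, of _ s] dual_norm_nonneg[OF g]
    by (intro dual_norm_least) (auto simp: abs_mult mult.assoc intro!: mult_left_mono dual_norm_le[OF g])
  show "dual_norm D N (s *\<^sub>R g) = \<bar>s\<bar> * dual_norm D N g" if g: "g \<in> dual_space D N" for g s
  proof (cases "s = 0")
    case True
    have "dual_norm D N 0 = 0"
      using le[OF zero_in_dual, of 0] dual_norm_nonneg[OF zero_in_dual] by simp
    then show ?thesis using True by simp
  next
    case False
    have "dual_norm D N ((1 / s) *\<^sub>R (s *\<^sub>R g)) \<le> \<bar>1 / s\<bar> * dual_norm D N (s *\<^sub>R g)"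
      by (rule le) (use g sub in \<open>auto intro: subspace_scale\<close>)
    then show ?thesis using le[OF g, of s] False by (simp add: field_simps)
  qed
  show "dual_norm D N (g + h) \<le> dual_norm D N g + dual_norm D N h"
    if "g \<in> dual_space D N" "h \<in> dual_space D N" for g h
    using dual_add_bound[OF that, where s = 1] dual_norm_nonneg that
    by (intro dual_norm_least) auto
qed

end

section \<open>Bochner square-integrable functions of time\<close>

lemma borel_measurable_lebesgue_on_AE_limit:
  fixes f :: "nat \<Rightarrow> 'a::euclidean_space \<Rightarrow> real"
  assumes S: "S \<in> sets lebesgue" and f: "\<And>n. f n \<in> borel_measurable (lebesgue_on S)"
    and lim: "AE t in lebesgue_on S. (\<lambda>n. f n t) \<longlonglongrightarrow> g t"
  shows "g \<in> borel_measurable (lebesgue_on S)"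
proof -
  have "(\<lambda>t. lim (\<lambda>n. f n t)) \<in> borel_measurable (lebesgue_on S)"
    using f by (rule borel_measurable_lim_metric)
  then have "(\<lambda>t. if t \<in> S then lim (\<lambda>n. f n t) else 0) \<in> borel_measurable lebesgue"
    using S by (simp add: borel_measurable_if)
  moreover have "AE t in lebesgue. (if t \<in> S then lim (\<lambda>n. f n t) else 0) = (if t \<in> S then g t else 0)"
    using lim S by (auto simp: AE_restrict_space_iff limI elim!: eventually_mono)
  ultimately have "(\<lambda>t. if t \<in> S then g t else 0) \<in> borel_measurable lebesgue"
    by (rule borel_measurable_AE)
  then show ?thesis using S by (simp add: borel_measurable_if)
qed

lemma borel_measurable_lebesgue_on_AE_cong:
  fixes f :: "'a::euclidean_space \<Rightarrow> real"
  assumes "S \<in> sets lebesgue" "f \<in> borel_measurable (lebesgue_on S)" "AE t in lebesgue_on S. f t = g t"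
  shows "g \<in> borel_measurable (lebesgue_on S)"
  by (rule borel_measurable_lebesgue_on_AE_limit[OF assms(1), of "\<lambda>n. f"]) (use assms in auto)

lemma AE_lebesgue_on_subset:
  assumes "AE t in lebesgue_on S. P t" "T \<subseteq> S" "S \<in> sets lebesgue" "T \<in> sets lebesgue"
  shows "AE t in lebesgue_on T. P t"
  using assms by (auto simp: AE_restrict_space_iff elim!: eventually_mono)

lemma integrable_lebesgue_on_subset:
  fixes f :: "'a::euclidean_space \<Rightarrow> real"
  assumes "integrable (lebesgue_on S) f" "T \<subseteq> S" "S \<in> sets lebesgue" "T \<in> sets lebesgue"
  shows "integrable (lebesgue_on T) f"
  using assms set_integrable_subset[of lebesgue S f T]
  by (simp add: integrable_restrict_space set_integrable_def)

lemma bochner_L2I: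
  assumes "\<And>n. simple_function (lebesgue_on S) (s n)" "\<And>n t. t \<in> S \<Longrightarrow> s n t \<in> E"
    "AE t in lebesgue_on S. v t \<in> E \<and> (\<lambda>n. N (s n t - v t)) \<longlonglongrightarrow> 0"
    "integrable (lebesgue_on S) (\<lambda>t. (N (v t))\<^sup>2)"
  shows "v \<in> bochner_L2 S E N"
  unfolding bochner_L2_def using assms by blast

text \<open>Each integrand in time below is a form of this kind applied to two functions of time.\<close>

definition bounded_bilinear_on where
  "bounded_bilinear_on (D :: 'v::real_vector set) N (E :: 'w::real_vector set) M B \<longleftrightarrow>
     (\<forall>v\<in>D. \<forall>v'\<in>D. \<forall>w\<in>E. \<forall>s. B (v + s *\<^sub>R v') w = B v w + s * B v' w) \<and>
     (\<forall>v\<in>D. \<forall>w\<in>E. \<forall>w'\<in>E. \<forall>s. B v (w + s *\<^sub>R w') = B v w + s * B v w') \<and>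
     (\<exists>C. \<forall>v\<in>D. \<forall>w\<in>E. \<bar>B v w\<bar> \<le> C * N v * (M w :: real))"

lemma bounded_bilinear_on_diff1:
  assumes "bounded_bilinear_on D N E M B" "v \<in> D" "v' \<in> D" "w \<in> E"
  shows "B (v - v') w = B v w - B v' w"
proof -
  have "B (v + (-1) *\<^sub>R v') w = B v w + (-1) * B v' w"
    using assms unfolding bounded_bilinear_on_def by blast
  then show ?thesis by simp
qed

lemma bounded_bilinear_on_diff2:
  assumes "bounded_bilinear_on D N E M B" "v \<in> D" "w \<in> E" "w' \<in> E"
  shows "B v (w - w') = B v w - B v w'"
proof -
  have "B v (w + (-1) *\<^sub>R w') = B v w + (-1) * B v w'"
    using assms unfolding bounded_bilinear_on_def by blast
  then show ?thesis by simp
qed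

lemma (in seminorm_space) dual_pairing_bounded_bilinear:
  "bounded_bilinear_on (dual_space D N) (dual_norm D N) D N (\<lambda>g v. g v)"
  unfolding bounded_bilinear_on_def
  using dual_norm_le by (auto simp: dual_linear intro!: exI[of _ 1])

lemma semi_inner_bounded_bilinear:
  assumes "semi_inner D b"
  shows "bounded_bilinear_on D (\<lambda>v. sqrt (b v v)) D (\<lambda>v. sqrt (b v v)) b"
  unfolding bounded_bilinear_on_def
proof (intro conjI)
  have D: "subspace D" by (rule semi_inner_subspace[OF assms])
  show "\<forall>v\<in>D. \<forall>v'\<in>D. \<forall>w\<in>D. \<forall>s. b (v + s *\<^sub>R v') w = b v w + s * b v' w"
    using semi_inner_linear[OF assms] by blast
  show "\<forall>v\<in>D. \<forall>w\<in>D. \<forall>w'\<in>D. \<forall>s. b v (w + s *\<^sub>R w') = b v w + s * b v w'"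
  proof (intro ballI allI)
    fix v w w' s assume v: "v \<in> D" and w: "w \<in> D" "w' \<in> D"
    have w': "w + s *\<^sub>R w' \<in> D" using D w by (simp add: subspace_add subspace_scale)
    show "b v (w + s *\<^sub>R w') = b v w + s * b v w'"
      using semi_inner_commute[OF assms v w'] semi_inner_linear[OF assms w v]
        semi_inner_commute[OF assms v w(1)] semi_inner_commute[OF assms v w(2)] by simp
  qed
  show "\<exists>C. \<forall>v\<in>D. \<forall>w\<in>D. \<bar>b v w\<bar> \<le> C * sqrt (b v v) * sqrt (b w w)"
    using semi_inner_Cauchy_Schwarz[OF assms] by (intro exI[of _ 1]) auto
qed

text \<open>The pairing of two simple functions is a simple function, and boundedness of the form carries
  the convergence of the approximations over to the pairing.\<close>

lemma bochner_pairing_measurable: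
  assumes DN: "seminorm_space D N" and EM: "seminorm_space E M"
    and S: "S \<in> sets lebesgue"
    and v: "v \<in> bochner_L2 S D N" and w: "w \<in> bochner_L2 S E M"
    and B: "bounded_bilinear_on D N E M B"
  shows "(\<lambda>t. B (v t) (w t)) \<in> borel_measurable (lebesgue_on S)"
proof -
  interpret D: seminorm_space D N by fact
  interpret E: seminorm_space E M by fact
  obtain s where s: "\<And>n. simple_function (lebesgue_on S) (s n)" "\<And>n t. t \<in> S \<Longrightarrow> s n t \<in> D"
    and sl: "AE t in lebesgue_on S. v t \<in> D \<and> (\<lambda>n. N (s n t - v t)) \<longlonglongrightarrow> 0"
    using v by (auto simp: bochner_L2_def)
  obtain r where r: "\<And>n. simple_function (lebesgue_on S) (r n)" "\<And>n t. t \<in> S \<Longrightarrow> r n t \<in> E"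
    and rl: "AE t in lebesgue_on S. w t \<in> E \<and> (\<lambda>n. M (r n t - w t)) \<longlonglongrightarrow> 0"
    using w by (auto simp: bochner_L2_def)
  obtain C where C: "\<And>x y. x \<in> D \<Longrightarrow> y \<in> E \<Longrightarrow> \<bar>B x y\<bar> \<le> C * N x * M y"
    using B unfolding bounded_bilinear_on_def by blast
  show ?thesis
  proof (rule borel_measurable_lebesgue_on_AE_limit[OF S])
    show "(\<lambda>t. B (s n t) (r n t)) \<in> borel_measurable (lebesgue_on S)" for n
      by (rule borel_measurable_simple_function) (rule simple_function_compose2[where h = B, OF s(1) r(1)])
    have "AE t in lebesgue_on S. t \<in> S" by (rule AE_I2) simp
    with sl rl show "AE t in lebesgue_on S. (\<lambda>n. B (s n t) (r n t)) \<longlonglongrightarrow> B (v t) (w t)"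
    proof eventually_elim
      case (elim t)
      have lim: "(\<lambda>n. C * N (s n t - v t) * M (r n t) + C * N (v t) * M (r n t - w t)) \<longlonglongrightarrow>
          C * 0 * M (w t) + C * N (v t) * 0"
        using elim s r by (intro tendsto_intros E.tendsto_norm) auto
      have le: "norm (B (s n t) (r n t) - B (v t) (w t)) \<le>
          C * N (s n t - v t) * M (r n t) + C * N (v t) * M (r n t - w t)" for n
      proof -
        have "B (s n t) (r n t) - B (v t) (w t) = B (s n t - v t) (r n t) + B (v t) (r n t - w t)"
          using elim s r by (simp add: bounded_bilinear_on_diff1[OF B] bounded_bilinear_on_diff2[OF B])
        then show ?thesis
          using C[of "s n t - v t" "r n t"] C[of "v t" "r n t - w t"] elim s(2)[of t n] r(2)[of t n]
            D.diff_in E.diff_in by auto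
      qed
      show ?case
        by (rule LIM_zero_cancel, rule Lim_null_comparison[OF _ lim[simplified]]) (use le in auto)
    qed
  qed
qed

lemma bochner_pairing_integrable:
  assumes DN: "seminorm_space D N" and EM: "seminorm_space E M"
    and S: "S \<in> sets lebesgue"
    and v: "v \<in> bochner_L2 S D N" and w: "w \<in> bochner_L2 S E M"
    and B: "bounded_bilinear_on D N E M B"
  shows "integrable (lebesgue_on S) (\<lambda>t. B (v t) (w t))"
proof -
  interpret D: seminorm_space D N by fact
  interpret E: seminorm_space E M by fact
  obtain C where C: "\<And>x y. x \<in> D \<Longrightarrow> y \<in> E \<Longrightarrow> \<bar>B x y\<bar> \<le> C * N x * M y"
    using B unfolding bounded_bilinear_on_def by blast
  show ?thesis
  proof (rule Bochner_Integration.integrable_bound)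
    show "integrable (lebesgue_on S) (\<lambda>t. \<bar>C\<bar> * ((N (v t))\<^sup>2 + (M (w t))\<^sup>2))"
      using v w by (auto simp: bochner_L2_def)
    show "(\<lambda>t. B (v t) (w t)) \<in> borel_measurable (lebesgue_on S)"
      by (rule bochner_pairing_measurable[OF assms])
    have "AE t in lebesgue_on S. v t \<in> D" "AE t in lebesgue_on S. w t \<in> E"
      using v w by (auto simp: bochner_L2_def elim: eventually_mono)
    then show "AE t in lebesgue_on S. norm (B (v t) (w t)) \<le> norm (\<bar>C\<bar> * ((N (v t))\<^sup>2 + (M (w t))\<^sup>2))"
    proof eventually_elim
      case (elim t)
      have nn: "0 \<le> N (v t)" "0 \<le> M (w t)" using elim D.nonneg E.nonneg by auto
      have "\<bar>B (v t) (w t)\<bar> \<le> C * N (v t) * M (w t)" using C elim by auto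
      also have "\<dots> \<le> \<bar>C\<bar> * (N (v t) * M (w t))"
        using nn by (simp add: mult.assoc mult_right_mono)
      also have "\<dots> \<le> \<bar>C\<bar> * ((N (v t))\<^sup>2 + (M (w t))\<^sup>2)"
      proof (intro mult_left_mono)
        show "N (v t) * M (w t) \<le> (N (v t))\<^sup>2 + (M (w t))\<^sup>2"
          using sum_squares_bound[of "N (v t)" "M (w t)"] mult_nonneg_nonneg[OF nn] by linarith
      qed simp
      finally show ?case by simp
    qed
  qed
qed

context seminorm_space
begin

lemma bochner_norm_measurable:
  assumes S: "S \<in> sets lebesgue"
    and s: "\<And>n. simple_function (lebesgue_on S) (s n)" "\<And>n t. t \<in> S \<Longrightarrow> s n t \<in> D"
    and sl: "AE t in lebesgue_on S. v t \<in> D \<and> (\<lambda>n. N (s n t - v t)) \<longlonglongrightarrow> 0"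
  shows "(\<lambda>t. N (v t)) \<in> borel_measurable (lebesgue_on S)"
proof (rule borel_measurable_lebesgue_on_AE_limit[OF S])
  show "(\<lambda>t. N (s n t)) \<in> borel_measurable (lebesgue_on S)" for n
    by (rule borel_measurable_simple_function) (rule simple_function_compose1[where g = N, OF s(1)])
  have "AE t in lebesgue_on S. t \<in> S" by (rule AE_I2) simp
  with sl show "AE t in lebesgue_on S. (\<lambda>n. N (s n t)) \<longlonglongrightarrow> N (v t)"
    by eventually_elim (use s in \<open>auto intro: tendsto_norm\<close>)
qed

lemma bochner_norm_measurable': "S \<in> sets lebesgue \<Longrightarrow> v \<in> bochner_L2 S D N \<Longrightarrow>
    (\<lambda>t. N (v t)) \<in> borel_measurable (lebesgue_on S)"
  unfolding bochner_L2_def using bochner_norm_measurable by blast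

lemma bochner_AE_in: "v \<in> bochner_L2 S D N \<Longrightarrow> AE t in lebesgue_on S. v t \<in> D"
  by (auto simp: bochner_L2_def elim: eventually_mono)

lemma bochner_square_integrable: "v \<in> bochner_L2 S D N \<Longrightarrow> integrable (lebesgue_on S) (\<lambda>t. (N (v t))\<^sup>2)"
  by (auto simp: bochner_L2_def)

lemma bochner_comb:
  assumes S: "S \<in> sets lebesgue" and v: "v \<in> bochner_L2 S D N" and w: "w \<in> bochner_L2 S D N"
  shows "(\<lambda>t. v t + c *\<^sub>R w t) \<in> bochner_L2 S D N"
proof -
  obtain s where s: "\<And>n. simple_function (lebesgue_on S) (s n)" "\<And>n t. t \<in> S \<Longrightarrow> s n t \<in> D"
    and sl: "AE t in lebesgue_on S. v t \<in> D \<and> (\<lambda>n. N (s n t - v t)) \<longlonglongrightarrow> 0"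
    and si: "integrable (lebesgue_on S) (\<lambda>t. (N (v t))\<^sup>2)"
    using v by (auto simp: bochner_L2_def)
  obtain r where r: "\<And>n. simple_function (lebesgue_on S) (r n)" "\<And>n t. t \<in> S \<Longrightarrow> r n t \<in> D"
    and rl: "AE t in lebesgue_on S. w t \<in> D \<and> (\<lambda>n. N (r n t - w t)) \<longlonglongrightarrow> 0"
    and ri: "integrable (lebesgue_on S) (\<lambda>t. (N (w t))\<^sup>2)"
    using w by (auto simp: bochner_L2_def)
  define q where "q n t = s n t + c *\<^sub>R r n t" for n t
  have q1: "simple_function (lebesgue_on S) (q n)" for n
    unfolding q_def[abs_def]
    by (rule simple_function_compose2[where h = "\<lambda>x y. x + c *\<^sub>R y", OF s(1) r(1)])
  have q2: "q n t \<in> D" if "t \<in> S" for n t using that s r by (simp add: q_def add_in scale_in)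
  have "AE t in lebesgue_on S. t \<in> S" by (rule AE_I2) simp
  with sl rl have q3: "AE t in lebesgue_on S. v t + c *\<^sub>R w t \<in> D \<and> (\<lambda>n. N (q n t - (v t + c *\<^sub>R w t))) \<longlonglongrightarrow> 0"
  proof eventually_elim
    case (elim t)
    have lim: "(\<lambda>n. N (s n t - v t) + \<bar>c\<bar> * N (r n t - w t)) \<longlonglongrightarrow> 0 + \<bar>c\<bar> * 0"
      using elim by (intro tendsto_intros) auto
    have "norm (N (q n t - (v t + c *\<^sub>R w t))) \<le> N (s n t - v t) + \<bar>c\<bar> * N (r n t - w t)" for n
    proof -
      have eq: "q n t - (v t + c *\<^sub>R w t) = (s n t - v t) + c *\<^sub>R (r n t - w t)"
        by (simp add: q_def algebra_simps)
      have i: "s n t - v t \<in> D" "r n t - w t \<in> D" using elim s r by (auto intro: diff_in)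
      have "N ((s n t - v t) + c *\<^sub>R (r n t - w t)) \<le> N (s n t - v t) + \<bar>c\<bar> * N (r n t - w t)"
        using triangle[OF i(1) scale_in[OF i(2)]] scale[OF i(2)] by simp
      then show ?thesis unfolding eq using nonneg[OF add_in[OF i(1) scale_in[OF i(2)]]] by simp
    qed
    then have "(\<lambda>n. N (q n t - (v t + c *\<^sub>R w t))) \<longlonglongrightarrow> 0"
      by (intro Lim_null_comparison[OF _ lim[simplified]] always_eventually) auto
    with elim show ?case by (auto intro: add_in scale_in)
  qed
  have "integrable (lebesgue_on S) (\<lambda>t. (N (v t + c *\<^sub>R w t))\<^sup>2)"
  proof (rule Bochner_Integration.integrable_bound)
    show "integrable (lebesgue_on S) (\<lambda>t. 2 * (N (v t))\<^sup>2 + 2 * (c\<^sup>2 * (N (w t))\<^sup>2))"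
      using si ri by auto
    show "(\<lambda>t. (N (v t + c *\<^sub>R w t))\<^sup>2) \<in> borel_measurable (lebesgue_on S)"
      by (intro borel_measurable_power bochner_norm_measurable[OF S q1 q2 q3])
    show "AE t in lebesgue_on S. norm ((N (v t + c *\<^sub>R w t))\<^sup>2) \<le> norm (2 * (N (v t))\<^sup>2 + 2 * (c\<^sup>2 * (N (w t))\<^sup>2))"
      using sl rl
    proof eventually_elim
      case (elim t)
      then show ?case using square_triangle[of "v t" "c *\<^sub>R w t"] scale_in[of "w t" c]
        by (simp add: scale power_mult_distrib)
    qed
  qed
  then show ?thesis
    unfolding bochner_L2_def using q1 q2 q3 by blast
qed

lemma bochner_add: "S \<in> sets lebesgue \<Longrightarrow> v \<in> bochner_L2 S D N \<Longrightarrow> w \<in> bochner_L2 S D N \<Longrightarrow>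
    (\<lambda>t. v t + w t) \<in> bochner_L2 S D N"
  using bochner_comb[of S v w 1] by simp

lemma bochner_cong:
  assumes S: "S \<in> sets lebesgue" and v: "v \<in> bochner_L2 S D N"
    and vw: "AE t in lebesgue_on S. w t \<in> D \<and> N (w t - v t) = 0"
  shows "w \<in> bochner_L2 S D N"
proof -
  obtain s where s: "\<And>n. simple_function (lebesgue_on S) (s n)" "\<And>n t. t \<in> S \<Longrightarrow> s n t \<in> D"
    and sl: "AE t in lebesgue_on S. v t \<in> D \<and> (\<lambda>n. N (s n t - v t)) \<longlonglongrightarrow> 0"
    and si: "integrable (lebesgue_on S) (\<lambda>t. (N (v t))\<^sup>2)"
    using v by (auto simp: bochner_L2_def)
  have "AE t in lebesgue_on S. t \<in> S" by (rule AE_I2) simp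
  with sl vw have l: "AE t in lebesgue_on S. w t \<in> D \<and> (\<lambda>n. N (s n t - w t)) \<longlonglongrightarrow> 0"
  proof eventually_elim
    case (elim t)
    have "N (s n t - w t) = N (s n t - v t)" for n
      using triangle_via[of "s n t" "v t" "w t"] triangle_via[of "s n t" "w t" "v t"]
        minus_commute[of "v t" "w t"] elim s by fastforce
    with elim show ?case by simp
  qed
  have "integrable (lebesgue_on S) (\<lambda>t. (N (w t))\<^sup>2)"
  proof (rule integrable_cong_AE_imp[OF si])
    show "(\<lambda>t. (N (w t))\<^sup>2) \<in> borel_measurable (lebesgue_on S)"
      by (intro borel_measurable_power bochner_norm_measurable[OF S s l])
    show "AE t in lebesgue_on S. (N (v t))\<^sup>2 = (N (w t))\<^sup>2"
      using sl vw by eventually_elim (use abs_diff_le in fastforce)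
  qed
  with s l show ?thesis unfolding bochner_L2_def by blast
qed

lemma bochner_zero: "(\<lambda>t. 0) \<in> bochner_L2 S D N"
  unfolding bochner_L2_def using zero zero_in by (auto intro!: exI[of _ "\<lambda>n t. 0"])

lemma bochner_scaled_const:
  assumes S: "S \<in> lmeasurable" and q: "q \<in> borel_measurable (lebesgue_on S)"
    and bd: "\<And>t. t \<in> S \<Longrightarrow> \<bar>q t\<bar> \<le> K" and c: "c \<in> D"
  shows "(\<lambda>t. q t *\<^sub>R c) \<in> bochner_L2 S D N"
proof -
  have S': "S \<in> sets lebesgue" using S by (auto simp: fmeasurable_def)
  interpret finite_measure "lebesgue_on S" by (rule finite_measure_lebesgue_on[OF S])
  obtain s where s: "\<And>n. simple_function (lebesgue_on S) (s n)"
    and sl: "\<And>t. t \<in> space (lebesgue_on S) \<Longrightarrow> (\<lambda>n. s n t) \<longlonglongrightarrow> q t"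
    using borel_measurable_implies_sequence_metric[OF q, of 0] by blast
  have "(\<lambda>n. N (s n t *\<^sub>R c - q t *\<^sub>R c)) \<longlonglongrightarrow> 0" if "t \<in> S" for t
  proof -
    have "N (s n t *\<^sub>R c - q t *\<^sub>R c) = \<bar>s n t - q t\<bar> * N c" for n
      using scale[OF c] by (simp add: scaleR_diff_left[symmetric])
    moreover have "(\<lambda>n. \<bar>s n t - q t\<bar> * N c) \<longlonglongrightarrow> \<bar>q t - q t\<bar> * N c"
      using sl that by (intro tendsto_intros) auto
    ultimately show ?thesis by simp
  qed
  moreover have "integrable (lebesgue_on S) (\<lambda>t. (N (q t *\<^sub>R c))\<^sup>2)"
  proof (rule integrable_const_bound)
    show "AE t in lebesgue_on S. norm ((N (q t *\<^sub>R c))\<^sup>2) \<le> (K * N c)\<^sup>2"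
    proof (rule AE_I2)
      fix t assume "t \<in> space (lebesgue_on S)"
      then have "(\<bar>q t\<bar> * N c)\<^sup>2 \<le> (K * N c)\<^sup>2"
        using bd[of t] nonneg[OF c] by (intro power_mono mult_right_mono) auto
      then show "norm ((N (q t *\<^sub>R c))\<^sup>2) \<le> (K * N c)\<^sup>2" by (simp add: scale[OF c])
    qed
    have "(\<lambda>t. (\<bar>q t\<bar> * N c)\<^sup>2) \<in> borel_measurable (lebesgue_on S)" using q by auto
    then show "(\<lambda>t. (N (q t *\<^sub>R c))\<^sup>2) \<in> borel_measurable (lebesgue_on S)" by (simp add: scale[OF c])
  qed
  ultimately show ?thesis
    unfolding bochner_L2_def using s c
    by (auto intro!: exI[of _ "\<lambda>n t. s n t *\<^sub>R c"] simp: scale_in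
        intro: simple_function_compose1[where g = "\<lambda>x. x *\<^sub>R c"])
qed

lemma bochner_subset:
  assumes "v \<in> bochner_L2 S D N" "T \<subseteq> S" "S \<in> sets lebesgue" "T \<in> sets lebesgue"
  shows "v \<in> bochner_L2 T D N"
proof -
  obtain s where s: "\<And>n. simple_function (lebesgue_on S) (s n)" "\<And>n t. t \<in> S \<Longrightarrow> s n t \<in> D"
    and sl: "AE t in lebesgue_on S. v t \<in> D \<and> (\<lambda>n. N (s n t - v t)) \<longlonglongrightarrow> 0"
    and si: "integrable (lebesgue_on S) (\<lambda>t. (N (v t))\<^sup>2)"
    using assms by (auto simp: bochner_L2_def)
  have "simple_function (lebesgue_on T) (s n)" for n
  proof -
    have T: "T \<in> sets (lebesgue_on S)" using assms by (auto simp: sets_restrict_space)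
    have "simple_function (restrict_space (lebesgue_on S) T) (s n)"
      unfolding simple_function_def
    proof (intro conjI ballI)
      have "finite (s n ` space (lebesgue_on S))" using s(1)[of n] by (simp add: simple_function_def)
      then show "finite (s n ` space (restrict_space (lebesgue_on S) T))"
        by (rule finite_subset[rotated]) (auto simp: space_restrict_space)
      fix x
      have "s n -` {x} \<inter> space (lebesgue_on S) \<in> sets (lebesgue_on S)"
        by (rule simple_functionD(2)[OF s(1)])
      moreover have "s n -` {x} \<inter> space (restrict_space (lebesgue_on S) T) =
          T \<inter> (s n -` {x} \<inter> space (lebesgue_on S))"
        using assms by (auto simp: space_restrict_space)
      ultimately show "s n -` {x} \<inter> space (restrict_space (lebesgue_on S) T) \<in>
          sets (restrict_space (lebesgue_on S) T)"
        by (auto simp: sets_restrict_space)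
    qed
    moreover have "restrict_space (lebesgue_on S) T = lebesgue_on T"
      using assms by (subst restrict_restrict_space) (auto simp: Int_absorb1)
    ultimately show ?thesis by simp
  qed
  then show ?thesis
    by (rule bochner_L2I[OF _ _ AE_lebesgue_on_subset[OF sl assms(2-)]
        integrable_lebesgue_on_subset[OF si assms(2-)]]) (use s(2) assms(2) in auto)
qed

text \<open>Bochner functions have essentially separable range: almost all values are limits of
  elements of one fixed countable set.\<close>

lemma bochner_separable:
  assumes "v \<in> bochner_L2 S D N"
  obtains W where "countable W" "W \<subseteq> D"
    "AE t in lebesgue_on S. v t \<in> D \<and> (\<exists>s. (\<forall>n::nat. s n \<in> W) \<and> (\<lambda>n. N (s n - v t)) \<longlonglongrightarrow> 0)"
proof -
  obtain s where s: "\<And>n. simple_function (lebesgue_on S) (s n)" "\<And>n t. t \<in> S \<Longrightarrow> s n t \<in> D"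
    and sl: "AE t in lebesgue_on S. v t \<in> D \<and> (\<lambda>n. N (s n t - v t)) \<longlonglongrightarrow> 0"
    using assms by (auto simp: bochner_L2_def)
  let ?W = "\<Union>n. s n ` S"
  have "finite (s n ` S)" for n using s(1)[of n] by (simp add: simple_function_def)
  then have "countable ?W" by (intro countable_UN) (auto intro: countable_finite)
  moreover have "?W \<subseteq> D" using s by auto
  moreover have "AE t in lebesgue_on S. t \<in> S" by (rule AE_I2) simp
  with sl have "AE t in lebesgue_on S. v t \<in> D \<and> (\<exists>s. (\<forall>n::nat. s n \<in> ?W) \<and> (\<lambda>n. N (s n - v t)) \<longlonglongrightarrow> 0)"
    by eventually_elim (auto intro!: exI[of _ "\<lambda>n. s n _"])
  ultimately show ?thesis by (rule that)
qed

end

section \<open>Calculus of test functions\<close>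

lemma test_fun_Ck: "\<phi> \<in> test_fun A \<Longrightarrow> Ck k \<phi>"
  unfolding test_fun_def by blast

lemma test_funI:
  assumes "\<And>k. Ck k \<phi>" "\<psi> \<in> test_fun A" "{x. \<phi> x \<noteq> 0} \<subseteq> closure {x. \<psi> x \<noteq> 0}"
  shows "\<phi> \<in> test_fun A"
proof -
  have sub: "closure {x. \<phi> x \<noteq> 0} \<subseteq> closure {x. \<psi> x \<noteq> 0}"
    using closure_minimal[OF assms(3)] by simp
  have "closure {x. \<phi> x \<noteq> 0} \<inter> closure {x. \<psi> x \<noteq> 0} = closure {x. \<phi> x \<noteq> 0}" using sub by auto
  moreover have "compact (closure {x. \<phi> x \<noteq> 0} \<inter> closure {x. \<psi> x \<noteq> 0})"
    using assms(2) unfolding test_fun_def by (intro closed_Int_compact) auto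
  ultimately have "compact (closure {x. \<phi> x \<noteq> 0})" by simp
  then show ?thesis using assms(1,2) sub unfolding test_fun_def by auto
qed

lemma test_fun_mult:
  assumes "\<phi> \<in> test_fun A" "\<And>k. Ck k \<psi>"
  shows "(\<lambda>x. \<phi> x * \<psi> x) \<in> test_fun A"
proof (rule test_funI[OF _ assms(1)])
  show "Ck k (\<lambda>x. \<phi> x * \<psi> x)" for k by (intro Ck_mult assms test_fun_Ck[OF assms(1)])
  have "{x. \<phi> x * \<psi> x \<noteq> 0} \<subseteq> {x. \<phi> x \<noteq> 0}" by auto
  then show "{x. \<phi> x * \<psi> x \<noteq> 0} \<subseteq> closure {x. \<phi> x \<noteq> 0}" using closure_subset by (rule order_trans)
qed

lemma test_fun_scale: "\<phi> \<in> test_fun A \<Longrightarrow> (\<lambda>x. s * \<phi> x) \<in> test_fun A"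
  using test_fun_mult[of \<phi> A "\<lambda>x. s"] by (simp add: Ck_const mult.commute)

lemma test_fun_add:
  assumes f: "\<phi> \<in> test_fun A" and g: "\<psi> \<in> test_fun A"
  shows "(\<lambda>x. \<phi> x + \<psi> x) \<in> test_fun A"
proof -
  have sub: "closure {x. \<phi> x + \<psi> x \<noteq> 0} \<subseteq> closure {x. \<phi> x \<noteq> 0} \<union> closure {x. \<psi> x \<noteq> 0}"
    unfolding closure_Un[symmetric] by (intro closure_mono) auto
  have "compact (closure {x. \<phi> x \<noteq> 0} \<union> closure {x. \<psi> x \<noteq> 0})"
    using f g unfolding test_fun_def by auto
  then have "compact (closure {x. \<phi> x + \<psi> x \<noteq> 0})"
    using sub closed_Int_compact[OF closed_closure[of "{x. \<phi> x + \<psi> x \<noteq> 0}"]]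
    by (metis Int_absorb2)
  moreover have "closure {x. \<phi> x + \<psi> x \<noteq> 0} \<subseteq> A"
    using sub f g unfolding test_fun_def by blast
  moreover have "Ck k (\<lambda>x. \<phi> x + \<psi> x)" for k
    by (intro Ck_add test_fun_Ck[OF f] test_fun_Ck[OF g])
  ultimately show ?thesis unfolding test_fun_def by simp
qed

lemma test_fun_mono: "A \<subseteq> B \<Longrightarrow> \<phi> \<in> test_fun A \<Longrightarrow> \<phi> \<in> test_fun B"
  unfolding test_fun_def by blast

lemma test_fun_eq_0: "\<phi> \<in> test_fun A \<Longrightarrow> x \<notin> A \<Longrightarrow> \<phi> x = 0"
  using closure_subset[of "{x. \<phi> x \<noteq> 0}"] unfolding test_fun_def by auto

lemma test_fun_derivative:
  assumes f: "\<phi> \<in> test_fun A" and b: "b \<in> Basis"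
  shows "(\<lambda>x. frechet_derivative \<phi> (at x) b) \<in> test_fun A"
proof (rule test_funI[OF _ f])
  show "Ck k (\<lambda>x. frechet_derivative \<phi> (at x) b)" for k
    using test_fun_Ck[OF f, of "Suc k"] b by simp
  show "{x. frechet_derivative \<phi> (at x) b \<noteq> 0} \<subseteq> closure {x. \<phi> x \<noteq> 0}"
  proof (rule ccontr)
    assume "\<not> ?thesis"
    then obtain x where x: "frechet_derivative \<phi> (at x) b \<noteq> 0" "x \<in> - closure {x. \<phi> x \<noteq> 0}" by auto
    have "(\<phi> has_derivative (\<lambda>h. 0)) (at x)"
    proof (rule has_derivative_transform_within_open[of "\<lambda>x. 0"])
      show "x \<in> - closure {x. \<phi> x \<noteq> 0}" by fact
      show "0 = \<phi> y" if "y \<in> - closure {x. \<phi> x \<noteq> 0}" for y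
        using that closure_subset[of "{x. \<phi> x \<noteq> 0}"] by auto
    qed auto
    from frechet_derivative_at[OF this] x(1) show False by (metis (full_types))
  qed
qed

lemma test_fun_bounded:
  assumes "\<phi> \<in> test_fun A"
  obtains K where "K > 0" "\<And>x. \<bar>\<phi> x\<bar> \<le> K"
proof -
  have "compact (\<phi> ` closure {x. \<phi> x \<noteq> 0})"
  proof (rule compact_continuous_image)
    show "continuous_on (closure {x. \<phi> x \<noteq> 0}) \<phi>"
      using test_fun_continuous[OF assms] by (rule continuous_on_subset) simp
    show "compact (closure {x. \<phi> x \<noteq> 0})" using assms unfolding test_fun_def by simp
  qed
  from compact_imp_bounded[OF this]
  obtain K where K: "K > 0" "\<And>y. y \<in> \<phi> ` closure {x. \<phi> x \<noteq> 0} \<Longrightarrow> norm y \<le> K"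
    unfolding bounded_pos by metis
  have "\<bar>\<phi> x\<bar> \<le> K" for x
    using K(2)[of "\<phi> x"] K(1) closure_subset[of "{x. \<phi> x \<noteq> 0}"] by (cases "\<phi> x = 0") auto
  with K(1) show ?thesis by (rule that)
qed

lemma test_fun_support_ball:
  assumes "\<phi> \<in> test_fun A"
  obtains R where "R > 0" "\<And>x. norm x > R \<Longrightarrow> \<phi> x = 0"
proof -
  have "bounded (closure {x. \<phi> x \<noteq> 0})"
    using assms compact_imp_bounded unfolding test_fun_def by auto
  then obtain R where R: "R > 0" "\<And>y. y \<in> closure {x. \<phi> x \<noteq> 0} \<Longrightarrow> norm y \<le> R"
    unfolding bounded_pos by metis
  have "\<phi> x = 0" if "norm x > R" for x
    using R(2)[of x] that closure_subset[of "{x. \<phi> x \<noteq> 0}"] by (cases "\<phi> x = 0") auto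
  with R(1) show ?thesis by (rule that)
qed

lemma test_fun_borel_measurable: "\<phi> \<in> test_fun A \<Longrightarrow> \<phi> \<in> borel_measurable borel"
  using test_fun_continuous by (rule borel_measurable_continuous_onI)

lemma test_fun_integrable:
  fixes \<phi> :: "'a::euclidean_space \<Rightarrow> real"
  assumes "\<phi> \<in> test_fun A"
  shows "integrable lborel \<phi>"
proof -
  obtain K where K: "K > 0" "\<And>x. \<bar>\<phi> x\<bar> \<le> K" using test_fun_bounded[OF assms] by blast
  obtain R where R: "R > 0" "\<And>x. norm x > R \<Longrightarrow> \<phi> x = 0" using test_fun_support_ball[OF assms] by blast
  show ?thesis
  proof (rule Bochner_Integration.integrable_bound)
    show "integrable lborel (\<lambda>x. indicat_real (cball (0::'a) R) x * K)"
      by (intro integrable_mult_left integrable_real_indicator) (use emeasure_lborel_cball_finite in auto)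
    show "AE x in lborel. norm (\<phi> x) \<le> norm (indicat_real (cball 0 R) x * K)"
    proof (rule AE_I2)
      fix x :: 'a
      show "norm (\<phi> x) \<le> norm (indicat_real (cball 0 R) x * K)"
        using K(2)[of x] K(1) R(2)[of x] by (cases "norm x \<le> R") auto
    qed
  qed (use test_fun_borel_measurable[OF assms] in simp)
qed

text \<open>By translation invariance the difference quotients of a test function have integral zero,
  and they converge boundedly to the derivative.\<close>

lemma integral_test_fun_derivative_eq_0:
  fixes \<phi> :: "'a::euclidean_space \<Rightarrow> real"
  assumes f: "\<phi> \<in> test_fun A" and b: "b \<in> Basis"
  shows "(LINT x|lborel. frechet_derivative \<phi> (at x) b) = 0"
proof -
  let ?d = "\<lambda>x. frechet_derivative \<phi> (at x) b"
  define h where "h n = inverse (real (Suc n))" for n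
  have h: "h n > 0" "h n \<le> 1" for n
    by (auto simp: h_def field_simps)
  have h0: "h \<longlonglongrightarrow> 0" unfolding h_def[abs_def] by (rule LIMSEQ_inverse_real_of_nat)
  have d: "?d \<in> test_fun A" using test_fun_derivative[OF f b] .
  obtain K where K: "K > 0" "\<And>x. \<bar>?d x\<bar> \<le> K" using test_fun_bounded[OF d] by blast
  obtain R where R: "R > 0" "\<And>x. norm x > R \<Longrightarrow> \<phi> x = 0" using test_fun_support_ball[OF f] by blast
  have D: "(\<phi> has_derivative frechet_derivative \<phi> (at x)) (at x)" for x
    using Ck_has_derivative[OF test_fun_Ck[OF f, of "Suc 0"]] .
  have line: "((\<lambda>t. \<phi> (x + t *\<^sub>R b)) has_real_derivative ?d (x + t *\<^sub>R b)) (at t)" for x t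
  proof -
    have "((\<lambda>t. x + t *\<^sub>R b) has_derivative (\<lambda>t. t *\<^sub>R b)) (at t)"
      by (auto intro!: derivative_eq_intros)
    from has_derivative_compose[OF this D]
    have "((\<lambda>t. \<phi> (x + t *\<^sub>R b)) has_derivative (\<lambda>s. frechet_derivative \<phi> (at (x + t *\<^sub>R b)) (s *\<^sub>R b))) (at t)" .
    moreover have "frechet_derivative \<phi> (at (x + t *\<^sub>R b)) (s *\<^sub>R b) = s * ?d (x + t *\<^sub>R b)" for s
      using linear_scale[OF has_derivative_linear[OF D]] by simp
    ultimately show ?thesis by (simp add: has_field_derivative_def mult.commute[of _ "?d _"])
  qed
  define q where "q n x = (\<phi> (x + h n *\<^sub>R b) - \<phi> x) / h n" for n x
  have \<phi>m: "\<phi> \<in> borel_measurable borel" using test_fun_borel_measurable[OF f] .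
  have \<phi>i: "integrable lborel \<phi>" using test_fun_integrable[OF f] .
  have tr: "has_bochner_integral lborel (\<lambda>x. \<phi> (x + c)) (integral\<^sup>L lborel \<phi>)" for c
  proof -
    have "integrable (distr lborel borel ((+) c)) \<phi>" using \<phi>i by (simp add: lborel_distr_plus)
    then have "integrable lborel (\<lambda>x. \<phi> (c + x))" using \<phi>m by (subst (asm) integrable_distr_eq) auto
    moreover have "integral\<^sup>L (distr lborel borel ((+) c)) \<phi> = (LINT x|lborel. \<phi> (c + x))"
      using \<phi>m by (subst integral_distr) auto
    ultimately show ?thesis by (simp add: has_bochner_integral_iff lborel_distr_plus add.commute)
  qed
  have q0: "integral\<^sup>L lborel (q n) = 0" for n
  proof -
    have "integral\<^sup>L lborel (q n) = ((LINT x|lborel. \<phi> (x + h n *\<^sub>R b)) - (LINT x|lborel. \<phi> x)) / h n"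
      unfolding q_def using tr[of "h n *\<^sub>R b"] \<phi>i
      by (subst integral_divide_zero) (auto simp: has_bochner_integral_iff)
    also have "\<dots> = 0" using tr[of "h n *\<^sub>R b"] by (simp add: has_bochner_integral_iff)
    finally show ?thesis .
  qed
  have "(\<lambda>n. integral\<^sup>L lborel (q n)) \<longlonglongrightarrow> (LINT x|lborel. ?d x)"
  proof (rule integral_dominated_convergence[where w = "\<lambda>x. indicat_real (cball 0 (R + 1)) x * K"])
    show "integrable lborel (\<lambda>x. indicat_real (cball (0::'a) (R + 1)) x * K)"
      by (intro integrable_mult_left integrable_real_indicator) (use emeasure_lborel_cball_finite in auto)
    show "?d \<in> borel_measurable lborel" using test_fun_borel_measurable[OF d] by simp
    show "q n \<in> borel_measurable lborel" for n
      unfolding q_def[abs_def] using \<phi>m by measurable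
    show "AE x in lborel. (\<lambda>n. q n x) \<longlonglongrightarrow> ?d x"
    proof (rule AE_I2)
      fix x
      have "((\<lambda>t. (\<phi> (x + t *\<^sub>R b) - \<phi> x) / t) \<longlongrightarrow> ?d x) (at 0)"
        using line[of x 0] by (simp add: DERIV_def)
      moreover have "filterlim h (at 0) sequentially"
        unfolding filterlim_at using h0 h(1) by (auto simp: less_imp_neq[symmetric])
      ultimately show "(\<lambda>n. q n x) \<longlonglongrightarrow> ?d x"
        unfolding q_def by (rule filterlim_compose)
    qed
    show "AE x in lborel. norm (q n x) \<le> indicat_real (cball 0 (R + 1)) x * K" for n
    proof (rule AE_I2)
      fix x
      show "norm (q n x) \<le> indicat_real (cball 0 (R + 1)) x * K"
      proof (cases "norm x \<le> R + 1")
        case True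
        obtain \<xi> where "\<phi> (x + h n *\<^sub>R b) - \<phi> (x + 0 *\<^sub>R b) = (h n - 0) * ?d (x + \<xi> *\<^sub>R b)"
          using MVT2[of 0 "h n" "\<lambda>t. \<phi> (x + t *\<^sub>R b)" "\<lambda>t. ?d (x + t *\<^sub>R b)"] h(1)[of n] line by blast
        then have "q n x = ?d (x + \<xi> *\<^sub>R b)" using h(1)[of n] by (simp add: q_def)
        then show ?thesis using K(2) True by simp
      next
        case False
        have "norm x \<le> norm (x + h n *\<^sub>R b) + norm (h n *\<^sub>R b)"
          using norm_triangle_ineq4[of "x + h n *\<^sub>R b" "h n *\<^sub>R b"] by simp
        then have "norm (x + h n *\<^sub>R b) > R" using False h[of n] b by simp
        then show ?thesis using R(2)[of x] R(2)[of "x + h n *\<^sub>R b"] False by (simp add: q_def)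
      qed
    qed
  qed
  then show ?thesis unfolding q0 using LIMSEQ_unique tendsto_const by blast
qed

lemma LINT_lebesgue_on_test_fun:
  fixes \<phi> :: "'a::euclidean_space \<Rightarrow> real"
  assumes A: "A \<in> sets lebesgue" and f: "\<phi> \<in> test_fun A"
  shows "(LINT x|lebesgue_on A. \<phi> x) = (LINT x|lborel. \<phi> x)"
proof -
  have "(LINT x|lebesgue_on A. \<phi> x) = (LINT x|lebesgue. indicat_real A x * \<phi> x)"
    using A by (simp add: integral_restrict_space)
  also have "(\<lambda>x. indicat_real A x * \<phi> x) = \<phi>"
    using test_fun_eq_0[OF f] by (auto simp: indicator_def fun_eq_iff)
  finally show ?thesis using test_fun_borel_measurable[OF f] by (simp add: integral_completion)
qed

section \<open>The spaces \<open>L\<^sup>2\<close>, \<open>H\<^sup>1\<close> and \<open>H\<^sup>1\<^sub>0\<close>\<close>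

locale bounded_domain =
  fixes A :: "(real^'d) set"
  assumes open_A: "open A" and bounded_A: "bounded A"
begin

lemma A_lmeasurable: "A \<in> lmeasurable"
  using open_A bounded_A by (rule lmeasurable_open[rotated])

lemma A_sets: "A \<in> sets lebesgue" using open_A by auto

sublocale finite_measure "lebesgue_on A"
  by (rule finite_measure_lebesgue_on[OF A_lmeasurable])

lemma L2_measurable: "v \<in> L2 A \<Longrightarrow> v \<in> borel_measurable (lebesgue_on A)"
  by (simp add: L2_def)

lemma L2_mult_integrable:
  assumes "v \<in> L2 A" "w \<in> L2 A"
  shows "integrable (lebesgue_on A) (\<lambda>x. v x * w x)"
proof (rule Bochner_Integration.integrable_bound)
  show "integrable (lebesgue_on A) (\<lambda>x. (v x)\<^sup>2 + (w x)\<^sup>2)" using assms by (auto simp: L2_def)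
  show "(\<lambda>x. v x * w x) \<in> borel_measurable (lebesgue_on A)" using assms by (auto simp: L2_def)
  have "\<bar>v x * w x\<bar> \<le> (v x)\<^sup>2 + (w x)\<^sup>2" for x
    using sum_squares_bound[of "\<bar>v x\<bar>" "\<bar>w x\<bar>"] mult_nonneg_nonneg[of "\<bar>v x\<bar>" "\<bar>w x\<bar>"]
    unfolding abs_mult power2_abs mult.assoc by linarith
  then show "AE x in lebesgue_on A. norm (v x * w x) \<le> norm ((v x)\<^sup>2 + (w x)\<^sup>2)" by auto
qed

lemma L2_bounded:
  assumes "v \<in> borel_measurable (lebesgue_on A)" "\<And>x. x \<in> A \<Longrightarrow> \<bar>v x\<bar> \<le> K"
  shows "v \<in> L2 A"
proof -
  have "integrable (lebesgue_on A) (\<lambda>x. (v x)\<^sup>2)"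
  proof (rule integrable_const_bound)
    show "AE x in lebesgue_on A. norm ((v x)\<^sup>2) \<le> K\<^sup>2"
      using assms(2) by (intro AE_I2) (fastforce simp: abs_le_square_iff[symmetric])
  qed (use assms in auto)
  then show ?thesis using assms by (simp add: L2_def)
qed

lemma const_in_L2: "(\<lambda>x. c) \<in> L2 A" by (rule L2_bounded[of _ "\<bar>c\<bar>"]) auto

lemma L2_integrable: "v \<in> L2 A \<Longrightarrow> integrable (lebesgue_on A) v"
  using L2_mult_integrable[OF _ const_in_L2[of 1]] by simp

lemma L2_subspace: "subspace (L2 A)"
proof (rule subspaceI)
  show "0 \<in> L2 A" using const_in_L2[of 0] by (simp add: zero_fun_def)
  show "v + w \<in> L2 A" if "v \<in> L2 A" "w \<in> L2 A" for v w
  proof -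
    have "integrable (lebesgue_on A) (\<lambda>x. (v x)\<^sup>2 + 2 * (v x * w x) + (w x)\<^sup>2)"
      using that L2_mult_integrable[OF that] by (auto simp: L2_def)
    then have "integrable (lebesgue_on A) (\<lambda>x. (v x + w x)\<^sup>2)"
      by (simp add: power2_sum algebra_simps)
    then show ?thesis using that by (auto simp: L2_def plus_fun_def)
  qed
  show "c *\<^sub>R v \<in> L2 A" if "v \<in> L2 A" for c v
    using that by (auto simp: L2_def scaleR_fun_def power_mult_distrib)
qed

lemma ip_commute: "ip A v w = ip A w v" by (simp add: ip_def mult.commute)

lemma ip_linear:
  assumes "u \<in> L2 A" "v \<in> L2 A" "w \<in> L2 A"
  shows "ip A (u + s *\<^sub>R v) w = ip A u w + s * ip A v w"
  using L2_mult_integrable[OF assms(1,3)] L2_mult_integrable[OF assms(2,3)]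
  by (simp add: ip_def distrib_right mult.assoc)

lemma semi_inner_L2: "semi_inner (L2 A) (ip A)"
  unfolding semi_inner_def using L2_subspace ip_commute ip_linear by (auto simp: ip_def)

lemma L2_norm_eq: "L2_norm A = (\<lambda>v. sqrt (ip A v v))" by (simp add: L2_norm_def fun_eq_iff)

lemma L2_seminorm_space: "seminorm_space (L2 A) (L2_norm A)"
  unfolding L2_norm_eq by (rule semi_inner_seminorm_space[OF semi_inner_L2])

sublocale L2: seminorm_space "L2 A" "L2_norm A" by (rule L2_seminorm_space)

lemma ip_Cauchy_Schwarz: "v \<in> L2 A \<Longrightarrow> w \<in> L2 A \<Longrightarrow> \<bar>ip A v w\<bar> \<le> L2_norm A v * L2_norm A w"
  unfolding L2_norm_def by (rule semi_inner_Cauchy_Schwarz[OF semi_inner_L2])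

lemma ip_bounded_bilinear: "bounded_bilinear_on (L2 A) (L2_norm A) (L2 A) (L2_norm A) (ip A)"
  unfolding L2_norm_eq by (rule semi_inner_bounded_bilinear[OF semi_inner_L2])

lemma L2_norm_square: "v \<in> L2 A \<Longrightarrow> (L2_norm A v)\<^sup>2 = ip A v v"
  by (simp add: L2_norm_def semi_inner_nonneg[OF semi_inner_L2])

lemma ip_cong_AE:
  assumes "v \<in> L2 A" "v' \<in> L2 A" "w \<in> L2 A" "w' \<in> L2 A"
    and "AE x in lebesgue_on A. v x = v' x" "AE x in lebesgue_on A. w x = w' x"
  shows "ip A v w = ip A v' w'"
  unfolding ip_def
proof (rule integral_cong_AE)
  show "AE x in lebesgue_on A. v x * w x = v' x * w' x"
    using assms(5,6) by eventually_elim simp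
qed (use assms in \<open>auto simp: L2_def\<close>)

lemma L2_AE_cong:
  assumes "v \<in> L2 A" "AE x in lebesgue_on A. v x = w x"
  shows "w \<in> L2 A"
proof -
  have m: "w \<in> borel_measurable (lebesgue_on A)"
    by (rule borel_measurable_lebesgue_on_AE_cong[OF A_sets L2_measurable[OF assms(1)] assms(2)])
  have "integrable (lebesgue_on A) (\<lambda>x. (w x)\<^sup>2)"
  proof (rule integrable_cong_AE_imp)
    show "integrable (lebesgue_on A) (\<lambda>x. (v x)\<^sup>2)" using assms by (simp add: L2_def)
    show "AE x in lebesgue_on A. (v x)\<^sup>2 = (w x)\<^sup>2" using assms(2) by eventually_elim simp
  qed (use m in auto)
  with m show ?thesis by (simp add: L2_def)
qed

lemma L2_norm_eq_0_iff:
  assumes "v \<in> L2 A"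
  shows "L2_norm A v = 0 \<longleftrightarrow> (AE x in lebesgue_on A. v x = 0)"
proof -
  have "L2_norm A v = 0 \<longleftrightarrow> (LINT x|lebesgue_on A. (v x)\<^sup>2) = 0"
    by (simp add: L2_norm_def ip_def power2_eq_square)
  also have "\<dots> \<longleftrightarrow> (AE x in lebesgue_on A. (v x)\<^sup>2 = 0)"
    using assms by (intro integral_nonneg_eq_0_iff_AE) (auto simp: L2_def)
  finally show ?thesis by simp
qed

text \<open>Riesz--Fischer. On a set of finite measure an \<open>L\<^sup>2\<close>-Cauchy sequence is \<open>L\<^sup>1\<close>-Cauchy, so a
  subsequence converges almost everywhere; Fatou's lemma identifies the limit in \<open>L\<^sup>2\<close>.\<close>

theorem L2_complete:
  fixes v :: "nat \<Rightarrow> real^'d \<Rightarrow> real"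
  assumes v: "\<And>n. v n \<in> L2 A"
    and cauchy: "\<And>e. e > 0 \<Longrightarrow> \<exists>K. \<forall>i\<ge>K. \<forall>j\<ge>K. L2_norm A (v i - v j) < e"
  obtains w where "w \<in> L2 A" "(\<lambda>n. L2_norm A (v n - w)) \<longlonglongrightarrow> 0"
proof -
  have abs_L2: "(\<lambda>x. \<bar>u x\<bar>) \<in> L2 A" if "u \<in> L2 A" for u using that by (auto simp: L2_def)
  have abs_norm: "L2_norm A (\<lambda>x. \<bar>u x\<bar>) = L2_norm A u" for u
    by (simp add: L2_norm_def ip_def)
  have L1: "(LINT x|lebesgue_on A. \<bar>u x\<bar>) \<le> L2_norm A u * L2_norm A (\<lambda>x. 1)" if "u \<in> L2 A" for u
    using ip_Cauchy_Schwarz[OF abs_L2[OF that] const_in_L2[of 1]] by (simp add: ip_def abs_norm)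
  obtain r where r: "strict_mono r" and rc: "AE x in lebesgue_on A. Cauchy (\<lambda>i. v (r i) x)"
  proof (rule cauchy_L1_AE_cauchy_subseq[of "lebesgue_on A" v])
    show "integrable (lebesgue_on A) (v n)" for n by (rule L2_integrable[OF v])
    fix e :: real assume e: "e > 0"
    define c where "c = L2_norm A (\<lambda>x. 1) + 1"
    have c: "c > 0" using L2.nonneg[OF const_in_L2[of 1]] by (simp add: c_def)
    obtain K where K: "\<And>i j. i \<ge> K \<Longrightarrow> j \<ge> K \<Longrightarrow> L2_norm A (v i - v j) < e / c"
      using cauchy[of "e / c"] e c by auto
    have "(LINT x|lebesgue_on A. norm (v i x - v j x)) < e" if "i \<ge> K" "j \<ge> K" for i j
    proof -
      have ij: "v i - v j \<in> L2 A" using v by (intro L2.diff_in)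
      have "(LINT x|lebesgue_on A. norm (v i x - v j x)) \<le> L2_norm A (v i - v j) * L2_norm A (\<lambda>x. 1)"
        using L1[OF ij] by simp
      also have "\<dots> \<le> L2_norm A (v i - v j) * c"
        using L2.nonneg[OF ij] by (intro mult_left_mono) (auto simp: c_def)
      also have "\<dots> < e" using K[OF that] c by (simp add: field_simps)
      finally show ?thesis .
    qed
    then show "\<exists>N. \<forall>i\<ge>N. \<forall>j\<ge>N. (LINT x|lebesgue_on A. norm (v i x - v j x)) < e" by blast
  qed blast
  define w where "w x = lim (\<lambda>i. v (r i) x)" for x
  have wm: "w \<in> borel_measurable (lebesgue_on A)"
    unfolding w_def[abs_def] by (rule borel_measurable_lim_metric) (use v in \<open>auto simp: L2_def\<close>)
  have lim: "AE x in lebesgue_on A. (\<lambda>i. v (r i) x) \<longlonglongrightarrow> w x"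
    using rc by eventually_elim (auto simp: w_def Cauchy_convergent_iff convergent_LIMSEQ_iff)
  have bound: "v i - w \<in> L2 A \<and> L2_norm A (v i - w) \<le> e"
    if e: "e > 0" and K: "\<And>i j. i \<ge> K \<Longrightarrow> j \<ge> K \<Longrightarrow> L2_norm A (v i - v j) < e" and i: "i \<ge> K" for e K i
  proof -
    have "(\<integral>\<^sup>+x. ennreal ((v i x - w x)\<^sup>2) \<partial>lebesgue_on A) =
        (\<integral>\<^sup>+x. liminf (\<lambda>j. ennreal ((v i x - v (r j) x)\<^sup>2)) \<partial>lebesgue_on A)"
    proof (rule nn_integral_cong_AE)
      show "AE x in lebesgue_on A. ennreal ((v i x - w x)\<^sup>2) = liminf (\<lambda>j. ennreal ((v i x - v (r j) x)\<^sup>2))"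
        using lim
      proof eventually_elim
        case (elim x)
        have "(\<lambda>j. ennreal ((v i x - v (r j) x)\<^sup>2)) \<longlonglongrightarrow> ennreal ((v i x - w x)\<^sup>2)"
          using elim by (intro tendsto_ennrealI tendsto_intros)
        then show ?case by (rule lim_imp_Liminf[OF sequentially_bot, symmetric])
      qed
    qed
    also have "\<dots> \<le> liminf (\<lambda>j. \<integral>\<^sup>+x. ennreal ((v i x - v (r j) x)\<^sup>2) \<partial>lebesgue_on A)"
      by (rule nn_integral_liminf) (use L2_measurable[OF v] in measurable)
    also have "\<dots> \<le> ennreal (e\<^sup>2)"
    proof (rule Liminf_le)
      have "(\<integral>\<^sup>+x. ennreal ((v i x - v (r j) x)\<^sup>2) \<partial>lebesgue_on A) \<le> ennreal (e\<^sup>2)" if "j \<ge> K" for j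
      proof -
        have ij: "v i - v (r j) \<in> L2 A" using v by (intro L2.diff_in)
        have "(\<integral>\<^sup>+x. ennreal ((v i x - v (r j) x)\<^sup>2) \<partial>lebesgue_on A) = ennreal (ip A (v i - v (r j)) (v i - v (r j)))"
          using ij by (subst nn_integral_eq_integral) (auto simp: L2_def ip_def power2_eq_square)
        also have "\<dots> = ennreal ((L2_norm A (v i - v (r j)))\<^sup>2)" by (simp add: L2_norm_square[OF ij])
        also have "\<dots> \<le> ennreal (e\<^sup>2)"
          using K[OF i, of "r j"] that L2.nonneg[OF ij] seq_suble[OF r, of j]
          by (intro ennreal_leI power_mono) auto
        finally show ?thesis .
      qed
      then show "\<forall>\<^sub>F j in sequentially. (\<integral>\<^sup>+x. ennreal ((v i x - v (r j) x)\<^sup>2) \<partial>lebesgue_on A) \<le> ennreal (e\<^sup>2)"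
        unfolding eventually_sequentially by blast
    qed simp
    finally have nn: "(\<integral>\<^sup>+x. ennreal ((v i x - w x)\<^sup>2) \<partial>lebesgue_on A) \<le> ennreal (e\<^sup>2)" .
    have m: "(\<lambda>x. v i x - w x) \<in> borel_measurable (lebesgue_on A)"
      using v[of i] wm by (auto simp: L2_def)
    have int: "integrable (lebesgue_on A) (\<lambda>x. (v i x - w x)\<^sup>2)"
      using nn m by (intro integrableI_bounded) (auto intro: le_less_trans)
    then have in_L2: "v i - w \<in> L2 A" using m by (simp add: L2_def fun_diff_def)
    have "ennreal (LINT x|lebesgue_on A. (v i x - w x)\<^sup>2) \<le> ennreal (e\<^sup>2)"
      using nn int by (subst (asm) nn_integral_eq_integral) auto
    then have "(L2_norm A (v i - w))\<^sup>2 \<le> e\<^sup>2"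
      unfolding L2_norm_square[OF in_L2] by (simp add: ip_def power2_eq_square)
    then show ?thesis using in_L2 e power2_le_imp_le by fastforce
  qed
  obtain K where "\<And>i j. i \<ge> K \<Longrightarrow> j \<ge> K \<Longrightarrow> L2_norm A (v i - v j) < 1" using cauchy[of 1] by auto
  from bound[OF _ this, of K] have "v K - w \<in> L2 A" by simp
  from L2.diff_in[OF v[of K] this] have w: "w \<in> L2 A" by simp
  moreover have "(\<lambda>n. L2_norm A (v n - w)) \<longlonglongrightarrow> 0"
  proof (rule LIMSEQ_I)
    fix e :: real assume e: "e > 0"
    obtain K where K: "\<And>i j. i \<ge> K \<Longrightarrow> j \<ge> K \<Longrightarrow> L2_norm A (v i - v j) < e / 2"
      using cauchy[of "e / 2"] e by auto
    have "norm (L2_norm A (v n - w) - 0) < e" if "n \<ge> K" for n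
      using bound[OF _ K that] e L2.nonneg[OF L2.diff_in[OF v w, of n]] by auto
    then show "\<exists>no. \<forall>n\<ge>no. norm (L2_norm A (v n - w) - 0) < e" by blast
  qed
  ultimately show ?thesis by (rule that)
qed

subsection \<open>Weak gradients\<close>

lemma test_fun_in_L2:
  assumes "\<phi> \<in> test_fun A"
  shows "\<phi> \<in> L2 A"
proof -
  obtain K where "\<And>x. \<bar>\<phi> x\<bar> \<le> K" using test_fun_bounded[OF assms] by blast
  then show ?thesis
    using test_fun_borel_measurable[OF assms]
    by (intro L2_bounded) (auto simp: measurable_restrict_space1 measurable_completion)
qed

lemma grad_test_fun: "\<phi> \<in> test_fun A \<Longrightarrow> (\<lambda>x. grad \<phi> x $ i) \<in> test_fun A"
  using test_fun_derivative[of \<phi> A "axis i 1"] by (simp add: grad_def axis_in_Basis_iff)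

text \<open>The derivative of the product of two test functions has integral zero.\<close>

lemma is_weak_grad_test_fun:
  assumes f: "\<phi> \<in> test_fun A"
  shows "is_weak_grad A \<phi> (grad \<phi>)"
  unfolding is_weak_grad_def
proof (intro conjI ballI allI)
  show "(\<lambda>x. grad \<phi> x $ i) \<in> L2 A" for i by (rule test_fun_in_L2[OF grad_test_fun[OF f]])
  fix \<psi> i assume g: "\<psi> \<in> test_fun A"
  have fg: "(\<lambda>x. \<phi> x * \<psi> x) \<in> test_fun A" using test_fun_mult[OF f] test_fun_Ck[OF g] by blast
  have D: "frechet_derivative (\<lambda>x. \<phi> x * \<psi> x) (at x) (axis i 1) =
      \<phi> x * grad \<psi> x $ i + grad \<phi> x $ i * \<psi> x" for x
    using frechet_derivative_at[OF has_derivative_mult[OF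
      Ck_has_derivative[OF test_fun_Ck[OF f], of x] Ck_has_derivative[OF test_fun_Ck[OF g], of x]]]
    by (simp add: grad_def fun_eq_iff)
  have ax: "axis i (1::real) \<in> Basis" by (simp add: axis_in_Basis_iff)
  have "0 = (LINT x|lebesgue_on A. \<phi> x * grad \<psi> x $ i + grad \<phi> x $ i * \<psi> x)"
    using integral_test_fun_derivative_eq_0[OF fg ax]
      LINT_lebesgue_on_test_fun[OF A_sets test_fun_derivative[OF fg ax]] by (simp add: D)
  also have "\<dots> = ip A \<phi> (\<lambda>x. grad \<psi> x $ i) + ip A (\<lambda>x. grad \<phi> x $ i) \<psi>"
    unfolding ip_def
    by (intro Bochner_Integration.integral_add L2_mult_integrable test_fun_in_L2 grad_test_fun f g)
  finally show "ip A \<phi> (\<lambda>x. grad \<psi> x $ i) = - ip A (\<lambda>x. grad \<phi> x $ i) \<psi>" by simp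
qed

lemma test_fun_in_H1: "\<phi> \<in> test_fun A \<Longrightarrow> \<phi> \<in> H1 A"
  using is_weak_grad_test_fun test_fun_in_L2 unfolding H1_def by blast

lemma is_weak_grad_in_L2: "is_weak_grad A v g \<Longrightarrow> (\<lambda>x. g x $ i) \<in> L2 A"
  by (simp add: is_weak_grad_def)

lemma is_weak_grad_unique:
  assumes g: "is_weak_grad A v g" and h: "is_weak_grad A v h"
  shows "AE x in lebesgue_on A. g x $ i = h x $ i"
proof -
  have gi: "(\<lambda>x. g x $ i) \<in> L2 A" and hi: "(\<lambda>x. h x $ i) \<in> L2 A"
    using assms by (auto simp: is_weak_grad_in_L2)
  have d: "(\<lambda>x. g x $ i) - (\<lambda>x. h x $ i) \<in> L2 A" by (rule L2.diff_in[OF gi hi])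
  have "AE x in lebesgue_on A. ((\<lambda>x. g x $ i) - (\<lambda>x. h x $ i)) x = 0"
  proof (rule AE_eq_0_if_orthogonal_to_test_fun[OF open_A L2_integrable[OF d]])
    fix \<phi> assume f: "\<phi> \<in> test_fun A"
    have "ip A (\<lambda>x. g x $ i) \<phi> = ip A (\<lambda>x. h x $ i) \<phi>"
      using assms f unfolding is_weak_grad_def by (metis neg_equal_iff_equal)
    then show "(LINT x|lebesgue_on A. ((\<lambda>x. g x $ i) - (\<lambda>x. h x $ i)) x * \<phi> x) = 0"
      using ip_linear[OF gi hi test_fun_in_L2[OF f], of "-1"]
      by (simp add: ip_def)
  qed
  then show ?thesis by simp
qed

lemma is_weak_grad_comb:
  assumes v: "v \<in> L2 A" "is_weak_grad A v g" and w: "w \<in> L2 A" "is_weak_grad A w h"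
  shows "is_weak_grad A (v + s *\<^sub>R w) (\<lambda>x. g x + s *\<^sub>R h x)"
  unfolding is_weak_grad_def
proof (intro conjI ballI allI)
  fix i
  have gi: "(\<lambda>x. g x $ i) \<in> L2 A" and hi: "(\<lambda>x. h x $ i) \<in> L2 A"
    using assms by (auto simp: is_weak_grad_in_L2)
  have eq: "(\<lambda>x. (g x + s *\<^sub>R h x) $ i) = (\<lambda>x. g x $ i) + s *\<^sub>R (\<lambda>x. h x $ i)"
    by (auto simp: fun_eq_iff)
  show "(\<lambda>x. (g x + s *\<^sub>R h x) $ i) \<in> L2 A"
    unfolding eq using gi hi by (intro L2.add_in L2.scale_in)
  fix \<phi> assume f: "\<phi> \<in> test_fun A"
  show "ip A (v + s *\<^sub>R w) (\<lambda>x. grad \<phi> x $ i) = - ip A (\<lambda>x. (g x + s *\<^sub>R h x) $ i) \<phi>"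
    unfolding eq using v w f
    by (simp add: ip_linear gi hi test_fun_in_L2 grad_test_fun is_weak_grad_def algebra_simps)
qed

lemma H1_in_L2: "v \<in> H1 A \<Longrightarrow> v \<in> L2 A" by (simp add: H1_def)

lemma wgrad_works: "v \<in> H1 A \<Longrightarrow> is_weak_grad A v (wgrad A v)"
  unfolding H1_def wgrad_def by (simp add: someI_ex)

lemma wgrad_in_L2: "v \<in> H1 A \<Longrightarrow> (\<lambda>x. wgrad A v x $ i) \<in> L2 A"
  using wgrad_works is_weak_grad_in_L2 by blast

lemma H1_subspace: "subspace (H1 A)"
proof -
  have comb: "v + s *\<^sub>R w \<in> H1 A" if "v \<in> H1 A" "w \<in> H1 A" for v w s
    using is_weak_grad_comb[OF H1_in_L2 wgrad_works H1_in_L2 wgrad_works, OF that(1,1,2,2)]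
      that by (auto simp: H1_def intro: L2.add_in L2.scale_in)
  have z: "0 \<in> H1 A" using test_fun_in_H1[OF test_fun_scale, of _ 0] box_bump_test_fun[of 0 0 A 0]
    by (simp add: zero_fun_def)
  show ?thesis using comb[of _ _ 1] comb[OF z] z by (intro subspaceI) auto
qed

lemma wgrad_comb:
  assumes "v \<in> H1 A" "w \<in> H1 A"
  shows "AE x in lebesgue_on A. wgrad A (v + s *\<^sub>R w) x $ i = wgrad A v x $ i + s * wgrad A w x $ i"
proof -
  have "v + s *\<^sub>R w \<in> H1 A" using H1_subspace assms by (simp add: subspace_add subspace_scale)
  from is_weak_grad_unique[OF wgrad_works[OF this]
      is_weak_grad_comb[OF H1_in_L2 wgrad_works H1_in_L2 wgrad_works, OF assms(1,1,2,2)]]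
  show ?thesis by simp
qed

lemma ip_vec_eq_sum:
  assumes "\<And>i. (\<lambda>x. g x $ i) \<in> L2 A" "\<And>i. (\<lambda>x. h x $ i) \<in> L2 A"
  shows "ip_vec A g h = (\<Sum>i\<in>UNIV. ip A (\<lambda>x. g x $ i) (\<lambda>x. h x $ i))"
  unfolding ip_vec_def ip_def inner_vec_def
  by (subst Bochner_Integration.integral_sum) (auto intro!: L2_mult_integrable assms)

lemma ip_vec_wgrad_linear:
  assumes "u \<in> H1 A" "v \<in> H1 A" "\<And>i. (\<lambda>x. h x $ i) \<in> L2 A"
  shows "ip_vec A (wgrad A (u + s *\<^sub>R v)) h = ip_vec A (wgrad A u) h + s * ip_vec A (wgrad A v) h"
proof -
  have uv: "u + s *\<^sub>R v \<in> H1 A" using H1_subspace assms by (simp add: subspace_add subspace_scale)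
  have "ip A (\<lambda>x. wgrad A (u + s *\<^sub>R v) x $ i) (\<lambda>x. h x $ i) =
      ip A (\<lambda>x. wgrad A u x $ i) (\<lambda>x. h x $ i) + s * ip A (\<lambda>x. wgrad A v x $ i) (\<lambda>x. h x $ i)" for i
  proof -
    let ?g = "(\<lambda>x. wgrad A u x $ i) + s *\<^sub>R (\<lambda>x. wgrad A v x $ i)"
    have g: "?g \<in> L2 A" using assms by (intro L2.add_in L2.scale_in wgrad_in_L2)
    have "ip A (\<lambda>x. wgrad A (u + s *\<^sub>R v) x $ i) (\<lambda>x. h x $ i) = ip A ?g (\<lambda>x. h x $ i)"
      using wgrad_comb[OF assms(1,2), of s i]
      by (intro ip_cong_AE wgrad_in_L2 uv g assms) auto
    then show ?thesis using assms by (simp add: ip_linear wgrad_in_L2)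
  qed
  then show ?thesis
    using assms uv by (simp add: ip_vec_eq_sum wgrad_in_L2 sum.distrib sum_distrib_left)
qed

lemma semi_inner_H1: "semi_inner (H1 A) (\<lambda>v w. ip A v w + ip_vec A (wgrad A v) (wgrad A w))"
  unfolding semi_inner_def
proof (intro conjI ballI allI)
  fix v w assume "v \<in> H1 A" "w \<in> H1 A"
  show "ip A v w + ip_vec A (wgrad A v) (wgrad A w) = ip A w v + ip_vec A (wgrad A w) (wgrad A v)"
    by (simp add: ip_commute[of v w] ip_vec_def inner_commute)
next
  fix u v w s assume u: "u \<in> H1 A" and v: "v \<in> H1 A" and w: "w \<in> H1 A"
  show "ip A (u + s *\<^sub>R v) w + ip_vec A (wgrad A (u + s *\<^sub>R v)) (wgrad A w) =
    ip A u w + ip_vec A (wgrad A u) (wgrad A w) + s * (ip A v w + ip_vec A (wgrad A v) (wgrad A w))"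
    by (simp add: ip_linear H1_in_L2 u v w ip_vec_wgrad_linear wgrad_in_L2 algebra_simps)
qed (use H1_subspace in \<open>auto simp: ip_def ip_vec_def\<close>)

lemma H1_norm_eq: "H1_norm A = (\<lambda>v. sqrt (ip A v v + ip_vec A (wgrad A v) (wgrad A v)))"
  by (simp add: H1_norm_def fun_eq_iff)

sublocale H1: seminorm_space "H1 A" "H1_norm A"
  unfolding H1_norm_eq by (rule semi_inner_seminorm_space[OF semi_inner_H1])

lemma L2_norm_le_H1_norm: "L2_norm A v \<le> H1_norm A v"
  unfolding L2_norm_def H1_norm_def by (intro real_sqrt_le_mono) (simp add: ip_vec_def)

lemma L2_norm_wgrad_le_H1_norm:
  assumes "v \<in> H1 A"
  shows "L2_norm A (\<lambda>x. wgrad A v x $ i) \<le> H1_norm A v"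
proof -
  have nn: "0 \<le> ip A (\<lambda>x. wgrad A v x $ i) (\<lambda>x. wgrad A v x $ i)" for i by (simp add: ip_def)
  have "ip A (\<lambda>x. wgrad A v x $ i) (\<lambda>x. wgrad A v x $ i) \<le> ip_vec A (wgrad A v) (wgrad A v)"
    unfolding ip_vec_eq_sum[OF wgrad_in_L2[OF assms] wgrad_in_L2[OF assms]]
    using member_le_sum[of i UNIV "\<lambda>i. ip A (\<lambda>x. wgrad A v x $ i) (\<lambda>x. wgrad A v x $ i)"] nn by simp
  moreover have "0 \<le> ip A v v" by (simp add: ip_def)
  ultimately show ?thesis unfolding L2_norm_def H1_norm_def by (intro real_sqrt_le_mono) simp
qed

text \<open>By uniqueness of weak gradients, membership and norms do not depend on the representative.\<close>

lemma H1_norm_eq_0: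
  assumes v: "v \<in> H1 A" and z: "AE x in lebesgue_on A. v x = 0"
  shows "H1_norm A v = 0"
proof -
  have ip0: "ip A v \<phi> = 0" if "\<phi> \<in> L2 A" for \<phi>
    using ip_cong_AE[of v 0 \<phi> \<phi>] v z that L2.zero_in by (simp add: H1_in_L2 ip_def)
  have "is_weak_grad A v (\<lambda>x. 0)"
    unfolding is_weak_grad_def using L2.zero_in ip0 test_fun_in_L2[OF grad_test_fun]
    by (auto simp: zero_fun_def ip_def[of A "\<lambda>x. 0"])
  from is_weak_grad_unique[OF wgrad_works[OF v] this]
  have "L2_norm A (\<lambda>x. wgrad A v x $ i) = 0" for i
    by (subst L2_norm_eq_0_iff[OF wgrad_in_L2[OF v]]) simp
  then have "ip A (\<lambda>x. wgrad A v x $ i) (\<lambda>x. wgrad A v x $ i) = 0" for i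
    using L2_norm_square[OF wgrad_in_L2[OF v]] by (metis power_zero_numeral)
  then show ?thesis
    unfolding H1_norm_def ip_vec_eq_sum[OF wgrad_in_L2[OF v] wgrad_in_L2[OF v]]
    using ip0[OF H1_in_L2[OF v]] by simp
qed

lemma H1_AE_cong:
  assumes v: "v \<in> H1 A" and vw: "AE x in lebesgue_on A. v x = w x"
  shows "w \<in> H1 A"
proof -
  have w: "w \<in> L2 A" using L2_AE_cong[OF H1_in_L2[OF v] vw] .
  have "ip A w \<phi> = ip A v \<phi>" if "\<phi> \<in> L2 A" for \<phi>
    using vw by (intro ip_cong_AE w H1_in_L2[OF v] that) (auto elim: eventually_mono)
  then have "is_weak_grad A w (wgrad A v)"
    using wgrad_works[OF v] test_fun_in_L2[OF grad_test_fun] unfolding is_weak_grad_def by auto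
  with w show ?thesis by (auto simp: H1_def)
qed

lemma H10_in_H1: "v \<in> H10 A \<Longrightarrow> v \<in> H1 A" by (simp add: H10_def)

lemma H10_in_L2: "v \<in> H10 A \<Longrightarrow> v \<in> L2 A" by (simp add: H10_in_H1 H1_in_L2)

lemma H10_AE_cong:
  assumes v: "v \<in> H10 A" and vw: "AE x in lebesgue_on A. v x = w x"
  shows "w \<in> H10 A"
proof -
  have w: "w \<in> H1 A" using H1_AE_cong[OF H10_in_H1[OF v] vw] .
  obtain \<phi> where f: "\<And>n. \<phi> n \<in> test_fun A" and lim: "(\<lambda>n. H1_norm A (v - \<phi> n)) \<longlonglongrightarrow> 0"
    using v by (auto simp: H10_def)
  have "H1_norm A (w - v) = 0"
    using vw by (intro H1_norm_eq_0 H1.diff_in w H10_in_H1 v) (auto elim: eventually_mono)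
  then have le: "H1_norm A (w - \<phi> n) \<le> H1_norm A (v - \<phi> n)" for n
    using H1.triangle_via[OF w H10_in_H1[OF v] test_fun_in_H1[OF f[of n]]] by simp
  have "(\<lambda>n. H1_norm A (w - \<phi> n)) \<longlonglongrightarrow> 0"
    using le H1.nonneg[OF H1.diff_in[OF w test_fun_in_H1[OF f]]]
    by (intro Lim_null_comparison[OF _ lim] always_eventually) auto
  with f w show ?thesis by (auto simp: H10_def)
qed

lemma H10_subspace: "subspace (H10 A)"
proof -
  have comb: "v + s *\<^sub>R w \<in> H10 A" if v: "v \<in> H10 A" and w: "w \<in> H10 A" for v w s
  proof -
    obtain \<phi> where f: "\<And>n. \<phi> n \<in> test_fun A" and fl: "(\<lambda>n. H1_norm A (v - \<phi> n)) \<longlonglongrightarrow> 0"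
      using v by (auto simp: H10_def)
    obtain \<psi> where g: "\<And>n. \<psi> n \<in> test_fun A" and gl: "(\<lambda>n. H1_norm A (w - \<psi> n)) \<longlonglongrightarrow> 0"
      using w by (auto simp: H10_def)
    have fg: "\<phi> n + s *\<^sub>R \<psi> n \<in> test_fun A" for n
      using test_fun_add[OF f[of n] test_fun_scale[OF g[of n], of s]]
      by (simp add: plus_fun_def scaleR_fun_def)
    have lim: "(\<lambda>n. H1_norm A (v - \<phi> n) + \<bar>s\<bar> * H1_norm A (w - \<psi> n)) \<longlonglongrightarrow> 0 + \<bar>s\<bar> * 0"
      by (intro tendsto_intros fl gl)
    have vs: "v - \<phi> n \<in> H1 A" "w - \<psi> n \<in> H1 A" for n
      by (intro H1.diff_in H10_in_H1 test_fun_in_H1 v w f g)+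
    have "norm (H1_norm A (v + s *\<^sub>R w - (\<phi> n + s *\<^sub>R \<psi> n))) \<le>
        H1_norm A (v - \<phi> n) + \<bar>s\<bar> * H1_norm A (w - \<psi> n)" for n
    proof -
      have eq: "v + s *\<^sub>R w - (\<phi> n + s *\<^sub>R \<psi> n) = (v - \<phi> n) + s *\<^sub>R (w - \<psi> n)"
        by (simp add: algebra_simps)
      show ?thesis
        unfolding eq using H1.triangle[OF vs(1) H1.scale_in[OF vs(2)]] H1.scale[OF vs(2)]
          H1.nonneg[OF H1.add_in[OF vs(1) H1.scale_in[OF vs(2)]]] by simp
    qed
    then have "(\<lambda>n. H1_norm A (v + s *\<^sub>R w - (\<phi> n + s *\<^sub>R \<psi> n))) \<longlonglongrightarrow> 0"
      by (intro Lim_null_comparison[OF _ lim[simplified]] always_eventually) auto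
    then show ?thesis
      using fg v w by (auto simp: H10_def intro!: H1.add_in H1.scale_in exI[of _ "\<lambda>n. \<phi> n + s *\<^sub>R \<psi> n"])
  qed
  have "0 \<in> test_fun A"
    using test_fun_scale[of _ A 0] box_bump_test_fun[of 0 0 A 0] by (simp add: zero_fun_def)
  then have z: "0 \<in> H10 A"
    using H1.zero H1.zero_in by (auto simp: H10_def intro!: exI[of _ "\<lambda>n. 0"])
  show ?thesis using comb[of _ _ 1] comb[OF z] z by (intro subspaceI) auto
qed

sublocale H10: seminorm_space "H10 A" "H1_norm A"
  by standard (use H10_subspace H1.nonneg H1.scale H1.triangle H10_in_H1 in auto)

sublocale Hm1: seminorm_space "Hm1 A" "Hm1_norm A"
  by (rule H10.dual_seminorm_space)

end

section \<open>Integrals over half-open intervals\<close>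

lemma Ioc_lmeasurable [simp]: "{a<..b::real} \<in> lmeasurable"
  by (rule bounded_set_imp_lmeasurable) auto

lemma Ioc_sets [simp]: "{a<..b::real} \<in> sets lebesgue" by simp

lemma finite_measure_Ioc: "finite_measure (lebesgue_on {a<..b::real})"
  by (rule finite_measure_lebesgue_on) simp

lemma LINT_on_eq_set: "S \<in> sets lebesgue \<Longrightarrow> (LINT t|lebesgue_on S. f t) = set_lebesgue_integral lebesgue S f"
  for f :: "real \<Rightarrow> real"
  by (simp add: integral_restrict_space set_lebesgue_integral_def)

lemma integrable_on_eq_set: "S \<in> sets lebesgue \<Longrightarrow> integrable (lebesgue_on S) f = set_integrable lebesgue S f"
  for f :: "real \<Rightarrow> real"
  by (simp add: integrable_restrict_space set_integrable_def)

lemma Ioc_eq_Ioo: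
  fixes f :: "real \<Rightarrow> real"
  shows "(LINT t|lebesgue_on {a<..b}. f t) = (LINT t|lebesgue_on {a<..<b}. f t)"
    and "integrable (lebesgue_on {a<..b}) f = integrable (lebesgue_on {a<..<b}) f"
proof -
  have "set_lebesgue_integral lebesgue {a<..b} f = set_lebesgue_integral lebesgue {a<..<b} f"
    by (rule set_integral_discrete_difference[where X = "{b}"]) auto
  then show "(LINT t|lebesgue_on {a<..b}. f t) = (LINT t|lebesgue_on {a<..<b}. f t)"
    by (simp add: LINT_on_eq_set)
  have "set_integrable lebesgue {a<..b} f = set_integrable lebesgue {a<..<b} f"
    by (rule set_integrable_discrete_difference[where X = "{b}"]) auto
  then show "integrable (lebesgue_on {a<..b}) f = integrable (lebesgue_on {a<..<b}) f"
    by (simp add: integrable_on_eq_set)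
qed

lemma AE_Ioo_imp_Ioc:
  assumes "AE t in lebesgue_on {a<..<b::real}. Q t"
  shows "AE t in lebesgue_on {a<..b}. Q t"
proof -
  have "AE t in lebesgue. t \<noteq> b" by (rule AE_I'[of "{b}"]) auto
  with assms show ?thesis
    by (auto simp: AE_restrict_space_iff elim!: eventually_elim2)
qed

lemma LINT_Ioc_add:
  fixes f :: "real \<Rightarrow> real"
  assumes "a \<le> b" "b \<le> c" "integrable (lebesgue_on {a<..c}) f"
  shows "(LINT t|lebesgue_on {a<..c}. f t) = (LINT t|lebesgue_on {a<..b}. f t) + (LINT t|lebesgue_on {b<..c}. f t)"
proof -
  have "{a<..c} = {a<..b} \<union> {b<..c}" using assms by auto
  moreover have "integrable (lebesgue_on {a<..b}) f" "integrable (lebesgue_on {b<..c}) f"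
    using assms by (auto intro!: integrable_lebesgue_on_subset[OF assms(3)])
  ultimately show ?thesis
    by (simp add: LINT_on_eq_set integrable_on_eq_set set_integral_Un)
qed

lemma LINT_nonneg_mono_set:
  fixes f :: "real \<Rightarrow> real"
  assumes f: "integrable (lebesgue_on S) f" and nn: "AE t in lebesgue_on S. 0 \<le> f t"
    and T: "T \<subseteq> S" "S \<in> sets lebesgue" "T \<in> sets lebesgue"
  shows "(LINT t|lebesgue_on T. f t) \<le> (LINT t|lebesgue_on S. f t)"
proof -
  have "(LINT t|lebesgue. indicator T t * f t) \<le> (LINT t|lebesgue. indicator S t * f t)"
  proof (rule integral_mono_AE)
    show "integrable lebesgue (\<lambda>t. indicator T t * f t)"
      using integrable_lebesgue_on_subset[OF f T] T by (simp add: integrable_restrict_space)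
    show "integrable lebesgue (\<lambda>t. indicator S t * f t)"
      using f T by (simp add: integrable_restrict_space)
    show "AE t in lebesgue. indicator T t * f t \<le> indicator S t * f t"
      using nn T by (auto simp: AE_restrict_space_iff indicator_def elim!: eventually_mono)
  qed
  then show ?thesis using T by (simp add: integral_restrict_space)
qed

lemma LINT_Ioc_FTC:
  fixes F f :: "real \<Rightarrow> real"
  assumes "a \<le> b" "finite S" "continuous_on {a..b} F"
    and "\<And>x. a < x \<Longrightarrow> x < b \<Longrightarrow> x \<notin> S \<Longrightarrow> (F has_real_derivative f x) (at x)"
    and f: "integrable (lebesgue_on {a<..b}) f"
  shows "(LINT t|lebesgue_on {a<..b}. f t) = F b - F a"
proof -
  have "(f has_integral (F b - F a)) {a..b}"
    using assms by (intro fundamental_theorem_of_calculus_interior_strong[of S])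
      (auto simp: has_real_derivative_iff_has_vector_derivative)
  then have "(f has_integral (F b - F a)) {a<..b}"
  proof (rule has_integral_spike_set_eq[THEN iffD1, rotated 2])
    show "negligible {x \<in> {a..b} - {a<..b}. f x \<noteq> 0}"
      by (rule negligible_subset[of "{a}"]) auto
    show "negligible {x \<in> {a<..b} - {a..b}. f x \<noteq> 0}"
      by (rule negligible_subset[of "{a}"]) auto
  qed
  then show ?thesis using lebesgue_integral_eq_integral[OF f] by (simp add: integral_unique)
qed

lemma integrable_mult_bounded:
  fixes f q :: "real \<Rightarrow> real"
  assumes f: "integrable (lebesgue_on S) f" and q: "q \<in> borel_measurable (lebesgue_on S)"
    and K: "\<And>t. t \<in> S \<Longrightarrow> \<bar>q t\<bar> \<le> K"
  shows "integrable (lebesgue_on S) (\<lambda>t. q t * f t)"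
proof (rule Bochner_Integration.integrable_bound)
  show "integrable (lebesgue_on S) (\<lambda>t. K * f t)" using f by simp
  show "(\<lambda>t. q t * f t) \<in> borel_measurable (lebesgue_on S)" using f q by auto
  show "AE t in lebesgue_on S. norm (q t * f t) \<le> norm (K * f t)"
  proof (rule AE_I2)
    fix t assume "t \<in> space (lebesgue_on S)"
    then have "\<bar>q t\<bar> \<le> \<bar>K\<bar>" using K[of t] by auto
    then show "norm (q t * f t) \<le> norm (K * f t)" by (simp add: abs_mult mult_right_mono)
  qed
qed

lemma borel_measurable_lebesgue_onI: "f \<in> borel_measurable borel \<Longrightarrow> f \<in> borel_measurable (lebesgue_on S)"
  by (simp add: measurable_restrict_space1 measurable_completion)

section \<open>Functions with an integrable weak derivative\<close>

lemma test_fun_has_deriv: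
  fixes \<eta> :: "real \<Rightarrow> real"
  assumes "\<eta> \<in> test_fun A"
  shows "(\<eta> has_real_derivative deriv \<eta> t) (at t)" "deriv \<eta> \<in> test_fun A"
proof -
  have D: "(\<eta> has_derivative frechet_derivative \<eta> (at t)) (at t)" for t
    using Ck_has_derivative[OF test_fun_Ck[OF assms, of "Suc 0"]] .
  have "frechet_derivative \<eta> (at t) h = frechet_derivative \<eta> (at t) 1 * h" for t h
    using linear_scale[OF has_derivative_linear[OF D], of t h 1] by (simp add: mult.commute)
  then have E: "(\<eta> has_real_derivative frechet_derivative \<eta> (at t) 1) (at t)" for t
    using D[of t] unfolding has_field_derivative_def by (metis (no_types, lifting) ext)
  have "deriv \<eta> = (\<lambda>t. frechet_derivative \<eta> (at t) 1)" using DERIV_imp_deriv[OF E] by auto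
  then show "(\<eta> has_real_derivative deriv \<eta> t) (at t)" "deriv \<eta> \<in> test_fun A"
    using E test_fun_derivative[OF assms, of 1] by auto
qed

text \<open>The antiderivative that vanishes at the left end is constant on both sides of the support, and
  the mean value condition makes it zero on the right.\<close>

lemma test_fun_antiderivative:
  fixes \<psi> :: "real \<Rightarrow> real"
  assumes ab: "a < b" and f: "\<psi> \<in> test_fun {a<..<b}" and z: "(LINT t|lebesgue_on {a<..b}. \<psi> t) = 0"
  obtains \<eta> where "\<eta> \<in> test_fun {a<..<b}" "deriv \<eta> = \<psi>"
proof -
  have "\<forall>x. isCont \<psi> x" using test_fun_continuous[OF f] by (simp add: continuous_on_eq_continuous_at)
  then obtain F where F: "\<And>x::real. (F has_vector_derivative \<psi> x) (at x)"
    using einterval_antiderivative[of "-\<infinity>" "\<infinity>" \<psi>] by auto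
  define \<eta> where "\<eta> t = F t - F a" for t
  have D: "(\<eta> has_real_derivative \<psi> t) (at t)" for t
    using F[of t] unfolding \<eta>_def has_real_derivative_iff_has_vector_derivative
    by (auto intro!: derivative_eq_intros)
  have cont: "continuous_on T \<eta>" for T
    using D by (intro DERIV_continuous_on) (auto intro: has_field_derivative_at_within)
  obtain c d where cd: "a < c" "d < b" "{t. \<psi> t \<noteq> 0} \<subseteq> {c..d}"
  proof (cases "closure {t. \<psi> t \<noteq> 0} = {}")
    case True
    then show ?thesis using that[of "(a+b)/2" "(a+b)/2"] ab by auto
  next
    case False
    have co: "compact (closure {t. \<psi> t \<noteq> 0})" and sub: "closure {t. \<psi> t \<noteq> 0} \<subseteq> {a<..<b}"
      using f unfolding test_fun_def by auto
    obtain c where c: "c \<in> closure {t. \<psi> t \<noteq> 0}" "\<And>t. t \<in> closure {t. \<psi> t \<noteq> 0} \<Longrightarrow> c \<le> t"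
      using compact_attains_inf[OF co False] by blast
    obtain d where d: "d \<in> closure {t. \<psi> t \<noteq> 0}" "\<And>t. t \<in> closure {t. \<psi> t \<noteq> 0} \<Longrightarrow> t \<le> d"
      using compact_attains_sup[OF co False] by blast
    have "a < c" "d < b" using c(1) d(1) sub by auto
    moreover have "{t. \<psi> t \<noteq> 0} \<subseteq> {c..d}" using c(2) d(2) closure_subset[of "{t. \<psi> t \<noteq> 0}"] by auto
    ultimately show ?thesis by (rule that)
  qed
  have "integrable (lebesgue_on {a<..b}) \<psi>"
  proof -
    interpret finite_measure "lebesgue_on {a<..b}" by (rule finite_measure_Ioc)
    obtain K where "\<And>x. \<bar>\<psi> x\<bar> \<le> K" using test_fun_bounded[OF f] by blast
    then show ?thesis
      using borel_measurable_lebesgue_onI[OF test_fun_borel_measurable[OF f]]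
      by (intro integrable_const_bound[of _ K]) auto
  qed
  then have "\<eta> b = 0"
    using LINT_Ioc_FTC[of a b "{}" \<eta> \<psi>] ab z D cont by (simp add: \<eta>_def)
  have low: "\<eta> t = 0" if t: "t < c" for t
  proof (rule ccontr)
    assume "\<eta> t \<noteq> 0"
    then have "t \<noteq> a" by (auto simp: \<eta>_def)
    define l r where "l = min t a" and "r = max t a"
    have "l < r" using \<open>t \<noteq> a\<close> by (auto simp: l_def r_def)
    then obtain z where "l < z" "z < r" "\<eta> r - \<eta> l = (r - l) * \<psi> z"
      using MVT2[of l r \<eta> \<psi>] D by blast
    moreover have "\<psi> z = 0" using \<open>z < r\<close> cd t subsetD[OF cd(3), of z] by (force simp: r_def)
    ultimately have "\<eta> r = \<eta> l" by simp
    then show False using \<open>\<eta> t \<noteq> 0\<close> by (auto simp: l_def r_def min_def max_def \<eta>_def split: if_splits)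
  qed
  have high: "\<eta> t = 0" if t: "d < t" for t
  proof (rule ccontr)
    assume "\<eta> t \<noteq> 0"
    then have "t \<noteq> b" using \<open>\<eta> b = 0\<close> by auto
    define l r where "l = min t b" and "r = max t b"
    have "l < r" using \<open>t \<noteq> b\<close> by (auto simp: l_def r_def)
    then obtain z where "l < z" "z < r" "\<eta> r - \<eta> l = (r - l) * \<psi> z"
      using MVT2[of l r \<eta> \<psi>] D by blast
    moreover have "\<psi> z = 0" using \<open>l < z\<close> cd t subsetD[OF cd(3), of z] by (force simp: l_def)
    ultimately have "\<eta> r = \<eta> l" by simp
    then show False using \<open>\<eta> t \<noteq> 0\<close> \<open>\<eta> b = 0\<close> by (auto simp: l_def r_def min_def max_def split: if_splits)
  qed
  have "Ck k \<eta>" for k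
  proof (cases k)
    case 0
    then show ?thesis using cont by simp
  next
    case (Suc m)
    have "Ck (Suc m) \<eta>"
      by (rule Ck_SucI[where f' = "\<lambda>x h. \<psi> x * h"])
        (use D test_fun_Ck[OF f] in \<open>auto simp: has_field_derivative_def\<close>)
    then show ?thesis using Suc by simp
  qed
  moreover have "{t. \<eta> t \<noteq> 0} \<subseteq> {c..d}" using low high by (auto simp: not_less[symmetric])
  then have "closure {t. \<eta> t \<noteq> 0} \<subseteq> {c..d}" by (rule closure_minimal) simp
  moreover from this have "compact (closure {t. \<eta> t \<noteq> 0})"
    by (metis closed_closure closed_Int_compact compact_Icc inf.absorb1)
  moreover have "{c..d} \<subseteq> {a<..<b}" using cd by auto
  ultimately have "\<eta> \<in> test_fun {a<..<b}" unfolding test_fun_def by auto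
  moreover have "deriv \<eta> = \<psi>" using DERIV_imp_deriv[OF D] by auto
  ultimately show ?thesis by (rule that)
qed

text \<open>The indefinite integral need not be differentiable at any given point, so Fubini on the triangle
  \<open>q \<le> t\<close> takes the place of the product rule.\<close>

lemma test_fun_indefinite_integral_parts:
  fixes h :: "real \<Rightarrow> real"
  assumes ab: "a < b" and h: "integrable (lebesgue_on {a<..b}) h" and f: "\<eta> \<in> test_fun {a<..<b}"
  defines "H \<equiv> \<lambda>t. LINT q|lebesgue_on {a<..t}. h q"
  shows "(LINT t|lebesgue_on {a<..b}. deriv \<eta> t * H t) = - (LINT t|lebesgue_on {a<..b}. \<eta> t * h t)"
    and "H \<in> borel_measurable (lebesgue_on {a<..b})"
    and "\<And>t. a < t \<Longrightarrow> t \<le> b \<Longrightarrow> \<bar>H t\<bar> \<le> (LINT q|lebesgue_on {a<..b}. \<bar>h q\<bar>)"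
proof -
  define h0 where "h0 q = indicat_real {a<..b} q * h q" for q
  have h0: "integrable lebesgue h0"
    using h by (simp add: h0_def[abs_def] integrable_restrict_space)
  obtain h1 where h1m: "h1 \<in> borel_measurable lborel" and eq: "AE q in lborel. h0 q = h1 q"
    using completion_ex_borel_measurable_real[OF borel_measurable_integrable[OF h0]] by auto
  have eq': "AE q in lebesgue. h0 q = h1 q" using eq by (rule AE_completion)
  have h1m': "h1 \<in> borel_measurable lebesgue" using h1m by (rule measurable_completion)
  have h1: "integrable lborel h1"
    using integrable_cong_AE[OF borel_measurable_integrable[OF h0] h1m' eq'] h0 h1m
    by (simp add: integrable_completion)
  have HH: "(LINT q|lborel. indicator {..t} q * h1 q) = H t" if "t \<le> b" for t
  proof -
    have "H t = (LINT q|lebesgue. indicator {a<..t} q * h q)"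
      unfolding H_def by (simp add: integral_restrict_space)
    also have "\<dots> = (LINT q|lebesgue. indicator {..t} q * h0 q)"
      using that by (intro Bochner_Integration.integral_cong) (auto simp: h0_def indicator_def)
    also have "\<dots> = (LINT q|lebesgue. indicator {..t} q * h1 q)"
    proof (rule integral_cong_AE)
      have ind: "indicat_real {..t} \<in> borel_measurable lebesgue" by (rule borel_measurable_indicator) auto
      show "(\<lambda>q. indicat_real {..t} q * h0 q) \<in> borel_measurable lebesgue"
        by (rule borel_measurable_times[OF ind borel_measurable_integrable[OF h0]])
      show "(\<lambda>q. indicat_real {..t} q * h1 q) \<in> borel_measurable lebesgue"
        by (rule borel_measurable_times[OF ind h1m'])
    qed (use eq' in auto)
    also have "\<dots> = (LINT q|lborel. indicator {..t} q * h1 q)"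
      using h1m by (intro integral_completion borel_measurable_times) auto
    finally show ?thesis by simp
  qed
  have Hm: "(\<lambda>t. LINT q|lborel. indicator {..t} q * h1 q) \<in> borel_measurable lborel"
  proof -
    have "(\<lambda>(t, q). indicat_real {x. snd x \<le> fst x} (t, q) * h1 q) \<in> borel_measurable (lborel \<Otimes>\<^sub>M lborel)"
      using h1m by measurable
    then have "(\<lambda>t. LINT q|lborel. indicat_real {x. snd x \<le> fst x} (t, q) * h1 q) \<in> borel_measurable lborel"
      by (rule lborel.borel_measurable_lebesgue_integral)
    moreover have "indicat_real {x. snd x \<le> fst x} (t, q) = indicat_real {..t} q" for t q :: real
      by (auto simp: indicator_def)
    ultimately show ?thesis by simp
  qed
  show Hm': "H \<in> borel_measurable (lebesgue_on {a<..b})"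
    using measurable_restrict_space1[OF measurable_completion[OF Hm], of "{a<..b}"]
    by (subst measurable_cong[of _ _ "\<lambda>t. LINT q|lborel. indicator {..t} q * h1 q"]) (auto simp: HH)
  show Hbd: "\<bar>H t\<bar> \<le> (LINT q|lebesgue_on {a<..b}. \<bar>h q\<bar>)" if "a < t" "t \<le> b" for t
  proof -
    have "\<bar>H t\<bar> \<le> (LINT q|lebesgue_on {a<..t}. \<bar>h q\<bar>)" unfolding H_def by (rule integral_abs_bound)
    also have "\<dots> \<le> (LINT q|lebesgue_on {a<..b}. \<bar>h q\<bar>)"
      using h that by (intro LINT_nonneg_mono_set) auto
    finally show ?thesis .
  qed
  obtain K where K: "\<And>x. \<bar>deriv \<eta> x\<bar> \<le> K" using test_fun_bounded[OF test_fun_has_deriv(2)[OF f]] by blast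
  have dm: "deriv \<eta> \<in> borel_measurable borel" by (rule test_fun_borel_measurable[OF test_fun_has_deriv(2)[OF f]])
  define G where "G t q = indicat_real {a<..b} t * deriv \<eta> t * (indicat_real {..t} q * h1 q)" for t q
  have Gm: "(\<lambda>(t, q). G t q) \<in> borel_measurable (lborel \<Otimes>\<^sub>M lborel)"
  proof -
    have "(\<lambda>(t, q). indicat_real {a<..b} t * deriv \<eta> t * (indicat_real {x. snd x \<le> fst x} (t, q) * h1 q))
        \<in> borel_measurable (lborel \<Otimes>\<^sub>M lborel)"
      using h1m dm by measurable
    moreover have "indicat_real {x. snd x \<le> fst x} (t, q) = indicat_real {..t} q" for t q :: real
      by (auto simp: indicator_def)
    ultimately show ?thesis by (simp add: G_def)
  qed
  have Gq: "integrable lborel (\<lambda>q. G t q)" for t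
    unfolding G_def using integrable_mult_indicator[OF _ h1, of "{..t}"] by (intro integrable_mult_right) simp
  have "integrable (lborel \<Otimes>\<^sub>M lborel) (\<lambda>(t, q). G t q)"
  proof (rule lborel_pair.Fubini_integrable[OF Gm])
    let ?C = "LINT q|lborel. \<bar>h1 q\<bar>"
    show "integrable lborel (\<lambda>t. LINT q|lborel. norm (case (t, q) of (t, q) \<Rightarrow> G t q))"
    proof (rule Bochner_Integration.integrable_bound)
      show "integrable lborel (\<lambda>t. indicat_real {a<..b} t * (\<bar>K\<bar> * ?C))"
        using ab by (intro integrable_mult_left integrable_real_indicator) (auto simp: less_imp_le)
      show "(\<lambda>t. LINT q|lborel. norm (case (t, q) of (t, q) \<Rightarrow> G t q)) \<in> borel_measurable lborel"
        using Gm by (intro lborel.borel_measurable_lebesgue_integral) (simp add: case_prod_unfold)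
      show "AE t in lborel. norm (LINT q|lborel. norm (case (t, q) of (t, q) \<Rightarrow> G t q)) \<le>
          norm (indicat_real {a<..b} t * (\<bar>K\<bar> * ?C))"
      proof (rule AE_I2)
        fix t
        have "(LINT q|lborel. \<bar>G t q\<bar>) \<le> (LINT q|lborel. indicat_real {a<..b} t * \<bar>K\<bar> * \<bar>h1 q\<bar>)"
        proof (rule integral_mono)
          show "integrable lborel (\<lambda>q. \<bar>G t q\<bar>)" using Gq by simp
          show "integrable lborel (\<lambda>q. indicat_real {a<..b} t * \<bar>K\<bar> * \<bar>h1 q\<bar>)" using h1 by simp
          fix q
          show "\<bar>G t q\<bar> \<le> indicat_real {a<..b} t * \<bar>K\<bar> * \<bar>h1 q\<bar>"
            using K[of t] by (auto simp: G_def indicator_def abs_mult intro!: mult_mono)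
        qed
        then show "norm (LINT q|lborel. norm (case (t, q) of (t, q) \<Rightarrow> G t q)) \<le>
            norm (indicat_real {a<..b} t * (\<bar>K\<bar> * ?C))"
          by (simp add: mult.assoc abs_mult)
      qed
    qed
    show "AE t in lborel. integrable lborel (\<lambda>q. case (t, q) of (t, q) \<Rightarrow> G t q)"
      using Gq by simp
  qed
  from lborel_pair.Fubini_integral[OF this]
  have fub: "(LINT q|lborel. LINT t|lborel. G t q) = (LINT t|lborel. LINT q|lborel. G t q)" .
  have "(LINT t|lebesgue_on {a<..b}. deriv \<eta> t * H t) =
      (LINT t|lebesgue. indicat_real {a<..b} t * (deriv \<eta> t * (LINT q|lborel. indicator {..t} q * h1 q)))"
  proof -
    have "indicat_real {a<..b} t * (deriv \<eta> t * H t) =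
        indicat_real {a<..b} t * (deriv \<eta> t * (LINT q|lborel. indicator {..t} q * h1 q))" for t
    proof (cases "t \<in> {a<..b}")
      case True
      then show ?thesis using HH[of t] by (simp only: greaterThanAtMost_iff)
    qed simp
    then have "(LINT t|lebesgue. indicat_real {a<..b} t * (deriv \<eta> t * H t)) =
        (LINT t|lebesgue. indicat_real {a<..b} t * (deriv \<eta> t * (LINT q|lborel. indicator {..t} q * h1 q)))"
      by presburger
    then show ?thesis by (subst integral_restrict_space) simp_all
  qed
  also have "\<dots> = (LINT t|lborel. indicat_real {a<..b} t * (deriv \<eta> t * (LINT q|lborel. indicator {..t} q * h1 q)))"
    using Hm dm by (intro integral_completion borel_measurable_times) auto
  also have "\<dots> = (LINT t|lborel. LINT q|lborel. G t q)"
    unfolding G_def by (simp add: mult.assoc)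
  also have "\<dots> = (LINT q|lborel. LINT t|lborel. G t q)" by (rule fub[symmetric])
  also have "\<dots> = (LINT q|lborel. - (\<eta> q * h1 q))"
  proof (rule integral_cong_AE)
    have "(\<lambda>(q, t). G t q) \<in> borel_measurable (lborel \<Otimes>\<^sub>M lborel)"
      using measurable_pair_swap[OF Gm] by (simp add: case_prod_unfold)
    then show "(\<lambda>q. LINT t|lborel. G t q) \<in> borel_measurable lborel"
      by (rule lborel.borel_measurable_lebesgue_integral)
    show "(\<lambda>q. - (\<eta> q * h1 q)) \<in> borel_measurable lborel"
      using h1m test_fun_borel_measurable[OF f] by auto
    show "AE q in lborel. (LINT t|lborel. G t q) = - (\<eta> q * h1 q)"
      using eq
    proof eventually_elim
      case (elim q)
      show ?case
      proof (cases "q \<in> {a<..b}")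
        case True
        have "indicat_real {a<..b} t * deriv \<eta> t * (indicat_real {..t} q * h1 q) =
            (indicat_real {q..b} t *\<^sub>R deriv \<eta> t) * h1 q" for t
          using True by (auto simp: indicator_def)
        then have "(LINT t|lborel. G t q) = (LINT t|lborel. indicat_real {q..b} t *\<^sub>R deriv \<eta> t) * h1 q"
          unfolding G_def by (simp only: integral_mult_left_zero)
        also have "(LINT t|lborel. indicat_real {q..b} t *\<^sub>R deriv \<eta> t) = \<eta> b - \<eta> q"
        proof (rule integral_FTC_atLeastAtMost)
          show "q \<le> b" using True by simp
          show "(\<eta> has_vector_derivative deriv \<eta> x) (at x within {q..b})" for x
            using test_fun_has_deriv(1)[OF f, of x]
            by (simp add: has_real_derivative_iff_has_vector_derivative has_vector_derivative_at_within)
          show "continuous_on {q..b} (deriv \<eta>)"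
            using test_fun_continuous[OF test_fun_has_deriv(2)[OF f]] by (rule continuous_on_subset) simp
        qed
        also have "\<eta> b = 0" using test_fun_eq_0[OF f] by simp
        finally show ?thesis by simp
      next
        case False
        then have "h1 q = 0" using elim by (simp add: h0_def)
        then show ?thesis by (simp add: G_def)
      qed
    qed
  qed
  also have "\<dots> = - (LINT q|lborel. \<eta> q * h1 q)" by simp
  also have "(LINT q|lborel. \<eta> q * h1 q) = (LINT q|lebesgue. \<eta> q * h1 q)"
    using h1m test_fun_borel_measurable[OF f] by (intro integral_completion[symmetric]) auto
  also have "\<dots> = (LINT q|lebesgue. \<eta> q * h0 q)"
  proof (rule integral_cong_AE)
    have "\<eta> \<in> borel_measurable lebesgue" using test_fun_borel_measurable[OF f] by (simp add: measurable_completion)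
    then show "(\<lambda>q. \<eta> q * h0 q) \<in> borel_measurable lebesgue" "(\<lambda>q. \<eta> q * h1 q) \<in> borel_measurable lebesgue"
      using borel_measurable_integrable[OF h0] h1m' by auto
  qed (use eq' in auto)
  also have "\<dots> = (LINT q|lebesgue_on {a<..b}. \<eta> q * h q)"
    by (simp add: integral_restrict_space h0_def mult_ac)
  finally show "(LINT t|lebesgue_on {a<..b}. deriv \<eta> t * H t) = - (LINT t|lebesgue_on {a<..b}. \<eta> t * h t)" .
qed

text \<open>The difference \<open>k\<close> of \<open>f\<close> and the indefinite integral is orthogonal to all derivatives of test
  functions. Every test function becomes such a derivative after subtraction of its integral times
  a fixed test function of integral 1, so \<open>k\<close> is constant.\<close>

theorem weak_derivative_imp_indefinite_integral:
  fixes f h :: "real \<Rightarrow> real"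
  assumes ab: "a < b" and f: "integrable (lebesgue_on {a<..b}) f" and h: "integrable (lebesgue_on {a<..b}) h"
    and weak: "\<And>\<eta>. \<eta> \<in> test_fun {a<..<b} \<Longrightarrow>
      (LINT t|lebesgue_on {a<..b}. deriv \<eta> t * f t) = - (LINT t|lebesgue_on {a<..b}. \<eta> t * h t)"
  obtains c where "AE t in lebesgue_on {a<..b}. f t = c + (LINT q|lebesgue_on {a<..t}. h q)"
proof -
  interpret finite_measure "lebesgue_on {a<..b}" by (rule finite_measure_Ioc)
  define H where "H t = (LINT q|lebesgue_on {a<..t}. h q)" for t
  define k where "k t = f t - H t" for t
  have tm: "\<eta> \<in> borel_measurable (lebesgue_on {a<..b})" if "\<eta> \<in> test_fun {a<..<b}" for \<eta> :: "real \<Rightarrow> real"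
    using test_fun_borel_measurable[OF that] by (rule borel_measurable_lebesgue_onI)
  have ti: "integrable (lebesgue_on {a<..b}) (\<lambda>t. \<eta> t * g t)"
    if e: "\<eta> \<in> test_fun {a<..<b}" and g: "integrable (lebesgue_on {a<..b}) g" for \<eta> g :: "real \<Rightarrow> real"
  proof -
    obtain K where "\<And>x. \<bar>\<eta> x\<bar> \<le> K" using test_fun_bounded[OF e] by blast
    then show ?thesis using integrable_mult_bounded[OF g tm[OF e]] by blast
  qed
  have z: "(\<lambda>t::real. 0) \<in> test_fun {a<..<b}"
    using test_fun_scale[of "box_bump a b 0" "{a<..<b}" 0] box_bump_test_fun[of a b "{a<..<b}" 0]
    by (simp add: box_real)
  note parts = test_fun_indefinite_integral_parts[OF ab h, folded H_def]
  have H: "integrable (lebesgue_on {a<..b}) H"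
  proof (rule integrable_const_bound)
    show "AE t in lebesgue_on {a<..b}. norm (H t) \<le> (LINT q|lebesgue_on {a<..b}. \<bar>h q\<bar>)"
      using parts(3)[OF z] by (intro AE_I2) (auto simp: H_def)
  qed (rule parts(2)[OF z])
  have k: "integrable (lebesgue_on {a<..b}) k" unfolding k_def using f H by simp
  have zero: "(LINT t|lebesgue_on {a<..b}. deriv \<eta> t * k t) = 0" if e: "\<eta> \<in> test_fun {a<..<b}" for \<eta>
  proof -
    have "(LINT t|lebesgue_on {a<..b}. deriv \<eta> t * k t) =
        (LINT t|lebesgue_on {a<..b}. deriv \<eta> t * f t) - (LINT t|lebesgue_on {a<..b}. deriv \<eta> t * H t)"
      unfolding k_def right_diff_distrib
      by (intro Bochner_Integration.integral_diff ti test_fun_has_deriv(2) e f H)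
    then show ?thesis using weak[OF e] parts(1)[OF e] by simp
  qed
  \<comment> \<open>Such a \<open>\<theta>\<close> exists, since otherwise all test functions would be orthogonal to the constant 1.\<close>
  obtain \<theta> where th: "\<theta> \<in> test_fun {a<..<b}" and th1: "(LINT t|lebesgue_on {a<..b}. \<theta> t) = 1"
  proof -
    have "\<not> (\<forall>\<phi>\<in>test_fun {a<..<b}. (LINT t|lebesgue_on {a<..<b}. 1 * \<phi> t) = 0)"
    proof
      assume A: "\<forall>\<phi>\<in>test_fun {a<..<b}. (LINT t|lebesgue_on {a<..<b}. 1 * \<phi> t) = 0"
      have "integrable (lebesgue_on {a<..<b}) (\<lambda>t. 1::real)"
        unfolding Ioc_eq_Ioo(2)[symmetric] by simp
      from AE_eq_0_if_orthogonal_to_test_fun[OF _ this] A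
      have "AE t in lebesgue_on {a<..<b}. (1::real) = 0" by auto
      then have "{a<..<b} \<in> null_sets lebesgue"
        by (simp add: AE_restrict_space_iff AE_iff_null_sets)
      then show False using ab by (simp add: null_sets_def emeasure_lborel_Ioo)
    qed
    then obtain \<phi> where p: "\<phi> \<in> test_fun {a<..<b}" "(LINT t|lebesgue_on {a<..b}. \<phi> t) \<noteq> 0"
      by (auto simp: Ioc_eq_Ioo)
    show ?thesis
      by (rule that[OF test_fun_scale[OF p(1), of "1 / (LINT t|lebesgue_on {a<..b}. \<phi> t)"]]) (use p in simp)
  qed
  define c where "c = (LINT t|lebesgue_on {a<..b}. \<theta> t * k t)"
  have "AE t in lebesgue_on {a<..<b}. k t - c = 0"
  proof (rule AE_eq_0_if_orthogonal_to_test_fun)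
    show "integrable (lebesgue_on {a<..<b}) (\<lambda>t. k t - c)"
      unfolding Ioc_eq_Ioo(2)[symmetric] using k by simp
    fix \<phi> assume p: "\<phi> \<in> test_fun {a<..<b}"
    define I where "I = (LINT t|lebesgue_on {a<..b}. \<phi> t)"
    define \<psi> where "\<psi> t = \<phi> t + (- I) * \<theta> t" for t
    have ps: "\<psi> \<in> test_fun {a<..<b}"
      unfolding \<psi>_def[abs_def] by (intro test_fun_add test_fun_scale p th)
    have pi: "integrable (lebesgue_on {a<..b}) \<phi>" "integrable (lebesgue_on {a<..b}) \<theta>"
      using ti[OF p, of "\<lambda>t. 1"] ti[OF th, of "\<lambda>t. 1"] by auto
    have "(LINT t|lebesgue_on {a<..b}. \<psi> t) = 0"
      unfolding \<psi>_def using pi th1 by (simp add: I_def)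
    from test_fun_antiderivative[OF ab ps this] obtain \<eta> where "\<eta> \<in> test_fun {a<..<b}" "deriv \<eta> = \<psi>"
      by blast
    with zero have "(LINT t|lebesgue_on {a<..b}. \<psi> t * k t) = 0" by auto
    moreover have "(LINT t|lebesgue_on {a<..b}. \<psi> t * k t) = (LINT t|lebesgue_on {a<..b}. \<phi> t * k t) - I * c"
      using ti[OF p k] ti[OF th k] by (simp add: \<psi>_def c_def distrib_right left_diff_distrib mult.assoc)
    moreover have "(LINT t|lebesgue_on {a<..b}. (k t - c) * \<phi> t) = (LINT t|lebesgue_on {a<..b}. \<phi> t * k t) - I * c"
    proof -
      have "(k t - c) * \<phi> t = \<phi> t * k t - c * \<phi> t" for t by (simp add: algebra_simps)
      then show ?thesis using ti[OF p k] pi by (simp add: I_def mult.commute)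
    qed
    ultimately show "(LINT t|lebesgue_on {a<..<b}. (k t - c) * \<phi> t) = 0" by (simp add: Ioc_eq_Ioo)
  qed simp
  then have "AE t in lebesgue_on {a<..b}. k t - c = 0" by (rule AE_Ioo_imp_Ioc)
  then have "AE t in lebesgue_on {a<..b}. f t = c + (LINT q|lebesgue_on {a<..t}. h q)"
    by eventually_elim (simp add: k_def H_def)
  then show ?thesis by (rule that)
qed

section \<open>A telescoping estimate\<close>

text \<open>A function cannot exceed its mean on a set of full measure.\<close>

lemma point_below_mean:
  fixes V :: "real \<Rightarrow> real"
  assumes cd: "c < d" and V: "integrable (lebesgue_on {c<..d}) V"
    and G: "AE t in lebesgue_on {c<..d}. t \<in> G"
  obtains x where "x \<in> G" "c < x" "x \<le> d" "(d - c) * V x \<le> (LINT t|lebesgue_on {c<..d}. V t)"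
proof (rule ccontr)
  interpret finite_measure "lebesgue_on {c<..d}" by (rule finite_measure_Ioc)
  let ?I = "LINT t|lebesgue_on {c<..d}. V t"
  have m: "measure (lebesgue_on {c<..d}) {c<..d} = d - c"
    using cd by (simp add: measure_restrict_space)
  assume "\<not> thesis"
  then have no: "\<And>x. x \<in> G \<Longrightarrow> c < x \<Longrightarrow> x \<le> d \<Longrightarrow> ?I / (d - c) < V x"
    using that cd by (force simp: field_simps)
  have "AE t in lebesgue_on {c<..d}. t \<in> {c<..d}" by (rule AE_I2) simp
  with G have "AE t in lebesgue_on {c<..d}. ?I / (d - c) < V t"
    by eventually_elim (use no in auto)
  then have "(LINT t|lebesgue_on {c<..d}. ?I / (d - c)) < ?I"
    using V cd by (intro integral_less_AE_space) (auto simp: emeasure_restrict_space)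
  then show False using m cd by simp
qed

text \<open>The interval is divided into cells of equal length \<open>l\<close>, and each cell contains a point \<open>p\<close> of \<open>G\<close>
  for which \<open>l V(p)\<close> is at most the integral of \<open>V\<close> over the cell. Points of neighbouring cells have
  distance at most \<open>2 l\<close>, so the sum of the bounds \<open>(q - p) (V p + V q)\<close> is controlled by the integral
  of \<open>V\<close>. The values \<open>V s\<close> and \<open>V t\<close> occur only with the factor \<open>l\<close>, which tends to 0.\<close>

lemma telescoping_estimate:
  fixes E V \<Psi> :: "real \<Rightarrow> real"
  assumes st: "s < t" "s \<in> G" "t \<in> G"
    and V: "integrable (lebesgue_on {s<..t}) V" and Vnn: "\<And>p. p \<in> G \<Longrightarrow> 0 \<le> V p"
    and G: "AE p in lebesgue_on {s<..t}. p \<in> G"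
    and step: "\<And>p q. p \<in> G \<Longrightarrow> q \<in> G \<Longrightarrow> s \<le> p \<Longrightarrow> p < q \<Longrightarrow> q \<le> t \<Longrightarrow>
      \<bar>E q - E p\<bar> \<le> \<Psi> q - \<Psi> p + (q - p) * (V p + V q)"
  shows "\<bar>E t - E s\<bar> \<le> \<Psi> t - \<Psi> s + 5 * (LINT p|lebesgue_on {s<..t}. V p)"
proof -
  let ?I = "LINT p|lebesgue_on {s<..t}. V p"
  have key: "\<bar>E t - E s\<bar> \<le> \<Psi> t - \<Psi> s + 5 * ?I + (V s + V t) * ((t - s) / real (Suc m))" for m
  proof -
    define n where "n = Suc m"
    define l where "l = (t - s) / real n"
    define c where "c k = s + real k * l" for k
    define J where "J k = (LINT p|lebesgue_on {s<..c k}. V p)" for k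
    have l: "l > 0" using st by (simp add: l_def n_def)
    have cn: "c n = t" by (simp add: c_def l_def n_def)
    have c0: "c 0 = s" by (simp add: c_def)
    have cS: "c (Suc k) = c k + l" for k by (simp add: c_def algebra_simps)
    have cmono: "k \<le> j \<Longrightarrow> c k \<le> c j" for k j using l by (simp add: c_def mult_right_mono)
    have cs: "s \<le> c k" for k using cmono[of 0 k] c0 by simp
    have ct: "k \<le> n \<Longrightarrow> c k \<le> t" for k using cmono[of k n] cn by simp
    have ex: "\<exists>x. x \<in> G \<and> c k < x \<and> x \<le> c (Suc k) \<and> l * V x \<le> J (Suc k) - J k" if k: "k < n" for k
    proof -
      have sub: "{c k<..c (Suc k)} \<subseteq> {s<..t}" using cs[of k] ct[of "Suc k"] k by auto
      have Vk: "integrable (lebesgue_on {c k<..c (Suc k)}) V"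
        by (rule integrable_lebesgue_on_subset[OF V sub]) auto
      have Gk: "AE p in lebesgue_on {c k<..c (Suc k)}. p \<in> G"
        by (rule AE_lebesgue_on_subset[OF G sub]) auto
      have "{s<..c (Suc k)} \<subseteq> {s<..t}" using ct[of "Suc k"] k by auto
      then have "integrable (lebesgue_on {s<..c (Suc k)}) V"
        by (rule integrable_lebesgue_on_subset[OF V]) auto
      then have "J (Suc k) = J k + (LINT p|lebesgue_on {c k<..c (Suc k)}. V p)"
        unfolding J_def using cs[of k] cmono[of k "Suc k"] by (intro LINT_Ioc_add) auto
      with point_below_mean[OF _ Vk Gk] l cS[of k] show ?thesis by (metis add.commute add_diff_cancel_left' less_add_same_cancel1)
    qed
    then obtain p where p: "\<And>k. k < n \<Longrightarrow> p k \<in> G \<and> c k < p k \<and> p k \<le> c (Suc k) \<and> l * V (p k) \<le> J (Suc k) - J k"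
      by metis
    have J0: "J 0 = 0" by (simp add: J_def c0)
    have Jn: "J n = ?I" by (simp add: J_def cn)
    \<comment> \<open>Every cell is used by at most two steps of length at most \<open>2 l\<close>, hence twice with factor 2.\<close>
    have ind: "k < n \<longrightarrow> \<bar>E (p k) - E s\<bar> \<le> \<Psi> (p k) - \<Psi> s + l * V s + 2 * J k + 2 * J (Suc k)" for k
    proof (induction k)
      case 0
      show ?case
      proof
        assume "0 < n"
        note p0 = p[OF this]
        have "\<bar>E (p 0) - E s\<bar> \<le> \<Psi> (p 0) - \<Psi> s + (p 0 - s) * (V s + V (p 0))"
          using p0 c0 ct[of 1] \<open>0 < n\<close> st by (intro step) auto
        moreover have "(p 0 - s) * (V s + V (p 0)) \<le> l * (V s + V (p 0))"
          using p0 c0 cS[of 0] Vnn[OF st(2)] Vnn[of "p 0"] by (intro mult_right_mono) auto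
        moreover have "l * (V s + V (p 0)) = l * V s + l * V (p 0)" by (simp add: distrib_left)
        moreover have "0 \<le> l * V (p 0)" using l Vnn[of "p 0"] p0 by simp
        ultimately show "\<bar>E (p 0) - E s\<bar> \<le> \<Psi> (p 0) - \<Psi> s + l * V s + 2 * J 0 + 2 * J (Suc 0)"
          using p0 J0 by linarith
      qed
    next
      case (Suc k)
      show ?case
      proof
        assume kn: "Suc k < n"
        note pk = p[of k] and pS = p[OF kn]
        have k: "k < n" using kn by simp
        have IH: "\<bar>E (p k) - E s\<bar> \<le> \<Psi> (p k) - \<Psi> s + l * V s + 2 * J k + 2 * J (Suc k)"
          using Suc k by simp
        have "\<bar>E (p (Suc k)) - E (p k)\<bar> \<le> \<Psi> (p (Suc k)) - \<Psi> (p k) + (p (Suc k) - p k) * (V (p k) + V (p (Suc k)))"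
          using pk[OF k] pS cs[of k] ct[of "Suc (Suc k)"] kn by (intro step) auto
        moreover have "(p (Suc k) - p k) * (V (p k) + V (p (Suc k))) \<le> (2 * l) * (V (p k) + V (p (Suc k)))"
          using pk[OF k] pS cS[of k] cS[of "Suc k"] Vnn[of "p k"] Vnn[of "p (Suc k)"]
          by (intro mult_right_mono) auto
        moreover have "(2 * l) * (V (p k) + V (p (Suc k))) = 2 * (l * V (p k)) + 2 * (l * V (p (Suc k)))"
          by (simp add: algebra_simps)
        moreover have "2 * (l * V (p k)) + 2 * (l * V (p (Suc k))) \<le> 2 * (J (Suc k) - J k) + 2 * (J (Suc (Suc k)) - J (Suc k))"
          using pk[OF k] pS by simp
        ultimately have "\<bar>E (p (Suc k)) - E (p k)\<bar> \<le> \<Psi> (p (Suc k)) - \<Psi> (p k) +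
            (2 * (J (Suc k) - J k) + 2 * (J (Suc (Suc k)) - J (Suc k)))"
          by (metis add_left_mono order_trans)
        then show "\<bar>E (p (Suc k)) - E s\<bar> \<le>
            \<Psi> (p (Suc k)) - \<Psi> s + l * V s + 2 * J (Suc k) + 2 * J (Suc (Suc k))"
          using IH by (simp add: algebra_simps abs_le_iff)
      qed
    qed
    have m: "m < n" by (simp add: n_def)
    note pm = p[OF m]
    have cSm: "c (Suc m) = t" using cn by (simp add: n_def)
    have nn: "0 \<le> l * V t" "0 \<le> l * V (p m)" using l Vnn[OF st(3)] Vnn[of "p m"] pm by auto
    have last: "\<bar>E t - E (p m)\<bar> \<le> \<Psi> t - \<Psi> (p m) + l * V t + (J (Suc m) - J m)"
    proof (cases "p m = t")
      case True
      then show ?thesis using nn pm by simp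
    next
      case False
      have "\<bar>E t - E (p m)\<bar> \<le> \<Psi> t - \<Psi> (p m) + (t - p m) * (V (p m) + V t)"
        using pm cSm False cs[of m] st by (intro step) auto
      moreover have "(t - p m) * (V (p m) + V t) \<le> l * (V (p m) + V t)"
        using pm cSm cS[of m] Vnn[OF st(3)] Vnn[of "p m"] by (intro mult_right_mono) auto
      moreover have "l * (V (p m) + V t) \<le> l * V t + (J (Suc m) - J m)" using pm by (simp add: distrib_left)
      ultimately show ?thesis by linarith
    qed
    have "J m \<le> J (Suc m)" using pm nn by linarith
    moreover have "0 \<le> J m"
    proof -
      have "AE p in lebesgue_on {s<..t}. 0 \<le> V p" using G by eventually_elim (rule Vnn)
      moreover have "{s<..c m} \<subseteq> {s<..t}" using ct[of m] m by auto
      ultimately have "AE p in lebesgue_on {s<..c m}. 0 \<le> V p"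
        by (rule AE_lebesgue_on_subset) simp_all
      then show ?thesis unfolding J_def by (rule integral_nonneg_AE)
    qed
    moreover have "J (Suc m) = ?I" using Jn by (simp add: n_def)
    ultimately have tot: "\<bar>E t - E s\<bar> \<le> \<Psi> t - \<Psi> s + 5 * ?I + (l * V s + l * V t)"
    proof -
      have "\<bar>E (p m) - E s\<bar> \<le> \<Psi> (p m) - \<Psi> s + l * V s + 2 * J m + 2 * J (Suc m)"
        using ind[of m] m by simp
      moreover have "\<bar>E t - E s\<bar> \<le> \<bar>E t - E (p m)\<bar> + \<bar>E (p m) - E s\<bar>" by linarith
      ultimately show ?thesis
        using last \<open>J m \<le> J (Suc m)\<close> \<open>0 \<le> J m\<close> \<open>J (Suc m) = ?I\<close> by linarith
    qed
    have "l * V s + l * V t = (V s + V t) * ((t - s) / real (Suc m))"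
      unfolding n_def[symmetric] l_def[symmetric] by (simp add: algebra_simps)
    with tot show ?thesis by simp
  qed
  have "(\<lambda>m. \<Psi> t - \<Psi> s + 5 * ?I + (V s + V t) * ((t - s) / real (Suc m))) \<longlonglongrightarrow>
      \<Psi> t - \<Psi> s + 5 * ?I + (V s + V t) * 0"
    by (intro tendsto_intros LIMSEQ_Suc[OF lim_const_over_n])
  then have "\<bar>E t - E s\<bar> \<le> \<Psi> t - \<Psi> s + 5 * ?I + (V s + V t) * 0"
    by (rule LIMSEQ_le_const) (use key in auto)
  then show ?thesis by simp
qed

lemma bounded_bilinear_on_mono:
  assumes B: "bounded_bilinear_on D N E M B" and sub: "D' \<subseteq> D" "E' \<subseteq> E"
    and N: "\<And>v. v \<in> D' \<Longrightarrow> 0 \<le> N v \<and> N v \<le> N' v" and M: "\<And>w. w \<in> E' \<Longrightarrow> 0 \<le> M w \<and> M w \<le> M' w"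
  shows "bounded_bilinear_on D' N' E' M' B"
proof -
  obtain C where C: "\<And>x y. x \<in> D \<Longrightarrow> y \<in> E \<Longrightarrow> \<bar>B x y\<bar> \<le> C * N x * M y"
    using B unfolding bounded_bilinear_on_def by blast
  have "\<bar>B x y\<bar> \<le> \<bar>C\<bar> * N' x * M' y" if "x \<in> D'" "y \<in> E'" for x y
  proof -
    have "\<bar>B x y\<bar> \<le> C * N x * M y" using C that sub by auto
    also have "\<dots> \<le> \<bar>C\<bar> * (N x * M y)"
      using N[OF that(1)] M[OF that(2)] by (simp add: mult.assoc mult_right_mono)
    also have "\<dots> \<le> \<bar>C\<bar> * (N' x * M' y)"
      using N[OF that(1)] M[OF that(2)] by (intro mult_left_mono mult_mono) auto
    finally show ?thesis by (simp add: mult.assoc)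
  qed
  then show ?thesis using B sub unfolding bounded_bilinear_on_def by blast
qed

lemma (in seminorm_space) dual_tendsto:
  assumes g: "g \<in> dual_space D N" and s: "\<And>n. s n \<in> D" and v: "v \<in> D" and lim: "(\<lambda>n. N (s n - v)) \<longlonglongrightarrow> 0"
  shows "(\<lambda>n. g (s n)) \<longlonglongrightarrow> g v"
proof (rule LIM_zero_cancel, rule Lim_null_comparison)
  show "\<forall>\<^sub>F n in sequentially. norm (g (s n) - g v) \<le> dual_norm D N g * N (s n - v)"
    using dual_norm_le[OF g diff_in[OF s v]] dual_diff[OF g s v] by (intro always_eventually) simp
  show "(\<lambda>n. dual_norm D N g * N (s n - v)) \<longlonglongrightarrow> 0"
    using tendsto_mult_left[OF lim, of "dual_norm D N g"] by simp
qed

lemma (in seminorm_space) dual_apply_integrable: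
  assumes S: "S \<in> lmeasurable" and g: "g \<in> bochner_L2 S (dual_space D N) (dual_norm D N)" and w: "w \<in> D"
  shows "integrable (lebesgue_on S) (\<lambda>t. g t w)"
proof -
  have "(\<lambda>t. 1 *\<^sub>R w) \<in> bochner_L2 S D N"
    by (rule bochner_scaled_const[OF S _ _ w, of _ 1]) auto
  from bochner_pairing_integrable[OF dual_seminorm_space seminorm_space_axioms _ g this dual_pairing_bounded_bilinear]
  show ?thesis using S by (auto simp: fmeasurable_def)
qed

lemma (in seminorm_space) bochner_norm_integrable:
  assumes S: "S \<in> lmeasurable" and v: "v \<in> bochner_L2 S D N"
  shows "integrable (lebesgue_on S) (\<lambda>t. N (v t))"
proof -
  interpret finite_measure "lebesgue_on S" by (rule finite_measure_lebesgue_on[OF S])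
  have S': "S \<in> sets lebesgue" using S by (auto simp: fmeasurable_def)
  show ?thesis
  proof (rule Bochner_Integration.integrable_bound)
    show "integrable (lebesgue_on S) (\<lambda>t. 1 + (N (v t))\<^sup>2)"
      using bochner_square_integrable[OF v] by simp
    show "(\<lambda>t. N (v t)) \<in> borel_measurable (lebesgue_on S)" by (rule bochner_norm_measurable'[OF S' v])
    have "\<bar>x\<bar> \<le> 1 + x\<^sup>2" for x :: real
      using sum_squares_bound[of 1 "\<bar>x\<bar>"] by auto
    then show "AE t in lebesgue_on S. norm (N (v t)) \<le> norm (1 + (N (v t))\<^sup>2)" by auto
  qed
qed

lemma (in seminorm_space) dual_integral_bound:
  assumes S: "S \<in> lmeasurable" and g: "g \<in> bochner_L2 S (dual_space D N) (dual_norm D N)" and w: "w \<in> D"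
  shows "\<bar>LINT t|lebesgue_on S. g t w\<bar> \<le> (LINT t|lebesgue_on S. dual_norm D N (g t) * N w)"
proof -
  interpret dual: seminorm_space "dual_space D N" "dual_norm D N" by (rule dual_seminorm_space)
  have "\<bar>LINT t|lebesgue_on S. g t w\<bar> \<le> (LINT t|lebesgue_on S. \<bar>g t w\<bar>)" by (rule integral_abs_bound)
  also have "\<dots> \<le> (LINT t|lebesgue_on S. dual_norm D N (g t) * N w)"
  proof (rule integral_mono_AE)
    show "integrable (lebesgue_on S) (\<lambda>t. \<bar>g t w\<bar>)" using dual_apply_integrable[OF assms] by simp
    show "integrable (lebesgue_on S) (\<lambda>t. dual_norm D N (g t) * N w)"
      using dual.bochner_norm_integrable[OF S g] by simp
    show "AE t in lebesgue_on S. \<bar>g t w\<bar> \<le> dual_norm D N (g t) * N w"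
      using dual.bochner_AE_in[OF g] by eventually_elim (rule dual_norm_le[OF _ w])
  qed
  finally show ?thesis .
qed

context bounded_domain
begin

abbreviation "H1_dt S \<equiv> bochner_L2 S (H10 A) (H1_norm A)"
abbreviation "Hm1_dt S \<equiv> bochner_L2 S (Hm1 A) (Hm1_norm A)"

lemma ip_bounded_bilinear_H10_L2: "bounded_bilinear_on (H10 A) (H1_norm A) (L2 A) (L2_norm A) (ip A)"
  by (rule bounded_bilinear_on_mono[OF ip_bounded_bilinear])
    (use H10_in_L2 L2_norm_le_H1_norm L2.nonneg in auto)

lemma ip_bounded_bilinear_H10: "bounded_bilinear_on (H10 A) (H1_norm A) (H10 A) (H1_norm A) (ip A)"
  by (rule bounded_bilinear_on_mono[OF ip_bounded_bilinear])
    (use H10_in_L2 L2_norm_le_H1_norm L2.nonneg in auto)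

lemma ip_in_Hm1: "c \<in> L2 A \<Longrightarrow> (\<lambda>w. ip A c w) \<in> Hm1 A"
proof (rule H10.dual_spaceI)
  assume c: "c \<in> L2 A"
  show "ip A c (v + s *\<^sub>R w) = ip A c v + s * ip A c w" if "v \<in> H10 A" "w \<in> H10 A" for v w s
    using that c ip_linear[of v w c s] by (simp add: ip_commute[of c] H10_in_L2)
  show "\<bar>ip A c v\<bar> \<le> L2_norm A c * H1_norm A v" if "v \<in> H10 A" for v
  proof -
    have "\<bar>ip A c v\<bar> \<le> L2_norm A c * L2_norm A v" using ip_Cauchy_Schwarz c that H10_in_L2 by blast
    also have "\<dots> \<le> L2_norm A c * H1_norm A v" using L2.nonneg[OF c] L2_norm_le_H1_norm by (intro mult_left_mono) auto
    finally show ?thesis .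
  qed
qed

lemma H1_dt_ip_integrable:
  assumes S: "S \<in> lmeasurable" and v: "v \<in> H1_dt S" and w: "w \<in> L2 A"
  shows "integrable (lebesgue_on S) (\<lambda>t. ip A (v t) w)"
proof -
  have "(\<lambda>t. 1 *\<^sub>R w) \<in> bochner_L2 S (L2 A) (L2_norm A)"
    by (rule L2.bochner_scaled_const[OF S _ _ w, of _ 1]) auto
  from bochner_pairing_integrable[OF H10.seminorm_space_axioms L2.seminorm_space_axioms _ v this ip_bounded_bilinear_H10_L2]
  show ?thesis using S by (auto simp: fmeasurable_def)
qed

lemma duality_integrable:
  assumes S: "S \<in> sets lebesgue" and g: "g \<in> Hm1_dt S" and v: "v \<in> H1_dt S"
  shows "integrable (lebesgue_on S) (\<lambda>t. g t (v t))"
  by (rule bochner_pairing_integrable[OF Hm1.seminorm_space_axioms H10.seminorm_space_axioms S g v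
      H10.dual_pairing_bounded_bilinear])

section \<open>Weak time derivatives\<close>

lemma is_weak_dt_in: "is_weak_dt A a b v g \<Longrightarrow> g \<in> Hm1_dt {a<..b}"
  by (simp add: is_weak_dt_def)

lemma is_weak_dt_identity: "is_weak_dt A a b v g \<Longrightarrow> \<eta> \<in> test_fun {a<..<b} \<Longrightarrow> w \<in> H10 A \<Longrightarrow>
    (LINT t|lebesgue_on {a<..b}. deriv \<eta> t * ip A (v t) w) = - (LINT t|lebesgue_on {a<..b}. \<eta> t * g t w)"
  by (simp add: is_weak_dt_def)

lemma integrable_test_fun_mult:
  fixes f :: "real \<Rightarrow> real"
  assumes e: "\<eta> \<in> test_fun B" and f: "integrable (lebesgue_on S) f"
  shows "integrable (lebesgue_on S) (\<lambda>t. \<eta> t * f t)"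
proof -
  obtain K where "\<And>x. \<bar>\<eta> x\<bar> \<le> K" using test_fun_bounded[OF e] by blast
  then show ?thesis
    using integrable_mult_bounded[OF f borel_measurable_lebesgue_onI[OF test_fun_borel_measurable[OF e]]] by blast
qed

text \<open>The fundamental lemma only gives equality almost everywhere for one element of \<open>H\<^sup>1\<^sub>0\<close> at a
  time. Strong measurability of the argument reduces it to countably many elements.\<close>

lemma is_weak_dt_unique:
  assumes g: "is_weak_dt A a b v g" and h: "is_weak_dt A a b v h" and f: "\<phi> \<in> H1_dt {a<..b}"
  shows "AE t in lebesgue_on {a<..b}. g t (\<phi> t) = h t (\<phi> t)"
proof -
  have gh: "AE t in lebesgue_on {a<..b}. g t w = h t w" if w: "w \<in> H10 A" for w
  proof -
    have gi: "integrable (lebesgue_on {a<..b}) (\<lambda>t. g t w)" "integrable (lebesgue_on {a<..b}) (\<lambda>t. h t w)"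
      using H10.dual_apply_integrable[OF _ is_weak_dt_in[OF g] w] H10.dual_apply_integrable[OF _ is_weak_dt_in[OF h] w]
      by auto
    have "AE t in lebesgue_on {a<..<b}. g t w - h t w = 0"
    proof (rule AE_eq_0_if_orthogonal_to_test_fun)
      show "integrable (lebesgue_on {a<..<b}) (\<lambda>t. g t w - h t w)"
        unfolding Ioc_eq_Ioo(2)[symmetric] using gi by simp
      fix \<eta> assume e: "\<eta> \<in> test_fun {a<..<b}"
      have "(LINT t|lebesgue_on {a<..b}. (g t w - h t w) * \<eta> t) =
          (LINT t|lebesgue_on {a<..b}. \<eta> t * g t w) - (LINT t|lebesgue_on {a<..b}. \<eta> t * h t w)"
      proof -
        have "(g t w - h t w) * \<eta> t = \<eta> t * g t w - \<eta> t * h t w" for t by (simp add: algebra_simps)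
        then show ?thesis
          using integrable_test_fun_mult[OF e gi(1)] integrable_test_fun_mult[OF e gi(2)] by simp
      qed
      also have "\<dots> = 0"
        using is_weak_dt_identity[OF g e w] is_weak_dt_identity[OF h e w] by simp
      finally show "(LINT t|lebesgue_on {a<..<b}. (g t w - h t w) * \<eta> t) = 0"
        by (simp add: Ioc_eq_Ioo)
    qed simp
    from AE_Ioo_imp_Ioc[OF this] show ?thesis by eventually_elim simp
  qed
  obtain W where W: "countable W" "W \<subseteq> H10 A"
    and sep: "AE t in lebesgue_on {a<..b}. \<phi> t \<in> H10 A \<and> (\<exists>s. (\<forall>n::nat. s n \<in> W) \<and> (\<lambda>n. H1_norm A (s n - \<phi> t)) \<longlonglongrightarrow> 0)"
    using H10.bochner_separable[OF f] by blast
  have "AE t in lebesgue_on {a<..b}. \<forall>w\<in>W. g t w = h t w"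
    using W gh by (subst AE_ball_countable) auto
  with sep Hm1.bochner_AE_in[OF is_weak_dt_in[OF g]] Hm1.bochner_AE_in[OF is_weak_dt_in[OF h]]
  show ?thesis
  proof eventually_elim
    case (elim t)
    then obtain s where s: "\<And>n::nat. s n \<in> W" "(\<lambda>n. H1_norm A (s n - \<phi> t)) \<longlonglongrightarrow> 0" by blast
    have sD: "\<And>n. s n \<in> H10 A" using s W by auto
    have "(\<lambda>n. g t (s n)) \<longlonglongrightarrow> g t (\<phi> t)" "(\<lambda>n. h t (s n)) \<longlonglongrightarrow> h t (\<phi> t)"
      by (rule H10.dual_tendsto[OF _ sD _ s(2)]; use elim in blast)+
    moreover have "(\<lambda>n. g t (s n)) = (\<lambda>n. h t (s n))" using elim s by auto
    ultimately show ?case using LIMSEQ_unique by metis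
  qed
qed

lemma is_weak_dt_comb:
  assumes v: "v \<in> H1_dt {a<..b}" "is_weak_dt A a b v g" and w: "w \<in> H1_dt {a<..b}" "is_weak_dt A a b w h"
  shows "is_weak_dt A a b (\<lambda>t. v t + s *\<^sub>R w t) (\<lambda>t. g t + s *\<^sub>R h t)"
  unfolding is_weak_dt_def
proof (intro conjI ballI)
  show "(\<lambda>t. g t + s *\<^sub>R h t) \<in> Hm1_dt {a<..b}"
    by (rule Hm1.bochner_comb[OF _ is_weak_dt_in[OF v(2)] is_weak_dt_in[OF w(2)]]) simp
  fix \<eta> y assume e: "\<eta> \<in> test_fun {a<..<b}" and y: "y \<in> H10 A"
  have i: "integrable (lebesgue_on {a<..b}) (\<lambda>t. g t y)" "integrable (lebesgue_on {a<..b}) (\<lambda>t. h t y)"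
    using H10.dual_apply_integrable[OF _ is_weak_dt_in[OF v(2)] y] H10.dual_apply_integrable[OF _ is_weak_dt_in[OF w(2)] y]
    by auto
  have j: "integrable (lebesgue_on {a<..b}) (\<lambda>t. ip A (v t) y)" "integrable (lebesgue_on {a<..b}) (\<lambda>t. ip A (w t) y)"
    by (intro H1_dt_ip_integrable Ioc_lmeasurable v w H10_in_L2 y)+
  have "(LINT t|lebesgue_on {a<..b}. deriv \<eta> t * ip A (v t + s *\<^sub>R w t) y) =
      (LINT t|lebesgue_on {a<..b}. deriv \<eta> t * ip A (v t) y + s * (deriv \<eta> t * ip A (w t) y))"
  proof (rule integral_cong_AE)
    have dm: "deriv \<eta> \<in> borel_measurable (lebesgue_on {a<..b})"
      by (rule borel_measurable_lebesgue_onI[OF test_fun_borel_measurable[OF test_fun_has_deriv(2)[OF e]]])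
    have "integrable (lebesgue_on {a<..b}) (\<lambda>t. ip A (v t + s *\<^sub>R w t) y)"
      by (intro H1_dt_ip_integrable Ioc_lmeasurable H10.bochner_comb Ioc_sets v w H10_in_L2 y)
    then show "(\<lambda>t. deriv \<eta> t * ip A (v t + s *\<^sub>R w t) y) \<in> borel_measurable (lebesgue_on {a<..b})"
      using dm by auto
    show "(\<lambda>t. deriv \<eta> t * ip A (v t) y + s * (deriv \<eta> t * ip A (w t) y)) \<in> borel_measurable (lebesgue_on {a<..b})"
      using dm j by auto
    show "AE t in lebesgue_on {a<..b}. deriv \<eta> t * ip A (v t + s *\<^sub>R w t) y =
        deriv \<eta> t * ip A (v t) y + s * (deriv \<eta> t * ip A (w t) y)"
      using H10.bochner_AE_in[OF v(1)] H10.bochner_AE_in[OF w(1)]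
      by eventually_elim (simp add: ip_linear H10_in_L2 y algebra_simps)
  qed
  also have "\<dots> = (LINT t|lebesgue_on {a<..b}. deriv \<eta> t * ip A (v t) y) + s * (LINT t|lebesgue_on {a<..b}. deriv \<eta> t * ip A (w t) y)"
    using integrable_test_fun_mult[OF test_fun_has_deriv(2)[OF e] j(1)]
      integrable_test_fun_mult[OF test_fun_has_deriv(2)[OF e] j(2)] by simp
  also have "\<dots> = - ((LINT t|lebesgue_on {a<..b}. \<eta> t * g t y) + s * (LINT t|lebesgue_on {a<..b}. \<eta> t * h t y))"
    using is_weak_dt_identity[OF v(2) e y] is_weak_dt_identity[OF w(2) e y] by simp
  also have "(LINT t|lebesgue_on {a<..b}. \<eta> t * g t y) + s * (LINT t|lebesgue_on {a<..b}. \<eta> t * h t y) =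
      (LINT t|lebesgue_on {a<..b}. \<eta> t * (g t + s *\<^sub>R h t) y)"
    using integrable_test_fun_mult[OF e i(1)] integrable_test_fun_mult[OF e i(2)]
    by (simp add: distrib_left mult.left_commute)
  finally show "(LINT t|lebesgue_on {a<..b}. deriv \<eta> t * ip A (v t + s *\<^sub>R w t) y) =
      - (LINT t|lebesgue_on {a<..b}. \<eta> t * (g t + s *\<^sub>R h t) y)" .
qed

lemma is_weak_dt_zero: "is_weak_dt A a b (\<lambda>t. 0) (\<lambda>t. 0)"
  unfolding is_weak_dt_def using Hm1.bochner_zero by (simp add: ip_def)

lemma is_weak_dt_sum:
  assumes "finite I" "\<And>i. i \<in> I \<Longrightarrow> v i \<in> H1_dt {a<..b} \<and> is_weak_dt A a b (v i) (g i)"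
  shows "(\<lambda>t. \<Sum>i\<in>I. v i t) \<in> H1_dt {a<..b} \<and> is_weak_dt A a b (\<lambda>t. \<Sum>i\<in>I. v i t) (\<lambda>t. \<Sum>i\<in>I. g i t)"
  using assms
proof (induction I rule: finite_induct)
  case empty
  then show ?case using H10.bochner_zero is_weak_dt_zero by (simp only: sum.empty simp_thms)
next
  case (insert i I)
  have IH: "(\<lambda>t. \<Sum>i\<in>I. v i t) \<in> H1_dt {a<..b}"
    "is_weak_dt A a b (\<lambda>t. \<Sum>i\<in>I. v i t) (\<lambda>t. \<Sum>i\<in>I. g i t)" using insert by auto
  have vi: "v i \<in> H1_dt {a<..b}" "is_weak_dt A a b (v i) (g i)" using insert by auto
  show ?case
    using is_weak_dt_comb[OF vi IH, of 1] H10.bochner_add[OF Ioc_sets vi(1) IH(1)]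
    by (simp only: sum.insert[OF insert(1,2)] scaleR_one simp_thms)
qed

lemma is_weak_dt_cong:
  assumes eq: "\<And>t x. a < t \<Longrightarrow> t \<le> b \<Longrightarrow> x \<in> A \<Longrightarrow> v t x = w t x" and v: "is_weak_dt A a b v g"
  shows "is_weak_dt A a b w g"
proof -
  have "ip A (w t) y = ip A (v t) y" if "a < t" "t \<le> b" for t y
    unfolding ip_def using eq[OF that] by (intro Bochner_Integration.integral_cong) auto
  then have "(LINT t|lebesgue_on {a<..b}. deriv \<eta> t * ip A (w t) y) =
      (LINT t|lebesgue_on {a<..b}. deriv \<eta> t * ip A (v t) y)" for \<eta> y
    by (intro Bochner_Integration.integral_cong) auto
  then show ?thesis using v by (simp add: is_weak_dt_def)
qed

lemma LINT_supported_in_subinterval: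
  fixes f :: "real \<Rightarrow> real"
  assumes "a \<le> c" "d \<le> b" "\<And>t. t \<notin> {c<..<d} \<Longrightarrow> f t = 0"
  shows "(LINT t|lebesgue_on {a<..b}. f t) = (LINT t|lebesgue_on {c<..d}. f t)"
proof -
  have "indicat_real {a<..b} t * f t = indicat_real {c<..d} t * f t" for t
    using assms(1,2) assms(3)[of t] by (cases "t \<in> {c<..<d}") auto
  then have "(LINT t|lebesgue. indicat_real {a<..b} t * f t) = (LINT t|lebesgue. indicat_real {c<..d} t * f t)"
    by presburger
  then show ?thesis by (simp add: integral_restrict_space)
qed

lemma is_weak_dt_subinterval:
  assumes v: "is_weak_dt A a b v g" and cd: "a \<le> c" "d \<le> b"
  shows "is_weak_dt A c d v g"
  unfolding is_weak_dt_def
proof (intro conjI ballI)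
  show "g \<in> Hm1_dt {c<..d}"
    by (rule Hm1.bochner_subset[OF is_weak_dt_in[OF v]]) (use cd in auto)
  fix \<eta> y assume e: "\<eta> \<in> test_fun {c<..<d}" and y: "y \<in> H10 A"
  have e': "\<eta> \<in> test_fun {a<..<b}" using cd by (intro test_fun_mono[OF _ e]) auto
  have "(LINT t|lebesgue_on {c<..d}. deriv \<eta> t * ip A (v t) y) = (LINT t|lebesgue_on {a<..b}. deriv \<eta> t * ip A (v t) y)"
    using test_fun_eq_0[OF test_fun_has_deriv(2)[OF e]]
    by (intro LINT_supported_in_subinterval[symmetric] cd) simp
  also have "\<dots> = - (LINT t|lebesgue_on {a<..b}. \<eta> t * g t y)" by (rule is_weak_dt_identity[OF v e' y])
  also have "(LINT t|lebesgue_on {a<..b}. \<eta> t * g t y) = (LINT t|lebesgue_on {c<..d}. \<eta> t * g t y)"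
    using test_fun_eq_0[OF e] by (intro LINT_supported_in_subinterval cd) simp
  finally show "(LINT t|lebesgue_on {c<..d}. deriv \<eta> t * ip A (v t) y) = - (LINT t|lebesgue_on {c<..d}. \<eta> t * g t y)" .
qed

lemma is_weak_dt_scaled_const:
  fixes \<kappa> h :: "real \<Rightarrow> real"
  assumes ab: "a \<le> b" and c: "c \<in> L2 A" and cont: "continuous_on {a..b} \<kappa>" and fin: "finite S"
    and der: "\<And>t. a < t \<Longrightarrow> t < b \<Longrightarrow> t \<notin> S \<Longrightarrow> (\<kappa> has_real_derivative h t) (at t)"
    and hm: "h \<in> borel_measurable (lebesgue_on {a<..b})" and hb: "\<And>t. a < t \<Longrightarrow> t \<le> b \<Longrightarrow> \<bar>h t\<bar> \<le> K"
  shows "is_weak_dt A a b (\<lambda>t. \<kappa> t *\<^sub>R c) (\<lambda>t. h t *\<^sub>R (\<lambda>w. ip A c w))"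
  unfolding is_weak_dt_def
proof (intro conjI ballI)
  interpret time: finite_measure "lebesgue_on {a<..b}" by (rule finite_measure_Ioc)
  show "(\<lambda>t. h t *\<^sub>R (\<lambda>w. ip A c w)) \<in> Hm1_dt {a<..b}"
    by (rule Hm1.bochner_scaled_const[OF Ioc_lmeasurable hm _ ip_in_Hm1[OF c], of K]) (use hb in auto)
  fix \<eta> y assume e: "\<eta> \<in> test_fun {a<..<b}" and y: "y \<in> H10 A"
  have hi: "integrable (lebesgue_on {a<..b}) h"
    by (rule time.integrable_const_bound[of _ K]) (use hm hb in auto)
  have xi: "integrable (lebesgue_on {a<..b}) \<kappa>"
  proof -
    have "set_integrable lebesgue {a..b} \<kappa>"
      using absolutely_integrable_continuous_real[OF cont] .
    then have "set_integrable lebesgue {a<..b} \<kappa>" by (rule set_integrable_subset) auto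
    then show ?thesis by (simp add: integrable_on_eq_set)
  qed
  have i1: "integrable (lebesgue_on {a<..b}) (\<lambda>t. deriv \<eta> t * \<kappa> t)"
    by (rule integrable_test_fun_mult[OF test_fun_has_deriv(2)[OF e] xi])
  have i2: "integrable (lebesgue_on {a<..b}) (\<lambda>t. \<eta> t * h t)"
    by (rule integrable_test_fun_mult[OF e hi])
  have "(LINT t|lebesgue_on {a<..b}. deriv \<eta> t * \<kappa> t + \<eta> t * h t) = \<eta> b * \<kappa> b - \<eta> a * \<kappa> a"
  proof (rule LINT_Ioc_FTC[OF ab fin])
    show "continuous_on {a..b} (\<lambda>t. \<eta> t * \<kappa> t)"
      using test_fun_continuous[OF e] cont by (intro continuous_on_mult) (auto intro: continuous_on_subset)
    show "((\<lambda>t. \<eta> t * \<kappa> t) has_real_derivative deriv \<eta> t * \<kappa> t + \<eta> t * h t) (at t)"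
      if "a < t" "t < b" "t \<notin> S" for t
      using test_fun_has_deriv(1)[OF e, of t] der[OF that]
      by (auto intro!: derivative_eq_intros simp: mult.commute)
    show "integrable (lebesgue_on {a<..b}) (\<lambda>t. deriv \<eta> t * \<kappa> t + \<eta> t * h t)"
      using i1 i2 by simp
  qed
  also have "\<dots> = 0" using test_fun_eq_0[OF e] by simp
  finally have z: "(LINT t|lebesgue_on {a<..b}. deriv \<eta> t * \<kappa> t) = - (LINT t|lebesgue_on {a<..b}. \<eta> t * h t)"
    using i1 i2 by simp
  have ips: "ip A (\<kappa> t *\<^sub>R c) y = \<kappa> t * ip A c y" for t
    by (simp add: ip_def mult.assoc)
  have "(LINT t|lebesgue_on {a<..b}. deriv \<eta> t * ip A (\<kappa> t *\<^sub>R c) y) =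
      (LINT t|lebesgue_on {a<..b}. deriv \<eta> t * \<kappa> t) * ip A c y"
    by (simp add: ips mult.assoc[symmetric])
  also have "\<dots> = - (LINT t|lebesgue_on {a<..b}. \<eta> t * (h t *\<^sub>R (\<lambda>w. ip A c w)) y)"
    unfolding z by (simp add: mult.assoc[symmetric])
  finally show "(LINT t|lebesgue_on {a<..b}. deriv \<eta> t * ip A (\<kappa> t *\<^sub>R c) y) =
      - (LINT t|lebesgue_on {a<..b}. \<eta> t * (h t *\<^sub>R (\<lambda>w. ip A c w)) y)" .
qed

section \<open>Traces in time of functions with a weak derivative\<close>

text \<open>For fixed \<open>w\<close> the function \<open>t \<mapsto> ip A (u t) w\<close> is an indefinite integral outside a null set that
  depends on \<open>w\<close>. Countably many \<open>w\<close> that approximate almost all values of \<open>u\<close> have a common null set,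
  and the identity extends to the limits \<open>w = u r\<close>.\<close>

lemma weak_dt_good_set:
  assumes ab: "a < b" and u: "u \<in> H1_dt {a<..b}" and g: "is_weak_dt A a b u g"
  obtains G where "AE t in lebesgue_on {a<..b}. t \<in> G" "\<And>t. t \<in> G \<Longrightarrow> a < t \<and> t \<le> b \<and> u t \<in> H10 A"
    "\<And>r s t. r \<in> G \<Longrightarrow> s \<in> G \<Longrightarrow> t \<in> G \<Longrightarrow> s < t \<Longrightarrow>
       ip A (u t - u s) (u r) = (LINT q|lebesgue_on {s<..t}. g q (u r))"
proof -
  obtain W where W: "countable W" "W \<subseteq> H10 A"
    and sep: "AE t in lebesgue_on {a<..b}. u t \<in> H10 A \<and> (\<exists>s. (\<forall>n::nat. s n \<in> W) \<and> (\<lambda>n. H1_norm A (s n - u t)) \<longlonglongrightarrow> 0)"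
    using H10.bochner_separable[OF u] by blast
  have "\<exists>c. AE t in lebesgue_on {a<..b}. ip A (u t) w = c + (LINT q|lebesgue_on {a<..t}. g q w)" if w: "w \<in> W" for w
  proof -
    have wH: "w \<in> H10 A" using w W by auto
    show ?thesis
      by (rule weak_derivative_imp_indefinite_integral[OF ab
            H1_dt_ip_integrable[OF Ioc_lmeasurable u H10_in_L2[OF wH]]
            H10.dual_apply_integrable[OF Ioc_lmeasurable is_weak_dt_in[OF g] wH]
            is_weak_dt_identity[OF g _ wH]]) blast+
  qed
  then have "\<forall>w\<in>W. \<exists>c. AE t in lebesgue_on {a<..b}. ip A (u t) w = c + (LINT q|lebesgue_on {a<..t}. g q w)"
    by blast
  from bchoice[OF this] obtain c
    where c: "\<forall>w\<in>W. AE t in lebesgue_on {a<..b}. ip A (u t) w = c w + (LINT q|lebesgue_on {a<..t}. g q w)" ..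
  define G where "G = {t. a < t \<and> t \<le> b \<and> u t \<in> H10 A \<and>
      (\<exists>s. (\<forall>n::nat. s n \<in> W) \<and> (\<lambda>n. H1_norm A (s n - u t)) \<longlonglongrightarrow> 0) \<and>
      (\<forall>w\<in>W. ip A (u t) w = c w + (LINT q|lebesgue_on {a<..t}. g q w))}"
  have "AE t in lebesgue_on {a<..b}. \<forall>w\<in>W. ip A (u t) w = c w + (LINT q|lebesgue_on {a<..t}. g q w)"
    using c by (subst AE_ball_countable[OF W(1)])
  moreover have "AE t in lebesgue_on {a<..b}. t \<in> {a<..b}" by (rule AE_I2) simp
  ultimately have "AE t in lebesgue_on {a<..b}. t \<in> G"
    using sep by eventually_elim (auto simp: G_def)
  moreover have "a < t \<and> t \<le> b \<and> u t \<in> H10 A" if "t \<in> G" for t using that by (simp add: G_def)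
  moreover have "ip A (u t - u s) (u r) = (LINT q|lebesgue_on {s<..t}. g q (u r))"
    if r: "r \<in> G" and s: "s \<in> G" and t: "t \<in> G" and st: "s < t" for r s t
  proof -
    obtain x where x: "\<And>n::nat. x n \<in> W" "(\<lambda>n. H1_norm A (x n - u r)) \<longlonglongrightarrow> 0"
      using r by (auto simp: G_def)
    have xD: "x n \<in> H10 A" for n using x W by auto
    have urH: "u r \<in> H10 A" "u s \<in> H10 A" "u t \<in> H10 A" using r s t by (auto simp: G_def)
    have utsL: "u t - u s \<in> L2 A" using urH by (intro L2.diff_in H10_in_L2)
    have gst: "g \<in> Hm1_dt {s<..t}"
      by (rule Hm1.bochner_subset[OF is_weak_dt_in[OF g]]) (use s t in \<open>auto simp: G_def\<close>)
    have gat: "g \<in> Hm1_dt {a<..t}"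
      by (rule Hm1.bochner_subset[OF is_weak_dt_in[OF g]]) (use s t in \<open>auto simp: G_def\<close>)
    have eq: "ip A (u t - u s) (x n) = (LINT q|lebesgue_on {s<..t}. g q (x n))" for n
    proof -
      have "ip A (u t - u s) (x n) = ip A (u t) (x n) - ip A (u s) (x n)"
        using ip_linear[of "u t" "u s" "x n" "-1"] urH xD by (simp add: H10_in_L2)
      also have "\<dots> = (LINT q|lebesgue_on {a<..t}. g q (x n)) - (LINT q|lebesgue_on {a<..s}. g q (x n))"
        using s t x by (simp add: G_def)
      also have "\<dots> = (LINT q|lebesgue_on {s<..t}. g q (x n))"
        using LINT_Ioc_add[of a s t, OF _ _ H10.dual_apply_integrable[OF Ioc_lmeasurable gat xD[of n]]] s st
        by (simp add: G_def)
      finally show ?thesis .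
    qed
    have "(\<lambda>n. ip A (u t - u s) (x n)) \<longlonglongrightarrow> ip A (u t - u s) (u r)"
      by (rule H10.dual_tendsto[OF ip_in_Hm1[OF utsL] xD urH(1) x(2)])
    moreover have "(\<lambda>n. LINT q|lebesgue_on {s<..t}. g q (x n)) \<longlonglongrightarrow> (LINT q|lebesgue_on {s<..t}. g q (u r))"
    proof (rule LIM_zero_cancel, rule Lim_null_comparison)
      let ?C = "LINT q|lebesgue_on {s<..t}. Hm1_norm A (g q)"
      have "norm ((LINT q|lebesgue_on {s<..t}. g q (x n)) - (LINT q|lebesgue_on {s<..t}. g q (u r))) \<le>
          ?C * H1_norm A (x n - u r)" for n
      proof -
        note i = H10.dual_apply_integrable[OF Ioc_lmeasurable gst]
        have "(LINT q|lebesgue_on {s<..t}. g q (x n)) - (LINT q|lebesgue_on {s<..t}. g q (u r)) =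
            (LINT q|lebesgue_on {s<..t}. g q (x n) - g q (u r))"
          by (rule Bochner_Integration.integral_diff[symmetric]) (intro i xD urH)+
        also have "\<dots> = (LINT q|lebesgue_on {s<..t}. g q (x n - u r))"
        proof (rule integral_cong_AE)
          show "AE q in lebesgue_on {s<..t}. g q (x n) - g q (u r) = g q (x n - u r)"
            using Hm1.bochner_AE_in[OF gst] by eventually_elim (simp add: H10.dual_diff xD urH)
          show "(\<lambda>q. g q (x n) - g q (u r)) \<in> borel_measurable (lebesgue_on {s<..t})"
            using i[OF xD[of n]] i[OF urH(1)] by auto
          show "(\<lambda>q. g q (x n - u r)) \<in> borel_measurable (lebesgue_on {s<..t})"
            using i[OF H10.diff_in[OF xD[of n] urH(1)]] by auto
        qed
        finally show ?thesis
          using H10.dual_integral_bound[OF Ioc_lmeasurable gst H10.diff_in[OF xD[of n] urH(1)]] by simp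
      qed
      then show "\<forall>\<^sub>F n in sequentially. norm ((LINT q|lebesgue_on {s<..t}. g q (x n)) -
          (LINT q|lebesgue_on {s<..t}. g q (u r))) \<le> ?C * H1_norm A (x n - u r)" by simp
      show "(\<lambda>n. ?C * H1_norm A (x n - u r)) \<longlonglongrightarrow> 0"
        using tendsto_mult_left[OF x(2), of ?C] by simp
    qed
    ultimately show ?thesis unfolding eq by (rule LIMSEQ_unique)
  qed
  ultimately show ?thesis by (rule that)
qed

text \<open>The function \<open>E q = (L2_norm A (u q - u s))\<^sup>2\<close> has the increments
  \<open>ip A (u q - u p) ((u p - u s) + (u q - u s))\<close>, which are integrals of the weak derivative, so the
  telescoping estimate applies with \<open>V q = (H1_norm A (u q - u s))\<^sup>2\<close>. The base point \<open>s\<close> is chosen such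
  that the norm of \<open>u s\<close> is bounded by a mean over \<open>(c,d]\<close>.\<close>

lemma weak_dt_oscillation:
  assumes ab: "a < b" and u: "u \<in> H1_dt {a<..b}" and gH: "g \<in> Hm1_dt {a<..b}"
    and G: "AE t in lebesgue_on {a<..b}. t \<in> G" "\<And>t. t \<in> G \<Longrightarrow> a < t \<and> t \<le> b \<and> u t \<in> H10 A"
    and Geq: "\<And>r s t. r \<in> G \<Longrightarrow> s \<in> G \<Longrightarrow> t \<in> G \<Longrightarrow> s < t \<Longrightarrow>
       ip A (u t - u s) (u r) = (LINT q|lebesgue_on {s<..t}. g q (u r))"
    and cd: "a \<le> c" "c < d" "d \<le> b"
  obtains s where "s \<in> G" "c < s" "s \<le> d"
    "\<And>t. t \<in> G \<Longrightarrow> c < t \<Longrightarrow> t \<le> d \<Longrightarrow>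
       (L2_norm A (u t - u s))\<^sup>2 \<le> 20 * (LINT q|lebesgue_on {c<..d}. (Hm1_norm A (g q))\<^sup>2 + (H1_norm A (u q))\<^sup>2)"
proof -
  have sub: "{c<..d} \<subseteq> {a<..b}" using cd by auto
  have ucd: "u \<in> H1_dt {c<..d}" by (rule H10.bochner_subset[OF u sub]) auto
  have gcd: "g \<in> Hm1_dt {c<..d}" by (rule Hm1.bochner_subset[OF gH sub]) auto
  have Gcd: "AE t in lebesgue_on {c<..d}. t \<in> G" by (rule AE_lebesgue_on_subset[OF G(1) sub]) auto
  note ui = H10.bochner_square_integrable[OF ucd] and gi = Hm1.bochner_square_integrable[OF gcd]
  let ?U = "LINT q|lebesgue_on {c<..d}. (H1_norm A (u q))\<^sup>2"
  let ?P = "LINT q|lebesgue_on {c<..d}. (Hm1_norm A (g q))\<^sup>2"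
  obtain s where s: "s \<in> G" "c < s" "s \<le> d" and sU: "(d - c) * (H1_norm A (u s))\<^sup>2 \<le> ?U"
    using point_below_mean[OF cd(2) ui Gcd] by blast
  have P0: "0 \<le> ?P" and U0: "0 \<le> ?U" by simp_all
  define V where "V q = (H1_norm A (u q - u s))\<^sup>2" for q
  define E where "E q = (L2_norm A (u q - u s))\<^sup>2" for q
  define \<Psi> where "\<Psi> t = (LINT q|lebesgue_on {a<..t}. (Hm1_norm A (g q))\<^sup>2) / 2" for t
  have usH: "u s \<in> H10 A" using G s by auto
  have usb: "(\<lambda>q. 1 *\<^sub>R u s) \<in> H1_dt {c<..d}"
    by (rule H10.bochner_scaled_const[OF Ioc_lmeasurable _ _ usH, where K = 1]) auto
  have "(\<lambda>q. u q + (-1) *\<^sub>R (1 *\<^sub>R u s)) \<in> H1_dt {c<..d}" by (rule H10.bochner_comb[OF Ioc_sets ucd usb])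
  then have Vi: "integrable (lebesgue_on {c<..d}) V"
    using H10.bochner_square_integrable by (simp add: V_def[abs_def])
  have VU: "(LINT q|lebesgue_on {c<..d}. V q) \<le> 4 * ?U"
  proof -
    have m: "measure (lebesgue_on {c<..d}) {c<..d} = d - c" using cd by (simp add: measure_restrict_space)
    interpret time: finite_measure "lebesgue_on {c<..d}" by (rule finite_measure_Ioc)
    have "(LINT q|lebesgue_on {c<..d}. V q) \<le> (LINT q|lebesgue_on {c<..d}. 2 * (H1_norm A (u q))\<^sup>2 + 2 * (H1_norm A (u s))\<^sup>2)"
    proof (rule integral_mono_AE[OF Vi])
      show "integrable (lebesgue_on {c<..d}) (\<lambda>q. 2 * (H1_norm A (u q))\<^sup>2 + 2 * (H1_norm A (u s))\<^sup>2)"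
        using ui by simp
      show "AE q in lebesgue_on {c<..d}. V q \<le> 2 * (H1_norm A (u q))\<^sup>2 + 2 * (H1_norm A (u s))\<^sup>2"
        using Gcd by eventually_elim (use G usH H10.square_triangle_diff in \<open>auto simp: V_def\<close>)
    qed
    also have "\<dots> = 2 * ?U + 2 * ((d - c) * (H1_norm A (u s))\<^sup>2)" using ui m by simp
    finally show ?thesis using sU by simp
  qed
  have step: "\<bar>E q - E p\<bar> \<le> \<Psi> q - \<Psi> p + (q - p) * (V p + V q)"
    if p: "p \<in> G" and q: "q \<in> G" and pq: "p < q" for p q
  proof -
    have pqb: "a < p" "q \<le> b" "u p \<in> H10 A" "u q \<in> H10 A" using G p q by auto
    let ?x = "(u p - u s) + (u q - u s)"
    have xp: "u p - u s \<in> H10 A" "u q - u s \<in> H10 A" using pqb usH by (auto intro: H10.diff_in)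
    have xH: "?x \<in> H10 A" using xp by (rule H10.add_in)
    have subpq: "{p<..q} \<subseteq> {a<..b}" using pqb by auto
    have gpq: "g \<in> Hm1_dt {p<..q}" by (rule Hm1.bochner_subset[OF gH subpq]) auto
    note i = H10.dual_apply_integrable[OF Ioc_lmeasurable gpq]
    interpret time: finite_measure "lebesgue_on {p<..q}" by (rule finite_measure_Ioc)
    have m: "measure (lebesgue_on {p<..q}) {p<..q} = q - p" using pq by (simp add: measure_restrict_space)
    note L = pqb(3)[THEN H10_in_L2] pqb(4)[THEN H10_in_L2] usH[THEN H10_in_L2]
    have lin: "ip A (v + w) y = ip A v y + ip A w y" "ip A (v - w) y = ip A v y - ip A w y"
      if "v \<in> L2 A" "w \<in> L2 A" "y \<in> L2 A" for v w y
      using ip_linear[OF that, of 1] ip_linear[OF that, of "-1"] by auto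
    have lin2: "ip A y (v - w) = ip A y v - ip A y w"
      if "v \<in> L2 A" "w \<in> L2 A" "y \<in> L2 A" for v w y
      using lin(2)[OF that] by (simp add: ip_commute[of y])
    have "E q - E p = ip A (u q - u s) (u q - u s) - ip A (u p - u s) (u p - u s)"
      using L by (simp add: E_def L2_norm_square L2.diff_in)
    also have "\<dots> = ip A (u q - u p) (u p) - ip A (u q - u p) (u s) + (ip A (u q - u p) (u q) - ip A (u q - u p) (u s))"
      using L ip_commute[of "u p" "u q"] ip_commute[of "u s" "u q"] ip_commute[of "u s" "u p"]
      by (simp add: lin lin2 L2.diff_in)
    also have "\<dots> = (LINT r|lebesgue_on {p<..q}. g r (u p)) - (LINT r|lebesgue_on {p<..q}. g r (u s)) +
        ((LINT r|lebesgue_on {p<..q}. g r (u q)) - (LINT r|lebesgue_on {p<..q}. g r (u s)))"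
      using Geq[OF p p q pq] Geq[OF s(1) p q pq] Geq[OF q p q pq] by simp
    also have "\<dots> = (LINT r|lebesgue_on {p<..q}. (g r (u p) - g r (u s)) + (g r (u q) - g r (u s)))"
      using i[OF pqb(3)] i[OF pqb(4)] i[OF usH] by simp
    also have "\<dots> = (LINT r|lebesgue_on {p<..q}. g r ?x)"
    proof (rule integral_cong_AE)
      show "AE r in lebesgue_on {p<..q}. (g r (u p) - g r (u s)) + (g r (u q) - g r (u s)) = g r ?x"
        using Hm1.bochner_AE_in[OF gpq]
        by eventually_elim (simp only: H10.dual_add[OF _ xp] H10.dual_diff[OF _ pqb(3) usH] H10.dual_diff[OF _ pqb(4) usH])
      show "(\<lambda>r. (g r (u p) - g r (u s)) + (g r (u q) - g r (u s))) \<in> borel_measurable (lebesgue_on {p<..q})"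
        using i[OF pqb(3)] i[OF pqb(4)] i[OF usH] by auto
      show "(\<lambda>r. g r ?x) \<in> borel_measurable (lebesgue_on {p<..q})" using i[OF xH] by auto
    qed
    finally have "\<bar>E q - E p\<bar> \<le> (LINT r|lebesgue_on {p<..q}. Hm1_norm A (g r) * H1_norm A ?x)"
      using H10.dual_integral_bound[OF Ioc_lmeasurable gpq xH] by simp
    also have "\<dots> \<le> (LINT r|lebesgue_on {p<..q}. (Hm1_norm A (g r))\<^sup>2 / 2 + (V p + V q))"
    proof (rule integral_mono)
      show "integrable (lebesgue_on {p<..q}) (\<lambda>r. Hm1_norm A (g r) * H1_norm A ?x)"
        using Hm1.bochner_norm_integrable[OF Ioc_lmeasurable gpq] by simp
      show "integrable (lebesgue_on {p<..q}) (\<lambda>r. (Hm1_norm A (g r))\<^sup>2 / 2 + (V p + V q))"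
        using Hm1.bochner_square_integrable[OF gpq] by simp
      fix r
      have "2 * (Hm1_norm A (g r) * H1_norm A ?x) \<le> (Hm1_norm A (g r))\<^sup>2 + (H1_norm A ?x)\<^sup>2"
        using sum_squares_bound[of "Hm1_norm A (g r)" "H1_norm A ?x"] by (simp add: mult.assoc)
      also have "(H1_norm A ?x)\<^sup>2 \<le> 2 * V p + 2 * V q"
        using H10.square_triangle[OF xp] by (simp add: V_def)
      finally show "Hm1_norm A (g r) * H1_norm A ?x \<le> (Hm1_norm A (g r))\<^sup>2 / 2 + (V p + V q)" by simp
    qed
    also have "\<dots> = (LINT r|lebesgue_on {p<..q}. (Hm1_norm A (g r))\<^sup>2) / 2 + (q - p) * (V p + V q)"
      using Hm1.bochner_square_integrable[OF gpq] m by simp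
    also have "(LINT r|lebesgue_on {p<..q}. (Hm1_norm A (g r))\<^sup>2) / 2 = \<Psi> q - \<Psi> p"
    proof -
      have "g \<in> Hm1_dt {a<..q}" by (rule Hm1.bochner_subset[OF gH]) (use pqb in auto)
      from LINT_Ioc_add[OF _ _ Hm1.bochner_square_integrable[OF this], of p] pqb pq
      show ?thesis by (simp add: \<Psi>_def add_divide_distrib)
    qed
    finally show ?thesis .
  qed
  \<comment> \<open>The factor 20 is 5 from the telescoping estimate times 4 from \<open>VU\<close>.\<close>
  have tele: "\<bar>E q - E p\<bar> \<le> 20 * (?P + ?U)" if p: "p \<in> G" "c < p" and q: "q \<in> G" "q \<le> d" and pq: "p < q" for p q
  proof -
    have sub': "{p<..q} \<subseteq> {c<..d}" using p q by auto
    have "\<bar>E q - E p\<bar> \<le> \<Psi> q - \<Psi> p + 5 * (LINT r|lebesgue_on {p<..q}. V r)"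
    proof (rule telescoping_estimate[OF pq p(1) q(1)])
      show "integrable (lebesgue_on {p<..q}) V" by (rule integrable_lebesgue_on_subset[OF Vi sub']) auto
      show "AE r in lebesgue_on {p<..q}. r \<in> G" by (rule AE_lebesgue_on_subset[OF Gcd sub']) auto
      show "0 \<le> V r" for r by (simp add: V_def)
    qed (rule step)
    moreover have "(LINT r|lebesgue_on {p<..q}. V r) \<le> (LINT r|lebesgue_on {c<..d}. V r)"
      by (rule LINT_nonneg_mono_set[OF Vi _ sub']) (auto simp: V_def)
    moreover have "\<Psi> q - \<Psi> p \<le> ?P / 2"
    proof -
      have "g \<in> Hm1_dt {a<..q}" by (rule Hm1.bochner_subset[OF gH]) (use q cd in auto)
      from LINT_Ioc_add[OF _ _ Hm1.bochner_square_integrable[OF this], of p] G(2)[OF p(1)] pq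
      have "\<Psi> q - \<Psi> p = (LINT r|lebesgue_on {p<..q}. (Hm1_norm A (g r))\<^sup>2) / 2" by (simp add: \<Psi>_def add_divide_distrib)
      moreover have "(LINT r|lebesgue_on {p<..q}. (Hm1_norm A (g r))\<^sup>2) \<le> ?P"
        by (rule LINT_nonneg_mono_set[OF gi _ sub']) auto
      ultimately show ?thesis by simp
    qed
    moreover have "x \<le> D + 5 * v \<Longrightarrow> v \<le> w \<Longrightarrow> D \<le> p / 2 \<Longrightarrow> w \<le> 4 * r \<Longrightarrow> 0 \<le> p \<Longrightarrow> 0 \<le> r \<Longrightarrow>
        x \<le> 20 * (p + r)" for x D v w p r :: real by simp
    ultimately show ?thesis using VU P0 U0 by blast
  qed
  have Es: "E s = 0" by (simp add: E_def L2.zero)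
  have "(L2_norm A (u t - u s))\<^sup>2 \<le> 20 * (?P + ?U)" if t: "t \<in> G" "c < t" "t \<le> d" for t
  proof (cases t s rule: linorder_cases)
    case less
    then show ?thesis using tele[of t s] t s Es by (simp add: E_def)
  next
    case equal
    then show ?thesis using Es P0 U0 by (simp add: E_def)
  next
    case greater
    then show ?thesis using tele[of s t] t s Es by (simp add: E_def)
  qed
  moreover have "?P + ?U = (LINT q|lebesgue_on {c<..d}. (Hm1_norm A (g q))\<^sup>2 + (H1_norm A (u q))\<^sup>2)"
    using ui gi by simp
  ultimately show ?thesis using s that by auto
qed

text \<open>The base points of the oscillation estimate on shrinking intervals form an \<open>L\<^sup>2\<close>-Cauchy sequence.\<close>

lemma weak_dt_trace:
  fixes c d :: "nat \<Rightarrow> real"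
  assumes ab: "a < b" and u: "u \<in> H1_dt {a<..b}" and g: "is_weak_dt A a b u g"
    and cd: "\<And>n. a \<le> c n" "\<And>n. c n < d n" "\<And>n. d n \<le> b"
    and nested: "\<And>m n. m \<le> n \<Longrightarrow> c m \<le> c n \<and> d n \<le> d m"
    and shrink: "\<And>t. a < t \<Longrightarrow> t < b \<Longrightarrow> \<forall>\<^sub>F n in sequentially. t \<notin> {c n<..d n}"
  obtains w where "w \<in> L2 A"
    "\<And>e. e > 0 \<Longrightarrow> \<exists>n. AE t in lebesgue_on {c n<..d n}. u t \<in> L2 A \<and> L2_norm A (u t - w) < e"
proof -
  obtain G where G: "AE t in lebesgue_on {a<..b}. t \<in> G" "\<And>t. t \<in> G \<Longrightarrow> a < t \<and> t \<le> b \<and> u t \<in> H10 A"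
    "\<And>r s t. r \<in> G \<Longrightarrow> s \<in> G \<Longrightarrow> t \<in> G \<Longrightarrow> s < t \<Longrightarrow>
       ip A (u t - u s) (u r) = (LINT q|lebesgue_on {s<..t}. g q (u r))"
    using weak_dt_good_set[OF ab u g] by blast
  define f where "f q = (Hm1_norm A (g q))\<^sup>2 + (H1_norm A (u q))\<^sup>2" for q
  define J where "J n = (LINT q|lebesgue_on {c n<..d n}. f q)" for n
  have gH: "g \<in> Hm1_dt {a<..b}" by (rule is_weak_dt_in[OF g])
  have fi: "integrable (lebesgue_on {a<..b}) f"
    unfolding f_def using Hm1.bochner_square_integrable[OF gH] H10.bochner_square_integrable[OF u] by simp
  have f0: "0 \<le> f q" for q by (simp add: f_def)
  have J0: "0 \<le> J n" for n unfolding J_def using f0 by simp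
  have "\<exists>s. s \<in> G \<and> c n < s \<and> s \<le> d n \<and> (\<forall>t\<in>G. c n < t \<longrightarrow> t \<le> d n \<longrightarrow> (L2_norm A (u t - u s))\<^sup>2 \<le> 20 * J n)" for n
  proof -
    obtain s where "s \<in> G" "c n < s" "s \<le> d n" "\<And>t. t \<in> G \<Longrightarrow> c n < t \<Longrightarrow> t \<le> d n \<Longrightarrow>
        (L2_norm A (u t - u s))\<^sup>2 \<le> 20 * J n"
      unfolding J_def f_def
      using weak_dt_oscillation[OF ab u gH G(1) G(2) G(3) cd(1)[of n] cd(2)[of n] cd(3)[of n]] by blast
    then show ?thesis by blast
  qed
  then obtain s where s: "\<And>n. s n \<in> G" "\<And>n. c n < s n" "\<And>n. s n \<le> d n"
    and osc: "\<And>n t. t \<in> G \<Longrightarrow> c n < t \<Longrightarrow> t \<le> d n \<Longrightarrow> (L2_norm A (u t - u (s n)))\<^sup>2 \<le> 20 * J n"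
    by metis
  have GL: "u t \<in> L2 A" if "t \<in> G" for t using G(2)[OF that] by (simp add: H10_in_L2)
  have Jlim: "J \<longlonglongrightarrow> 0"
  proof -
    have "(\<lambda>n. LINT q|lebesgue_on {a<..b}. indicat_real {c n<..d n} q * f q) \<longlonglongrightarrow> (LINT q|lebesgue_on {a<..b}. 0)"
    proof (rule integral_dominated_convergence[OF _ _ fi])
      show "(\<lambda>q. indicat_real {c n<..d n} q * f q) \<in> borel_measurable (lebesgue_on {a<..b})" for n
        by (rule borel_measurable_times[OF borel_measurable_lebesgue_onI borel_measurable_integrable[OF fi]]) auto
      show "AE q in lebesgue_on {a<..b}. (\<lambda>n. indicat_real {c n<..d n} q * f q) \<longlonglongrightarrow> 0"
      proof -
        have "AE q in lebesgue_on {a<..<b}. (\<lambda>n. indicat_real {c n<..d n} q * f q) \<longlonglongrightarrow> 0"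
        proof (rule AE_I2)
          fix q assume "q \<in> space (lebesgue_on {a<..<b})"
          then have "\<forall>\<^sub>F n in sequentially. indicat_real {c n<..d n} q * f q = 0"
            using shrink[of q] by (auto elim!: eventually_mono)
          then show "(\<lambda>n. indicat_real {c n<..d n} q * f q) \<longlonglongrightarrow> 0" by (rule tendsto_eventually)
        qed
        then show ?thesis by (rule AE_Ioo_imp_Ioc)
      qed
      show "AE q in lebesgue_on {a<..b}. norm (indicat_real {c n<..d n} q * f q) \<le> f q" for n
        using f0 by (auto simp: indicator_def)
    qed simp
    moreover have "(LINT q|lebesgue_on {a<..b}. indicat_real {c n<..d n} q * f q) = J n" for n
    proof -
      have "indicat_real {a<..b} q * (indicat_real {c n<..d n} q * f q) = indicat_real {c n<..d n} q * f q" for q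
        using cd(1)[of n] cd(3)[of n] by (auto simp: indicator_def)
      then have "(LINT q|lebesgue. indicat_real {a<..b} q * (indicat_real {c n<..d n} q * f q)) =
          (LINT q|lebesgue. indicat_real {c n<..d n} q * f q)" by presburger
      then show ?thesis by (simp add: J_def integral_restrict_space)
    qed
    ultimately show ?thesis by simp
  qed
  have small: "\<exists>K. \<forall>n\<ge>K. sqrt (20 * J n) < e" if "e > 0" for e
  proof -
    have "(\<lambda>n. sqrt (20 * J n)) \<longlonglongrightarrow> sqrt (20 * 0)" by (intro tendsto_intros Jlim)
    then have "\<forall>\<^sub>F n in sequentially. sqrt (20 * J n) < e" using that by (intro order_tendstoD(2)[of _ 0]) auto
    then show ?thesis by (simp add: eventually_sequentially)
  qed
  have osc': "L2_norm A (u t - u (s n)) \<le> sqrt (20 * J n)" if "t \<in> G" "c n < t" "t \<le> d n" for n t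
    using osc[OF that] by (intro real_le_rsqrt)
  obtain w where w: "w \<in> L2 A" and wl: "(\<lambda>n. L2_norm A (u (s n) - w)) \<longlonglongrightarrow> 0"
  proof (rule L2_complete[of "\<lambda>n. u (s n)"])
    show "u (s n) \<in> L2 A" for n by (rule GL[OF s(1)])
    fix e :: real assume "e > 0"
    then obtain K where K: "\<And>n. n \<ge> K \<Longrightarrow> sqrt (20 * J n) < e / 2" using small[of "e / 2"] by auto
    have near: "L2_norm A (u (s i) - u (s K)) < e / 2" if "i \<ge> K" for i
    proof -
      have "c K < s i" "s i \<le> d K" using s(2,3)[of i] nested[OF that] by linarith+
      from osc'[OF s(1) this] K[of K] show ?thesis by simp
    qed
    have "L2_norm A (u (s i) - u (s j)) < e" if "i \<ge> K" "j \<ge> K" for i j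
      using L2.triangle_via[of "u (s i)" "u (s K)" "u (s j)"] near[OF that(1)] near[OF that(2)]
        L2.minus_commute[of "u (s j)" "u (s K)"] GL[OF s(1)] by simp
    then show "\<exists>K. \<forall>i\<ge>K. \<forall>j\<ge>K. L2_norm A (u (s i) - u (s j)) < e" by blast
  qed blast
  have "\<exists>n. AE t in lebesgue_on {c n<..d n}. u t \<in> L2 A \<and> L2_norm A (u t - w) < e" if e: "e > 0" for e
  proof -
    obtain K where K: "\<And>n. n \<ge> K \<Longrightarrow> sqrt (20 * J n) < e / 2" using small[of "e / 2"] e by auto
    have "\<forall>\<^sub>F n in sequentially. L2_norm A (u (s n) - w) < e / 2"
      using e by (intro order_tendstoD(2)[OF wl]) auto
    then obtain K' where K': "\<And>n. n \<ge> K' \<Longrightarrow> L2_norm A (u (s n) - w) < e / 2"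
      by (auto simp: eventually_sequentially)
    define n where "n = max K K'"
    have "AE t in lebesgue_on {c n<..d n}. t \<in> G"
      by (rule AE_lebesgue_on_subset[OF G(1)]) (use cd(1)[of n] cd(3)[of n] in auto)
    moreover have "AE t in lebesgue_on {c n<..d n}. t \<in> {c n<..d n}" by (rule AE_I2) simp
    ultimately have "AE t in lebesgue_on {c n<..d n}. u t \<in> L2 A \<and> L2_norm A (u t - w) < e"
    proof eventually_elim
      case (elim t)
      then have "L2_norm A (u t - u (s n)) < e / 2" using osc'[of t n] K[of n] by (auto simp: n_def)
      moreover have "L2_norm A (u (s n) - w) < e / 2" using K'[of n] by (simp add: n_def)
      moreover have "L2_norm A (u t - w) \<le> L2_norm A (u t - u (s n)) + L2_norm A (u (s n) - w)"
        using elim by (intro L2.triangle_via GL s w) auto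
      ultimately show ?case using GL[OF elim(1)] by simp
    qed
    then show ?thesis by blast
  qed
  with w show ?thesis by (rule that)
qed

theorem weak_dt_ess_lim:
  assumes ab: "a < b" and u: "u \<in> H1_dt {a<..b}" and g: "is_weak_dt A a b u g"
  shows "\<exists>w. ess_lim_right A u a w" "\<exists>w. ess_lim_left A u b w"
proof -
  define h where "h n = (b - a) / real (Suc n)" for n
  have h: "h n > 0" "h n \<le> b - a" for n
    using ab divide_left_mono[of 1 "real (Suc n)" "b - a"] by (auto simp: h_def)
  have hm: "m \<le> n \<Longrightarrow> h n \<le> h m" for m n using ab by (auto simp: h_def intro!: divide_left_mono)
  have "h \<longlonglongrightarrow> 0" unfolding h_def by (rule LIMSEQ_Suc[OF lim_const_over_n])
  then have hs: "\<forall>\<^sub>F n in sequentially. h n < e" if "e > 0" for e using that by (rule order_tendstoD(2))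
  obtain w where w: "w \<in> L2 A"
    "\<And>e. e > 0 \<Longrightarrow> \<exists>n. AE t in lebesgue_on {a<..a + h n}. u t \<in> L2 A \<and> L2_norm A (u t - w) < e"
  proof (rule weak_dt_trace[OF ab u g, of "\<lambda>n. a" "\<lambda>n. a + h n"])
    show "\<forall>\<^sub>F n in sequentially. t \<notin> {a<..a + h n}" if "a < t" "t < b" for t
      using hs[of "t - a"] that by (auto elim!: eventually_mono)
  qed (use h hm in \<open>auto simp: le_diff_eq add.commute\<close>)
  have "\<exists>d>0. AE t in lebesgue_on {a<..<a + d}. u t \<in> L2 A \<and> L2_norm A (u t - w) < e" if e: "e > 0" for e
  proof -
    obtain n where n: "AE t in lebesgue_on {a<..a + h n}. u t \<in> L2 A \<and> L2_norm A (u t - w) < e"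
      using w(2)[OF e] by blast
    have "AE t in lebesgue_on {a<..<a + h n}. u t \<in> L2 A \<and> L2_norm A (u t - w) < e"
      by (rule AE_lebesgue_on_subset[OF n]) auto
    then show ?thesis using h by blast
  qed
  with w show "\<exists>w. ess_lim_right A u a w" unfolding ess_lim_right_def by blast
  obtain w where w: "w \<in> L2 A"
    "\<And>e. e > 0 \<Longrightarrow> \<exists>n. AE t in lebesgue_on {b - h n<..b}. u t \<in> L2 A \<and> L2_norm A (u t - w) < e"
  proof (rule weak_dt_trace[OF ab u g, of "\<lambda>n. b - h n" "\<lambda>n. b"])
    show "\<forall>\<^sub>F n in sequentially. t \<notin> {b - h n<..b}" if "a < t" "t < b" for t
      using hs[of "b - t"] that by (auto elim!: eventually_mono)
  qed (use h hm in \<open>auto simp: le_diff_eq add.commute\<close>)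
  have "\<exists>d>0. AE t in lebesgue_on {b - d<..<b}. u t \<in> L2 A \<and> L2_norm A (u t - w) < e" if e: "e > 0" for e
  proof -
    obtain n where n: "AE t in lebesgue_on {b - h n<..b}. u t \<in> L2 A \<and> L2_norm A (u t - w) < e"
      using w(2)[OF e] by blast
    have "AE t in lebesgue_on {b - h n<..<b}. u t \<in> L2 A \<and> L2_norm A (u t - w) < e"
      by (rule AE_lebesgue_on_subset[OF n]) auto
    then show ?thesis using h by blast
  qed
  with w show "\<exists>w. ess_lim_left A u b w" unfolding ess_lim_left_def by blast
qed

subsection \<open>Calculus of one-sided limits\<close>

lemma ess_lim_right_unique:
  assumes "ess_lim_right A v a w" "ess_lim_right A v a w'"
  shows "L2_norm A (w - w') = 0"
proof (rule ccontr)
  have w: "w \<in> L2 A" "w' \<in> L2 A" using assms by (auto simp: ess_lim_right_def)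
  assume "\<not> ?thesis"
  then have e: "L2_norm A (w - w') / 2 > 0" using L2.nonneg[OF L2.diff_in[OF w]] by auto
  obtain d where d: "d > 0" "AE s in lebesgue_on {a<..<a + d}. v s \<in> L2 A \<and> L2_norm A (v s - w) < L2_norm A (w - w') / 2"
    using assms(1) e unfolding ess_lim_right_def by blast
  obtain d' where d': "d' > 0" "AE s in lebesgue_on {a<..<a + d'}. v s \<in> L2 A \<and> L2_norm A (v s - w') < L2_norm A (w - w') / 2"
    using assms(2) e unfolding ess_lim_right_def by blast
  define r where "r = min d d'"
  have "AE s in lebesgue_on {a<..<a + r}. v s \<in> L2 A \<and> L2_norm A (v s - w) < L2_norm A (w - w') / 2"
    by (rule AE_lebesgue_on_subset[OF d(2)]) (auto simp: r_def)
  moreover have "AE s in lebesgue_on {a<..<a + r}. v s \<in> L2 A \<and> L2_norm A (v s - w') < L2_norm A (w - w') / 2"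
    by (rule AE_lebesgue_on_subset[OF d'(2)]) (auto simp: r_def)
  ultimately have "AE s in lebesgue_on {a<..<a + r}. False"
  proof eventually_elim
    case (elim s)
    then have "L2_norm A (w - w') \<le> L2_norm A (w - v s) + L2_norm A (v s - w')" "L2_norm A (w - v s) = L2_norm A (v s - w)"
      using w by (auto intro: L2.triangle_via L2.minus_commute)
    with elim show False by simp
  qed
  then have "{a<..<a + r} \<in> null_sets lebesgue" by (simp add: AE_restrict_space_iff AE_iff_null_sets)
  then show False using d(1) d'(1) by (auto simp: null_sets_def emeasure_lborel_Ioo r_def)
qed

end

lemma bounded_bilinear_on_linear1:
  "bounded_bilinear_on D N E K B \<Longrightarrow> v \<in> D \<Longrightarrow> v' \<in> D \<Longrightarrow> w \<in> E \<Longrightarrow> B (v + s *\<^sub>R v') w = B v w + s * B v' w"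
  unfolding bounded_bilinear_on_def by blast

lemma bounded_bilinear_on_linear2:
  "bounded_bilinear_on D N E K B \<Longrightarrow> v \<in> D \<Longrightarrow> w \<in> E \<Longrightarrow> w' \<in> E \<Longrightarrow> B v (w + s *\<^sub>R w') = B v w + s * B v w'"
  unfolding bounded_bilinear_on_def by blast

context bounded_domain
begin

lemma ess_lim_right_comb:
  assumes "ess_lim_right A v a x" "ess_lim_right A w a y"
  shows "ess_lim_right A (v + s *\<^sub>R w) a (x + s *\<^sub>R y)"
  unfolding ess_lim_right_def
proof (intro conjI allI impI)
  have xy: "x \<in> L2 A" "y \<in> L2 A" using assms by (auto simp: ess_lim_right_def)
  then show "x + s *\<^sub>R y \<in> L2 A" by (intro L2.add_in L2.scale_in)
  fix e :: real assume e: "e > 0"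
  define e' where "e' = e / (1 + \<bar>s\<bar>)"
  have e': "e' > 0" "e' + \<bar>s\<bar> * e' = e"
    using e by (auto simp: e'_def add_pos_nonneg) (simp add: add_divide_distrib[symmetric] divide_eq_eq add_pos_nonneg algebra_simps)
  obtain d where d: "d > 0" "AE t in lebesgue_on {a<..<a + d}. v t \<in> L2 A \<and> L2_norm A (v t - x) < e'"
    using assms(1) e' unfolding ess_lim_right_def by blast
  obtain d' where d': "d' > 0" "AE t in lebesgue_on {a<..<a + d'}. w t \<in> L2 A \<and> L2_norm A (w t - y) < e'"
    using assms(2) e' unfolding ess_lim_right_def by blast
  define r where "r = min d d'"
  have "AE t in lebesgue_on {a<..<a + r}. v t \<in> L2 A \<and> L2_norm A (v t - x) < e'"
    by (rule AE_lebesgue_on_subset[OF d(2)]) (auto simp: r_def)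
  moreover have "AE t in lebesgue_on {a<..<a + r}. w t \<in> L2 A \<and> L2_norm A (w t - y) < e'"
    by (rule AE_lebesgue_on_subset[OF d'(2)]) (auto simp: r_def)
  ultimately have "AE t in lebesgue_on {a<..<a + r}. (v + s *\<^sub>R w) t \<in> L2 A \<and> L2_norm A ((v + s *\<^sub>R w) t - (x + s *\<^sub>R y)) < e"
  proof eventually_elim
    case (elim t)
    have eq: "(v + s *\<^sub>R w) t - (x + s *\<^sub>R y) = (v t - x) + s *\<^sub>R (w t - y)" by (simp add: algebra_simps)
    have i: "v t - x \<in> L2 A" "w t - y \<in> L2 A" using elim xy by (auto intro: L2.diff_in)
    have "L2_norm A ((v t - x) + s *\<^sub>R (w t - y)) \<le> L2_norm A (v t - x) + \<bar>s\<bar> * L2_norm A (w t - y)"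
      using L2.triangle[OF i(1) L2.scale_in[OF i(2)]] L2.scale[OF i(2)] by simp
    also have "\<dots> < e' + \<bar>s\<bar> * e'" using elim by (intro add_less_le_mono mult_left_mono) auto
    finally have "L2_norm A ((v + s *\<^sub>R w) t - (x + s *\<^sub>R y)) < e" unfolding eq e'(2) .
    moreover have "(v + s *\<^sub>R w) t \<in> L2 A" using elim by (auto intro: L2.add_in L2.scale_in)
    ultimately show ?case by simp
  qed
  moreover have "r > 0" using d d' by (simp add: r_def)
  ultimately show "\<exists>d>0. AE t in lebesgue_on {a<..<a + d}.
      (v + s *\<^sub>R w) t \<in> L2 A \<and> L2_norm A ((v + s *\<^sub>R w) t - (x + s *\<^sub>R y)) < e" by blast
qed

text \<open>Reflection of time turns statements about right limits into statements about left limits.\<close>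

lemma AE_reflect:
  assumes "AE t in lebesgue_on {l<..<r::real}. Q t"
  shows "AE t in lebesgue_on {- r<..<- l}. Q (- t)"
proof -
  have "AE t in lebesgue. t \<in> {l<..<r} \<longrightarrow> Q t" using assms by (simp add: AE_restrict_space_iff)
  then obtain Z where Z: "Z \<in> null_sets lebesgue" "\<And>t. t \<notin> Z \<Longrightarrow> t \<in> {l<..<r} \<longrightarrow> Q t"
    unfolding completion.AE_iff_null_sets by auto
  have neg: "uminus ` Z \<in> null_sets lebesgue"
    using Z(1) negligible_differentiable_image_negligible[of Z "uminus :: real \<Rightarrow> real"]
    by (simp add: negligible_iff_null_sets[symmetric] differentiable_on_minus)
  have "AE t in lebesgue. t \<in> {- r<..<- l} \<longrightarrow> Q (- t)"
  proof (rule AE_I'[OF neg])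
    show "{t \<in> space lebesgue. \<not> (t \<in> {- r<..<- l} \<longrightarrow> Q (- t))} \<subseteq> uminus ` Z"
    proof
      fix t assume t: "t \<in> {t \<in> space lebesgue. \<not> (t \<in> {- r<..<- l} \<longrightarrow> Q (- t))}"
      then have "- t \<in> Z" using Z(2)[of "- t"] by auto
      then show "t \<in> uminus ` Z" by (intro image_eqI[of _ _ "- t"]) auto
    qed
  qed
  then show ?thesis by (simp add: AE_restrict_space_iff)
qed

lemma ess_lim_left_reflect: "ess_lim_left A v a w \<longleftrightarrow> ess_lim_right A (\<lambda>t. v (- t)) (- a) w"
proof -
  have "(AE s in lebesgue_on {a - d<..<a}. Q (v s)) \<longleftrightarrow> (AE s in lebesgue_on {- a<..<- a + d}. Q (v (- s)))" for d Q
  proof -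
    have e: "- (a - d) = - a + d" "- (- a + d) = a - d" by simp_all
    show ?thesis
      using AE_reflect[where l = "a - d" and r = a and Q = "\<lambda>s. Q (v s)"]
        AE_reflect[where l = "- a" and r = "- a + d" and Q = "\<lambda>s. Q (v (- s))"]
      unfolding e minus_minus by blast
  qed
  note this[where Q = "\<lambda>x. x \<in> L2 A \<and> L2_norm A (x - w) < e" for e]
  then show ?thesis unfolding ess_lim_left_def ess_lim_right_def by (simp only:)
qed

lemma ess_lim_left_comb:
  assumes "ess_lim_left A v a x" "ess_lim_left A w a y"
  shows "ess_lim_left A (v + s *\<^sub>R w) a (x + s *\<^sub>R y)"
  using ess_lim_right_comb[of "\<lambda>t. v (- t)" "- a" x "\<lambda>t. w (- t)" y s] assms
  unfolding ess_lim_left_reflect by (simp add: plus_fun_def scaleR_fun_def)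

lemma ess_lim_left_unique:
  "ess_lim_left A v a w \<Longrightarrow> ess_lim_left A v a w' \<Longrightarrow> L2_norm A (w - w') = 0"
  unfolding ess_lim_left_reflect by (rule ess_lim_right_unique)

lemma ess_lim_right_of_continuous:
  assumes ab: "a < b" and w: "\<And>t. t \<in> {a..b} \<Longrightarrow> w t \<in> H10 A"
    and lim: "((\<lambda>s. H1_norm A (w s - w a)) \<longlongrightarrow> 0) (at a within {a..b})"
    and vw: "AE t in lebesgue_on {a<..<b}. v t \<in> H10 A \<and> (AE x in lebesgue_on A. v t x = w t x)"
  shows "ess_lim_right A v a (w a)"
  unfolding ess_lim_right_def
proof (intro conjI allI impI)
  have wa: "w a \<in> H10 A" using w ab by simp
  then show waL: "w a \<in> L2 A" by (rule H10_in_L2)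
  fix e :: real assume "e > 0"
  then have "\<forall>\<^sub>F s in at a within {a..b}. H1_norm A (w s - w a) < e" by (rule order_tendstoD(2)[OF lim])
  then obtain d where d: "d > 0" "\<And>s. s \<in> {a..b} \<Longrightarrow> s \<noteq> a \<Longrightarrow> dist s a < d \<Longrightarrow> H1_norm A (w s - w a) < e"
    unfolding eventually_at by blast
  define r where "r = min d (b - a)"
  have "AE t in lebesgue_on {a<..<a + r}. v t \<in> H10 A \<and> (AE x in lebesgue_on A. v t x = w t x)"
    by (rule AE_lebesgue_on_subset[OF vw]) (auto simp: r_def)
  moreover have "AE t in lebesgue_on {a<..<a + r}. t \<in> {a<..<a + r}" by (rule AE_I2) simp
  ultimately have "AE t in lebesgue_on {a<..<a + r}. v t \<in> L2 A \<and> L2_norm A (v t - w a) < e"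
  proof eventually_elim
    case (elim t)
    have t: "t \<in> {a..b}" "t \<noteq> a" "dist t a < d" using elim by (auto simp: r_def dist_real_def)
    have wt: "w t \<in> L2 A" using w[OF t(1)] by (rule H10_in_L2)
    have vt: "v t \<in> L2 A" using elim by (auto intro: H10_in_L2)
    have "L2_norm A (v t - w t) = 0"
      using elim by (subst L2_norm_eq_0_iff[OF L2.diff_in[OF vt wt]]) (auto elim: eventually_mono)
    then have "L2_norm A (v t - w a) \<le> L2_norm A (w t - w a)"
      using L2.triangle_via[OF vt wt waL] by simp
    also have "\<dots> \<le> H1_norm A (w t - w a)" by (rule L2_norm_le_H1_norm)
    also have "\<dots> < e" using d(2)[OF t] .
    finally show ?case using vt by simp
  qed
  moreover have "r > 0" using d ab by (simp add: r_def)
  ultimately show "\<exists>d>0. AE t in lebesgue_on {a<..<a + d}. v t \<in> L2 A \<and> L2_norm A (v t - w a) < e" by blast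
qed

lemma ess_lim_left_of_continuous:
  assumes ab: "a < b" and w: "\<And>t. t \<in> {a..b} \<Longrightarrow> w t \<in> H10 A"
    and lim: "((\<lambda>s. H1_norm A (w s - w b)) \<longlongrightarrow> 0) (at b within {a..b})"
    and vw: "AE t in lebesgue_on {a<..<b}. v t \<in> H10 A \<and> (AE x in lebesgue_on A. v t x = w t x)"
  shows "ess_lim_left A v b (w b)"
proof -
  have "ess_lim_right A (\<lambda>t. v (- t)) (- b) ((\<lambda>t. w (- t)) (- b))"
  proof (rule ess_lim_right_of_continuous[of "- b" "- a"])
    show "((\<lambda>s. H1_norm A (w (- s) - w (- (- b)))) \<longlongrightarrow> 0) (at (- b) within {- b..- a})"
    proof -
      have "filterlim uminus (at b within {a..b}) (at (- b) within {- b..- a})"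
        unfolding filterlim_at by (auto simp: eventually_at_filter intro!: tendsto_eq_intros)
      from filterlim_compose[OF lim this] show ?thesis by simp
    qed
    show "AE t in lebesgue_on {- b<..<- a}. v (- t) \<in> H10 A \<and> (AE x in lebesgue_on A. v (- t) x = w (- t) x)"
      using AE_reflect[OF vw] .
  qed (use ab w in auto)
  then show ?thesis unfolding ess_lim_left_reflect by simp
qed

lemma L2_norm_0_imp_ip_eq:
  assumes "w \<in> L2 A" "w' \<in> L2 A" "L2_norm A (w - w') = 0" "y \<in> L2 A"
  shows "ip A w y = ip A w' y"
proof -
  have "\<bar>ip A (w - w') y\<bar> \<le> 0"
    using ip_Cauchy_Schwarz[OF L2.diff_in[OF assms(1,2)] assms(4)] assms(3) by simp
  then show ?thesis using ip_linear[OF assms(1,2,4), of "-1"] by simp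
qed

lemma H10_bilinear_cong:
  assumes B: "bounded_bilinear_on (H10 A) (H1_norm A) E K B"
    and v: "v \<in> H10 A" "v' \<in> H10 A" "w \<in> E" and eq: "\<And>x. x \<in> A \<Longrightarrow> v x = v' x"
  shows "B v w = B v' w"
proof -
  have "H1_norm A (v - v') = 0"
    using eq by (intro H1_norm_eq_0 H1.diff_in H10_in_H1 v AE_I2) auto
  then have "B (v - v') w = 0"
  proof -
    obtain C where "\<And>x y. x \<in> H10 A \<Longrightarrow> y \<in> E \<Longrightarrow> \<bar>B x y\<bar> \<le> C * H1_norm A x * K y"
      using B unfolding bounded_bilinear_on_def by blast
    from this[OF H10.diff_in[OF v(1,2)] v(3)] show ?thesis using \<open>H1_norm A (v - v') = 0\<close> by simp
  qed
  then show ?thesis using bounded_bilinear_on_diff1[OF B v] by simp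
qed

end

section \<open>The bilinear forms\<close>

locale dwr_problem =
  fixes P :: "('d::finite) dwr_data"
  assumes data: "admissible_data P"
begin

abbreviation (input) "A \<equiv> Omega P"
abbreviation (input) "T \<equiv> tgrid P"
abbreviation (input) "M \<equiv> nslab P"

sublocale bounded_domain "Omega P"
  using data by unfold_locales (auto simp: admissible_data_def polyhedral_domain_def)

lemma tgrid_0: "T 0 = 0" and nslab_ge_1: "1 \<le> M"
  using data by (auto simp: admissible_data_def)

lemma tgrid_strict_mono: "i < j \<Longrightarrow> j \<le> M \<Longrightarrow> T i < T j"
proof (induction j)
  case (Suc j)
  have "T j < T (Suc j)" using data Suc.prems by (auto simp: admissible_data_def)
  then show ?case using Suc by (cases "i = j") auto
qed simp

lemma tgrid_mono: "i \<le> j \<Longrightarrow> j \<le> M \<Longrightarrow> T i \<le> T j"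
  using tgrid_strict_mono[of i j] by (cases "i = j") auto

lemma tgrid_nonneg: "i \<le> M \<Longrightarrow> 0 \<le> T i" using tgrid_mono[of 0 i] tgrid_0 by simp

lemma slab_ends: "m \<in> {1..M} \<Longrightarrow> T (m - 1) < T m"
  using tgrid_strict_mono[of "m - 1" m] by auto

lemma slab_subset: "m \<in> {1..M} \<Longrightarrow> slab P m \<subseteq> timeint P"
proof -
  assume m: "m \<in> {1..M}"
  then have "0 \<le> T (m - 1)" "T m \<le> T M" by (auto intro!: tgrid_nonneg tgrid_mono)
  then show ?thesis unfolding slab_def timeint_def by auto
qed

lemma slab_sets [simp]: "slab P m \<in> sets lebesgue" and timeint_sets [simp]: "timeint P \<in> sets lebesgue"
  and timeint_lmeasurable: "timeint P \<in> lmeasurable"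
  by (simp_all add: slab_def timeint_def)

lemma slab_AE: "m \<in> {1..M} \<Longrightarrow> AE t in lebesgue_on (timeint P). Q t \<Longrightarrow> AE t in lebesgue_on (slab P m). Q t"
  by (rule AE_lebesgue_on_subset) (auto intro: slab_subset[THEN subsetD])

lemma slab_integrable: "m \<in> {1..M} \<Longrightarrow> integrable (lebesgue_on (timeint P)) f \<Longrightarrow> integrable (lebesgue_on (slab P m)) f"
  for f :: "real \<Rightarrow> real"
  by (rule integrable_lebesgue_on_subset) (auto intro: slab_subset[THEN subsetD])

lemma LINT_tail_sum:
  fixes f :: "real \<Rightarrow> real"
  assumes f: "integrable (lebesgue_on (timeint P)) f" and n: "n \<le> M"
  shows "(LINT t|lebesgue_on {0<..T n}. f t) = (\<Sum>m=1..n. LINT t|lebesgue_on (slab P m). f t)"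
  using n
proof (induction n)
  case 0
  then show ?case by (simp add: tgrid_0 integral_restrict_space)
next
  case (Suc n)
  have "integrable (lebesgue_on {0<..T (Suc n)}) f"
    using f tgrid_mono[of "Suc n" M] Suc.prems
    by (intro integrable_lebesgue_on_subset[OF f]) (auto simp: timeint_def)
  then show ?case
    using LINT_Ioc_add[of 0 "T n" "T (Suc n)" f] tgrid_nonneg[of n] tgrid_mono[of n "Suc n"] Suc
    by (simp add: slab_def)
qed

lemma LINT_timeint:
  fixes f :: "real \<Rightarrow> real"
  assumes "integrable (lebesgue_on (timeint P)) f"
  shows "(LINT t|lebesgue_on (timeint P). f t) = (\<Sum>m=1..M. LINT t|lebesgue_on (slab P m). f t)"
  using LINT_tail_sum[OF assms order_refl] by (simp add: timeint_def)

lemma timeint_slab: "t \<in> timeint P \<Longrightarrow> \<exists>m\<in>{1..M}. t \<in> slab P m"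
proof -
  assume "t \<in> timeint P"
  then have t: "0 < t" "t \<le> T M" by (auto simp: timeint_def)
  define m where "m = (LEAST m. t \<le> T m)"
  have m: "t \<le> T m" unfolding m_def by (rule LeastI[of _ M]) (rule t)
  have "m \<le> M" unfolding m_def by (rule Least_le) (rule t)
  moreover have "m \<noteq> 0" using m t tgrid_0 by (intro notI) auto
  moreover have "T (m - 1) < t" using not_less_Least[of "m - 1" "\<lambda>m. t \<le> T m"] \<open>m \<noteq> 0\<close> by (simp add: m_def)
  ultimately show ?thesis using m by (intro bexI[of _ m]) (auto simp: slab_def)
qed

lemma slab_disjoint: "m \<in> {1..M} \<Longrightarrow> n \<in> {1..M} \<Longrightarrow> t \<in> slab P m \<Longrightarrow> t \<in> slab P n \<Longrightarrow> m = n"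
proof -
  have "m \<le> n" if "m \<in> {1..M}" "n \<in> {1..M}" "t \<in> slab P m" "t \<in> slab P n" for m n
  proof (rule ccontr)
    assume "\<not> m \<le> n"
    then have "T n \<le> T (m - 1)" using that by (intro tgrid_mono) auto
    then show False using that by (auto simp: slab_def)
  qed
  then show "m \<in> {1..M} \<Longrightarrow> n \<in> {1..M} \<Longrightarrow> t \<in> slab P m \<Longrightarrow> t \<in> slab P n \<Longrightarrow> m = n"
    by (meson order_antisym)
qed

subsection \<open>The spatial bilinear form\<close>

lemma conv_bounded: obtains C where "C \<ge> 0" "AE x in lebesgue_on A. norm (conv P x) \<le> C"
proof -
  obtain C where "AE x in lebesgue_on A. norm (conv P x) \<le> C"
    using data by (auto simp: admissible_data_def)
  then have "AE x in lebesgue_on A. norm (conv P x) \<le> \<bar>C\<bar>" by eventually_elim simp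
  then show ?thesis using that[of "\<bar>C\<bar>"] by simp
qed

lemma conv_measurable: "(\<lambda>x. conv P x $ i) \<in> borel_measurable (lebesgue_on A)"
  using data H1_in_L2 L2_measurable by (auto simp: admissible_data_def)

lemma conv_deriv_bound:
  obtains C where "C \<ge> 0" "\<And>v. v \<in> H1 A \<Longrightarrow> conv_deriv P v \<in> L2 A \<and> L2_norm A (conv_deriv P v) \<le> C * H1_norm A v"
proof -
  obtain C where C: "C \<ge> 0" "AE x in lebesgue_on A. norm (conv P x) \<le> C" using conv_bounded by blast
  have "conv_deriv P v \<in> L2 A \<and> L2_norm A (conv_deriv P v) \<le> C * H1_norm A v" if v: "v \<in> H1 A" for v
  proof -
    let ?g = "wgrad A v"
    have m: "conv_deriv P v \<in> borel_measurable (lebesgue_on A)"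
    proof -
      have "(\<lambda>x. \<Sum>i\<in>UNIV. conv P x $ i * ?g x $ i) \<in> borel_measurable (lebesgue_on A)"
        using conv_measurable L2_measurable[OF wgrad_in_L2[OF v]] by (intro borel_measurable_sum borel_measurable_times) auto
      then show ?thesis unfolding conv_deriv_def[abs_def] inner_vec_def by simp
    qed
    have gi: "integrable (lebesgue_on A) (\<lambda>x. C\<^sup>2 * (?g x \<bullet> ?g x))"
      unfolding inner_vec_def using L2_mult_integrable[OF wgrad_in_L2[OF v] wgrad_in_L2[OF v]]
      by (intro integrable_mult_right Bochner_Integration.integrable_sum) auto
    have le: "AE x in lebesgue_on A. (conv_deriv P v x)\<^sup>2 \<le> C\<^sup>2 * (?g x \<bullet> ?g x)"
      using C(2)
    proof eventually_elim
      case (elim x)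
      have "\<bar>conv P x \<bullet> ?g x\<bar> \<le> norm (conv P x) * norm (?g x)" by (rule Cauchy_Schwarz_ineq2)
      also have "\<dots> \<le> C * norm (?g x)" using elim by (intro mult_right_mono) auto
      finally have "\<bar>conv P x \<bullet> ?g x\<bar>\<^sup>2 \<le> (C * norm (?g x))\<^sup>2" by (intro power_mono) auto
      then show ?case by (simp add: conv_deriv_def power_mult_distrib power2_norm_eq_inner)
    qed
    have i: "integrable (lebesgue_on A) (\<lambda>x. (conv_deriv P v x)\<^sup>2)"
      by (rule Bochner_Integration.integrable_bound[OF gi]) (use m le C in auto)
    have "ip A (conv_deriv P v) (conv_deriv P v) \<le> C\<^sup>2 * ip_vec A ?g ?g"
      using integral_mono_AE[OF i gi le] by (simp add: ip_def ip_vec_def power2_eq_square)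
    also have "\<dots> \<le> C\<^sup>2 * (ip A v v + ip_vec A ?g ?g)" by (intro mult_left_mono) (auto simp: ip_def)
    finally have "L2_norm A (conv_deriv P v) \<le> sqrt (C\<^sup>2 * (ip A v v + ip_vec A ?g ?g))"
      unfolding L2_norm_def by (rule real_sqrt_le_mono)
    also have "\<dots> = C * H1_norm A v" using C(1) by (simp add: H1_norm_def real_sqrt_mult)
    finally show ?thesis using m i by (simp add: L2_def)
  qed
  with C(1) show ?thesis by (rule that)
qed

lemma conv_deriv_in_L2: "v \<in> H1 A \<Longrightarrow> conv_deriv P v \<in> L2 A"
  using conv_deriv_bound by metis

definition conv_form :: "(real^'d \<Rightarrow> real) \<Rightarrow> (real^'d \<Rightarrow> real) \<Rightarrow> real" where
  "conv_form v w = ip A (conv_deriv P v) w"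

definition grad_form :: "(real^'d \<Rightarrow> real) \<Rightarrow> (real^'d \<Rightarrow> real) \<Rightarrow> real" where
  "grad_form v w = ip_vec A (\<lambda>x. epsi P *\<^sub>R wgrad A v x) (wgrad A w)"

definition mass_form :: "(real^'d \<Rightarrow> real) \<Rightarrow> (real^'d \<Rightarrow> real) \<Rightarrow> real" where
  "mass_form v w = ip A (alpha P *\<^sub>R v) w"

definition space_form :: "(real^'d \<Rightarrow> real) \<Rightarrow> (real^'d \<Rightarrow> real) \<Rightarrow> real" where
  "space_form v w = conv_form v w + grad_form v w + mass_form v w"

lemma bilinear_onI:
  assumes "\<And>v v' w s. v \<in> H10 A \<Longrightarrow> v' \<in> H10 A \<Longrightarrow> w \<in> H10 A \<Longrightarrow> B (v + s *\<^sub>R v') w = B v w + s * B v' w"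
    and "\<And>v w w' s. v \<in> H10 A \<Longrightarrow> w \<in> H10 A \<Longrightarrow> w' \<in> H10 A \<Longrightarrow> B v (w + s *\<^sub>R w') = B v w + s * B v w'"
    and "\<And>v w. v \<in> H10 A \<Longrightarrow> w \<in> H10 A \<Longrightarrow> \<bar>B v w\<bar> \<le> C * H1_norm A v * H1_norm A w"
  shows "bounded_bilinear_on (H10 A) (H1_norm A) (H10 A) (H1_norm A) B"
  unfolding bounded_bilinear_on_def using assms by blast

lemma ip_linear2:
  "u \<in> L2 A \<Longrightarrow> v \<in> L2 A \<Longrightarrow> w \<in> L2 A \<Longrightarrow> ip A u (v + s *\<^sub>R w) = ip A u v + s * ip A u w"
  using ip_linear[of v w u s] by (simp add: ip_commute[of u])

lemma conv_form_bilinear: "bounded_bilinear_on (H10 A) (H1_norm A) (H10 A) (H1_norm A) conv_form"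
proof -
  obtain C where C: "C \<ge> 0" "\<And>v. v \<in> H1 A \<Longrightarrow> conv_deriv P v \<in> L2 A \<and> L2_norm A (conv_deriv P v) \<le> C * H1_norm A v"
    using conv_deriv_bound by blast
  show ?thesis
  proof (rule bilinear_onI[where C = C])
    fix v v' w s assume v: "v \<in> H10 A" "v' \<in> H10 A" and w: "w \<in> H10 A"
    note h = v[THEN H10_in_H1] H10.add_in[OF v(1) H10.scale_in[OF v(2)], THEN H10_in_H1]
    have d: "conv_deriv P v + s *\<^sub>R conv_deriv P v' \<in> L2 A" using h by (intro L2.add_in L2.scale_in conv_deriv_in_L2)
    have "AE x in lebesgue_on A. \<forall>i\<in>UNIV. wgrad A (v + s *\<^sub>R v') x $ i = wgrad A v x $ i + s * wgrad A v' x $ i"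
      using wgrad_comb[OF h(1,2)] by (subst AE_ball_countable) auto
    then have "AE x in lebesgue_on A. conv_deriv P (v + s *\<^sub>R v') x = (conv_deriv P v + s *\<^sub>R conv_deriv P v') x"
    proof eventually_elim
      case (elim x)
      then have "wgrad A (v + s *\<^sub>R v') x = wgrad A v x + s *\<^sub>R wgrad A v' x" by (simp add: vec_eq_iff)
      then show ?case by (simp add: conv_deriv_def inner_add_right)
    qed
    then have "ip A (conv_deriv P (v + s *\<^sub>R v')) w = ip A (conv_deriv P v + s *\<^sub>R conv_deriv P v') w"
      by (intro ip_cong_AE conv_deriv_in_L2 h d H10_in_L2 w) auto
    then show "conv_form (v + s *\<^sub>R v') w = conv_form v w + s * conv_form v' w"
      using h w by (simp add: conv_form_def ip_linear conv_deriv_in_L2 H10_in_L2)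
  next
    fix v w assume v: "v \<in> H10 A" and w: "w \<in> H10 A"
    have "\<bar>conv_form v w\<bar> \<le> L2_norm A (conv_deriv P v) * L2_norm A w"
      unfolding conv_form_def using v w by (intro ip_Cauchy_Schwarz conv_deriv_in_L2 H10_in_L2 H10_in_H1)
    also have "\<dots> \<le> (C * H1_norm A v) * H1_norm A w"
      using C H10_in_H1[OF v] L2_norm_le_H1_norm[of w] L2.nonneg[OF H10_in_L2[OF w]] H10.nonneg[OF v]
      by (intro mult_mono) auto
    finally show "\<bar>conv_form v w\<bar> \<le> C * H1_norm A v * H1_norm A w" .
  qed (simp add: conv_form_def ip_linear2 conv_deriv_in_L2 H10_in_H1 H10_in_L2)
qed

lemma grad_form_eq: "grad_form v w = epsi P * ip_vec A (wgrad A v) (wgrad A w)"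
  by (simp add: grad_form_def ip_vec_def)

lemma grad_form_bilinear: "bounded_bilinear_on (H10 A) (H1_norm A) (H10 A) (H1_norm A) grad_form"
proof (rule bilinear_onI[where C = "\<bar>epsi P\<bar> * real CARD('d)"])
  fix v v' w s assume "v \<in> H10 A" "v' \<in> H10 A" "w \<in> H10 A"
  then show lin: "grad_form (v + s *\<^sub>R v') w = grad_form v w + s * grad_form v' w"
    by (simp add: grad_form_eq ip_vec_wgrad_linear H10_in_H1 wgrad_in_L2 algebra_simps)
next
  fix v w w' s assume "v \<in> H10 A" "w \<in> H10 A" "w' \<in> H10 A"
  moreover have "ip_vec A g h = ip_vec A h g" for g h by (simp add: ip_vec_def inner_commute)
  ultimately show "grad_form v (w + s *\<^sub>R w') = grad_form v w + s * grad_form v w'"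
    using ip_vec_wgrad_linear[of w w' "wgrad A v" s]
    by (simp add: grad_form_eq H10_in_H1 wgrad_in_L2 algebra_simps)
next
  fix v w assume v: "v \<in> H10 A" and w: "w \<in> H10 A"
  note h = v[THEN H10_in_H1] w[THEN H10_in_H1]
  have "\<bar>ip A (\<lambda>x. wgrad A v x $ i) (\<lambda>x. wgrad A w x $ i)\<bar> \<le> H1_norm A v * H1_norm A w" for i
  proof -
    have "\<bar>ip A (\<lambda>x. wgrad A v x $ i) (\<lambda>x. wgrad A w x $ i)\<bar> \<le>
        L2_norm A (\<lambda>x. wgrad A v x $ i) * L2_norm A (\<lambda>x. wgrad A w x $ i)"
      by (intro ip_Cauchy_Schwarz wgrad_in_L2 h)
    also have "\<dots> \<le> H1_norm A v * H1_norm A w"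
      using h L2.nonneg[OF wgrad_in_L2[OF h(2)]] H10.nonneg[OF v] by (intro mult_mono L2_norm_wgrad_le_H1_norm) auto
    finally show ?thesis .
  qed
  then have "\<bar>\<Sum>i\<in>UNIV. ip A (\<lambda>x. wgrad A v x $ i) (\<lambda>x. wgrad A w x $ i)\<bar> \<le> (\<Sum>i\<in>(UNIV::'d set). H1_norm A v * H1_norm A w)"
    by (intro order_trans[OF sum_abs] sum_mono)
  then have "\<bar>ip_vec A (wgrad A v) (wgrad A w)\<bar> \<le> real CARD('d) * (H1_norm A v * H1_norm A w)"
    using h by (simp add: ip_vec_eq_sum wgrad_in_L2)
  then have "\<bar>epsi P\<bar> * \<bar>ip_vec A (wgrad A v) (wgrad A w)\<bar> \<le> \<bar>epsi P\<bar> * (real CARD('d) * (H1_norm A v * H1_norm A w))"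
    by (intro mult_left_mono) auto
  then show "\<bar>grad_form v w\<bar> \<le> \<bar>epsi P\<bar> * real CARD('d) * H1_norm A v * H1_norm A w"
    by (simp add: grad_form_eq abs_mult mult.assoc)
qed

lemma mass_form_eq: "mass_form v w = alpha P * ip A v w"
  by (simp add: mass_form_def ip_def mult.assoc)

lemma mass_form_bilinear: "bounded_bilinear_on (H10 A) (H1_norm A) (H10 A) (H1_norm A) mass_form"
proof (rule bilinear_onI[where C = "\<bar>alpha P\<bar>"])
  fix v w assume v: "v \<in> H10 A" and w: "w \<in> H10 A"
  have "\<bar>ip A v w\<bar> \<le> L2_norm A v * L2_norm A w" using v w by (intro ip_Cauchy_Schwarz H10_in_L2)
  also have "\<dots> \<le> H1_norm A v * H1_norm A w"
    using L2_norm_le_H1_norm L2.nonneg[OF H10_in_L2[OF w]] H10.nonneg[OF v] by (intro mult_mono) auto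
  finally show "\<bar>mass_form v w\<bar> \<le> \<bar>alpha P\<bar> * H1_norm A v * H1_norm A w"
    by (simp add: mass_form_eq abs_mult mult.assoc mult_left_mono)
qed (simp_all add: mass_form_eq ip_linear ip_linear2 H10_in_L2 algebra_simps)

lemma space_form_bilinear: "bounded_bilinear_on (H10 A) (H1_norm A) (H10 A) (H1_norm A) space_form"
proof -
  note b = conv_form_bilinear grad_form_bilinear mass_form_bilinear
  obtain C1 where C1: "\<And>v w. v \<in> H10 A \<Longrightarrow> w \<in> H10 A \<Longrightarrow> \<bar>conv_form v w\<bar> \<le> C1 * H1_norm A v * H1_norm A w"
    using b(1) unfolding bounded_bilinear_on_def by blast
  obtain C2 where C2: "\<And>v w. v \<in> H10 A \<Longrightarrow> w \<in> H10 A \<Longrightarrow> \<bar>grad_form v w\<bar> \<le> C2 * H1_norm A v * H1_norm A w"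
    using b(2) unfolding bounded_bilinear_on_def by blast
  obtain C3 where C3: "\<And>v w. v \<in> H10 A \<Longrightarrow> w \<in> H10 A \<Longrightarrow> \<bar>mass_form v w\<bar> \<le> C3 * H1_norm A v * H1_norm A w"
    using b(3) unfolding bounded_bilinear_on_def by blast
  show ?thesis
  proof (rule bilinear_onI[where C = "C1 + C2 + C3"])
    fix v w assume "v \<in> H10 A" "w \<in> H10 A"
    from C1[OF this] C2[OF this] C3[OF this]
    show "\<bar>space_form v w\<bar> \<le> (C1 + C2 + C3) * H1_norm A v * H1_norm A w"
      unfolding space_form_def by (simp add: distrib_right)
  next
    fix v v' w s assume "v \<in> H10 A" "v' \<in> H10 A" "w \<in> H10 A"
    then have "conv_form (v + s *\<^sub>R v') w = conv_form v w + s * conv_form v' w"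
      "grad_form (v + s *\<^sub>R v') w = grad_form v w + s * grad_form v' w"
      "mass_form (v + s *\<^sub>R v') w = mass_form v w + s * mass_form v' w"
      using b[THEN bounded_bilinear_on_linear1] by blast+
    then show "space_form (v + s *\<^sub>R v') w = space_form v w + s * space_form v' w"
      by (simp add: space_form_def algebra_simps)
  next
    fix v w w' s assume "v \<in> H10 A" "w \<in> H10 A" "w' \<in> H10 A"
    then have "conv_form v (w + s *\<^sub>R w') = conv_form v w + s * conv_form v w'"
      "grad_form v (w + s *\<^sub>R w') = grad_form v w + s * grad_form v w'"
      "mass_form v (w + s *\<^sub>R w') = mass_form v w + s * mass_form v w'"
      using b[THEN bounded_bilinear_on_linear2] by blast+
    then show "space_form v (w + s *\<^sub>R w') = space_form v w + s * space_form v w'"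
      by (simp add: space_form_def algebra_simps)
  qed
qed

lemma L2H10_eq: "L2H10 P = H1_dt (timeint P)" by (simp add: L2H10_def)

lemma L2H10_comb: "v \<in> L2H10 P \<Longrightarrow> w \<in> L2H10 P \<Longrightarrow> v + s *\<^sub>R w \<in> L2H10 P"
  using H10.bochner_comb[OF timeint_sets, of v w s] by (simp add: L2H10_eq plus_fun_def scaleR_fun_def)

lemma L2H10_slab: "m \<in> {1..M} \<Longrightarrow> v \<in> L2H10 P \<Longrightarrow> v \<in> H1_dt (slab P m)"
  unfolding L2H10_eq by (rule H10.bochner_subset) (auto intro: slab_subset[THEN subsetD])

lemma bilinear_time_integrable:
  assumes "bounded_bilinear_on (H10 A) (H1_norm A) (H10 A) (H1_norm A) B" "v \<in> L2H10 P" "w \<in> L2H10 P"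
  shows "integrable (lebesgue_on (timeint P)) (\<lambda>t. B (v t) (w t))"
  using bochner_pairing_integrable[OF H10.seminorm_space_axioms H10.seminorm_space_axioms timeint_sets _ _ assms(1)]
    assms(2,3) by (simp add: L2H10_eq)

lemma a_form_eq:
  assumes "v \<in> L2H10 P" "w \<in> L2H10 P"
  shows "a_form P v w = (LINT t|lebesgue_on (timeint P). space_form (v t) (w t))"
  using bilinear_time_integrable[OF conv_form_bilinear assms] bilinear_time_integrable[OF grad_form_bilinear assms]
    bilinear_time_integrable[OF mass_form_bilinear assms]
  by (simp add: a_form_def st_ip_def diff_form_def space_form_def conv_form_def grad_form_def mass_form_def)

end

context bounded_domain
begin

lemma H1_dt_sum:
  assumes "finite I" "S \<in> sets lebesgue" "\<And>i. i \<in> I \<Longrightarrow> v i \<in> H1_dt S"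
  shows "(\<lambda>t. \<Sum>i\<in>I. v i t) \<in> H1_dt S"
  using assms(1,3)
proof (induction I rule: finite_induct)
  case empty
  then show ?case using H10.bochner_zero by (simp only: sum.empty)
next
  case (insert i I)
  then have "v i \<in> H1_dt S" "(\<lambda>t. \<Sum>i\<in>I. v i t) \<in> H1_dt S" by auto
  from H10.bochner_add[OF assms(2) this] show ?case by (simp only: sum.insert[OF insert(1,2)])
qed

end

context dwr_problem
begin

section \<open>Trial and test functions with traces at the time nodes\<close>

text \<open>The traces in the forms are choices; this says that there is something to choose from at every node
  at which a form uses them.\<close>

definition has_traces :: "(real \<Rightarrow> real^'d \<Rightarrow> real) \<Rightarrow> bool" where
  "has_traces v \<longleftrightarrow> (\<forall>m\<in>{1..M}. (\<exists>w. ess_lim_right A v (T (m - 1)) w) \<and> (\<exists>w. ess_lim_left A v (T m) w))"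

text \<open>Common domains on which the forms below are bilinear: both \<open>X\<close> and the finite element space lie in
  \<open>trial_space\<close>, and \<open>Y\<close> lies in \<open>test_space\<close>.\<close>

definition test_space :: "(real \<Rightarrow> real^'d \<Rightarrow> real) set" where
  "test_space = {v \<in> L2H10 P. has_traces v}"

definition trial_space :: "(real \<Rightarrow> real^'d \<Rightarrow> real) set" where
  "trial_space = {v \<in> test_space. \<forall>m\<in>{1..M}. \<exists>g. is_weak_dt A (T (m - 1)) (T m) v g}"

lemma tr_plus_works: "has_traces v \<Longrightarrow> k < M \<Longrightarrow> ess_lim_right A v (T k) (tr_plus P v k)"
proof -
  assume "has_traces v" "k < M"
  then have "\<exists>w. ess_lim_right A v (T (Suc k - 1)) w" unfolding has_traces_def by (metis Suc_leI atLeastAtMost_iff le_add1 plus_1_eq_Suc)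
  then show ?thesis unfolding tr_plus_def by (simp add: someI_ex)
qed

lemma tr_minus_works: "has_traces v \<Longrightarrow> k \<in> {1..M} \<Longrightarrow> ess_lim_left A v (T k) (tr_minus P v k)"
  unfolding has_traces_def tr_minus_def by (simp add: someI_ex)

lemma tr_plus_in_L2: "has_traces v \<Longrightarrow> k < M \<Longrightarrow> tr_plus P v k \<in> L2 A"
  using tr_plus_works unfolding ess_lim_right_def by blast

lemma tr_minus_in_L2: "has_traces v \<Longrightarrow> k \<in> {1..M} \<Longrightarrow> tr_minus P v k \<in> L2 A"
  using tr_minus_works unfolding ess_lim_left_def by blast

lemma tr_plus_eq:
  assumes "ess_lim_right A v (T k) w" "y \<in> L2 A"
  shows "ip A (tr_plus P v k) y = ip A w y"
proof -
  have t: "ess_lim_right A v (T k) (tr_plus P v k)" 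
    unfolding tr_plus_def by (rule someI[of "\<lambda>w. ess_lim_right A v (T k) w", OF assms(1)])
  show ?thesis
    using t assms ess_lim_right_unique[OF t assms(1)]
    by (intro L2_norm_0_imp_ip_eq) (auto simp: ess_lim_right_def)
qed

lemma tr_minus_eq:
  assumes "ess_lim_left A v (T k) w" "y \<in> L2 A"
  shows "ip A (tr_minus P v k) y = ip A w y"
proof -
  have t: "ess_lim_left A v (T k) (tr_minus P v k)" 
    unfolding tr_minus_def by (rule someI[of "\<lambda>w. ess_lim_left A v (T k) w", OF assms(1)])
  show ?thesis
    using t assms ess_lim_left_unique[OF t assms(1)]
    by (intro L2_norm_0_imp_ip_eq) (auto simp: ess_lim_left_def)
qed

lemma has_traces_comb:
  assumes "has_traces v" "has_traces w"
  shows "has_traces (v + s *\<^sub>R w)"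
  using assms ess_lim_right_comb ess_lim_left_comb unfolding has_traces_def by meson

lemma tr_plus_comb:
  assumes "has_traces v" "has_traces w" "k < M" "y \<in> L2 A"
  shows "ip A (tr_plus P (v + s *\<^sub>R w) k) y = ip A (tr_plus P v k) y + s * ip A (tr_plus P w k) y"
  using tr_plus_eq[OF ess_lim_right_comb[OF tr_plus_works tr_plus_works, OF assms(1,3,2,3)] assms(4)]
    assms by (simp add: ip_linear tr_plus_in_L2)

lemma tr_minus_comb:
  assumes "has_traces v" "has_traces w" "k \<in> {1..M}" "y \<in> L2 A"
  shows "ip A (tr_minus P (v + s *\<^sub>R w) k) y = ip A (tr_minus P v k) y + s * ip A (tr_minus P w k) y"
  using tr_minus_eq[OF ess_lim_left_comb[OF tr_minus_works tr_minus_works, OF assms(1,3,2,3)] assms(4)]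
    assms by (simp add: ip_linear tr_minus_in_L2)

lemma jump_ip:
  assumes "has_traces v" "k \<in> {1..<M}" "y \<in> L2 A"
  shows "ip A (jump P v k) y = ip A (tr_plus P v k) y - ip A (tr_minus P v k) y"
  using ip_linear[of "tr_plus P v k" "tr_minus P v k" y "-1"] assms
  by (simp add: jump_def tr_plus_in_L2 tr_minus_in_L2)

lemma jump_in_L2: "has_traces v \<Longrightarrow> k \<in> {1..<M} \<Longrightarrow> jump P v k \<in> L2 A"
  unfolding jump_def by (intro L2.diff_in tr_plus_in_L2 tr_minus_in_L2) auto

lemma test_space_comb: "v \<in> test_space \<Longrightarrow> w \<in> test_space \<Longrightarrow> v + s *\<^sub>R w \<in> test_space"
  by (simp add: test_space_def has_traces_comb L2H10_comb)

lemma slab_dt_comb: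
  assumes m: "m \<in> {1..M}" and v: "v \<in> L2H10 P" "is_weak_dt A (T (m - 1)) (T m) v g"
    and w: "w \<in> L2H10 P" "is_weak_dt A (T (m - 1)) (T m) w h"
  shows "is_weak_dt A (T (m - 1)) (T m) (v + s *\<^sub>R w) (\<lambda>t. g t + s *\<^sub>R h t)"
  using is_weak_dt_comb[OF L2H10_slab[OF m v(1), unfolded slab_def] v(2) L2H10_slab[OF m w(1), unfolded slab_def] w(2), of s]
  by (simp add: plus_fun_def scaleR_fun_def)

lemma trial_space_comb: "v \<in> trial_space \<Longrightarrow> w \<in> trial_space \<Longrightarrow> v + s *\<^sub>R w \<in> trial_space"
  using slab_dt_comb[of _ v _ w _ s] test_space_comb[of v w s] unfolding trial_space_def test_space_def by blast

lemma weak_dt_works: "is_weak_dt A a b v g \<Longrightarrow> is_weak_dt A a b v (weak_dt A a b v)"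
  unfolding weak_dt_def by (rule someI[of "\<lambda>g. is_weak_dt A a b v g"])

lemma slab_weak_dt_works:
  "v \<in> trial_space \<Longrightarrow> m \<in> {1..M} \<Longrightarrow> is_weak_dt A (T (m - 1)) (T m) v (weak_dt A (T (m - 1)) (T m) v)"
  unfolding trial_space_def using weak_dt_works by blast

lemma slab_duality_integrable:
  "m \<in> {1..M} \<Longrightarrow> is_weak_dt A (T (m - 1)) (T m) v g \<Longrightarrow> w \<in> L2H10 P \<Longrightarrow>
    integrable (lebesgue_on (slab P m)) (\<lambda>t. g t (w t))"
  using duality_integrable[OF slab_sets, of g m w] L2H10_slab[of m w] is_weak_dt_in by (simp add: slab_def)

lemma slab_LINT_weak_dt:
  assumes m: "m \<in> {1..M}" and g: "is_weak_dt A (T (m - 1)) (T m) v g" and w: "w \<in> L2H10 P"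
  shows "(LINT t|lebesgue_on (slab P m). weak_dt A (T (m - 1)) (T m) v t (w t)) = (LINT t|lebesgue_on (slab P m). g t (w t))"
proof (rule integral_cong_AE)
  have g': "is_weak_dt A (T (m - 1)) (T m) v (weak_dt A (T (m - 1)) (T m) v)"
    by (rule weak_dt_works[OF g])
  show "AE t in lebesgue_on (slab P m). weak_dt A (T (m - 1)) (T m) v t (w t) = g t (w t)"
    using is_weak_dt_unique[OF g' g, of w] L2H10_slab[OF m w] unfolding slab_def by blast
  show "(\<lambda>t. weak_dt A (T (m - 1)) (T m) v t (w t)) \<in> borel_measurable (lebesgue_on (slab P m))"
    using slab_duality_integrable[OF m g' w] by auto
  show "(\<lambda>t. g t (w t)) \<in> borel_measurable (lebesgue_on (slab P m))"
    using slab_duality_integrable[OF m g w] by auto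
qed

lemma dt_sum_eq:
  assumes "\<And>m. m \<in> {1..M} \<Longrightarrow> is_weak_dt A (T (m - 1)) (T m) v (g m)" "w \<in> L2H10 P"
  shows "dt_sum P v w = (\<Sum>m=1..M. LINT t|lebesgue_on (slab P m). g m t (w t))"
  unfolding dt_sum_def by (intro sum.cong refl slab_LINT_weak_dt assms) auto

lemma dt_sum_linear1:
  assumes "v \<in> trial_space" "v' \<in> trial_space" "w \<in> L2H10 P"
  shows "dt_sum P (v + s *\<^sub>R v') w = dt_sum P v w + s * dt_sum P v' w"
proof -
  have L: "v \<in> L2H10 P" "v' \<in> L2H10 P" using assms by (auto simp: trial_space_def test_space_def)
  note g = slab_weak_dt_works[OF assms(1)] and g' = slab_weak_dt_works[OF assms(2)]
  have "dt_sum P (v + s *\<^sub>R v') w = (\<Sum>m=1..M. LINT t|lebesgue_on (slab P m).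
      (weak_dt A (T (m - 1)) (T m) v t + s *\<^sub>R weak_dt A (T (m - 1)) (T m) v' t) (w t))"
    by (intro dt_sum_eq slab_dt_comb g g' L assms)
  also have "\<dots> = (\<Sum>m=1..M. (LINT t|lebesgue_on (slab P m). weak_dt A (T (m - 1)) (T m) v t (w t)) +
      s * (LINT t|lebesgue_on (slab P m). weak_dt A (T (m - 1)) (T m) v' t (w t)))"
  proof (intro sum.cong refl)
    fix m assume m: "m \<in> {1..M}"
    show "(LINT t|lebesgue_on (slab P m). (weak_dt A (T (m - 1)) (T m) v t + s *\<^sub>R weak_dt A (T (m - 1)) (T m) v' t) (w t)) =
      (LINT t|lebesgue_on (slab P m). weak_dt A (T (m - 1)) (T m) v t (w t)) +
      s * (LINT t|lebesgue_on (slab P m). weak_dt A (T (m - 1)) (T m) v' t (w t))"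
      using slab_duality_integrable[OF m g[OF m] assms(3)] slab_duality_integrable[OF m g'[OF m] assms(3)] by simp
  qed
  finally show ?thesis by (simp add: dt_sum_def sum.distrib sum_distrib_left)
qed

lemma dt_sum_linear2:
  assumes v: "v \<in> trial_space" and w: "w \<in> L2H10 P" "w' \<in> L2H10 P"
  shows "dt_sum P v (w + s *\<^sub>R w') = dt_sum P v w + s * dt_sum P v w'"
  unfolding dt_sum_def sum_distrib_left sum.distrib[symmetric]
proof (intro sum.cong refl)
  fix m assume m: "m \<in> {1..M}"
  let ?g = "weak_dt A (T (m - 1)) (T m) v"
  note g = slab_weak_dt_works[OF v m]
  note i = slab_duality_integrable[OF m g w(1)] slab_duality_integrable[OF m g w(2)]
  have "(LINT t|lebesgue_on (slab P m). ?g t ((w + s *\<^sub>R w') t)) =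
      (LINT t|lebesgue_on (slab P m). ?g t (w t) + s * ?g t (w' t))"
  proof (rule integral_cong_AE)
    show "(\<lambda>t. ?g t ((w + s *\<^sub>R w') t)) \<in> borel_measurable (lebesgue_on (slab P m))"
      using slab_duality_integrable[OF m g L2H10_comb[OF w, of s]] by blast
    show "(\<lambda>t. ?g t (w t) + s * ?g t (w' t)) \<in> borel_measurable (lebesgue_on (slab P m))"
      using i by auto
    have "AE t in lebesgue_on (slab P m). ?g t \<in> Hm1 A"
      using Hm1.bochner_AE_in[OF is_weak_dt_in[OF g]] unfolding slab_def .
    with H10.bochner_AE_in[OF L2H10_slab[OF m w(1)]] H10.bochner_AE_in[OF L2H10_slab[OF m w(2)]]
    show "AE t in lebesgue_on (slab P m). ?g t ((w + s *\<^sub>R w') t) = ?g t (w t) + s * ?g t (w' t)"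
      by eventually_elim (simp add: H10.dual_linear)
  qed
  then show "(LINT t|lebesgue_on (slab P m). ?g t ((w + s *\<^sub>R w') t)) =
      (LINT t|lebesgue_on (slab P m). ?g t (w t)) + s * (LINT t|lebesgue_on (slab P m). ?g t (w' t))"
    using i by simp
qed

lemma bilinear_time_linear1:
  assumes B: "bounded_bilinear_on (H10 A) (H1_norm A) (H10 A) (H1_norm A) B"
    and v: "v \<in> L2H10 P" "v' \<in> L2H10 P" "w \<in> L2H10 P"
  shows "(LINT t|lebesgue_on (timeint P). B ((v + s *\<^sub>R v') t) (w t)) =
    (LINT t|lebesgue_on (timeint P). B (v t) (w t)) + s * (LINT t|lebesgue_on (timeint P). B (v' t) (w t))"
proof -
  note i = bilinear_time_integrable[OF B v(1,3)] bilinear_time_integrable[OF B v(2,3)]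
    bilinear_time_integrable[OF B L2H10_comb[OF v(1,2)] v(3), of s]
  have "(LINT t|lebesgue_on (timeint P). B ((v + s *\<^sub>R v') t) (w t)) =
      (LINT t|lebesgue_on (timeint P). B (v t) (w t) + s * B (v' t) (w t))"
  proof (rule integral_cong_AE)
    show "AE t in lebesgue_on (timeint P). B ((v + s *\<^sub>R v') t) (w t) = B (v t) (w t) + s * B (v' t) (w t)"
      using H10.bochner_AE_in[OF v(1)[unfolded L2H10_eq]] H10.bochner_AE_in[OF v(2)[unfolded L2H10_eq]]
        H10.bochner_AE_in[OF v(3)[unfolded L2H10_eq]]
      by eventually_elim (simp add: bounded_bilinear_on_linear1[OF B])
  qed (use i in \<open>auto simp del: plus_fun_apply\<close>)
  then show ?thesis using i by simp
qed

lemma bilinear_time_linear2: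
  assumes B: "bounded_bilinear_on (H10 A) (H1_norm A) (H10 A) (H1_norm A) B"
    and v: "v \<in> L2H10 P" "w \<in> L2H10 P" "w' \<in> L2H10 P"
  shows "(LINT t|lebesgue_on (timeint P). B (v t) ((w + s *\<^sub>R w') t)) =
    (LINT t|lebesgue_on (timeint P). B (v t) (w t)) + s * (LINT t|lebesgue_on (timeint P). B (v t) (w' t))"
proof -
  note i = bilinear_time_integrable[OF B v(1,2)] bilinear_time_integrable[OF B v(1,3)]
    bilinear_time_integrable[OF B v(1) L2H10_comb[OF v(2,3)], of s]
  have "(LINT t|lebesgue_on (timeint P). B (v t) ((w + s *\<^sub>R w') t)) =
      (LINT t|lebesgue_on (timeint P). B (v t) (w t) + s * B (v t) (w' t))"
  proof (rule integral_cong_AE)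
    show "AE t in lebesgue_on (timeint P). B (v t) ((w + s *\<^sub>R w') t) = B (v t) (w t) + s * B (v t) (w' t)"
      using H10.bochner_AE_in[OF v(1)[unfolded L2H10_eq]] H10.bochner_AE_in[OF v(2)[unfolded L2H10_eq]]
        H10.bochner_AE_in[OF v(3)[unfolded L2H10_eq]]
      by eventually_elim (simp add: bounded_bilinear_on_linear2[OF B])
  qed (use i in \<open>auto simp del: plus_fun_apply\<close>)
  then show ?thesis using i by simp
qed

text \<open>\<open>A_form\<close> completed by the initial term, so that primal residual and Lagrangian are a linear
  functional of the test function minus this form.\<close>

definition B_form :: "(real \<Rightarrow> real^'d \<Rightarrow> real) \<Rightarrow> (real \<Rightarrow> real^'d \<Rightarrow> real) \<Rightarrow> real" where
  "B_form v w = A_form P v w + ip A (tr_plus P v 0) (tr_plus P w 0)"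

definition load :: "(real \<Rightarrow> real^'d \<Rightarrow> real) \<Rightarrow> real" where
  "load w = F_form P w + ip A (init P) (tr_plus P w 0)"

lemma init_in_L2: "init P \<in> L2 A" using data by (simp add: admissible_data_def)

lemma B_form_linear1:
  assumes "v \<in> trial_space" "v' \<in> trial_space" "w \<in> test_space"
  shows "B_form (v + s *\<^sub>R v') w = B_form v w + s * B_form v' w"
proof -
  have L: "v \<in> L2H10 P" "v' \<in> L2H10 P" "w \<in> L2H10 P" and t: "has_traces v" "has_traces v'" "has_traces w"
    using assms by (auto simp: trial_space_def test_space_def)
  have j: "ip A (jump P (v + s *\<^sub>R v') k) (tr_plus P w k) =
      ip A (jump P v k) (tr_plus P w k) + s * ip A (jump P v' k) (tr_plus P w k)"
    if "k \<in> {1..<M}" for k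
    using that t has_traces_comb[OF t(1,2), of s]
    by (simp add: jump_ip tr_plus_comb tr_minus_comb tr_plus_in_L2 algebra_simps)
  have "(\<Sum>m=2..M. ip A (jump P (v + s *\<^sub>R v') (m - 1)) (tr_plus P w (m - 1))) =
     (\<Sum>m=2..M. ip A (jump P v (m - 1)) (tr_plus P w (m - 1))) +
     s * (\<Sum>m=2..M. ip A (jump P v' (m - 1)) (tr_plus P w (m - 1)))"
    unfolding sum_distrib_left sum.distrib[symmetric] by (intro sum.cong refl j) auto
  moreover have "a_form P (v + s *\<^sub>R v') w = a_form P v w + s * a_form P v' w"
    using bilinear_time_linear1[OF space_form_bilinear L] L2H10_comb[OF L(1,2)] L by (simp only: a_form_eq)
  ultimately show ?thesis
    using dt_sum_linear1[OF assms(1,2) L(3)] tr_plus_comb[OF t(1,2) _ tr_plus_in_L2[OF t(3)]] nslab_ge_1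
    by (simp add: B_form_def A_form_def algebra_simps)
qed

lemma B_form_linear2:
  assumes "v \<in> trial_space" "w \<in> test_space" "w' \<in> test_space"
  shows "B_form v (w + s *\<^sub>R w') = B_form v w + s * B_form v w'"
proof -
  have L: "v \<in> L2H10 P" "w \<in> L2H10 P" "w' \<in> L2H10 P" and t: "has_traces v" "has_traces w" "has_traces w'"
    using assms by (auto simp: trial_space_def test_space_def)
  have c: "ip A y (tr_plus P (w + s *\<^sub>R w') k) = ip A y (tr_plus P w k) + s * ip A y (tr_plus P w' k)"
    if "k < M" "y \<in> L2 A" for k y
    using tr_plus_comb[OF t(2,3) that] by (simp add: ip_commute[of y])
  have "(\<Sum>m=2..M. ip A (jump P v (m - 1)) (tr_plus P (w + s *\<^sub>R w') (m - 1))) =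
     (\<Sum>m=2..M. ip A (jump P v (m - 1)) (tr_plus P w (m - 1))) +
     s * (\<Sum>m=2..M. ip A (jump P v (m - 1)) (tr_plus P w' (m - 1)))"
    unfolding sum_distrib_left sum.distrib[symmetric]
    by (intro sum.cong refl c jump_in_L2 t) auto
  moreover have "a_form P v (w + s *\<^sub>R w') = a_form P v w + s * a_form P v w'"
    using bilinear_time_linear2[OF space_form_bilinear L] L2H10_comb[OF L(2,3)] L by (simp only: a_form_eq)
  ultimately show ?thesis
    using dt_sum_linear2[OF assms(1) L(2,3)] c[of 0 "tr_plus P v 0"] tr_plus_in_L2[OF t(1)] nslab_ge_1
    by (simp add: B_form_def A_form_def algebra_simps)
qed

lemma load_linear:
  assumes "w \<in> test_space" "w' \<in> test_space"
  shows "load (w + s *\<^sub>R w') = load w + s * load w'"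
proof -
  have L: "w \<in> L2H10 P" "w' \<in> L2H10 P" and t: "has_traces w" "has_traces w'"
    using assms by (auto simp: test_space_def)
  have src: "src P \<in> Hm1_dt (timeint P)" using data by (simp add: admissible_data_def)
  note L' = L[unfolded L2H10_eq]
  note i = duality_integrable[OF timeint_sets src L'(1)] duality_integrable[OF timeint_sets src L'(2)]
    duality_integrable[OF timeint_sets src L2H10_comb[OF L, of s, unfolded L2H10_eq]]
  have "F_form P (w + s *\<^sub>R w') = (LINT t|lebesgue_on (timeint P). src P t (w t) + s * src P t (w' t))"
    unfolding F_form_def
  proof (rule integral_cong_AE)
    show "AE t in lebesgue_on (timeint P). src P t ((w + s *\<^sub>R w') t) = src P t (w t) + s * src P t (w' t)"
      using Hm1.bochner_AE_in[OF src] H10.bochner_AE_in[OF L'(1)] H10.bochner_AE_in[OF L'(2)]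
      by eventually_elim (simp add: H10.dual_linear)
    show "(\<lambda>t. src P t ((w + s *\<^sub>R w') t)) \<in> borel_measurable (lebesgue_on (timeint P))" using i(3) by blast
  qed (use i in auto)
  then have "F_form P (w + s *\<^sub>R w') = F_form P w + s * F_form P w'" using i by (simp add: F_form_def)
  then show ?thesis
    using tr_plus_comb[OF t _ init_in_L2] nslab_ge_1
    by (simp add: load_def ip_commute[of "init P"] algebra_simps)
qed

lemma primal_residual_eq:
  assumes "v \<in> trial_space" "w \<in> test_space"
  shows "primal_residual P v w = load w - B_form v w"
  using ip_linear[of "tr_plus P v 0" "init P" "tr_plus P w 0" "-1"] init_in_L2 tr_plus_in_L2 assms nslab_ge_1
  by (auto simp: primal_residual_def load_def B_form_def trial_space_def test_space_def)

lemma Lagrangian_eq: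
  assumes "v \<in> trial_space" "w \<in> test_space"
  shows "Lagrangian P J v w = J v + load w - B_form v w"
  using ip_linear[of "tr_plus P v 0" "init P" "tr_plus P w 0" "-1"] init_in_L2 tr_plus_in_L2 assms nslab_ge_1
  by (auto simp: Lagrangian_def load_def B_form_def A_form_def trial_space_def test_space_def)

section \<open>Trial, test and finite element spaces\<close>

lemma X_space_subset_trial: "v \<in> X_space P \<Longrightarrow> v \<in> trial_space"
proof -
  assume v: "v \<in> X_space P"
  then obtain g where L: "v \<in> L2H10 P" and g: "is_weak_dt A 0 (T M) v g" by (auto simp: X_space_def)
  have gm: "is_weak_dt A (T (m - 1)) (T m) v g" if "m \<in> {1..M}" for m
    by (rule is_weak_dt_subinterval[OF g tgrid_nonneg tgrid_mono]) (use that in auto)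
  have "has_traces v"
    unfolding has_traces_def
  proof
    fix m assume m: "m \<in> {1..M}"
    from weak_dt_ess_lim[OF slab_ends[OF m] L2H10_slab[OF m L, unfolded slab_def] gm[OF m]]
    show "(\<exists>w. ess_lim_right A v (T (m - 1)) w) \<and> (\<exists>w. ess_lim_left A v (T m) w)" by blast
  qed
  with L gm show ?thesis unfolding trial_space_def test_space_def by blast
qed

lemma X_space_comb: "v \<in> X_space P \<Longrightarrow> w \<in> X_space P \<Longrightarrow> v + s *\<^sub>R w \<in> X_space P"
proof -
  assume v: "v \<in> X_space P" and w: "w \<in> X_space P"
  then obtain g h where g: "is_weak_dt A 0 (T M) v g" and h: "is_weak_dt A 0 (T M) w h"
    and L: "v \<in> L2H10 P" "w \<in> L2H10 P" by (auto simp: X_space_def)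
  have "is_weak_dt A 0 (T M) (v + s *\<^sub>R w) (\<lambda>t. g t + s *\<^sub>R h t)"
    using is_weak_dt_comb[OF L(1)[unfolded L2H10_eq timeint_def] g L(2)[unfolded L2H10_eq timeint_def] h, of s]
    by (simp add: plus_fun_def scaleR_fun_def)
  then show ?thesis using L2H10_comb[OF L] by (auto simp: X_space_def)
qed

lemma X_space_zero: "0 \<in> X_space P"
  using H10.bochner_zero[of "timeint P"] is_weak_dt_zero[of 0 "T M"]
  unfolding X_space_def L2H10_eq zero_fun_def by auto

lemma Y_space_zero: "0 \<in> Y_space P"
proof -
  have "(0 :: real \<Rightarrow> real^'d \<Rightarrow> real) \<in> L2H10 P"
    using X_space_zero by (simp add: X_space_def)
  then show ?thesis
    unfolding Y_space_def by (auto intro!: exI[of _ "0 :: real \<Rightarrow> real^'d \<Rightarrow> real"] simp: H10.zero_in H10.zero)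
qed

lemma Y_space_comb:
  assumes v: "v \<in> Y_space P" and w: "w \<in> Y_space P"
  shows "v + s *\<^sub>R w \<in> Y_space P"
proof -
  have "\<exists>x. (\<forall>t\<in>{T (m - 1)..T m}. x t \<in> H10 A \<and>
        ((\<lambda>s. H1_norm A (x s - x t)) \<longlongrightarrow> 0) (at t within {T (m - 1)..T m})) \<and>
      (AE t in lebesgue_on (slab P m). AE y in lebesgue_on A. (v + s *\<^sub>R w) t y = x t y)" if m: "m \<in> {1..M}" for m
  proof -
    let ?I = "{T (m - 1)..T m}"
    obtain x where x: "\<And>t. t \<in> ?I \<Longrightarrow> x t \<in> H10 A" "\<And>t. t \<in> ?I \<Longrightarrow> ((\<lambda>s. H1_norm A (x s - x t)) \<longlongrightarrow> 0) (at t within ?I)"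
      "AE t in lebesgue_on (slab P m). AE y in lebesgue_on A. v t y = x t y"
      using v m unfolding Y_space_def by blast
    obtain z where z: "\<And>t. t \<in> ?I \<Longrightarrow> z t \<in> H10 A" "\<And>t. t \<in> ?I \<Longrightarrow> ((\<lambda>s. H1_norm A (z s - z t)) \<longlongrightarrow> 0) (at t within ?I)"
      "AE t in lebesgue_on (slab P m). AE y in lebesgue_on A. w t y = z t y"
      using w m unfolding Y_space_def by blast
    have "((\<lambda>r. H1_norm A ((x r + s *\<^sub>R z r) - (x t + s *\<^sub>R z t))) \<longlongrightarrow> 0) (at t within ?I)" if t: "t \<in> ?I" for t
    proof (rule Lim_null_comparison)
      have lim: "((\<lambda>r. H1_norm A (x r - x t) + \<bar>s\<bar> * H1_norm A (z r - z t)) \<longlongrightarrow> 0 + \<bar>s\<bar> * 0) (at t within ?I)"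
        by (intro tendsto_intros x z t)
      then show "((\<lambda>r. H1_norm A (x r - x t) + \<bar>s\<bar> * H1_norm A (z r - z t)) \<longlongrightarrow> 0) (at t within ?I)" by simp
      have "norm (H1_norm A ((x r + s *\<^sub>R z r) - (x t + s *\<^sub>R z t))) \<le> H1_norm A (x r - x t) + \<bar>s\<bar> * H1_norm A (z r - z t)"
        if r: "r \<in> ?I" for r
      proof -
        have eq: "(x r + s *\<^sub>R z r) - (x t + s *\<^sub>R z t) = (x r - x t) + s *\<^sub>R (z r - z t)" by (simp add: algebra_simps)
        have i: "x r - x t \<in> H10 A" "z r - z t \<in> H10 A" using x z r t by (auto intro: H10.diff_in)
        show ?thesis unfolding eq
          using H10.triangle[OF i(1) H10.scale_in[OF i(2)]] H10.scale[OF i(2)] H10.nonneg[OF H10.add_in[OF i(1) H10.scale_in[OF i(2)]]]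
          by simp
      qed
      then show "\<forall>\<^sub>F r in at t within ?I. norm (H1_norm A ((x r + s *\<^sub>R z r) - (x t + s *\<^sub>R z t))) \<le>
          H1_norm A (x r - x t) + \<bar>s\<bar> * H1_norm A (z r - z t)"
        unfolding eventually_at_filter by (intro always_eventually) auto
    qed
    moreover have "AE t in lebesgue_on (slab P m). AE y in lebesgue_on A. (v + s *\<^sub>R w) t y = (x t + s *\<^sub>R z t) y"
      using x(3) z(3)
    proof eventually_elim
      case (elim t)
      from elim show ?case by eventually_elim simp
    qed
    moreover have "x t + s *\<^sub>R z t \<in> H10 A" if "t \<in> ?I" for t
      by (intro H10.add_in H10.scale_in x z that)
    ultimately show ?thesis by (intro exI[of _ "\<lambda>t. x t + s *\<^sub>R z t"] conjI ballI)
  qed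
  then show ?thesis using v w L2H10_comb unfolding Y_space_def by blast
qed

lemma Y_space_subset_test:
  assumes v: "v \<in> Y_space P"
  shows "v \<in> test_space"
proof -
  have L: "v \<in> L2H10 P" using v by (simp add: Y_space_def)
  have "has_traces v"
    unfolding has_traces_def
  proof
    fix m assume m: "m \<in> {1..M}"
    let ?I = "{T (m - 1)..T m}"
    obtain x where x: "\<And>t. t \<in> ?I \<Longrightarrow> x t \<in> H10 A" "\<And>t. t \<in> ?I \<Longrightarrow> ((\<lambda>s. H1_norm A (x s - x t)) \<longlongrightarrow> 0) (at t within ?I)"
      "AE t in lebesgue_on (slab P m). AE y in lebesgue_on A. v t y = x t y"
      using v m unfolding Y_space_def by blast
    have "AE t in lebesgue_on (slab P m). v t \<in> H10 A \<and> (AE y in lebesgue_on A. v t y = x t y)"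
      using x(3) H10.bochner_AE_in[OF L2H10_slab[OF m L]] by eventually_elim simp
    then have vx: "AE t in lebesgue_on {T (m - 1)<..<T m}. v t \<in> H10 A \<and> (AE y in lebesgue_on A. v t y = x t y)"
      by (rule AE_lebesgue_on_subset) (auto simp: slab_def)
    have "ess_lim_right A v (T (m - 1)) (x (T (m - 1)))"
      using x slab_ends[OF m] by (intro ess_lim_right_of_continuous[OF _ _ _ vx]) auto
    moreover have "ess_lim_left A v (T m) (x (T m))"
      using x slab_ends[OF m] by (intro ess_lim_left_of_continuous[OF _ _ _ vx]) auto
    ultimately show "(\<exists>w. ess_lim_right A v (T (m - 1)) w) \<and> (\<exists>w. ess_lim_left A v (T m) w)" by blast
  qed
  with L show ?thesis by (simp add: test_space_def)
qed

lemma XY_space_subspace: "subspace (XY_space P)"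
proof -
  have comb: "v + s *\<^sub>R w \<in> XY_space P" if v: "v \<in> XY_space P" and w: "w \<in> XY_space P" for v w s
  proof -
    obtain a b where ab: "a \<in> X_space P" "b \<in> Y_space P" "v = a + b" using v by (auto simp: XY_space_def elim: set_plus_elim)
    obtain c d where cd: "c \<in> X_space P" "d \<in> Y_space P" "w = c + d" using w by (auto simp: XY_space_def elim: set_plus_elim)
    have "v + s *\<^sub>R w = (a + s *\<^sub>R c) + (b + s *\<^sub>R d)" by (simp add: ab cd scaleR_add_right)
    also have "\<dots> \<in> X_space P + Y_space P" by (intro set_plus_intro X_space_comb Y_space_comb ab cd)
    finally show ?thesis by (simp add: XY_space_def)
  qed
  have z: "0 \<in> XY_space P" using set_plus_intro[OF X_space_zero Y_space_zero] by (simp add: XY_space_def)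
  show ?thesis using comb[of _ _ 1] comb[OF z] z by (intro subspaceI) auto
qed

lemma X_in_XY: "v \<in> X_space P \<Longrightarrow> v \<in> XY_space P"
  using set_plus_intro[OF _ Y_space_zero, of v "X_space P"] by (simp add: XY_space_def)

lemma Y_in_XY: "v \<in> Y_space P \<Longrightarrow> v \<in> XY_space P"
  using set_plus_intro[OF X_space_zero, of v "Y_space P"] by (simp add: XY_space_def)

end

context dwr_problem
begin

subsection \<open>Finite element functions\<close>

lemma Xkh_coefficients:
  assumes "v \<in> Xkh_space P"
  obtains c where "\<And>m i. m \<in> {1..M} \<Longrightarrow> i \<le> tdeg P \<Longrightarrow> c m i \<in> H10 A"
    "\<And>m t x. m \<in> {1..M} \<Longrightarrow> t \<in> slab P m \<Longrightarrow> x \<in> A \<Longrightarrow> v t x = (\<Sum>i\<le>tdeg P. t ^ i *\<^sub>R c m i) x"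
proof -
  have "\<forall>m\<in>{1..M}. \<exists>c. (\<forall>i\<le>tdeg P. c i \<in> FE_space A (mesh P m) (xdeg P)) \<and>
      (\<forall>t\<in>slab P m. \<forall>x\<in>closure A. v t x = (\<Sum>i\<le>tdeg P. t ^ i * c i x))"
    using assms unfolding Xkh_space_def by blast
  from bchoice[OF this] obtain c where
    c: "\<forall>m\<in>{1..M}. (\<forall>i\<le>tdeg P. c m i \<in> FE_space A (mesh P m) (xdeg P)) \<and>
      (\<forall>t\<in>slab P m. \<forall>x\<in>closure A. v t x = (\<Sum>i\<le>tdeg P. t ^ i * c m i x))" ..
  show ?thesis
  proof (rule that[of c])
    show "c m i \<in> H10 A" if "m \<in> {1..M}" "i \<le> tdeg P" for m i
      using c that unfolding FE_space_def by blast
    show "v t x = (\<Sum>i\<le>tdeg P. t ^ i *\<^sub>R c m i) x" if "m \<in> {1..M}" "t \<in> slab P m" "x \<in> A" for m t x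
    proof -
      have "x \<in> closure A" using that closure_subset by blast
      then have "v t x = (\<Sum>i\<le>tdeg P. t ^ i * c m i x)" using c that by blast
      then show ?thesis by (simp add: sum_fun_apply)
    qed
  qed
qed

lemma power_bounded_Ioc:
  fixes a b t :: real
  assumes "0 \<le> a" "a < t" "t \<le> b"
  shows "\<bar>t ^ i\<bar> \<le> b ^ i"
  using assms by (simp add: power_abs[symmetric] power_mono)

lemma Xkh_in_L2H10:
  assumes v: "v \<in> Xkh_space P"
  shows "v \<in> L2H10 P"
proof -
  obtain c where c: "\<And>m i. m \<in> {1..M} \<Longrightarrow> i \<le> tdeg P \<Longrightarrow> c m i \<in> H10 A"
    and vc: "\<And>m t x. m \<in> {1..M} \<Longrightarrow> t \<in> slab P m \<Longrightarrow> x \<in> A \<Longrightarrow> v t x = (\<Sum>i\<le>tdeg P. t ^ i *\<^sub>R c m i) x"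
    using Xkh_coefficients[OF v] by blast
  define w where "w t = (\<Sum>m\<in>{1..M}. \<Sum>i\<le>tdeg P. (indicat_real (slab P m) t * t ^ i) *\<^sub>R c m i)" for t
  have "w \<in> H1_dt (timeint P)"
    unfolding w_def
  proof (intro H1_dt_sum timeint_sets finite_atLeastAtMost finite_atMost)
    fix m i assume m: "m \<in> {1..M}" and i: "i \<in> {..tdeg P}"
    show "(\<lambda>t. (indicat_real (slab P m) t * t ^ i) *\<^sub>R c m i) \<in> H1_dt (timeint P)"
    proof (rule H10.bochner_scaled_const[where K = "T M ^ i", OF timeint_lmeasurable])
      show "(\<lambda>t. indicat_real (slab P m) t * t ^ i) \<in> borel_measurable (lebesgue_on (timeint P))"
        by (rule borel_measurable_lebesgue_onI) (auto simp: slab_def)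
      show "\<bar>indicat_real (slab P m) t * t ^ i\<bar> \<le> T M ^ i" if "t \<in> timeint P" for t
        using power_bounded_Ioc[of 0 t "T M" i] that tgrid_nonneg[of M]
        by (cases "t \<in> slab P m") (auto simp: timeint_def)
    qed (use c m i in auto)
  qed
  moreover have "AE t in lebesgue_on (timeint P). v t \<in> H10 A \<and> H1_norm A (v t - w t) = 0"
  proof (rule AE_I2)
    fix t assume "t \<in> space (lebesgue_on (timeint P))"
    then obtain m where m: "m \<in> {1..M}" "t \<in> slab P m" using timeint_slab[of t] by auto
    have ind: "indicat_real (slab P n) t = (if n = m then 1 else 0)" if "n \<in> {1..M}" for n
    proof (cases "n = m")
      case True
      then show ?thesis using m(2) by simp
    next
      case False
      then have "t \<notin> slab P n" using slab_disjoint[OF m(1) that m(2)] by blast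
      then show ?thesis using False by simp
    qed
    have "w t = (\<Sum>n\<in>{1..M}. if n = m then (\<Sum>i\<le>tdeg P. t ^ i *\<^sub>R c m i) else 0)"
      unfolding w_def
    proof (intro sum.cong refl)
      fix n assume "n \<in> {1..M}"
      then show "(\<Sum>i\<le>tdeg P. (indicat_real (slab P n) t * t ^ i) *\<^sub>R c n i) =
          (if n = m then (\<Sum>i\<le>tdeg P. t ^ i *\<^sub>R c m i) else 0)"
        using ind by (cases "n = m") simp_all
    qed
    then have wt: "w t = (\<Sum>i\<le>tdeg P. t ^ i *\<^sub>R c m i)" using m by (simp add: sum.delta')
    have wH: "w t \<in> H10 A" unfolding wt using c m by (intro H10.sum_in H10.scale_in) auto
    have eq: "AE x in lebesgue_on A. w t x = v t x" using vc[OF m] by (intro AE_I2) (simp add: wt)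
    have vH: "v t \<in> H10 A" by (rule H10_AE_cong[OF wH eq])
    moreover have "H1_norm A (v t - w t) = 0"
      using eq by (intro H1_norm_eq_0 H10_in_H1 H10.diff_in vH wH) (auto elim: eventually_mono)
    ultimately show "v t \<in> H10 A \<and> H1_norm A (v t - w t) = 0" ..
  qed
  ultimately show ?thesis unfolding L2H10_eq by (rule H10.bochner_cong[OF timeint_sets])
qed

lemma polynomial_in_time_continuous:
  fixes t :: real
  assumes c: "\<And>i. i \<le> r \<Longrightarrow> c i \<in> H10 A"
  shows "((\<lambda>s. H1_norm A ((\<Sum>i\<le>r. s ^ i *\<^sub>R c i) - (\<Sum>i\<le>r. t ^ i *\<^sub>R c i))) \<longlongrightarrow> 0) (at t within S)"
proof (rule Lim_null_comparison)
  have "((\<lambda>s. \<Sum>i\<le>r. \<bar>s ^ i - t ^ i\<bar> * H1_norm A (c i)) \<longlongrightarrow> (\<Sum>i\<le>r. \<bar>t ^ i - t ^ i\<bar> * H1_norm A (c i))) (at t within S)"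
    by (intro tendsto_intros)
  then show "((\<lambda>s. \<Sum>i\<le>r. \<bar>s ^ i - t ^ i\<bar> * H1_norm A (c i)) \<longlongrightarrow> 0) (at t within S)" by simp
  have sumle: "H1_norm A (\<Sum>i\<in>I. f i) \<le> (\<Sum>i\<in>I. H1_norm A (f i))" if "finite I" "\<And>i. i \<in> I \<Longrightarrow> f i \<in> H10 A" for I and f :: "nat \<Rightarrow> real^'d \<Rightarrow> real"
    using that
  proof (induction I rule: finite_induct)
    case empty
    then show ?case by (simp only: sum.empty H10.zero order_refl)
  next
    case (insert i I)
    then have "H1_norm A (f i + (\<Sum>i\<in>I. f i)) \<le> H1_norm A (f i) + H1_norm A (\<Sum>i\<in>I. f i)"
      by (intro H10.triangle H10.sum_in) auto
    also have "\<dots> \<le> H1_norm A (f i) + (\<Sum>i\<in>I. H1_norm A (f i))" using insert by simp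
    finally show ?case by (simp only: sum.insert[OF insert(1,2)])
  qed
  have "norm (H1_norm A ((\<Sum>i\<le>r. s ^ i *\<^sub>R c i) - (\<Sum>i\<le>r. t ^ i *\<^sub>R c i))) \<le> (\<Sum>i\<le>r. \<bar>s ^ i - t ^ i\<bar> * H1_norm A (c i))" for s
  proof -
    have eq: "(\<Sum>i\<le>r. s ^ i *\<^sub>R c i) - (\<Sum>i\<le>r. t ^ i *\<^sub>R c i) = (\<Sum>i\<le>r. (s ^ i - t ^ i) *\<^sub>R c i)"
      by (simp add: sum_subtractf[symmetric] scaleR_diff_left)
    have in': "(s ^ i - t ^ i) *\<^sub>R c i \<in> H10 A" if "i \<in> {..r}" for i using c that by (intro H10.scale_in) auto
    have "H1_norm A (\<Sum>i\<le>r. (s ^ i - t ^ i) *\<^sub>R c i) \<le> (\<Sum>i\<le>r. H1_norm A ((s ^ i - t ^ i) *\<^sub>R c i))"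
      by (rule sumle) (use in' in auto)
    moreover have "(\<Sum>i\<le>r. H1_norm A ((s ^ i - t ^ i) *\<^sub>R c i)) = (\<Sum>i\<le>r. \<bar>s ^ i - t ^ i\<bar> * H1_norm A (c i))"
      using c by (intro sum.cong refl H10.scale) auto
    moreover have "0 \<le> H1_norm A (\<Sum>i\<le>r. (s ^ i - t ^ i) *\<^sub>R c i)"
      by (rule H10.nonneg[OF H10.sum_in[OF in']])
    ultimately show ?thesis unfolding eq by simp
  qed
  then show "\<forall>\<^sub>F s in at t within S. norm (H1_norm A ((\<Sum>i\<le>r. s ^ i *\<^sub>R c i) - (\<Sum>i\<le>r. t ^ i *\<^sub>R c i)))
      \<le> (\<Sum>i\<le>r. \<bar>s ^ i - t ^ i\<bar> * H1_norm A (c i))" by (intro always_eventually) blast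
qed

lemma Xkh_subset_Y:
  assumes v: "v \<in> Xkh_space P"
  shows "v \<in> Y_space P"
proof -
  obtain c where c: "\<And>m i. m \<in> {1..M} \<Longrightarrow> i \<le> tdeg P \<Longrightarrow> c m i \<in> H10 A"
    and vc: "\<And>m t x. m \<in> {1..M} \<Longrightarrow> t \<in> slab P m \<Longrightarrow> x \<in> A \<Longrightarrow> v t x = (\<Sum>i\<le>tdeg P. t ^ i *\<^sub>R c m i) x"
    using Xkh_coefficients[OF v] by blast
  have "\<exists>w. (\<forall>t\<in>{T (m - 1)..T m}. w t \<in> H10 A \<and>
        ((\<lambda>s. H1_norm A (w s - w t)) \<longlongrightarrow> 0) (at t within {T (m - 1)..T m})) \<and>
     (AE t in lebesgue_on (slab P m). AE x in lebesgue_on A. v t x = w t x)" if m: "m \<in> {1..M}" for m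
  proof (intro exI[of _ "\<lambda>t. \<Sum>i\<le>tdeg P. t ^ i *\<^sub>R c m i"] conjI ballI)
    show "(\<Sum>i\<le>tdeg P. t ^ i *\<^sub>R c m i) \<in> H10 A" for t
      using c[OF m] by (intro H10.sum_in H10.scale_in) auto
    show "((\<lambda>s. H1_norm A ((\<Sum>i\<le>tdeg P. s ^ i *\<^sub>R c m i) - (\<Sum>i\<le>tdeg P. t ^ i *\<^sub>R c m i))) \<longlongrightarrow> 0)
        (at t within {T (m - 1)..T m})" for t
      by (rule polynomial_in_time_continuous[OF c[OF m]])
    show "AE t in lebesgue_on (slab P m). AE x in lebesgue_on A. v t x = (\<Sum>i\<le>tdeg P. t ^ i *\<^sub>R c m i) x"
      using vc[OF m] by (intro AE_I2) auto
  qed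
  then show ?thesis using Xkh_in_L2H10[OF v] unfolding Y_space_def by blast
qed

lemma Xkh_slab:
  assumes v: "v \<in> Xkh_space P" and m: "m \<in> {1..M}"
    and c: "\<And>i. i \<le> tdeg P \<Longrightarrow> c i \<in> H10 A"
    and vc: "\<And>t x. t \<in> slab P m \<Longrightarrow> x \<in> A \<Longrightarrow> v t x = (\<Sum>i\<le>tdeg P. t ^ i *\<^sub>R c i) x"
  shows "is_weak_dt A (T (m - 1)) (T m) v (\<lambda>t. \<Sum>i\<le>tdeg P. (real i * t ^ (i - 1)) *\<^sub>R (\<lambda>w. ip A (c i) w))"
    and "ess_lim_right A v (T (m - 1)) (\<Sum>i\<le>tdeg P. T (m - 1) ^ i *\<^sub>R c i)"
    and "ess_lim_left A v (T m) (\<Sum>i\<le>tdeg P. T m ^ i *\<^sub>R c i)"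
proof -
  have ab: "T (m - 1) < T m" "0 \<le> T (m - 1)" using slab_ends[OF m] tgrid_nonneg[of "m - 1"] m by auto
  have "is_weak_dt A (T (m - 1)) (T m) (\<lambda>t. \<Sum>i\<le>tdeg P. t ^ i *\<^sub>R c i)
      (\<lambda>t. \<Sum>i\<le>tdeg P. (real i * t ^ (i - 1)) *\<^sub>R (\<lambda>w. ip A (c i) w))"
  proof (rule is_weak_dt_sum[THEN conjunct2], simp, intro conjI)
    fix i assume i: "i \<in> {..tdeg P}"
    show "(\<lambda>t. t ^ i *\<^sub>R c i) \<in> H1_dt {T (m - 1)<..T m}"
    proof (rule H10.bochner_scaled_const[where K = "T m ^ i"])
      show "(\<lambda>t. t ^ i) \<in> borel_measurable (lebesgue_on {T (m - 1)<..T m})"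
        by (rule borel_measurable_lebesgue_onI) auto
    qed (use i c ab power_bounded_Ioc in auto)
    show "is_weak_dt A (T (m - 1)) (T m) (\<lambda>t. t ^ i *\<^sub>R c i) (\<lambda>t. (real i * t ^ (i - 1)) *\<^sub>R (\<lambda>w. ip A (c i) w))"
    proof (rule is_weak_dt_scaled_const[where S = "{}" and K = "real i * T m ^ (i - 1)"])
      show "T (m - 1) \<le> T m" using ab by simp
      show "c i \<in> L2 A" using c i by (simp add: H10_in_L2)
      show "((\<lambda>t. t ^ i) has_real_derivative real i * t ^ (i - 1)) (at t)" for t
        by (auto intro!: derivative_eq_intros)
      show "(\<lambda>t. real i * t ^ (i - 1)) \<in> borel_measurable (lebesgue_on {T (m - 1)<..T m})"
        by (rule borel_measurable_lebesgue_onI) auto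
      show "\<bar>real i * t ^ (i - 1)\<bar> \<le> real i * T m ^ (i - 1)" if "T (m - 1) < t" "t \<le> T m" for t
        using power_bounded_Ioc[OF ab(2) that, of "i - 1"] by (simp add: abs_mult mult_left_mono)
    qed (auto intro: continuous_intros)
  qed
  then show "is_weak_dt A (T (m - 1)) (T m) v (\<lambda>t. \<Sum>i\<le>tdeg P. (real i * t ^ (i - 1)) *\<^sub>R (\<lambda>w. ip A (c i) w))"
    by (rule is_weak_dt_cong[rotated]) (use vc in \<open>auto simp: slab_def\<close>)
  have H: "(\<Sum>i\<le>tdeg P. t ^ i *\<^sub>R c i) \<in> H10 A" for t using c by (intro H10.sum_in H10.scale_in) auto
  have "AE t in lebesgue_on (slab P m). v t \<in> H10 A \<and> (AE x in lebesgue_on A. v t x = (\<Sum>i\<le>tdeg P. t ^ i *\<^sub>R c i) x)"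
  proof (rule AE_I2)
    fix t assume "t \<in> space (lebesgue_on (slab P m))"
    then have eq: "AE x in lebesgue_on A. (\<Sum>i\<le>tdeg P. t ^ i *\<^sub>R c i) x = v t x"
      using vc[of t] by (intro AE_I2) simp
    then show "v t \<in> H10 A \<and> (AE x in lebesgue_on A. v t x = (\<Sum>i\<le>tdeg P. t ^ i *\<^sub>R c i) x)"
      using H10_AE_cong[OF H eq] by (auto elim: eventually_mono)
  qed
  then have eq: "AE t in lebesgue_on {T (m - 1)<..<T m}. v t \<in> H10 A \<and> (AE x in lebesgue_on A. v t x = (\<Sum>i\<le>tdeg P. t ^ i *\<^sub>R c i) x)"
    by (rule AE_lebesgue_on_subset) (auto simp: slab_def)
  note cont = polynomial_in_time_continuous[OF c]
  show "ess_lim_right A v (T (m - 1)) (\<Sum>i\<le>tdeg P. T (m - 1) ^ i *\<^sub>R c i)"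
    by (rule ess_lim_right_of_continuous[OF ab(1) H cont eq])
  show "ess_lim_left A v (T m) (\<Sum>i\<le>tdeg P. T m ^ i *\<^sub>R c i)"
    by (rule ess_lim_left_of_continuous[OF ab(1) H cont eq])
qed

lemma Xkh_subset_trial:
  assumes v: "v \<in> Xkh_space P"
  shows "v \<in> trial_space"
proof -
  obtain c where c: "\<And>m i. m \<in> {1..M} \<Longrightarrow> i \<le> tdeg P \<Longrightarrow> c m i \<in> H10 A"
    and vc: "\<And>m t x. m \<in> {1..M} \<Longrightarrow> t \<in> slab P m \<Longrightarrow> x \<in> A \<Longrightarrow> v t x = (\<Sum>i\<le>tdeg P. t ^ i *\<^sub>R c m i) x"
    using Xkh_coefficients[OF v] by blast
  have "\<exists>g. is_weak_dt A (T (m - 1)) (T m) v g" if m: "m \<in> {1..M}" for m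
    using Xkh_slab(1)[OF v m c[OF m] vc[OF m]] by blast
  then show ?thesis using Y_space_subset_test[OF Xkh_subset_Y[OF v]] unfolding trial_space_def by blast
qed

section \<open>The dual identity for discontinuous arguments\<close>

text \<open>As a factor of a spatial profile, this lets a trial function vary only during \<open>(a,b]\<close>. Subtracting
  \<open>p a\<close> makes it vanish at time 0.\<close>

definition ramp :: "(real \<Rightarrow> real) \<Rightarrow> real \<Rightarrow> real \<Rightarrow> real \<Rightarrow> real" where
  "ramp p a b t = p (max a (min t b)) - p a"

lemma ramp_continuous:
  assumes "continuous_on UNIV p"
  shows "continuous_on S (ramp p a b)"
proof -
  have "continuous_on S (\<lambda>t. max a (min t b))"
    by (intro continuous_on_max continuous_on_min continuous_on_const continuous_on_id)
  from continuous_on_compose2[OF assms this] show ?thesis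
    unfolding ramp_def[abs_def] by (intro continuous_on_diff continuous_on_const) auto
qed

lemma ramp_bounded:
  assumes "continuous_on UNIV p"
  obtains K where "\<And>t. t \<in> {l..u} \<Longrightarrow> \<bar>ramp p a b t\<bar> \<le> K"
proof -
  have "compact (ramp p a b ` {l..u})"
    using ramp_continuous[OF assms] by (intro compact_continuous_image) auto
  then have "bounded (ramp p a b ` {l..u})" by (rule compact_imp_bounded)
  then obtain K where "\<forall>x\<in>ramp p a b ` {l..u}. norm x \<le> K" unfolding bounded_iff by blast
  then have "\<bar>ramp p a b t\<bar> \<le> K" if "t \<in> {l..u}" for t using that by auto
  then show ?thesis by (rule that)
qed

lemma ramp_derivative:
  assumes p: "\<And>t. (p has_real_derivative p' t) (at t)" and t: "t \<noteq> a" "t \<noteq> b" and ab: "a \<le> b"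
  shows "(ramp p a b has_real_derivative (if a < t \<and> t \<le> b then p' t else 0)) (at t)"
proof -
  consider "t < a" | "a < t" "t < b" | "b < t" using t ab by linarith
  then show ?thesis
  proof cases
    case 1
    have "((\<lambda>t. 0) has_real_derivative 0) (at t)" by simp
    moreover have "\<forall>\<^sub>F s in nhds t. 0 = ramp p a b s"
      using eventually_nhds_in_open[of "{..<a}" t] 1 by (auto simp: ramp_def elim!: eventually_mono)
    ultimately show ?thesis using 1 by (subst (asm) DERIV_cong_ev[OF refl _ refl]) auto
  next
    case 2
    have "((\<lambda>t. p t - p a) has_real_derivative p' t) (at t)" using p[of t] by (auto intro!: derivative_eq_intros)
    moreover have "\<forall>\<^sub>F s in nhds t. p s - p a = ramp p a b s"
      using eventually_nhds_in_open[of "{a<..<b}" t] 2 by (auto simp: ramp_def elim!: eventually_mono)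
    ultimately show ?thesis using 2 by (subst (asm) DERIV_cong_ev[OF refl _ refl]) auto
  next
    case 3
    have "((\<lambda>t. p b - p a) has_real_derivative 0) (at t)" by simp
    moreover have "\<forall>\<^sub>F s in nhds t. p b - p a = ramp p a b s"
      using eventually_nhds_in_open[of "{b<..}" t] 3 ab by (auto simp: ramp_def elim!: eventually_mono)
    ultimately show ?thesis using 3 by (subst (asm) DERIV_cong_ev[OF refl _ refl]) auto
  qed
qed

lemma ramp_trial:
  assumes p: "\<And>t. (p has_real_derivative p' t) (at t)" and p': "continuous_on UNIV p'"
    and ab: "0 \<le> a" "a \<le> b" and c: "c \<in> H10 A"
  defines "\<psi> \<equiv> \<lambda>t. ramp p a b t *\<^sub>R c" and "h \<equiv> \<lambda>t. if a < t \<and> t \<le> b then p' t else 0"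
  shows "\<psi> \<in> X_space P" and "is_weak_dt A 0 (T M) \<psi> (\<lambda>t. h t *\<^sub>R (\<lambda>w. ip A c w))"
    and "\<And>k. k < M \<Longrightarrow> ess_lim_right A \<psi> (T k) (\<psi> (T k))"
    and "\<And>k. k \<in> {1..M} \<Longrightarrow> ess_lim_left A \<psi> (T k) (\<psi> (T k))"
proof -
  have pc: "continuous_on UNIV p" using p by (intro DERIV_continuous_on) (auto intro: has_field_derivative_at_within)
  obtain K where K: "\<And>t. t \<in> {0..T M} \<Longrightarrow> \<bar>ramp p a b t\<bar> \<le> K" using ramp_bounded[OF pc] by blast
  have L: "\<psi> \<in> L2H10 P"
    unfolding \<psi>_def L2H10_eq
    by (rule H10.bochner_scaled_const[where K = K, OF timeint_lmeasurable
          borel_measurable_lebesgue_onI[OF borel_measurable_continuous_onI[OF ramp_continuous[OF pc]]]])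
      (use K c in \<open>auto simp: timeint_def\<close>)
  have "compact (p' ` {a..b})" using p' by (intro compact_continuous_image) (auto intro: continuous_on_subset)
  then have "bounded (p' ` {a..b})" by (rule compact_imp_bounded)
  then obtain C where "\<forall>x\<in>p' ` {a..b}. norm x \<le> C" unfolding bounded_iff by blast
  then have C: "\<bar>p' t\<bar> \<le> C" if "t \<in> {a..b}" for t using that by auto
  have hm: "h \<in> borel_measurable borel"
  proof -
    have "p' \<in> borel_measurable borel" using p' by (rule borel_measurable_continuous_onI)
    then show ?thesis unfolding h_def by measurable
  qed
  show g: "is_weak_dt A 0 (T M) \<psi> (\<lambda>t. h t *\<^sub>R (\<lambda>w. ip A c w))"
    unfolding \<psi>_def
  proof (rule is_weak_dt_scaled_const[where S = "{a, b}" and K = "\<bar>C\<bar>"])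
    show "0 \<le> T M" by (rule tgrid_nonneg) simp
    show "(ramp p a b has_real_derivative h t) (at t)" if "t \<notin> {a, b}" for t
      unfolding h_def using ramp_derivative[OF p _ _ ab(2), of t] that by auto
    show "h \<in> borel_measurable (lebesgue_on {0<..T M})" using hm by (rule borel_measurable_lebesgue_onI)
    show "\<bar>h t\<bar> \<le> \<bar>C\<bar>" for t using C[of t] by (auto simp: h_def intro: order_trans)
  qed (use ramp_continuous[OF pc] c in \<open>auto intro: H10_in_L2\<close>)
  show "\<psi> \<in> X_space P" using L g by (auto simp: X_space_def)
  have H: "\<psi> t \<in> H10 A" for t unfolding \<psi>_def by (rule H10.scale_in[OF c])
  have cont: "((\<lambda>s. H1_norm A (\<psi> s - \<psi> t)) \<longlongrightarrow> 0) (at t within S)" for t S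
  proof -
    have "H1_norm A (\<psi> s - \<psi> t) = \<bar>ramp p a b s - ramp p a b t\<bar> * H1_norm A c" for s
      unfolding \<psi>_def by (simp add: scaleR_diff_left[symmetric] H10.scale[OF c])
    moreover have "(ramp p a b \<longlongrightarrow> ramp p a b t) (at t within S)"
      using ramp_continuous[OF pc, of UNIV] tendsto_within_subset by (fastforce simp: continuous_on_def)
    then have "((\<lambda>s. \<bar>ramp p a b s - ramp p a b t\<bar> * H1_norm A c) \<longlongrightarrow> \<bar>ramp p a b t - ramp p a b t\<bar> * H1_norm A c) (at t within S)"
      by (intro tendsto_intros)
    ultimately show ?thesis by simp
  qed
  show "ess_lim_right A \<psi> (T k) (\<psi> (T k))" if "k < M" for k
    using tgrid_strict_mono[of k M] that H
    by (intro ess_lim_right_of_continuous[of "T k" "T M" \<psi>] cont) auto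
  show "ess_lim_left A \<psi> (T k) (\<psi> (T k))" if "k \<in> {1..M}" for k
    using tgrid_strict_mono[of 0 k] that H
    by (intro ess_lim_left_of_continuous[of "T 0" "T k" \<psi>] cont) auto
qed

text \<open>Ramps are continuous in time, so the jump terms drop out, and so does the initial term.\<close>

lemma B_form_ramp:
  assumes p: "\<And>t. (p has_real_derivative p' t) (at t)" and p': "continuous_on UNIV p'"
    and ab: "0 \<le> a" "a \<le> b" "b \<le> T M" and c: "c \<in> H10 A" and z: "z \<in> test_space"
  shows "B_form (\<lambda>t. ramp p a b t *\<^sub>R c) z = (LINT t|lebesgue_on {a<..b}. p' t * ip A c (z t)) +
    (LINT t|lebesgue_on (timeint P). ramp p a b t * space_form c (z t))"
proof -
  let ?\<psi> = "\<lambda>t. ramp p a b t *\<^sub>R c"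
  define h where "h t = (if a < t \<and> t \<le> b then p' t else 0)" for t
  note R = ramp_trial[OF p p' ab(1,2) c, folded h_def]
  have zL: "z \<in> L2H10 P" and zt: "has_traces z" using z by (auto simp: test_space_def)
  have psi: "?\<psi> \<in> trial_space" by (rule X_space_subset_trial[OF R(1)])
  then have psiL: "?\<psi> \<in> L2H10 P" and psit: "has_traces ?\<psi>" by (auto simp: trial_space_def test_space_def)
  have g: "is_weak_dt A (T (m - 1)) (T m) ?\<psi> (\<lambda>t. h t *\<^sub>R (\<lambda>w. ip A c w))" if "m \<in> {1..M}" for m
    by (rule is_weak_dt_subinterval[OF R(2) tgrid_nonneg tgrid_mono]) (use that in auto)
  have "(\<lambda>t. h t *\<^sub>R (\<lambda>w. ip A c w)) \<in> Hm1_dt (timeint P)"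
    using is_weak_dt_in[OF R(2)] by (simp add: timeint_def)
  from duality_integrable[OF timeint_sets this zL[unfolded L2H10_eq]]
  have hi: "integrable (lebesgue_on (timeint P)) (\<lambda>t. h t * ip A c (z t))" by simp
  have "dt_sum P ?\<psi> z = (LINT t|lebesgue_on (timeint P). h t * ip A c (z t))"
    using dt_sum_eq[OF g zL] LINT_timeint[OF hi] by simp
  also have "\<dots> = (LINT t|lebesgue_on {a<..b}. p' t * ip A c (z t))"
  proof -
    have "indicat_real (timeint P) t * (h t * ip A c (z t)) = indicat_real {a<..b} t * (p' t * ip A c (z t))" for t
      using ab by (auto simp: h_def timeint_def indicator_def)
    then have "(LINT t|lebesgue. indicat_real (timeint P) t * (h t * ip A c (z t))) =
        (LINT t|lebesgue. indicat_real {a<..b} t * (p' t * ip A c (z t)))" by presburger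
    then show ?thesis by (simp add: integral_restrict_space)
  qed
  finally have dt: "dt_sum P ?\<psi> z = (LINT t|lebesgue_on {a<..b}. p' t * ip A c (z t))" .
  have "a_form P ?\<psi> z = (LINT t|lebesgue_on (timeint P). space_form (ramp p a b t *\<^sub>R c) (z t))"
    by (rule a_form_eq[OF psiL zL])
  also have "\<dots> = (LINT t|lebesgue_on (timeint P). ramp p a b t * space_form c (z t))"
  proof (rule integral_cong_AE)
    have eq: "space_form (ramp p a b t *\<^sub>R c) w = ramp p a b t * space_form c w" if "w \<in> H10 A" for t w
      using bounded_bilinear_on_linear1[OF space_form_bilinear H10.zero_in c that, of "ramp p a b t"]
        bounded_bilinear_on_diff1[OF space_form_bilinear c c that] by simp
    show e: "AE t in lebesgue_on (timeint P). space_form (ramp p a b t *\<^sub>R c) (z t) = ramp p a b t * space_form c (z t)"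
      using H10.bochner_AE_in[OF zL[unfolded L2H10_eq]] by eventually_elim (rule eq)
    show m: "(\<lambda>t. space_form (ramp p a b t *\<^sub>R c) (z t)) \<in> borel_measurable (lebesgue_on (timeint P))"
      using bilinear_time_integrable[OF space_form_bilinear psiL zL] by auto
    show "(\<lambda>t. ramp p a b t * space_form c (z t)) \<in> borel_measurable (lebesgue_on (timeint P))"
      by (rule borel_measurable_lebesgue_on_AE_cong[OF timeint_sets m e])
  qed
  finally have af: "a_form P ?\<psi> z = (LINT t|lebesgue_on (timeint P). ramp p a b t * space_form c (z t))" .
  have j0: "ip A (jump P ?\<psi> k) (tr_plus P z k) = 0" if "k \<in> {1..<M}" for k
    using that tr_plus_eq[OF R(3), of k "tr_plus P z k"] tr_minus_eq[OF R(4), of k "tr_plus P z k"]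
      jump_ip[OF psit, of k "tr_plus P z k"] tr_plus_in_L2[OF zt, of k] by auto
  have "(\<Sum>m=2..M. ip A (jump P ?\<psi> (m - 1)) (tr_plus P z (m - 1))) = 0"
  proof (intro sum.neutral ballI)
    fix m assume "m \<in> {2..M}"
    then have "m - 1 \<in> {1..<M}" by auto
    then show "ip A (jump P ?\<psi> (m - 1)) (tr_plus P z (m - 1)) = 0" by (rule j0)
  qed
  moreover have "ip A (tr_plus P ?\<psi> 0) (tr_plus P z 0) = 0"
  proof -
    have "ramp p a b (T 0) = 0" using ab by (auto simp: ramp_def tgrid_0 max_def min_def)
    then show ?thesis
      using tr_plus_eq[OF R(3), of 0 "tr_plus P z 0"] tr_plus_in_L2[OF zt, of 0] nslab_ge_1 by (simp add: ip_def)
  qed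
  ultimately show ?thesis by (simp add: B_form_def A_form_def dt af)
qed

end

context dwr_problem
begin

context
  fixes z \<beta> :: "real \<Rightarrow> real^'d \<Rightarrow> real"
  assumes z: "z \<in> test_space"
    and \<beta>: "\<beta> \<in> bochner_L2 (timeint P) (L2 A) (L2_norm A)"
    and dual: "\<And>\<psi>. \<psi> \<in> X_space P \<Longrightarrow> st_ip P \<beta> \<psi> = B_form \<psi> z"
begin

text \<open>The density in time of \<open>st_ip P \<beta> \<psi> - a_form P \<psi> z\<close> for trial functions \<open>\<psi>\<close> with spatial profile \<open>c\<close>.\<close>

definition defect :: "(real^'d \<Rightarrow> real) \<Rightarrow> real \<Rightarrow> real" where
  "defect c t = ip A (\<beta> t) c - space_form c (z t)"

lemma z_L2H10: "z \<in> L2H10 P" and z_traces: "has_traces z"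
  using z by (auto simp: test_space_def)

lemma const_H1_dt: "S \<in> lmeasurable \<Longrightarrow> c \<in> H10 A \<Longrightarrow> (\<lambda>t. c) \<in> H1_dt S"
  using H10.bochner_scaled_const[of S "\<lambda>t. 1" 1 c] by simp

lemma ip_bounded_bilinear_L2_H10: "bounded_bilinear_on (L2 A) (L2_norm A) (H10 A) (H1_norm A) (ip A)"
  by (rule bounded_bilinear_on_mono[OF ip_bounded_bilinear])
    (use H10_in_L2 L2_norm_le_H1_norm L2.nonneg in auto)

lemma source_ip_integrable: "v \<in> L2H10 P \<Longrightarrow> integrable (lebesgue_on (timeint P)) (\<lambda>t. ip A (\<beta> t) (v t))"
  using bochner_pairing_integrable[OF L2.seminorm_space_axioms H10.seminorm_space_axioms timeint_sets \<beta> _ ip_bounded_bilinear_L2_H10]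
  by (simp add: L2H10_eq)

lemma profile_integrable:
  assumes c: "c \<in> H10 A"
  shows "integrable (lebesgue_on (timeint P)) (\<lambda>t. ip A (\<beta> t) c)"
    "integrable (lebesgue_on (timeint P)) (\<lambda>t. space_form c (z t))"
    "integrable (lebesgue_on (timeint P)) (defect c)"
    "integrable (lebesgue_on (timeint P)) (\<lambda>t. ip A c (z t))"
proof -
  have cL: "(\<lambda>t. c) \<in> L2H10 P" unfolding L2H10_eq by (rule const_H1_dt[OF timeint_lmeasurable c])
  show a: "integrable (lebesgue_on (timeint P)) (\<lambda>t. ip A (\<beta> t) c)" using source_ip_integrable[OF cL] .
  show b: "integrable (lebesgue_on (timeint P)) (\<lambda>t. space_form c (z t))"
    using bilinear_time_integrable[OF space_form_bilinear cL z_L2H10] .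
  show "integrable (lebesgue_on (timeint P)) (defect c)" unfolding defect_def[abs_def] using a b by simp
  show "integrable (lebesgue_on (timeint P)) (\<lambda>t. ip A c (z t))"
    using bilinear_time_integrable[OF ip_bounded_bilinear_H10 cL z_L2H10] .
qed

lemma ramp_identity:
  assumes p: "\<And>t. (p has_real_derivative p' t) (at t)" and p': "continuous_on UNIV p'"
    and ab: "0 \<le> a" "a \<le> b" "b \<le> T M" and c: "c \<in> H10 A"
  shows "(LINT t|lebesgue_on (timeint P). ramp p a b t * defect c t) = (LINT t|lebesgue_on {a<..b}. p' t * ip A c (z t))"
    and "integrable (lebesgue_on (timeint P)) (\<lambda>t. ramp p a b t * defect c t)"
proof -
  have pc: "continuous_on UNIV p" using p by (intro DERIV_continuous_on) (auto intro: has_field_derivative_at_within)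
  obtain K where K: "\<And>t. t \<in> {0..T M} \<Longrightarrow> \<bar>ramp p a b t\<bar> \<le> K" using ramp_bounded[OF pc] by blast
  have ri: "integrable (lebesgue_on (timeint P)) (\<lambda>t. ramp p a b t * f t)"
    if "integrable (lebesgue_on (timeint P)) f" for f
    by (rule integrable_mult_bounded[OF that
          borel_measurable_lebesgue_onI[OF borel_measurable_continuous_onI[OF ramp_continuous[OF pc]]], where K = K])
      (use K in \<open>auto simp: timeint_def\<close>)
  show "integrable (lebesgue_on (timeint P)) (\<lambda>t. ramp p a b t * defect c t)"
    by (rule ri[OF profile_integrable(3)[OF c]])
  have "st_ip P \<beta> (\<lambda>t. ramp p a b t *\<^sub>R c) = (LINT t|lebesgue_on (timeint P). ramp p a b t * ip A (\<beta> t) c)"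
  proof -
    have "ip A (\<beta> t) (r *\<^sub>R c) = r * ip A (\<beta> t) c" for t r
    proof -
      have "ip A (\<beta> t) (r *\<^sub>R c) = (LINT x|lebesgue_on A. r * (\<beta> t x * c x))"
        unfolding ip_def by (intro Bochner_Integration.integral_cong refl) (simp add: mult.left_commute)
      then show ?thesis by (simp add: ip_def)
    qed
    then show ?thesis by (simp add: st_ip_def)
  qed
  moreover have "st_ip P \<beta> (\<lambda>t. ramp p a b t *\<^sub>R c) = B_form (\<lambda>t. ramp p a b t *\<^sub>R c) z"
    by (rule dual[OF ramp_trial(1)[OF p p' ab(1,2) c]])
  moreover have "(LINT t|lebesgue_on (timeint P). ramp p a b t * defect c t) =
      (LINT t|lebesgue_on (timeint P). ramp p a b t * ip A (\<beta> t) c) - (LINT t|lebesgue_on (timeint P). ramp p a b t * space_form c (z t))"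
    unfolding defect_def right_diff_distrib
    by (intro Bochner_Integration.integral_diff ri profile_integrable c)
  ultimately show "(LINT t|lebesgue_on (timeint P). ramp p a b t * defect c t) = (LINT t|lebesgue_on {a<..b}. p' t * ip A c (z t))"
    using B_form_ramp[OF p p' ab c z] by simp
qed

text \<open>Steep ramps turn the dual identity into a formula for the right limits of the dual solution.\<close>

lemma defect_tail:
  assumes k: "k < M" and c: "c \<in> H10 A"
  shows "(LINT t|lebesgue_on {T k<..T M}. defect c t) = ip A c (tr_plus P z k)"
proof -
  define w where "w = tr_plus P z k"
  define h where "h n = (T M - T k) / real (Suc n)" for n
  define p where "p n t = t / h n" for n and t :: real
  have kM: "T k < T M" "0 \<le> T k" using tgrid_strict_mono[of k M] tgrid_nonneg[of k] k by auto
  have h: "h n > 0" "h n \<le> T M - T k" for n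
    using kM divide_left_mono[of 1 "real (Suc n)" "T M - T k"] by (auto simp: h_def)
  have "h \<longlonglongrightarrow> 0" unfolding h_def by (rule LIMSEQ_Suc[OF lim_const_over_n])
  then have hs: "\<forall>\<^sub>F n in sequentially. h n < e" if "e > 0" for e using that by (rule order_tendstoD(2))
  have pd: "(p n has_real_derivative 1 / h n) (at t)" for n t
    unfolding p_def using h(1)[of n] by (auto intro!: derivative_eq_intros)
  have bM: "T k \<le> T k + h n" "T k + h n \<le> T M" for n using h[of n] by auto
  note R = ramp_identity[OF pd continuous_on_const kM(2) bM c]
  have lhs: "(\<lambda>n. LINT t|lebesgue_on (timeint P). ramp (p n) (T k) (T k + h n) t * defect c t) \<longlonglongrightarrow>
      (LINT t|lebesgue_on (timeint P). indicat_real {T k<..T M} t * defect c t)"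
  proof (rule integral_dominated_convergence[where w = "\<lambda>t. norm (defect c t)"])
    note di = profile_integrable(3)[OF c]
    show "integrable (lebesgue_on (timeint P)) (\<lambda>t. norm (defect c t))" using di by simp
    show "(\<lambda>t. ramp (p n) (T k) (T k + h n) t * defect c t) \<in> borel_measurable (lebesgue_on (timeint P))" for n
      using R(2) by auto
    show "(\<lambda>t. indicat_real {T k<..T M} t * defect c t) \<in> borel_measurable (lebesgue_on (timeint P))"
      by (rule borel_measurable_times[OF borel_measurable_lebesgue_onI borel_measurable_integrable[OF di]]) auto
    show "AE t in lebesgue_on (timeint P). (\<lambda>n. ramp (p n) (T k) (T k + h n) t * defect c t) \<longlonglongrightarrow>
        indicat_real {T k<..T M} t * defect c t"
    proof (intro AE_I2 tendsto_mult tendsto_const)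
      fix t assume "t \<in> space (lebesgue_on (timeint P))"
      then have t: "t \<le> T M" by (simp add: timeint_def)
      show "(\<lambda>n. ramp (p n) (T k) (T k + h n) t) \<longlonglongrightarrow> indicat_real {T k<..T M} t"
      proof (cases "T k < t")
        case True
        have "\<forall>\<^sub>F n in sequentially. ramp (p n) (T k) (T k + h n) t = 1"
          using hs[of "t - T k"] True
        proof (simp, elim eventually_mono)
          fix n assume "h n < t - T k"
          then have "max (T k) (min t (T k + h n)) = T k + h n" using h(1)[of n] by auto
          then show "ramp (p n) (T k) (T k + h n) t = 1"
            using h(1)[of n] by (simp add: ramp_def p_def diff_divide_distrib[symmetric])
        qed
        then have "(\<lambda>n. ramp (p n) (T k) (T k + h n) t) \<longlonglongrightarrow> 1" by (rule tendsto_eventually)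
        then show ?thesis using True t by simp
      next
        case False
        then have "ramp (p n) (T k) (T k + h n) t = 0" for n by (simp add: ramp_def max_def min_def)
        then show ?thesis using False by simp
      qed
    qed
    show "AE t in lebesgue_on (timeint P). norm (ramp (p n) (T k) (T k + h n) t * defect c t) \<le> norm (defect c t)" for n
    proof (rule AE_I2)
      fix t
      have "ramp (p n) (T k) (T k + h n) t = (max (T k) (min t (T k + h n)) - T k) / h n"
        by (simp add: ramp_def p_def diff_divide_distrib)
      moreover have "0 \<le> max (T k) (min t (T k + h n)) - T k" "max (T k) (min t (T k + h n)) - T k \<le> h n"
        using h(1)[of n] by auto
      ultimately have "\<bar>ramp (p n) (T k) (T k + h n) t\<bar> \<le> 1" using h(1)[of n] by simp
      then show "norm (ramp (p n) (T k) (T k + h n) t * defect c t) \<le> norm (defect c t)"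
        by (simp add: abs_mult mult_left_le_one_le)
    qed
  qed
  have ind: "(LINT t|lebesgue_on (timeint P). indicat_real {T k<..T M} t * defect c t) = (LINT t|lebesgue_on {T k<..T M}. defect c t)"
  proof -
    have "indicat_real (timeint P) t * (indicat_real {T k<..T M} t * defect c t) = indicat_real {T k<..T M} t * defect c t" for t
      using kM by (auto simp: timeint_def indicator_def)
    then have "(LINT t|lebesgue. indicat_real (timeint P) t * (indicat_real {T k<..T M} t * defect c t)) =
        (LINT t|lebesgue. indicat_real {T k<..T M} t * defect c t)" by presburger
    then show ?thesis by (simp add: integral_restrict_space)
  qed
  have wL: "w \<in> L2 A" unfolding w_def by (rule tr_plus_in_L2[OF z_traces k])
  have "(\<lambda>n. LINT t|lebesgue_on {T k<..T k + h n}. 1 / h n * ip A c (z t)) \<longlonglongrightarrow> ip A c w"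
  proof (rule LIMSEQ_I)
    fix e :: real assume e: "e > 0"
    \<comment> \<open>The summand 1 covers profiles \<open>c\<close> of norm zero.\<close>
    define e' where "e' = e / (2 * (L2_norm A c + 1))"
    have c0: "0 \<le> L2_norm A c" by (rule L2.nonneg[OF H10_in_L2[OF c]])
    have e': "e' > 0" using e c0 by (simp add: e'_def)
    have "L2_norm A c * e' \<le> (L2_norm A c + 1) * e'" using e' by (intro mult_right_mono) auto
    also have "(L2_norm A c + 1) * e' = e / 2" using c0 by (simp add: e'_def field_simps)
    finally have ce: "L2_norm A c * e' \<le> e / 2" .
    obtain d where d: "d > 0" "AE t in lebesgue_on {T k<..<T k + d}. z t \<in> L2 A \<and> L2_norm A (z t - w) < e'"
      using tr_plus_works[OF z_traces k] e' unfolding ess_lim_right_def w_def by blast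
    obtain n0 where n0: "\<And>n. n \<ge> n0 \<Longrightarrow> h n < d" using hs[OF d(1)] by (auto simp: eventually_sequentially)
    have "norm ((LINT t|lebesgue_on {T k<..T k + h n}. 1 / h n * ip A c (z t)) - ip A c w) < e" if n: "n \<ge> n0" for n
    proof -
      let ?S = "{T k<..T k + h n}"
      interpret time: finite_measure "lebesgue_on ?S" by (rule finite_measure_Ioc)
      have m: "measure (lebesgue_on ?S) ?S = h n" using h(1)[of n] by (simp add: measure_restrict_space)
      have sub: "?S \<subseteq> timeint P" using kM bM(2)[of n] by (auto simp: timeint_def)
      have zi: "integrable (lebesgue_on ?S) (\<lambda>t. ip A c (z t))"
        by (rule integrable_lebesgue_on_subset[OF profile_integrable(4)[OF c] sub]) simp_all
      have "AE t in lebesgue_on ?S. z t \<in> L2 A \<and> L2_norm A (z t - w) < e'"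
        by (rule AE_lebesgue_on_subset[OF d(2)]) (use n0[OF n] in auto)
      then have close: "AE t in lebesgue_on ?S. \<bar>ip A c (z t) - ip A c w\<bar> \<le> e / 2"
      proof eventually_elim
        case (elim t)
        have "ip A c (z t) - ip A c w = ip A c (z t - w)"
          using ip_linear2[OF H10_in_L2[OF c] _ wL, of "z t" "-1"] elim by simp
        then have "\<bar>ip A c (z t) - ip A c w\<bar> \<le> L2_norm A c * L2_norm A (z t - w)"
          using ip_Cauchy_Schwarz[OF H10_in_L2[OF c] L2.diff_in[OF _ wL], of "z t"] elim by simp
        also have "\<dots> \<le> L2_norm A c * e'" using elim c0 by (intro mult_left_mono) auto
        finally show ?case using ce by simp
      qed
      have "(LINT t|lebesgue_on ?S. 1 / h n * ip A c (z t)) - ip A c w = 1 / h n * (LINT t|lebesgue_on ?S. ip A c (z t) - ip A c w)"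
      proof -
        have "(LINT t|lebesgue_on ?S. ip A c (z t) - ip A c w) = (LINT t|lebesgue_on ?S. ip A c (z t)) - h n * ip A c w"
          using zi m by simp
        then show ?thesis using h(1)[of n] by (simp add: field_simps)
      qed
      moreover have "\<bar>LINT t|lebesgue_on ?S. ip A c (z t) - ip A c w\<bar> \<le> h n * (e / 2)"
      proof -
        have "\<bar>LINT t|lebesgue_on ?S. ip A c (z t) - ip A c w\<bar> \<le> (LINT t|lebesgue_on ?S. \<bar>ip A c (z t) - ip A c w\<bar>)"
          by (rule integral_abs_bound)
        also have "\<dots> \<le> (LINT t|lebesgue_on ?S. e / 2)"
          using zi close by (intro integral_mono_AE) auto
        finally show ?thesis using m by simp
      qed
      ultimately have "\<bar>(LINT t|lebesgue_on ?S. 1 / h n * ip A c (z t)) - ip A c w\<bar> \<le> 1 / h n * (h n * (e / 2))"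
        using h(1)[of n] by (simp only: abs_mult) (intro mult_mono, auto)
      also have "\<dots> = e / 2" using h(1)[of n] by simp
      finally show ?thesis using e by simp
    qed
    then show "\<exists>no. \<forall>n\<ge>no. norm ((LINT t|lebesgue_on {T k<..T k + h n}. 1 / h n * ip A c (z t)) - ip A c w) < e" by blast
  qed
  then have "(\<lambda>n. LINT t|lebesgue_on (timeint P). ramp (p n) (T k) (T k + h n) t * defect c t) \<longlonglongrightarrow> ip A c w"
    unfolding R(1) .
  from LIMSEQ_unique[OF lhs this] show ?thesis unfolding ind w_def .
qed

text \<open>At the final node the value 0 is that of an integral over an empty time interval.\<close>

definition node_value :: "(real^'d \<Rightarrow> real) \<Rightarrow> nat \<Rightarrow> real" where
  "node_value c k = (if k < M then ip A c (tr_plus P z k) else 0)"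

lemma defect_tail': "k \<le> M \<Longrightarrow> c \<in> H10 A \<Longrightarrow> (LINT t|lebesgue_on {T k<..T M}. defect c t) = node_value c k"
  using defect_tail[of k c] by (cases "k = M") (auto simp: node_value_def integral_restrict_space)

text \<open>The ramp of \<open>p\<close> over the slab differs from \<open>p\<close> by a constant on the slab and is constant later on.
  The integrals of the defect against these constants are node values.\<close>

lemma slab_parts:
  assumes m: "m \<in> {1..M}" and c: "c \<in> H10 A"
    and p: "\<And>t. (p has_real_derivative p' t) (at t)" and p': "continuous_on UNIV p'"
  shows "(LINT t|lebesgue_on (slab P m). p t * defect c t) =
    (LINT t|lebesgue_on (slab P m). p' t * ip A c (z t)) + p (T (m - 1)) * node_value c (m - 1) - p (T m) * node_value c m"
    and "integrable (lebesgue_on (slab P m)) (\<lambda>t. p t * defect c t)"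
proof -
  let ?a = "T (m - 1)" and ?b = "T m"
  have ab: "0 \<le> ?a" "?a < ?b" "?b \<le> T M" using m slab_ends[OF m] tgrid_nonneg[of "m - 1"] tgrid_mono[of m M] by auto
  have pc: "continuous_on UNIV p" using p by (intro DERIV_continuous_on) (auto intro: has_field_derivative_at_within)
  note di = profile_integrable(3)[OF c]
  have ds: "integrable (lebesgue_on {l<..u}) (defect c)" if "0 \<le> l" "u \<le> T M" for l u
    by (rule integrable_lebesgue_on_subset[OF di]) (use that in \<open>auto simp: timeint_def\<close>)
  have "compact (p ` {?a..?b})" using pc by (intro compact_continuous_image) (auto intro: continuous_on_subset)
  then have "bounded (p ` {?a..?b})" by (rule compact_imp_bounded)
  then obtain K where K: "\<forall>x\<in>p ` {?a..?b}. norm x \<le> K" unfolding bounded_iff by blast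
  have pi: "integrable (lebesgue_on (slab P m)) (\<lambda>t. p t * defect c t)"
    unfolding slab_def
    by (rule integrable_mult_bounded[OF ds[OF ab(1,3)] borel_measurable_lebesgue_onI[OF borel_measurable_continuous_onI[OF pc]], where K = K])
      (use K in auto)
  then show "integrable (lebesgue_on (slab P m)) (\<lambda>t. p t * defect c t)" .
  note R = ramp_identity[OF p p' ab(1) less_imp_le[OF ab(2)] ab(3) c]
  let ?f = "\<lambda>t. ramp p ?a ?b t * defect c t"
  have fi: "integrable (lebesgue_on {0<..T M}) ?f" using R(2) by (simp add: timeint_def)
  have fi': "integrable (lebesgue_on {?a<..T M}) ?f"
    by (rule integrable_lebesgue_on_subset[OF fi]) (use ab in auto)
  have "(LINT t|lebesgue_on (timeint P). ?f t) = (LINT t|lebesgue_on {0<..?a}. ?f t) + ((LINT t|lebesgue_on {?a<..?b}. ?f t) + (LINT t|lebesgue_on {?b<..T M}. ?f t))"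
    unfolding timeint_def using LINT_Ioc_add[of 0 ?a "T M" ?f] LINT_Ioc_add[of ?a ?b "T M" ?f] ab fi fi' by simp
  also have "(LINT t|lebesgue_on {0<..?a}. ?f t) = (LINT t|lebesgue_on {0<..?a}. 0)"
    using ab by (intro Bochner_Integration.integral_cong) (auto simp: ramp_def max_def min_def)
  also have "(LINT t|lebesgue_on {?a<..?b}. ?f t) = (LINT t|lebesgue_on {?a<..?b}. p t * defect c t - p ?a * defect c t)"
    using ab by (intro Bochner_Integration.integral_cong) (auto simp: ramp_def max_def min_def left_diff_distrib)
  also have "\<dots> = (LINT t|lebesgue_on (slab P m). p t * defect c t) - p ?a * (LINT t|lebesgue_on {?a<..?b}. defect c t)"
    using pi ds[OF ab(1,3)] by (simp add: slab_def)
  also have "(LINT t|lebesgue_on {?b<..T M}. ?f t) = (LINT t|lebesgue_on {?b<..T M}. (p ?b - p ?a) * defect c t)"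
    using ab by (intro Bochner_Integration.integral_cong) (auto simp: ramp_def max_def min_def)
  also have "\<dots> = (p ?b - p ?a) * node_value c m" using defect_tail'[of m c] c m by simp
  also have "(LINT t|lebesgue_on {?a<..?b}. defect c t) = node_value c (m - 1) - node_value c m"
  proof -
    have t: "(LINT t|lebesgue_on {?b<..T M}. defect c t) = node_value c m"
      "(LINT t|lebesgue_on {?a<..T M}. defect c t) = node_value c (m - 1)"
      by (rule defect_tail'[OF _ c]; use m in auto)+
    have "(LINT t|lebesgue_on {?a<..T M}. defect c t) =
        (LINT t|lebesgue_on {?a<..?b}. defect c t) + (LINT t|lebesgue_on {?b<..T M}. defect c t)"
      by (rule LINT_Ioc_add[OF less_imp_le[OF ab(2)] ab(3) ds[OF ab(1) order_refl]])
    then show ?thesis unfolding t by simp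
  qed
  finally show "(LINT t|lebesgue_on (slab P m). p t * defect c t) =
    (LINT t|lebesgue_on (slab P m). p' t * ip A c (z t)) + p (T (m - 1)) * node_value c (m - 1) - p (T m) * node_value c m"
    using R(1) by (simp add: slab_def algebra_simps)
qed

lemma ip_sum_left:
  assumes "finite I" "\<And>i. i \<in> I \<Longrightarrow> f i \<in> L2 A" "y \<in> L2 A"
  shows "ip A (\<Sum>i\<in>I. r i *\<^sub>R f i) y = (\<Sum>i\<in>I. r i * ip A (f i) y)"
  using assms(1,2)
proof (induction I rule: finite_induct)
  case empty
  then show ?case by (simp add: ip_def)
next
  case (insert i I)
  have "(\<Sum>i\<in>I. r i *\<^sub>R f i) \<in> L2 A" using insert by (intro L2.sum_in L2.scale_in) auto
  then have eq: "ip A ((\<Sum>i\<in>I. r i *\<^sub>R f i) + r i *\<^sub>R f i) y = ip A (\<Sum>i\<in>I. r i *\<^sub>R f i) y + r i * ip A (f i) y"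
    using insert assms(3) by (intro ip_linear) auto
  have IH: "ip A (\<Sum>i\<in>I. r i *\<^sub>R f i) y = (\<Sum>i\<in>I. r i * ip A (f i) y)"
    by (rule insert.IH) (use insert.prems in blast)
  show ?case
    unfolding sum.insert[OF insert(1,2)] add.commute[of "r i *\<^sub>R f i"] eq IH by (rule add.commute)
qed

lemma space_form_sum_left:
  assumes "finite I" "\<And>i. i \<in> I \<Longrightarrow> f i \<in> H10 A" "y \<in> H10 A"
  shows "space_form (\<Sum>i\<in>I. r i *\<^sub>R f i) y = (\<Sum>i\<in>I. r i * space_form (f i) y)"
  using assms(1,2)
proof (induction I rule: finite_induct)
  case empty
  have "space_form (0 - 0) y = 0"
    using bounded_bilinear_on_diff1[OF space_form_bilinear H10.zero_in H10.zero_in assms(3)] by simp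
  then show ?case by (simp only: sum.empty diff_zero)
next
  case (insert i I)
  have "(\<Sum>i\<in>I. r i *\<^sub>R f i) \<in> H10 A" using insert by (intro H10.sum_in H10.scale_in) auto
  then have eq: "space_form ((\<Sum>i\<in>I. r i *\<^sub>R f i) + r i *\<^sub>R f i) y = space_form (\<Sum>i\<in>I. r i *\<^sub>R f i) y + r i * space_form (f i) y"
    using insert assms(3) by (intro bounded_bilinear_on_linear1[OF space_form_bilinear]) auto
  have IH: "space_form (\<Sum>i\<in>I. r i *\<^sub>R f i) y = (\<Sum>i\<in>I. r i * space_form (f i) y)"
    by (rule insert.IH) (use insert.prems in blast)
  show ?case
    unfolding sum.insert[OF insert(1,2)] add.commute[of "r i *\<^sub>R f i"] eq IH by (rule add.commute)
qed

text \<open>On each slab \<open>v\<close> is a sum of terms \<open>t ^ i *\<^sub>R c\<close>, to which \<open>slab_parts\<close> applies. The terms from the two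
  slabs that meet at a node combine to the jump term there.\<close>

theorem dual_identity_Xkh:
  assumes v: "v \<in> Xkh_space P"
  shows "st_ip P \<beta> v = B_form v z"
proof -
  let ?r = "tdeg P"
  obtain c where c: "\<And>m i. m \<in> {1..M} \<Longrightarrow> i \<le> ?r \<Longrightarrow> c m i \<in> H10 A"
    and vc: "\<And>m t x. m \<in> {1..M} \<Longrightarrow> t \<in> slab P m \<Longrightarrow> x \<in> A \<Longrightarrow> v t x = (\<Sum>i\<le>?r. t ^ i *\<^sub>R c m i) x"
    using Xkh_coefficients[OF v] by blast
  have vL: "v \<in> L2H10 P" by (rule Xkh_in_L2H10[OF v])
  have vt: "has_traces v" using Xkh_subset_trial[OF v] by (simp add: trial_space_def test_space_def)
  have S: "is_weak_dt A (T (m - 1)) (T m) v (\<lambda>t. \<Sum>i\<le>?r. (real i * t ^ (i - 1)) *\<^sub>R (\<lambda>w. ip A (c m i) w))"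
    "ess_lim_right A v (T (m - 1)) (\<Sum>i\<le>?r. T (m - 1) ^ i *\<^sub>R c m i)"
    "ess_lim_left A v (T m) (\<Sum>i\<le>?r. T m ^ i *\<^sub>R c m i)" if m: "m \<in> {1..M}" for m
    by (rule Xkh_slab[OF v m c[OF m] vc[OF m]]; assumption)+
  have pd: "((\<lambda>t. t ^ i) has_real_derivative real i * t ^ (i - 1)) (at t)" for i and t :: real
    by (auto intro!: derivative_eq_intros)
  have pc: "continuous_on UNIV (\<lambda>t::real. real i * t ^ (i - 1))" for i by (intro continuous_intros)
  let ?dt = "\<lambda>m. LINT t|lebesgue_on (slab P m). (\<Sum>i\<le>?r. (real i * t ^ (i - 1)) *\<^sub>R (\<lambda>w. ip A (c m i) w)) (z t)"
  have dt: "dt_sum P v z = (\<Sum>m=1..M. ?dt m)"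
    by (rule dt_sum_eq[OF S(1) z_L2H10])
  let ?plus = "\<lambda>k. ip A (tr_plus P v k) (tr_plus P z k)" and ?minus = "\<lambda>k. ip A (tr_minus P v k) (tr_plus P z k)"
  have slab: "(LINT t|lebesgue_on (slab P m). ip A (\<beta> t) (v t) - space_form (v t) (z t)) =
      ?dt m + ?plus (m - 1) - (if m < M then ?minus m else 0)" if m: "m \<in> {1..M}" for m
  proof -
    let ?L = "lebesgue_on (slab P m)"
    have cH: "c m i \<in> H10 A" if "i \<in> {..?r}" for i using c m that by auto
    have zi: "integrable ?L (\<lambda>t. (real i * t ^ (i - 1)) * ip A (c m i) (z t))" if "i \<in> {..?r}" for i
    proof (rule integrable_mult_bounded)
      show "integrable ?L (\<lambda>t. ip A (c m i) (z t))" by (rule slab_integrable[OF m profile_integrable(4)[OF cH[OF that]]])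
      show "(\<lambda>t. real i * t ^ (i - 1)) \<in> borel_measurable ?L" by (rule borel_measurable_lebesgue_onI) auto
      show "\<bar>real i * t ^ (i - 1)\<bar> \<le> real i * T m ^ (i - 1)" if "t \<in> slab P m" for t
      proof -
        have "0 \<le> T (m - 1)" by (rule tgrid_nonneg) (use m in auto)
        then have "\<bar>t ^ (i - 1)\<bar> \<le> T m ^ (i - 1)"
          by (rule power_bounded_Ioc) (use that in \<open>auto simp: slab_def\<close>)
        then show ?thesis unfolding abs_mult abs_of_nat by (rule mult_left_mono) simp
      qed
    qed
    have "(LINT t|?L. ip A (\<beta> t) (v t) - space_form (v t) (z t)) = (LINT t|?L. (\<Sum>i\<le>?r. t ^ i * defect (c m i) t))"
    proof (rule integral_cong_AE)
      show "(\<lambda>t. ip A (\<beta> t) (v t) - space_form (v t) (z t)) \<in> borel_measurable ?L"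
        using slab_integrable[OF m source_ip_integrable[OF vL]]
          slab_integrable[OF m bilinear_time_integrable[OF space_form_bilinear vL z_L2H10]] by auto
      show "(\<lambda>t. \<Sum>i\<le>?r. t ^ i * defect (c m i) t) \<in> borel_measurable ?L"
        using slab_parts(2)[OF m cH pd pc] by (intro borel_measurable_sum) auto
      have "AE t in ?L. t \<in> slab P m" by (rule AE_I2) simp
      with slab_AE[OF m L2.bochner_AE_in[OF \<beta>]] slab_AE[OF m H10.bochner_AE_in[OF vL[unfolded L2H10_eq]]]
        slab_AE[OF m H10.bochner_AE_in[OF z_L2H10[unfolded L2H10_eq]]]
      show "AE t in ?L. ip A (\<beta> t) (v t) - space_form (v t) (z t) = (\<Sum>i\<le>?r. t ^ i * defect (c m i) t)"
      proof eventually_elim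
        case (elim t)
        let ?p = "\<Sum>i\<le>?r. t ^ i *\<^sub>R c m i"
        have pH: "?p \<in> H10 A" using cH by (intro H10.sum_in H10.scale_in) auto
        have "ip A (\<beta> t) (v t) = ip A ?p (\<beta> t)"
          unfolding ip_commute[of "\<beta> t"] using vc[OF m elim(4)]
          by (intro ip_cong_AE AE_I2 H10_in_L2 elim pH) auto
        also have "\<dots> = (\<Sum>i\<le>?r. t ^ i * ip A (\<beta> t) (c m i))"
          unfolding ip_commute[of "\<beta> t"] using cH elim by (intro ip_sum_left) (auto intro: H10_in_L2)
        finally have "ip A (\<beta> t) (v t) = (\<Sum>i\<le>?r. t ^ i * ip A (\<beta> t) (c m i))" .
        moreover have "space_form (v t) (z t) = space_form ?p (z t)"
          by (rule H10_bilinear_cong[OF space_form_bilinear elim(2) pH elim(3) vc[OF m elim(4)]])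
        moreover have "space_form ?p (z t) = (\<Sum>i\<le>?r. t ^ i * space_form (c m i) (z t))"
          using cH elim by (intro space_form_sum_left) auto
        ultimately show ?case by (simp add: defect_def right_diff_distrib sum_subtractf)
      qed
    qed
    also have "\<dots> = (\<Sum>i\<le>?r. (LINT t|?L. t ^ i * defect (c m i) t))"
      by (intro Bochner_Integration.integral_sum slab_parts(2)[OF m cH pd pc])
    also have "\<dots> = (\<Sum>i\<le>?r. (LINT t|?L. (real i * t ^ (i - 1)) * ip A (c m i) (z t)) +
        T (m - 1) ^ i * node_value (c m i) (m - 1) - T m ^ i * node_value (c m i) m)"
      by (intro sum.cong refl slab_parts(1)[OF m cH pd pc])
    also have "\<dots> = (\<Sum>i\<le>?r. (LINT t|?L. (real i * t ^ (i - 1)) * ip A (c m i) (z t))) +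
        (\<Sum>i\<le>?r. T (m - 1) ^ i * node_value (c m i) (m - 1)) - (\<Sum>i\<le>?r. T m ^ i * node_value (c m i) m)"
      by (simp add: sum.distrib sum_subtractf)
    also have "(\<Sum>i\<le>?r. (LINT t|?L. (real i * t ^ (i - 1)) * ip A (c m i) (z t))) = ?dt m"
      using zi by (simp add: sum_fun_apply)
    also have "(\<Sum>i\<le>?r. T (m - 1) ^ i * node_value (c m i) (m - 1)) = ?plus (m - 1)"
    proof -
      have k: "m - 1 < M" using m by auto
      have y: "tr_plus P z (m - 1) \<in> L2 A" by (rule tr_plus_in_L2[OF z_traces k])
      show ?thesis
        using tr_plus_eq[OF S(2)[OF m] y] ip_sum_left[OF _ _ y, of "{..?r}" "c m" "\<lambda>i. T (m - 1) ^ i"] cH k m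
        by (auto simp: node_value_def H10_in_L2)
    qed
    also have "(\<Sum>i\<le>?r. T m ^ i * node_value (c m i) m) = (if m < M then ?minus m else 0)"
    proof (cases "m < M")
      case True
      have y: "tr_plus P z m \<in> L2 A" by (rule tr_plus_in_L2[OF z_traces True])
      show ?thesis
        using tr_minus_eq[OF S(3)[OF m] y] ip_sum_left[OF _ _ y, of "{..?r}" "c m" "\<lambda>i. T m ^ i"] cH True m
        by (auto simp: node_value_def H10_in_L2)
    qed (simp add: node_value_def)
    finally show ?thesis .
  qed
  note i1 = source_ip_integrable[OF vL] and i2 = bilinear_time_integrable[OF space_form_bilinear vL z_L2H10]
  have "st_ip P \<beta> v - a_form P v z = (LINT t|lebesgue_on (timeint P). ip A (\<beta> t) (v t) - space_form (v t) (z t))"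
    using i1 i2 by (simp add: st_ip_def a_form_eq[OF vL z_L2H10])
  also have "\<dots> = (\<Sum>m=1..M. LINT t|lebesgue_on (slab P m). ip A (\<beta> t) (v t) - space_form (v t) (z t))"
    using i1 i2 by (intro LINT_timeint) simp
  also have "\<dots> = (\<Sum>m=1..M. ?dt m + ?plus (m - 1) - (if m < M then ?minus m else 0))"
    by (intro sum.cong refl slab) auto
  also have "\<dots> = dt_sum P v z + ((\<Sum>m=1..M. ?plus (m - 1)) - (\<Sum>m=1..M. if m < M then ?minus m else 0))"
    unfolding dt by (simp add: sum.distrib sum_subtractf)
  also have "(\<Sum>m=1..M. ?plus (m - 1)) - (\<Sum>m=1..M. if m < M then ?minus m else 0) =
      ?plus 0 + (\<Sum>m=2..M. ip A (jump P v (m - 1)) (tr_plus P z (m - 1)))"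
  proof -
    obtain n where n: "M = Suc n" using nslab_ge_1 by (cases M) auto
    have "(\<Sum>m=1..M. ?plus (m - 1)) = ?plus 0 + (\<Sum>m=2..M. ?plus (m - 1))"
      using nslab_ge_1 by (subst sum.atLeast_Suc_atMost) (auto simp: numeral_2_eq_2)
    moreover have "(\<Sum>m=1..M. if m < M then ?minus m else 0) = (\<Sum>m=2..M. ?minus (m - 1))"
    proof -
      have "(\<Sum>m=1..M. if m < M then ?minus m else 0) = (\<Sum>m=1..n. ?minus m)"
        unfolding n by (simp cong: sum.cong) (intro sum.cong, auto)
      also have "\<dots> = (\<Sum>m=Suc 1..Suc n. ?minus (m - 1))" by (subst sum.shift_bounds_cl_Suc_ivl) simp
      finally show ?thesis by (simp add: n numeral_2_eq_2)
    qed
    moreover have "(\<Sum>m=2..M. ip A (jump P v (m - 1)) (tr_plus P z (m - 1))) = (\<Sum>m=2..M. ?plus (m - 1) - ?minus (m - 1))"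
    proof (intro sum.cong refl)
      fix m assume "m \<in> {2..M}"
      then have k: "m - 1 \<in> {1..<M}" by auto
      then show "ip A (jump P v (m - 1)) (tr_plus P z (m - 1)) = ?plus (m - 1) - ?minus (m - 1)"
        by (intro jump_ip vt tr_plus_in_L2 z_traces) auto
    qed
    ultimately show ?thesis by (simp add: sum_subtractf)
  qed
  finally show ?thesis by (simp add: B_form_def A_form_def)
qed

end

end

section \<open>Differentiation along a segment\<close>

text \<open>The bound is the form in which the definitions of the Frechet derivatives control increments along a
  line; \<open>n\<close> is the norm of its direction.\<close>

lemma DERIV_from_linear_bound:
  fixes g :: "real \<Rightarrow> real"
  assumes n: "0 \<le> n" and K: "0 \<le> K"
    and bd: "\<And>e. e > 0 \<Longrightarrow> \<exists>d>0. \<forall>h. \<bar>h\<bar> * n < d \<longrightarrow> \<bar>g (s + h) - g s - h * L\<bar> \<le> e * (\<bar>h\<bar> * n) * K"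
  shows "(g has_real_derivative L) (at s)"
  unfolding DERIV_def
proof (rule LIM_I)
  fix r :: real assume r: "r > 0"
  define e where "e = r / (2 * (n * K + 1))"
  have nK: "0 \<le> n * K" using n K by simp
  have e: "e > 0" using r nK by (simp add: e_def)
  obtain d where d: "d > 0" "\<And>h. \<bar>h\<bar> * n < d \<Longrightarrow> \<bar>g (s + h) - g s - h * L\<bar> \<le> e * (\<bar>h\<bar> * n) * K"
    using bd[OF e] by blast
  have "norm ((g (s + h) - g s) / h - L) < r" if h: "h \<noteq> 0" "norm (h - 0) < d / (n + 1)" for h
  proof -
    have "\<bar>h\<bar> * (n + 1) < d" using h n by (simp add: field_simps)
    moreover have "\<bar>h\<bar> * n \<le> \<bar>h\<bar> * (n + 1)" by (intro mult_left_mono) auto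
    ultimately have "\<bar>h\<bar> * n < d" by linarith
    from d(2)[OF this] have "\<bar>g (s + h) - g s - h * L\<bar> / \<bar>h\<bar> \<le> e * (n * K)"
      using h by (simp add: field_simps)
    moreover have "(g (s + h) - g s) / h - L = (g (s + h) - g s - h * L) / h" using h by (simp add: field_simps)
    ultimately have "\<bar>(g (s + h) - g s) / h - L\<bar> \<le> e * (n * K)" by simp
    also have "\<dots> \<le> e * (n * K + 1)" using e by (intro mult_left_mono) auto
    also have "\<dots> = r / 2" using nK by (simp add: e_def field_simps)
    finally show ?thesis using r by simp
  qed
  moreover have "d / (n + 1) > 0" using d n by simp
  ultimately show "\<exists>s'>0. \<forall>x. x \<noteq> 0 \<and> norm (x - 0) < s' \<longrightarrow> norm ((g (s + x) - g s) / x - L) < r" by blast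
qed

text \<open>The trapezoidal rule with its exact remainder, corrected to an evaluation of \<open>g1\<close> at the right
  end point. The fundamental theorem applies to \<open>g3 s * s * (s - 1)\<close> because a primitive of it
  can be written down in terms of \<open>g\<close>, \<open>g1\<close> and \<open>g2\<close>.\<close>

lemma segment_expansion:
  fixes g g1 g2 g3 :: "real \<Rightarrow> real"
  assumes "\<And>s. (g has_real_derivative g1 s) (at s)" "\<And>s. (g1 has_real_derivative g2 s) (at s)"
    "\<And>s. (g2 has_real_derivative g3 s) (at s)"
  shows "g 1 - g 0 = g1 1 + 1 / 2 * integral {0..1} (\<lambda>s. g3 s * s * (s - 1)) + 1 / 2 * (- integral {0..1} g2)"
proof -
  define G where "G s = g2 s * s * (s - 1) - g1 s * (2 * s - 1) + 2 * g s" for s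
  have "(G has_real_derivative g3 s * s * (s - 1)) (at s)" for s
    unfolding G_def using assms[of s] by (auto intro!: derivative_eq_intros simp: algebra_simps)
  then have "((\<lambda>s. g3 s * s * (s - 1)) has_integral (G 1 - G 0)) {0..1}"
    by (intro fundamental_theorem_of_calculus)
      (auto simp: has_real_derivative_iff_has_vector_derivative[symmetric] intro: has_field_derivative_at_within)
  moreover have "(g2 has_integral (g1 1 - g1 0)) {0..1}"
    using assms(2) by (intro fundamental_theorem_of_calculus)
      (auto simp: has_real_derivative_iff_has_vector_derivative[symmetric] intro: has_field_derivative_at_within)
  ultimately have "integral {0..1} (\<lambda>s. g3 s * s * (s - 1)) = G 1 - G 0" "integral {0..1} g2 = g1 1 - g1 0"
    by (auto simp: integral_unique)
  then show ?thesis by (simp add: G_def field_simps)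
qed

lemma norm_on_nonneg: "norm_on P D N \<Longrightarrow> v \<in> D \<Longrightarrow> 0 \<le> N v"
  and norm_on_scale: "norm_on P D N \<Longrightarrow> v \<in> D \<Longrightarrow> N (s *\<^sub>R v) = \<bar>s\<bar> * N v"
  unfolding norm_on_def by blast+

lemma dual_space_linear:
  assumes D: "subspace D" and g: "g \<in> dual_space D N" and v: "v \<in> D" "w \<in> D"
  shows "g (v + s *\<^sub>R w) = g v + s * g w" and "g (s *\<^sub>R w) = s * g w"
proof -
  have lin: "g (v + s *\<^sub>R w) = g v + s * g w" if "v \<in> D" "w \<in> D" for v w s
    using g that unfolding dual_space_def by blast
  show "g (v + s *\<^sub>R w) = g v + s * g w" by (rule lin[OF v])
  have "g 0 = 0" using lin[OF subspace_0[OF D] subspace_0[OF D], of 1] by simp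
  then show "g (s *\<^sub>R w) = s * g w" using lin[OF subspace_0[OF D] v(2), of s] by simp
qed

lemma Frechet_derivatives_on_line:
  assumes D: "subspace D" and N: "\<And>v. v \<in> D \<Longrightarrow> 0 \<le> N v" "\<And>v s. v \<in> D \<Longrightarrow> N (s *\<^sub>R v) = \<bar>s\<bar> * N v"
    and v: "v \<in> D" and e: "e \<in> D"
  shows "frechet_deriv1 D N J J1 \<Longrightarrow> ((\<lambda>s. J (v + s *\<^sub>R e)) has_real_derivative J1 (v + s *\<^sub>R e) e) (at s)"
    and "frechet_deriv2 D N J1 J2 \<Longrightarrow> ((\<lambda>s. J1 (v + s *\<^sub>R e) e) has_real_derivative J2 (v + s *\<^sub>R e) e e) (at s)"
    and "frechet_deriv3 D N J2 J3 \<Longrightarrow> ((\<lambda>s. J2 (v + s *\<^sub>R e) e e) has_real_derivative J3 (v + s *\<^sub>R e) e e e) (at s)"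
proof -
  let ?x = "v + s *\<^sub>R e"
  have x: "?x \<in> D" using D v e by (simp add: subspace_add subspace_scale)
  have he: "h *\<^sub>R e \<in> D" for h using D e by (simp add: subspace_scale)
  have shift: "v + (s + h) *\<^sub>R e = ?x + h *\<^sub>R e" for h by (simp add: scaleR_add_left)
  show "((\<lambda>s. J (v + s *\<^sub>R e)) has_real_derivative J1 ?x e) (at s)" if f: "frechet_deriv1 D N J J1"
  proof (rule DERIV_from_linear_bound[where n = "N e" and K = 1])
    fix r :: real assume "r > 0"
    then obtain d where d: "d > 0" "\<And>h. h \<in> D \<Longrightarrow> N h < d \<Longrightarrow> \<bar>J (?x + h) - J ?x - J1 ?x h\<bar> \<le> r * N h"
      using bspec[OF f[unfolded frechet_deriv1_def] x, THEN conjunct2] by blast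
    have J1: "J1 ?x \<in> dual_space D N"
      using bspec[OF f[unfolded frechet_deriv1_def] x, THEN conjunct1] .
    show "\<exists>d>0. \<forall>h. \<bar>h\<bar> * N e < d \<longrightarrow> \<bar>J (v + (s + h) *\<^sub>R e) - J ?x - h * J1 ?x e\<bar> \<le> r * (\<bar>h\<bar> * N e) * 1"
    proof (intro exI[of _ d] conjI d(1) allI impI)
      fix h assume "\<bar>h\<bar> * N e < d"
      then have "N (h *\<^sub>R e) < d" by (simp add: N(2)[OF e])
      from d(2)[OF he this] show "\<bar>J (v + (s + h) *\<^sub>R e) - J ?x - h * J1 ?x e\<bar> \<le> r * (\<bar>h\<bar> * N e) * 1"
        unfolding shift by (simp only: N(2)[OF e] dual_space_linear(2)[OF D J1 e e] mult_1_right)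
    qed
  qed (use N e in auto)
  show "((\<lambda>s. J1 (v + s *\<^sub>R e) e) has_real_derivative J2 ?x e e) (at s)" if f: "frechet_deriv2 D N J1 J2"
  proof (rule DERIV_from_linear_bound[where n = "N e" and K = "N e"])
    fix r :: real assume "r > 0"
    then obtain d where d: "d > 0" "\<And>h. h \<in> D \<Longrightarrow> N h < d \<Longrightarrow> \<bar>J1 (?x + h) e - J1 ?x e - J2 ?x h e\<bar> \<le> r * N h * N e"
      using bspec[OF f[unfolded frechet_deriv2_def] x, THEN conjunct2, THEN conjunct2] e by blast
    have J2: "(\<lambda>h. J2 ?x h e) \<in> dual_space D N"
      using bspec[OF f[unfolded frechet_deriv2_def] x, THEN conjunct1] e by blast
    show "\<exists>d>0. \<forall>h. \<bar>h\<bar> * N e < d \<longrightarrow> \<bar>J1 (v + (s + h) *\<^sub>R e) e - J1 ?x e - h * J2 ?x e e\<bar> \<le> r * (\<bar>h\<bar> * N e) * N e"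
    proof (intro exI[of _ d] conjI d(1) allI impI)
      fix h assume "\<bar>h\<bar> * N e < d"
      then have "N (h *\<^sub>R e) < d" by (simp add: N(2)[OF e])
      from d(2)[OF he this] show "\<bar>J1 (v + (s + h) *\<^sub>R e) e - J1 ?x e - h * J2 ?x e e\<bar> \<le> r * (\<bar>h\<bar> * N e) * N e"
        unfolding shift by (simp only: N(2)[OF e] dual_space_linear(2)[OF D J2 e e])
    qed
  qed (use N e in auto)
  show "((\<lambda>s. J2 (v + s *\<^sub>R e) e e) has_real_derivative J3 ?x e e e) (at s)" if f: "frechet_deriv3 D N J2 J3"
  proof (rule DERIV_from_linear_bound[where n = "N e" and K = "N e * N e"])
    fix r :: real assume "r > 0"
    then obtain d where d: "d > 0" "\<And>h. h \<in> D \<Longrightarrow> N h < d \<Longrightarrow> \<bar>J2 (?x + h) e e - J2 ?x e e - J3 ?x h e e\<bar> \<le> r * N h * N e * N e"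
      using bspec[OF f[unfolded frechet_deriv3_def] x, THEN conjunct2, THEN conjunct2] e by blast
    have J3: "(\<lambda>h. J3 ?x h e e) \<in> dual_space D N"
      using bspec[OF f[unfolded frechet_deriv3_def] x, THEN conjunct1] e by blast
    show "\<exists>d>0. \<forall>h. \<bar>h\<bar> * N e < d \<longrightarrow> \<bar>J2 (v + (s + h) *\<^sub>R e) e e - J2 ?x e e - h * J3 ?x e e e\<bar> \<le> r * (\<bar>h\<bar> * N e) * (N e * N e)"
    proof (intro exI[of _ d] conjI d(1) allI impI)
      fix h assume "\<bar>h\<bar> * N e < d"
      then have "N (h *\<^sub>R e) < d" by (simp add: N(2)[OF e])
      from d(2)[OF he this]
      show "\<bar>J2 (v + (s + h) *\<^sub>R e) e e - J2 ?x e e - h * J3 ?x e e e\<bar> \<le> r * (\<bar>h\<bar> * N e) * (N e * N e)"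
        unfolding shift by (simp only: N(2)[OF e] dual_space_linear(2)[OF D J3 e e] mult.assoc)
    qed
  qed (use N e in auto)
qed

section \<open>The error representation\<close>

theorem corollary3p5:
  fixes P :: "('d::finite) dwr_data"
    and N J :: "(real \<Rightarrow> real^'d \<Rightarrow> real) \<Rightarrow> real"
    and J1 :: "(real \<Rightarrow> real^'d \<Rightarrow> real) \<Rightarrow> (real \<Rightarrow> real^'d \<Rightarrow> real) \<Rightarrow> real"
    and J2 :: "(real \<Rightarrow> real^'d \<Rightarrow> real) \<Rightarrow> (real \<Rightarrow> real^'d \<Rightarrow> real) \<Rightarrow>
               (real \<Rightarrow> real^'d \<Rightarrow> real) \<Rightarrow> real"
    and J3 :: "(real \<Rightarrow> real^'d \<Rightarrow> real) \<Rightarrow> (real \<Rightarrow> real^'d \<Rightarrow> real) \<Rightarrow>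
               (real \<Rightarrow> real^'d \<Rightarrow> real) \<Rightarrow> (real \<Rightarrow> real^'d \<Rightarrow> real) \<Rightarrow> real"
    and j :: "(real \<Rightarrow> real^'d \<Rightarrow> real) \<Rightarrow> real \<Rightarrow> real^'d \<Rightarrow> real"
    and u z ukh zkh \<phi>kh :: "real \<Rightarrow> real^'d \<Rightarrow> real"
  assumes data: "admissible_data P"
    and norm: "norm_on P (XY_space P) N"
    and J_deriv: "frechet_deriv1 (XY_space P) N J J1" "frechet_deriv2 (XY_space P) N J1 J2" "frechet_deriv3 (XY_space P) N J2 J3"
    and J_repr: "\<forall>v\<in>XY_space P. j v \<in> bochner_L2 (timeint P) (L2 (Omega P)) (L2_norm (Omega P)) \<and>
                       (\<forall>\<phi>\<in>XY_space P. J1 v \<phi> = st_ip P (j v) \<phi>)"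
    and stationary: "stationary_point P J u z"
    and primal: "discrete_primal P ukh"
    and dual: "discrete_dual P J1 j ukh zkh"
    and phi: "\<phi>kh \<in> Xkh_space P"
  shows "let e = u - ukh in
         J u - J ukh =
           primal_residual P ukh (z - \<phi>kh)
           + S_form P ukh \<phi>kh
           + 1 / 2 * integral {0..1} (\<lambda>s. J3 (ukh + s *\<^sub>R e) e e e * s * (s - 1))
           + 1 / 2 * (- integral {0..1} (\<lambda>s. J2 (ukh + s *\<^sub>R e) e e))"
proof -
  interpret dwr_problem P by unfold_locales (rule data)
  note XY = XY_space_subspace
  have line: "((\<lambda>s. J (v + s *\<^sub>R e)) has_real_derivative J1 (v + s *\<^sub>R e) e) (at s)"
    "((\<lambda>s. J1 (v + s *\<^sub>R e) e) has_real_derivative J2 (v + s *\<^sub>R e) e e) (at s)"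
    "((\<lambda>s. J2 (v + s *\<^sub>R e) e e) has_real_derivative J3 (v + s *\<^sub>R e) e e e) (at s)"
    if ve: "v \<in> XY_space P" "e \<in> XY_space P" for v e s
  proof -
    note L = Frechet_derivatives_on_line[where N = N, OF XY _ _ ve]
    show "((\<lambda>s. J (v + s *\<^sub>R e)) has_real_derivative J1 (v + s *\<^sub>R e) e) (at s)"
      by (rule L(1)[OF norm_on_nonneg[OF norm] norm_on_scale[OF norm] J_deriv(1)])
    show "((\<lambda>s. J1 (v + s *\<^sub>R e) e) has_real_derivative J2 (v + s *\<^sub>R e) e e) (at s)"
      by (rule L(2)[OF norm_on_nonneg[OF norm] norm_on_scale[OF norm] J_deriv(2)])
    show "((\<lambda>s. J2 (v + s *\<^sub>R e) e e) has_real_derivative J3 (v + s *\<^sub>R e) e e e) (at s)"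
      by (rule L(3)[OF norm_on_nonneg[OF norm] norm_on_scale[OF norm] J_deriv(3)])
  qed
  have uX: "u \<in> X_space P" and zY: "z \<in> Y_space P"
    and stat: "\<And>\<psi> \<phi>. \<psi> \<in> X_space P \<Longrightarrow> \<phi> \<in> Y_space P \<Longrightarrow> Lagrangian_u P J u z \<psi> + Lagrangian_z P J u z \<phi> = 0"
    using stationary by (auto simp: stationary_point_def)
  have ukh: "ukh \<in> Xkh_space P" using primal by (simp add: discrete_primal_def)
  note uT = X_space_subset_trial[OF uX] and zT = Y_space_subset_test[OF zY]
  note ukhT = Xkh_subset_trial[OF ukh] and ukhY = Xkh_subset_Y[OF ukh]
  note phiT = Y_space_subset_test[OF Xkh_subset_Y[OF phi]]
  have uXY: "u \<in> XY_space P" and ukhXY: "ukh \<in> XY_space P" by (intro X_in_XY uX Y_in_XY ukhY)+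
  have Lu: "Lagrangian_u P J u z \<psi> = J1 u \<psi> - B_form \<psi> z" if \<psi>: "\<psi> \<in> X_space P" for \<psi>
  proof -
    have "Lagrangian P J (u + s *\<^sub>R \<psi>) z = J (u + s *\<^sub>R \<psi>) + load z - (B_form u z + s * B_form \<psi> z)" for s
      using Lagrangian_eq[OF trial_space_comb[OF uT X_space_subset_trial[OF \<psi>]] zT]
        B_form_linear1[OF uT X_space_subset_trial[OF \<psi>] zT] by simp
    moreover have "((\<lambda>s. J (u + s *\<^sub>R \<psi>) + load z - (B_form u z + s * B_form \<psi> z)) has_real_derivative
        J1 (u + 0 *\<^sub>R \<psi>) \<psi> - B_form \<psi> z) (at 0)"
      by (auto intro!: derivative_eq_intros line(1)[OF uXY X_in_XY[OF \<psi>]])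
    ultimately show ?thesis unfolding Lagrangian_u_def using DERIV_imp_deriv by fastforce
  qed
  have Lz: "Lagrangian_z P J u z \<phi> = load \<phi> - B_form u \<phi>" if \<phi>: "\<phi> \<in> Y_space P" for \<phi>
  proof -
    note fT = Y_space_subset_test[OF \<phi>]
    have "Lagrangian P J u (z + s *\<^sub>R \<phi>) = J u + (load z + s * load \<phi>) - (B_form u z + s * B_form u \<phi>)" for s
      using Lagrangian_eq[OF uT test_space_comb[OF zT fT]] load_linear[OF zT fT] B_form_linear2[OF uT zT fT] by simp
    moreover have "((\<lambda>s. J u + (load z + s * load \<phi>) - (B_form u z + s * B_form u \<phi>)) has_real_derivative
        load \<phi> - B_form u \<phi>) (at 0)"
      by (auto intro!: derivative_eq_intros)
    ultimately show ?thesis unfolding Lagrangian_z_def using DERIV_imp_deriv by fastforce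
  qed
  \<comment> \<open>The direction 0 in one argument isolates the stationarity condition of the other.\<close>
  have "Lagrangian_z P J u z 0 = 0" "Lagrangian_u P J u z 0 = 0"
    by (simp_all add: Lagrangian_z_def Lagrangian_u_def)
  then have dual_eq: "J1 u \<psi> = B_form \<psi> z" if "\<psi> \<in> X_space P" for \<psi>
    using stat[OF that Y_space_zero] Lu[OF that] by simp
  have primal_eq: "load z = B_form u z"
    using stat[OF X_space_zero zY] Lz[OF zY] \<open>Lagrangian_u P J u z 0 = 0\<close> by simp
  have ju: "j u \<in> bochner_L2 (timeint P) (L2 A) (L2_norm A)" "\<And>\<phi>. \<phi> \<in> XY_space P \<Longrightarrow> J1 u \<phi> = st_ip P (j u) \<phi>"
    using J_repr uXY by auto
  have "st_ip P (j u) \<psi> = B_form \<psi> z" if "\<psi> \<in> X_space P" for \<psi>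
    using dual_eq[OF that] ju(2)[OF X_in_XY[OF that]] by simp
  from dual_identity_Xkh[OF zT ju(1) this ukh] have ukh_dual: "J1 u ukh = B_form ukh z"
    using ju(2)[OF ukhXY] by simp
  define e where "e = u - ukh"
  have eXY: "e \<in> XY_space P" unfolding e_def using XY uXY ukhXY by (rule subspace_diff)
  have "J1 u \<in> dual_space (XY_space P) N" using J_deriv(1) uXY by (simp add: frechet_deriv1_def)
  from dual_space_linear(1)[OF XY this uXY ukhXY, of "-1"] have "J1 u e = J1 u u - J1 u ukh" by (simp add: e_def)
  also have "\<dots> = load z - B_form ukh z" using dual_eq[OF uX] primal_eq ukh_dual by simp
  finally have J1e: "J1 u e = primal_residual P ukh z" using primal_residual_eq[OF ukhT zT] by simp
  have "A_form P ukh \<phi>kh + S_form P ukh \<phi>kh + ip A (tr_plus P ukh 0) (tr_plus P \<phi>kh 0) =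
      F_form P \<phi>kh + ip A (init P) (tr_plus P \<phi>kh 0)"
    using primal phi by (simp add: discrete_primal_def)
  then have S: "primal_residual P ukh \<phi>kh = S_form P ukh \<phi>kh"
    using primal_residual_eq[OF ukhT phiT] by (simp add: load_def B_form_def)
  have lin: "primal_residual P ukh (z - \<phi>kh) = primal_residual P ukh z - primal_residual P ukh \<phi>kh"
    using primal_residual_eq[OF ukhT test_space_comb[OF zT phiT, of "-1"]] primal_residual_eq[OF ukhT zT]
      primal_residual_eq[OF ukhT phiT] load_linear[OF zT phiT, of "-1"] B_form_linear2[OF ukhT zT phiT, of "-1"]
    by simp
  note seg = segment_expansion[OF line(1)[OF ukhXY eXY] line(2)[OF ukhXY eXY]
      line(3)[OF ukhXY eXY]]
  have end_pts: "ukh + 1 *\<^sub>R e = u" "ukh + 0 *\<^sub>R e = ukh" by (simp_all add: e_def)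
  show ?thesis
    unfolding Let_def e_def[symmetric]
    using seg[unfolded end_pts] J1e S lin by simp
qed

end
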